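(* Let $1<p<2<q<\infty$. In $L(\ell_p,\ell_q)$ the following hold. (a) $\{0\}\subsetneq\mathcal K\subsetneq\mathcal J^{I_{p,q}}\subseteq\mathcal J^{\mathrm{FSS}}\cap\mathcal J^{\ell_2}$; moreover $\mathcal K$ is the only immediate successor of $\{0\}$, and $\mathcal J^{I_{p,q}}$ is the only immediate successor of $\mathcal K$. (b) $\mathcal J^{\mathrm{FSS}}\cap\mathcal J^{\ell_2}\subsetneq\mathcal J^{\mathrm{FSS}}$. (c) $\mathcal J^{\mathrm{FSS}}\cap\mathcal J^{\ell_2}\subsetneq\mathcal J^{\ell_2}$, and no closed ideal lies strictly between $\mathcal J^{\mathrm{FSS}}\cap\mathcal J^{\ell_2}$ and $\mathcal J^{\ell_2}$. (d) $\mathcal J^{\mathrm{FSS}}\subsetneq\mathcal J^{\mathrm{FSS}}\vee\mathcal J^{\ell_2}$, and $\mathcal J^{\mathrm{FSS}}\vee\mathcal J^{\ell_2}$ is the only immediate successor of $\mathcal J^{\mathrm{FSS}}$. (e) $\mathcal J^{\ell_2}\subsetneq\mathcal J^{\mathrm{FSS}}\vee\mathcal J^{\ell_2}$. In particular, the closed ideals of $L(\ell_p,\ell_q)$ are not totally ordered by inclusion.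
   Context: $L(X,Y)$ is the space of bounded linear operators from $X$ to $Y$, and $L(X)=L(X,X)$. An ideal in $L(\ell_p,\ell_q)$ is a linear subspace $\mathcal J\subseteq L(\ell_p,\ell_q)$ such that $ATB\in\mathcal J$ whenever $A\in L(\ell_q)$, $T\in\mathcal J$, $B\in L(\ell_p)$; it is closed if it is closed in the operator norm. $\mathcal K$ is the ideal of compact operators. For $S\in L(\ell_p,\ell_q)$, $\mathcal J^S$ is the smallest closed ideal containing $S$. $I_{p,q}\colon\ell_p\to\ell_q$ is the formal identity $x\mapsto x$. $\mathcal J^{\ell_2}$ is the operator-norm closure of the set of operators $S\in L(\ell_p,\ell_q)$ that can be written $S=AB$ with $B\in L(\ell_p,\ell_2)$, $A\in L(\ell_2,\ell_q)$. An operator $S\colon X\to Y$ is finitely strictly singular (FSS) if for every $\varepsilon>0$ there is $n\in\mathbb N$ such that $\inf_{x\in E,\|x\|=1}\|Sx\|<\varepsilon$ for every $n$-dimensional subspace $E$ of $X$; $\mathcal J^{\mathrm{FSS}}$ is the set (a closed ideal) of all FSS operators in $L(\ell_p,\ell_q)$. $\mathcal J_1\vee\mathcal J_2$ denotes the smallest closed ideal containing $\mathcal J_1$ and $\mathcal J_2$. A closed ideal $\mathcal J_2$ is an immediate successor of a closed ideal $\mathcal J_1$ if $\mathcal J_1\subsetneq\mathcal J_2$ and no closed ideal $\mathcal J$ satisfies $\mathcal J_1\subsetneq\mathcal J\subsetneq\mathcal J_2$. *)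

theory Defs
  imports "HOL-Analysis.Analysis" "HOL-Library.Function_Algebras"
begin

text \<open>
  The exponent of \<open>\<ell>\<^sub>p\<close> is a real variable, so \<open>\<ell>\<^sub>p\<close> is a carrier set of sequences rather than a
  type. The scalars are a type \<open>'k\<close> of class \<open>real_normed_field\<close>; its complete instances are, up to
  isometric isomorphism, exactly \<open>real\<close> and \<open>complex\<close>.
\<close>

type_synonym 'k seq = "nat \<Rightarrow> 'k"
type_synonym 'k seq_op = "'k seq \<Rightarrow> 'k seq"

definition seq_scale :: "'k \<Rightarrow> 'k::real_normed_field seq \<Rightarrow> 'k seq" where
  "seq_scale c x = (\<lambda>n. c * x n)"

definition op_scale :: "'k \<Rightarrow> 'k::real_normed_field seq_op \<Rightarrow> 'k seq_op" where
  "op_scale c T = (\<lambda>x. seq_scale c (T x))"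

interpretation seq: vector_space seq_scale
  by standard (auto simp: seq_scale_def fun_eq_iff algebra_simps)

interpretation oper: vector_space op_scale
  by standard (auto simp: op_scale_def seq_scale_def fun_eq_iff algebra_simps)


section \<open>The spaces \<open>\<ell>\<^sub>p\<close>\<close>

definition lp :: "real \<Rightarrow> 'k::real_normed_field seq set" where
  "lp p = {x. summable (\<lambda>n. norm (x n) powr p)}"

definition lp_norm :: "real \<Rightarrow> 'k::real_normed_field seq \<Rightarrow> real" where
  "lp_norm p x = (\<Sum>n. norm (x n) powr p) powr (1 / p)"

definition lp_ball :: "real \<Rightarrow> 'k::real_normed_field seq set" where
  "lp_ball p = {x \<in> lp p. lp_norm p x \<le> 1}"

definition lp_topology :: "real \<Rightarrow> 'k::real_normed_field seq topology" where
  "lp_topology p = Metric_space.mtopology (lp p) (\<lambda>x y. lp_norm p (x - y))"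


section \<open>Bounded operators\<close>

text \<open>
  An operator is a function on all sequences that vanishes outside \<open>\<ell>\<^sub>p\<close>. This normalisation makes
  equality of operators equality of functions and is preserved by composition and by the linear
  operations.
\<close>

definition bounded_ops :: "real \<Rightarrow> real \<Rightarrow> 'k::real_normed_field seq_op set" where
  "bounded_ops p q =
    {T. (\<forall>x\<in>lp p. T x \<in> lp q) \<and>
        (\<forall>x\<in>lp p. \<forall>y\<in>lp p. T (x + y) = T x + T y) \<and>
        (\<forall>c. \<forall>x\<in>lp p. T (seq_scale c x) = seq_scale c (T x)) \<and>
        (\<exists>C. \<forall>x\<in>lp p. lp_norm q (T x) \<le> C * lp_norm p x) \<and>
        (\<forall>x. x \<notin> lp p \<longrightarrow> T x = 0)}"

text \<open>
  The supremum is formed in \<open>ennreal\<close> because \<open>Metric_space\<close> requires the distance to be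
  nonnegative outside the carrier as well, where a real supremum could be unspecified.
\<close>

definition op_norm :: "real \<Rightarrow> real \<Rightarrow> 'k::real_normed_field seq_op \<Rightarrow> real" where
  "op_norm p q T = enn2real (SUP x\<in>lp_ball p. ennreal (lp_norm q (T x)))"

definition op_topology :: "real \<Rightarrow> real \<Rightarrow> 'k::real_normed_field seq_op topology" where
  "op_topology p q =
    Metric_space.mtopology (bounded_ops p q) (\<lambda>S T. op_norm p q (S - T))"

definition formal_identity :: "real \<Rightarrow> 'k::real_normed_field seq_op" where
  "formal_identity p = (\<lambda>x. if x \<in> lp p then x else 0)"


section \<open>Closed ideals\<close>

definition op_ideal :: "real \<Rightarrow> real \<Rightarrow> 'k::real_normed_field seq_op set \<Rightarrow> bool" where
  "op_ideal p q J \<longleftrightarrow>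
    J \<subseteq> bounded_ops p q \<and> oper.subspace J \<and>
    (\<forall>A\<in>bounded_ops q q. \<forall>T\<in>J. \<forall>B\<in>bounded_ops p p. A \<circ> T \<circ> B \<in> J)"

definition closed_ideal :: "real \<Rightarrow> real \<Rightarrow> 'k::real_normed_field seq_op set \<Rightarrow> bool" where
  "closed_ideal p q J \<longleftrightarrow> op_ideal p q J \<and> closedin (op_topology p q) J"

definition generated_ideal ::
    "real \<Rightarrow> real \<Rightarrow> 'k::real_normed_field seq_op set \<Rightarrow> 'k seq_op set" where
  "generated_ideal p q M = \<Inter>{J. closed_ideal p q J \<and> M \<subseteq> J}"

definition ideal_join ::
    "real \<Rightarrow> real \<Rightarrow> 'k::real_normed_field seq_op set \<Rightarrow> 'k seq_op set \<Rightarrow> 'k seq_op set" where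
  "ideal_join p q J1 J2 = generated_ideal p q (J1 \<union> J2)"

definition immediate_successor ::
    "real \<Rightarrow> real \<Rightarrow> 'k::real_normed_field seq_op set \<Rightarrow> 'k seq_op set \<Rightarrow> bool" where
  "immediate_successor p q J1 J2 \<longleftrightarrow>
    closed_ideal p q J1 \<and> closed_ideal p q J2 \<and> J1 \<subset> J2 \<and>
    \<not> (\<exists>J. closed_ideal p q J \<and> J1 \<subset> J \<and> J \<subset> J2)"

definition only_immediate_successor ::
    "real \<Rightarrow> real \<Rightarrow> 'k::real_normed_field seq_op set \<Rightarrow> 'k seq_op set \<Rightarrow> bool" where
  "only_immediate_successor p q J1 J2 \<longleftrightarrow>
    immediate_successor p q J1 J2 \<and> (\<forall>J. immediate_successor p q J1 J \<longrightarrow> J = J2)"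

definition compact_ops :: "real \<Rightarrow> real \<Rightarrow> 'k::real_normed_field seq_op set" where
  "compact_ops p q =
    {T \<in> bounded_ops p q. compactin (lp_topology q) (lp_topology q closure_of (T ` lp_ball p))}"

definition identity_ideal :: "real \<Rightarrow> real \<Rightarrow> 'k::real_normed_field seq_op set" where
  "identity_ideal p q = generated_ideal p q {formal_identity p}"

definition hilbert_ideal :: "real \<Rightarrow> real \<Rightarrow> 'k::real_normed_field seq_op set" where
  "hilbert_ideal p q =
    op_topology p q closure_of {A \<circ> B | A B. A \<in> bounded_ops 2 q \<and> B \<in> bounded_ops p 2}"

text \<open>The infimum is taken in the extended reals, so that it is \<open>\<infinity>\<close> for the zero subspace.\<close>

definition fss_ops :: "real \<Rightarrow> real \<Rightarrow> 'k::real_normed_field seq_op set" where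
  "fss_ops p q =
    {S \<in> bounded_ops p q. \<forall>\<epsilon>>0. \<exists>n. \<forall>E. E \<subseteq> lp p \<and> seq.subspace E \<and> seq.dim E = n \<longrightarrow>
      (INF x\<in>{x\<in>E. lp_norm p x = 1}. ereal (lp_norm q (S x))) < ereal \<epsilon>}"

end

theory Submission
  imports Defs
begin

text \<open>
 The part of the lattice described by the theorem is governed by two dichotomies and two examples.

 A non-compact operator \<open>T\<close> maps normalised blocks arbitrarily far out to blocks whose images stay away
 from \<open>0\<close> (\<open>noncompact_local_copies\<close>). Since \<open>p \<le> q\<close>, infinitely many such one-dimensional pieces can be placed on disjoint
 blocks and added up; the off-diagonal terms are made small by choosing the blocks sparse enough, and what remains
 is the formal identity. So every closed ideal not inside the compact operators contains \<open>I\<^sub>p\<^sub>,\<^sub>q\<close>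
 (\<open>noncompact_identity\<close>), while every nonzero closed ideal contains all rank one operators and hence all compact ones.

 The second dichotomy has the same form with Hilbert spaces of growing finite dimension in place of lines. If \<open>T\<close> is not FSS, it is bounded below
 by a fixed \<open>d\<close> on finitely supported subspaces of every dimension. Khintchine's inequality and a convexity argument turn
 the lower bound in \<open>\<ell>\<^sub>q\<close> into a lower bound in a weighted \<open>\<ell>\<^sub>2\<close> (\<open>bounded_below_density\<close>), and a basis of the
 subspace that is orthonormal for this weight exhibits \<open>T\<close> as a uniform isomorphism between complemented copies of \<open>\<ell>\<^sub>2\<^sup>n\<close>
 (\<open>nonfss_local_copies\<close>). An operator through \<open>\<ell>\<^sub>2\<close> is, up to a small error, a finite sum of block operators with finite-dimensional
 blocks, so it can be assembled from these copies: every closed ideal containing a non-FSS operator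
 contains \<open>J\<^sup>\<ell>\<^sup>2\<close> (\<open>nonfss_hilbert\<close>). Both dichotomies use \<open>assemble_local_copies\<close>.

 The strict inclusions come from two explicit operators. Rademacher matrices give an operator through
 \<open>\<ell>\<^sub>2\<close> that is bounded below on the span of \<open>n\<close> Rademacher functions for every \<open>n\<close>, because Khintchine's inequality
 holds in \<open>\<ell>\<^sub>q\<close> and in the dual of \<open>\<ell>\<^sub>p\<close> (\<open>hilbert_not_fss\<close>). For the opposite example a \<open>4 \<times> 2\<close> matrix is shown to be contractive
 from \<open>\<ell>\<^sub>r\<close> to \<open>\<ell>\<^sub>q\<close> for some \<open>r > q / (q - 1)\<close>, by perturbing Clarkson's inequality. Its tensor powers stay contractive by Minkowski's
 inequality, and the trace duality with a matching matrix grows like \<open>2^n\<close>, whereas on products of operators through \<open>\<ell>\<^sub>2\<close>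
 it grows at most like \<open>\<kappa>^n\<close> with \<open>\<kappa> < 2\<close>; so the sum of these blocks is not approximable through \<open>\<ell>\<^sub>2\<close>. It is FSS because the
 gain in the exponent lets it factor through a formal identity between different \<open>\<ell>\<^sub>s\<close> (\<open>fss_not_hilbert\<close>). Incomparability of
 \<open>J\<^sup>F\<^sup>S\<^sup>S\<close> and \<open>J\<^sup>\<ell>\<^sup>2\<close> together with the two dichotomies yields all assertions.
\<close>

section \<open>Sequences and their norms\<close>

lemma powr_inverse_powr [simp]:
 fixes a p :: real
 assumes "0 <= a" "p ~= 0"
 shows "(a powr (1 / p)) powr p = a" "(a powr p) powr (1 / p) = a"
 using assms by (auto simp: powr_powr)

lemma lp_norm_nonneg [simp]: "0 <= lp_norm p x"
 by (simp add: lp_norm_def)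

lemma lp_norm_powr:
 assumes "x \<in> lp p" "0 < p"
 shows "lp_norm p x powr p = (\<Sum>n. norm (x n) powr p)"
 using assms by (simp add: lp_norm_def lp_def suminf_nonneg)

lemma lp_sum_le:
 assumes "x \<in> lp p" "0 < p" "finite A"
 shows "(\<Sum>i\<in>A. norm (x i) powr p) <= lp_norm p x powr p"
 unfolding lp_norm_powr[OF assms(1,2)]
 by (rule sum_le_suminf) (use assms in \<open>auto simp: lp_def\<close>)

lemma le_powr_cancel:
 fixes a b p :: real
 assumes "a powr p <= b powr p" "0 <= b" "0 < p"
 shows "a <= b"
proof (rule ccontr)
 assume "\<not> a <= b"
 then have "b powr p < a powr p" using assms by (intro powr_less_mono2) auto
 then show False using assms by simp
qed

lemma lp_leI:
 assumes "0 < p" "0 <= c" "!!N. (\<Sum>i<N. norm (x i) powr p) <= c powr p"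
 shows "x \<in> lp p" "lp_norm p x <= c"
proof -
 have s: "summable (%n. norm (x n) powr p)"
  by (rule summableI_nonneg_bounded[OF _ assms(3)]) auto
 then show x: "x \<in> lp p" by (simp add: lp_def)
 have "lp_norm p x powr p <= c powr p"
  unfolding lp_norm_powr[OF x assms(1)] by (rule suminf_le_const[OF s assms(3)])
 then show "lp_norm p x <= c" by (rule le_powr_cancel) (use assms in auto)
qed

lemma lp_norm_component:
 assumes "x \<in> lp p" "0 < p"
 shows "norm (x i) <= lp_norm p x"
 by (rule le_powr_cancel[of _ p]) (use lp_sum_le[OF assms, of "{i}"] assms in auto)

lemma lp_norm_0 [simp]: "lp_norm p 0 = 0"
 by (simp add: lp_norm_def)

lemma zero_in_lp [simp]: "0 \<in> lp p"
 by (simp add: lp_def)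

lemma lp_norm_eq_0:
 assumes "x \<in> lp p" "0 < p"
 shows "lp_norm p x = 0 \<longleftrightarrow> x = 0"
proof
 assume "lp_norm p x = 0"
 then have "norm (x i) <= 0" for i using lp_norm_component[OF assms, of i] by simp
 then show "x = 0" by (auto simp: fun_eq_iff)
qed simp

lemma lp_norm_pos:
 assumes "x \<in> lp p" "0 < p" "x ~= 0"
 shows "0 < lp_norm p x"
 using lp_norm_eq_0[OF assms(1,2)] assms(3) lp_norm_nonneg[of p x] by linarith

lemma lp_scale:
 assumes "0 < p" "x \<in> lp p"
 shows "seq_scale c x \<in> lp p" "lp_norm p (seq_scale c x) = norm c * lp_norm p x"
proof -
 have eq: "(%n. norm (seq_scale c x n) powr p) = (%n. norm c powr p * norm (x n) powr p)"
  by (auto simp: seq_scale_def norm_mult powr_mult)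
 have s: "summable (%n. norm (x n) powr p)" using assms by (simp add: lp_def)
 show "seq_scale c x \<in> lp p"
  unfolding lp_def mem_Collect_eq eq by (intro summable_mult s)
 show "lp_norm p (seq_scale c x) = norm c * lp_norm p x"
  unfolding lp_norm_def eq suminf_mult[OF s]
  using assms by (simp add: powr_mult suminf_nonneg[OF s])
qed

lemma convex_powr:
 fixes u v t p :: real
 assumes "1 <= p" "0 <= u" "0 <= v" "0 <= t" "t <= 1"
 shows "((1 - t) * u + t * v) powr p <= (1 - t) * u powr p + t * v powr p"
proof (cases "u = 0 \<or> v = 0")
 case True
 have *: "(s * w) powr p <= s * w powr p" if "0 <= s" "s <= 1" "0 <= w" for s w :: real
 proof -
  have "s powr p <= s"
  proof (cases "s = 0")
   case False
   then have "s powr p <= s powr 1" using that assms by (intro powr_mono') auto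
   then show ?thesis using that by simp
  qed (use assms in auto)
  then show ?thesis using that by (simp add: powr_mult mult_right_mono)
 qed
 show ?thesis using True *[of t v] *[of "1 - t" u] assms by auto
next
 case False
 then show ?thesis
  using convex_onD[OF powr_convex[OF assms(1)], of t u v] assms by simp
qed

lemma lp_add:
 fixes x y :: "'k::real_normed_field seq"
 assumes "1 <= p" "x \<in> lp p" "y \<in> lp p"
 shows "x + y \<in> lp p" "lp_norm p (x + y) <= lp_norm p x + lp_norm p y"
proof -
 define a b where "a = lp_norm p x" and "b = lp_norm p y"
 have nn: "0 <= a" "0 <= b" by (auto simp: a_def b_def)
 have key: "(\<Sum>i<N. norm ((x + y) i) powr p) <= (a + b) powr p" for N
 proof (cases "a = 0 \<or> b = 0")
  case True
  then show ?thesis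
   using lp_norm_eq_0[OF assms(2)] lp_norm_eq_0[OF assms(3)]
    lp_sum_le[OF assms(2), of "{..<N}"] lp_sum_le[OF assms(3), of "{..<N}"] assms
   by (auto simp: a_def b_def)
 next
  case False
  then have pos: "a > 0" "b > 0" using nn by auto
  define t where "t = b / (a + b)"
  have t: "0 <= t" "t <= 1" "1 - t = a / (a + b)"
   using pos by (auto simp: t_def field_simps)
  have "norm ((x + y) i) powr p <= (a + b) powr p * ((1 - t) * (norm (x i) / a) powr p + t * (norm (y i) / b) powr p)" for i
  proof -
   have "norm ((x + y) i) <= (a + b) * ((1 - t) * (norm (x i) / a) + t * (norm (y i) / b))"
   proof -
    have "(a + b) * ((1 - t) * (norm (x i) / a) + t * (norm (y i) / b)) = norm (x i) + norm (y i)"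
     using pos unfolding t(3) by (simp add: t_def distrib_left)
    then show ?thesis using norm_triangle_ineq[of "x i" "y i"] by simp
   qed
   then have "norm ((x + y) i) powr p <= ((a + b) * ((1 - t) * (norm (x i) / a) + t * (norm (y i) / b))) powr p"
    using assms by (intro powr_mono2) auto
   also have "\<dots> = (a + b) powr p * ((1 - t) * (norm (x i) / a) + t * (norm (y i) / b)) powr p"
    using pos t by (subst powr_mult) auto
   also have "\<dots> <= (a + b) powr p * ((1 - t) * (norm (x i) / a) powr p + t * (norm (y i) / b) powr p)"
    using pos t assms by (intro mult_left_mono convex_powr) auto
   finally show ?thesis .
  qed
  then have "(\<Sum>i<N. norm ((x + y) i) powr p) \<le>
   (\<Sum>i<N. (a + b) powr p * ((1 - t) * (norm (x i) / a) powr p + t * (norm (y i) / b) powr p))"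
   by (rule sum_mono)
  also have "\<dots> = (a + b) powr p * ((1 - t) * ((\<Sum>i<N. norm (x i) powr p) / a powr p) + t * ((\<Sum>i<N. norm (y i) powr p) / b powr p))"
   using pos by (simp add: powr_divide sum_distrib_left sum.distrib sum_divide_distrib distrib_left)
  also have "\<dots> <= (a + b) powr p * ((1 - t) * 1 + t * 1)"
   using lp_sum_le[OF assms(2), of "{..<N}"] lp_sum_le[OF assms(3), of "{..<N}"] assms pos t
   by (intro mult_left_mono add_mono) (auto simp: a_def b_def divide_le_eq_1)
  finally show ?thesis by simp
 qed
 show "x + y \<in> lp p" "lp_norm p (x + y) <= lp_norm p x + lp_norm p y"
  using lp_leI[where x="x + y", OF _ _ key] nn assms by (auto simp: a_def b_def)
qed

lemma lp_uminus:
 shows "- x \<in> lp p \<longleftrightarrow> x \<in> lp p" "lp_norm p (- x) = lp_norm p x"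
 by (auto simp: lp_def lp_norm_def)

lemma lp_diff:
 fixes x y :: "'k::real_normed_field seq"
 assumes "1 <= p" "x \<in> lp p" "y \<in> lp p"
 shows "x - y \<in> lp p" "lp_norm p (x - y) <= lp_norm p x + lp_norm p y"
 using lp_add[OF assms(1,2), of "- y"] assms lp_uminus[where x = y] by auto

lemma lp_norm_minus_commute: "lp_norm p (x - y) = lp_norm p (y - x)"
 using lp_uminus(2)[of p "x - y"] by simp

lemma lp_sum:
 assumes "1 <= p" "finite J" "!!j. j \<in> J ==> f j \<in> lp p"
 shows "sum f J \<in> lp p \<and> lp_norm p (sum f J) <= (\<Sum>j\<in>J. lp_norm p (f j))"
 using assms(2,3)
proof (induction J rule: finite_induct)
 case (insert j J)
 then have "f j + sum f J \<in> lp p \<and> lp_norm p (f j + sum f J) <= lp_norm p (f j) + (\<Sum>j\<in>J. lp_norm p (f j))"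
  using lp_add[OF assms(1), of "f j" "sum f J"] by auto
 then show ?case unfolding sum.insert[OF insert(1,2)] .
qed (simp only: sum.empty lp_norm_0 zero_in_lp order_refl simp_thms)

definition restr :: "nat set => 'k::zero seq => 'k seq" where
 "restr S x = (%i. if i \<in> S then x i else 0)"

lemma restr_simps [simp]:
 fixes x y :: "'k::real_normed_field seq"
 shows "restr S (x + y) = restr S x + restr S y" "restr S (x - y) = restr S x - restr S y"
  "restr S (seq_scale c x) = seq_scale c (restr S x)" "restr S 0 = (0 :: 'k seq)"
  "restr S (restr T x) = restr (S \<inter> T) x" "restr UNIV x = x" "restr {} x = 0"
 by (auto simp: restr_def fun_eq_iff seq_scale_def)

lemma restr_apply: "restr S x i = (if i \<in> S then x i else 0)"
 by (simp add: restr_def)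

lemma sum_fun_apply: "sum f A i = (\<Sum>a\<in>A. f a i)"
 by (induction A rule: infinite_finite_induct) auto

lemma restr_sum: "restr S (sum f A) = (\<Sum>a\<in>A. restr S (f a :: 'k::real_normed_field seq))"
 by (rule ext) (simp add: restr_def sum_fun_apply)

lemma restr_Un_disjoint:
 fixes x :: "'k::real_normed_field seq"
 assumes "S \<inter> T = {}"
 shows "restr (S \<union> T) x = restr S x + restr T x"
 using assms by (auto simp: restr_def fun_eq_iff)

lemma restr_compl: "x - restr S x = restr (- S) (x :: 'k::real_normed_field seq)"
 by (auto simp: restr_def fun_eq_iff)

lemma lp_restr:
 assumes "0 < p" "x \<in> lp p"
 shows "restr S x \<in> lp p" "lp_norm p (restr S x) <= lp_norm p x"
proof -
 have "(\<Sum>i<N. norm (restr S x i) powr p) <= lp_norm p x powr p" for N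
  by (rule order_trans[OF sum_mono lp_sum_le[OF assms(2,1)]]) (auto simp: restr_def)
 from lp_leI[OF assms(1) _ this] show "restr S x \<in> lp p" "lp_norm p (restr S x) <= lp_norm p x"
  by auto
qed

lemma lp_restr_mono:
 assumes "0 < p" "x \<in> lp p" "S \<subseteq> T"
 shows "lp_norm p (restr S x) <= lp_norm p (restr T x)"
 using lp_restr(2)[OF assms(1) lp_restr(1)[OF assms(1,2)], of S T] assms(3)
 by (simp add: Int_absorb2)

lemma lp_restr_finite:
 assumes "0 < p" "finite S"
 shows "restr S x \<in> lp p" "lp_norm p (restr S x) powr p = (\<Sum>i\<in>S. norm (x i) powr p)"
proof -
 have z: "norm (restr S x n) powr p = 0" if "n \<notin> S" for n
  using that by (simp add: restr_def)
 show m: "restr S x \<in> lp p"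
  unfolding lp_def mem_Collect_eq by (rule summable_finite[OF assms(2) z])
 show "lp_norm p (restr S x) powr p = (\<Sum>i\<in>S. norm (x i) powr p)"
  unfolding lp_norm_powr[OF m assms(1)] by (subst suminf_finite[OF assms(2) z]) (auto simp: restr_def)
qed

lemma lp_norm_split:
 assumes "0 < p" "x \<in> lp p"
 shows "lp_norm p x powr p = lp_norm p (restr S x) powr p + lp_norm p (restr (- S) x) powr p"
proof -
 have "(%n. norm (x n) powr p) = (%n. norm (restr S x n) powr p + norm (restr (- S) x n) powr p)"
  by (auto simp: restr_def)
 then show ?thesis
  unfolding lp_norm_powr[OF assms(2,1)] lp_norm_powr[OF lp_restr(1)[OF assms] assms(1)]
  using lp_restr(1)[OF assms] by (simp add: suminf_add lp_def)
qed

text \<open>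
 Used to sum over disjoint blocks of coordinates: this is where estimates on single blocks become estimates for block operators.
\<close>

lemma lp_disjoint_sum_le:
 assumes "0 < p" "x \<in> lp p" "finite J" "disjoint_family_on D J"
 shows "(\<Sum>j\<in>J. lp_norm p (restr (D j) x) powr p) <= lp_norm p (restr (\<Union>j\<in>J. D j) x) powr p"
 using assms(3,4)
proof (induction J rule: finite_induct)
 case (insert j J)
 let ?U = "\<Union>j\<in>J. D j"
 have dis: "D j \<inter> ?U = {}"
  using insert by (auto simp: disjoint_family_on_def)
 have e: "D j \<inter> (D j \<union> ?U) = D j" "- D j \<inter> (D j \<union> ?U) = ?U" using dis by auto
 have "lp_norm p (restr (D j \<union> ?U) x) powr p = lp_norm p (restr (D j) x) powr p + lp_norm p (restr ?U x) powr p"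
  using lp_norm_split[OF assms(1) lp_restr(1)[OF assms(1,2)], of "D j \<union> ?U" "D j"]
  unfolding restr_simps(5) e .
 moreover have "disjoint_family_on D J" using insert(4) by (auto simp: disjoint_family_on_def)
 ultimately show ?case using insert by simp
qed simp

lemma lp_tail:
 assumes "0 < p" "x \<in> lp p" "0 < e"
 shows "\<exists>M. \<forall>m\<ge>M. lp_norm p (restr {m..} x) < e"
proof -
 have s: "summable (%n. norm (x n) powr p)" using assms by (simp add: lp_def)
 have "e powr p > 0" using assms by auto
 from suminf_exist_split[OF this s]
 obtain M where M: "!!n. n >= M ==> norm (\<Sum>i. norm (x (i + n)) powr p) < e powr p" by blast
 have "lp_norm p (restr {m..} x) < e" if "m >= M" for m
 proof -
  have r: "restr {m..} x \<in> lp p" using lp_restr assms by auto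
  have sm: "summable (%n. norm (restr {m..} x n) powr p)" using r by (simp add: lp_def)
  have "lp_norm p (restr {m..} x) powr p = (\<Sum>i. norm (x (i + m)) powr p)"
   unfolding lp_norm_powr[OF r assms(1)]
   by (subst suminf_split_initial_segment[OF sm, of m]) (simp add: restr_def)
  also have "\<dots> < e powr p" using M[OF that] by simp
  finally show ?thesis
   using assms by (meson less_le_not_le linorder_not_less lp_norm_nonneg powr_mono2 less_eq_real_def)
 qed
 then show ?thesis by blast
qed

text \<open>
 From \<open>\<bar>x\<^sub>i\<bar>^q \<le> s^(q - p) \<bar>x\<^sub>i\<bar>^p\<close>. With \<open>s = \<parallel>x\<parallel>\<^sub>p\<close> it gives the inclusion of \<open>\<ell>\<^sub>p\<close> in \<open>\<ell>\<^sub>q\<close>, with small \<open>s\<close> the strict singularity of that inclusion.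
\<close>

lemma lp_norm_interpolate:
 assumes "0 < p" "p <= q" "x \<in> lp p" "!!i. norm (x i) <= s"
 shows "x \<in> lp q" "lp_norm q x powr q <= s powr (q - p) * lp_norm p x powr p"
proof -
 have s: "0 <= s" using order_trans[OF norm_ge_zero assms(4)] .
 define c where "c = s powr (q - p) * lp_norm p x powr p"
 have c: "0 <= c" by (simp add: c_def)
 have "(\<Sum>i<N. norm (x i) powr q) <= (c powr (1 / q)) powr q" for N
 proof -
  have "norm (x i) powr q <= s powr (q - p) * norm (x i) powr p" for i
  proof -
   have "norm (x i) powr q = norm (x i) powr (q - p) * norm (x i) powr p"
    by (simp flip: powr_add)
   also have "\<dots> <= s powr (q - p) * norm (x i) powr p"
    using assms by (intro mult_right_mono powr_mono2) auto
   finally show ?thesis .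
  qed
  then have "(\<Sum>i<N. norm (x i) powr q) <= (\<Sum>i<N. s powr (q - p) * norm (x i) powr p)"
   by (rule sum_mono)
  also have "\<dots> <= c" unfolding c_def sum_distrib_left[symmetric]
   using lp_sum_le[OF assms(3,1)] by (intro mult_left_mono) auto
  finally show ?thesis using assms c by simp
 qed
 note * = lp_leI[OF _ _ this]
 show "x \<in> lp q" using * assms by auto
 have "lp_norm q x <= c powr (1 / q)" using * assms by auto
 then have "lp_norm q x powr q <= (c powr (1 / q)) powr q" using assms by (intro powr_mono2) auto
 then show "lp_norm q x powr q <= s powr (q - p) * lp_norm p x powr p"
  using assms c by (simp add: c_def)
qed

lemma lp_mono:
 assumes "0 < p" "p <= q" "x \<in> lp p"
 shows "x \<in> lp q" "lp_norm q x <= lp_norm p x"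
proof -
 note * = lp_norm_interpolate[OF assms lp_norm_component[OF assms(3,1)]]
 show "x \<in> lp q" by (rule *(1))
 have "lp_norm q x powr q <= lp_norm p x powr q" using *(2) by (simp flip: powr_add)
 then show "lp_norm q x <= lp_norm p x" by (rule le_powr_cancel) (use assms in auto)
qed

definition unit :: "nat => 'k::real_normed_field seq" where
 "unit i = (%j. if j = i then 1 else 0)"

lemma unit_lp:
 assumes "0 < p"
 shows "(unit i :: 'k::real_normed_field seq) \<in> lp p" "lp_norm p (unit i :: 'k seq) = 1"
proof -
 have u: "(unit i :: 'k seq) = restr {i} (%_. 1)" by (auto simp: unit_def restr_def)
 show "(unit i :: 'k seq) \<in> lp p" unfolding u using lp_restr_finite[OF assms] by blast
 have "lp_norm p (unit i :: 'k seq) powr p = 1 powr p"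
  unfolding u using lp_restr_finite(2)[OF assms, of "{i}" "%_. 1 :: 'k"] by simp
 then show "lp_norm p (unit i :: 'k seq) = 1"
  using assms by (metis lp_norm_nonneg powr_inverse_powr(2) less_irrefl zero_le_one)
qed

lemma restr_finite_eq_sum:
 assumes "finite S"
 shows "restr S x = (\<Sum>i\<in>S. seq_scale (x i) (unit i))"
proof
 fix j
 have "(\<Sum>i\<in>S. seq_scale (x i) (unit i)) j = (\<Sum>i\<in>S. if j = i then x i else 0)"
  unfolding sum_fun_apply by (rule sum.cong) (auto simp: seq_scale_def unit_def)
 also have "\<dots> = restr S x j" using assms by (simp add: restr_def)
 finally show "restr S x j = (\<Sum>i\<in>S. seq_scale (x i) (unit i)) j" by simp
qed

section \<open>Bounded operators\<close>

lemma bounded_opsI: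
 assumes "!!x. x \<in> lp p ==> T x \<in> lp q"
  "!!x y. x \<in> lp p ==> y \<in> lp p ==> T (x + y) = T x + T y"
  "!!c x. x \<in> lp p ==> T (seq_scale c x) = seq_scale c (T x)"
  "!!x. x \<in> lp p ==> lp_norm q (T x) <= C * lp_norm p x"
  "!!x. x \<notin> lp p ==> T x = 0"
 shows "T \<in> bounded_ops p q"
 unfolding bounded_ops_def mem_Collect_eq
proof (intro conjI exI[of _ C])
qed (use assms in auto)

lemma ops_in: "T \<in> bounded_ops p q ==> x \<in> lp p ==> T x \<in> lp q"
 and ops_add: "T \<in> bounded_ops p q ==> x \<in> lp p ==> y \<in> lp p ==> T (x + y) = T x + T y"
 and ops_scale: "T \<in> bounded_ops p q ==> x \<in> lp p ==> T (seq_scale c x) = seq_scale c (T x)"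
 and ops_out: "T \<in> bounded_ops p q ==> x \<notin> lp p ==> T x = 0"
 by (auto simp: bounded_ops_def)

lemma ops_bound:
 assumes "T \<in> bounded_ops p q"
 obtains C where "0 < C" "!!x. x \<in> lp p ==> lp_norm q (T x) <= C * lp_norm p x"
proof -
 obtain C where C: "\<forall>x\<in>lp p. lp_norm q (T x) <= C * lp_norm p x"
  using assms by (auto simp: bounded_ops_def)
 have "lp_norm q (T x) <= (\<bar>C\<bar> + 1) * lp_norm p x" if "x \<in> lp p" for x
 proof -
  have "C * lp_norm p x <= (\<bar>C\<bar> + 1) * lp_norm p x" by (intro mult_right_mono) auto
  then show ?thesis using C that by force
 qed
 then show thesis using that[of "\<bar>C\<bar> + 1"] by auto
qed

lemma seq_scale_0 [simp]: "seq_scale 0 x = 0" "seq_scale c 0 = 0" "seq_scale 1 x = x"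
 by (auto simp: seq_scale_def fun_eq_iff)

lemma ops_0 [simp]: "T \<in> bounded_ops p q ==> T 0 = 0"
 using ops_scale[of T p q 0 0] by simp

lemma ops_diff:
 assumes "T \<in> bounded_ops p q" "1 <= p" "x \<in> lp p" "y \<in> lp p"
 shows "T (x - y) = T x - T y"
proof -
 have "T (x - y) + T y = T x" using ops_add[OF assms(1) lp_diff(1)[OF assms(2-4)] assms(4)] by simp
 then show ?thesis by (simp add: algebra_simps)
qed

lemma ops_sum:
 assumes "T \<in> bounded_ops p q" "1 <= p" "finite J" "!!j. j \<in> J ==> f j \<in> lp p"
 shows "T (sum f J) = (\<Sum>j\<in>J. T (f j))"
 using assms(3,4)
proof (induction J rule: finite_induct)
 case empty
 show ?case unfolding sum.empty by (rule ops_0[OF assms(1)])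
next
 case (insert j J)
 then have "T (f j + sum f J) = T (f j) + (\<Sum>j\<in>J. T (f j))"
  using ops_add[OF assms(1), of "f j" "sum f J"] lp_sum[OF assms(2), of J f] by auto
 then show ?case unfolding sum.insert[OF insert(1,2)] .
qed

lemma zero_bounded_ops [simp]: "0 \<in> bounded_ops p q"
 by (rule bounded_opsI[where C=0]) auto

lemma bounded_ops_add:
 fixes S T :: "'k::real_normed_field seq_op"
 assumes "1 <= q" "S \<in> bounded_ops p q" "T \<in> bounded_ops p q"
 shows "S + T \<in> bounded_ops p q"
proof -
 obtain C D where C: "!!x. x \<in> lp p ==> lp_norm q (S x) <= C * lp_norm p x"
  and D: "!!x. x \<in> lp p ==> lp_norm q (T x) <= D * lp_norm p x"
  using ops_bound assms(2,3) by metis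
 show ?thesis
 proof (rule bounded_opsI[where C="C + D"])
  fix x :: "'k seq" assume x: "x \<in> lp p"
  show "(S + T) x \<in> lp q" using lp_add[OF assms(1)] ops_in[OF assms(2) x] ops_in[OF assms(3) x] by simp
  show "lp_norm q ((S + T) x) <= (C + D) * lp_norm p x"
   using lp_add(2)[OF assms(1) ops_in[OF assms(2) x] ops_in[OF assms(3) x]] C[OF x] D[OF x]
   by (simp add: algebra_simps plus_fun_def[of S T])
  show "(S + T) (seq_scale c x) = seq_scale c ((S + T) x)" for c
   using ops_scale[OF assms(2) x, of c] ops_scale[OF assms(3) x, of c]
   by (simp add: seq.scale_right_distrib plus_fun_def[of S T])
  fix y :: "'k seq" assume y: "y \<in> lp p"
  show "(S + T) (x + y) = (S + T) x + (S + T) y"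
   using ops_add[OF assms(2) x y] ops_add[OF assms(3) x y] by (simp add: plus_fun_def[of S T] algebra_simps)
 next
  fix x :: "'k seq" assume "x \<notin> lp p"
  then show "(S + T) x = 0" using ops_out[OF assms(2)] ops_out[OF assms(3)] by simp
 qed
qed

lemma bounded_ops_scale:
 fixes T :: "'k::real_normed_field seq_op"
 assumes "1 <= q" "T \<in> bounded_ops p q"
 shows "op_scale c T \<in> bounded_ops p q"
proof -
 obtain D where D: "!!x. x \<in> lp p ==> lp_norm q (T x) <= D * lp_norm p x"
  using ops_bound assms(2) by metis
 show ?thesis
 proof (rule bounded_opsI[where C="norm c * D"])
  fix x :: "'k seq" assume x: "x \<in> lp p"
  show "op_scale c T x \<in> lp q" using lp_scale(1)[OF _ ops_in[OF assms(2) x], of c] assms by (simp add: op_scale_def)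
  show "lp_norm q (op_scale c T x) <= norm c * D * lp_norm p x"
   using lp_scale(2)[OF _ ops_in[OF assms(2) x], of c] D[OF x] assms
   by (simp add: op_scale_def mult_left_mono mult.assoc)
  show "op_scale c T (seq_scale d x) = seq_scale d (op_scale c T x)" for d
   using ops_scale[OF assms(2) x, of d] by (simp add: op_scale_def mult.commute)
  fix y :: "'k seq" assume y: "y \<in> lp p"
  show "op_scale c T (x + y) = op_scale c T x + op_scale c T y"
   using ops_add[OF assms(2) x y] by (simp add: op_scale_def seq.scale_right_distrib)
 next
  fix x :: "'k seq" assume "x \<notin> lp p"
  then show "op_scale c T x = 0" using ops_out assms(2) by (fastforce simp: op_scale_def)
 qed
qed

lemma op_scale_minus_one: "op_scale (- 1) T = - T"
 by (auto simp: op_scale_def seq_scale_def fun_eq_iff)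

lemma bounded_ops_diff:
 fixes S T :: "'k::real_normed_field seq_op"
 assumes "1 <= q" "S \<in> bounded_ops p q" "T \<in> bounded_ops p q"
 shows "S - T \<in> bounded_ops p q"
 using bounded_ops_add[OF assms(1,2) bounded_ops_scale[OF assms(1,3), of "- 1"]]
 by (simp add: op_scale_minus_one)

lemma bounded_ops_comp:
 fixes A T :: "'k::real_normed_field seq_op"
 assumes "A \<in> bounded_ops q r" "T \<in> bounded_ops p q"
 shows "A \<circ> T \<in> bounded_ops p r"
proof -
 obtain C where C: "C > 0" "!!x. x \<in> lp q ==> lp_norm r (A x) <= C * lp_norm q x"
  using ops_bound[OF assms(1)] by metis
 obtain D where D: "!!x. x \<in> lp p ==> lp_norm q (T x) <= D * lp_norm p x"
  using ops_bound[OF assms(2)] by metis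
 show ?thesis
 proof (rule bounded_opsI[where C="C * D"])
  fix x :: "'k seq" assume x: "x \<in> lp p"
  note Tx = ops_in[OF assms(2) x]
  show "(A \<circ> T) x \<in> lp r" using ops_in[OF assms(1) Tx] by simp
  show "lp_norm r ((A \<circ> T) x) <= C * D * lp_norm p x"
   using order_trans[OF C(2)[OF Tx] mult_left_mono[OF D[OF x], of C]] C(1) by (simp add: mult.assoc)
  show "(A \<circ> T) (seq_scale d x) = seq_scale d ((A \<circ> T) x)" for d
   using ops_scale[OF assms(2) x, of d] ops_scale[OF assms(1) Tx, of d] by simp
  fix y :: "'k seq" assume y: "y \<in> lp p"
  show "(A \<circ> T) (x + y) = (A \<circ> T) x + (A \<circ> T) y"
   using ops_add[OF assms(2) x y] ops_add[OF assms(1) Tx ops_in[OF assms(2) y]] by simp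
 next
  fix x :: "'k seq" assume "x \<notin> lp p"
  then show "(A \<circ> T) x = 0" using ops_out[OF assms(2)] ops_0[OF assms(1)] by (simp del: ops_0)
 qed
qed

text \<open>
 The target exponent does not enter, so \<open>proj p UNIV\<close> is the formal identity into every \<open>\<ell>\<^sub>q\<close> with \<open>q \<ge> p\<close>.
\<close>

definition proj :: "real => nat set => 'k::real_normed_field seq_op" where
 "proj p S x = (if x \<in> lp p then restr S x else 0)"

lemma proj_bounded_ops:
 assumes "1 <= p" "p <= q"
 shows "(proj p S :: 'k::real_normed_field seq_op) \<in> bounded_ops p q"
proof (rule bounded_opsI[where C=1])
 fix x :: "'k seq" assume x: "x \<in> lp p"
 have r: "restr S x \<in> lp p" "lp_norm p (restr S x) <= lp_norm p x" using lp_restr[OF _ x, of S] assms by auto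
 show "proj p S x \<in> lp q" "lp_norm q (proj p S x) <= 1 * lp_norm p x"
  using lp_mono[OF _ assms(2) r(1)] r assms x by (auto simp: proj_def)
 show "proj p S (seq_scale c x) = seq_scale c (proj p S x)" for c
  using x lp_scale[of p x] assms by (simp add: proj_def)
 show "proj p S (x + y) = proj p S x + proj p S y" if "y \<in> lp p" for y
  using x that lp_add[of p x y] assms by (simp add: proj_def)
qed (simp add: proj_def)

lemma formal_identity_eq_proj: "formal_identity p = proj p UNIV"
 by (auto simp: formal_identity_def proj_def fun_eq_iff)

lemma formal_identity_bounded_ops:
 "1 <= p ==> p <= q ==> formal_identity p \<in> bounded_ops p q"
 by (simp add: formal_identity_eq_proj proj_bounded_ops)

section \<open>The operator norm\<close>

lemma op_norm_le:
 fixes T :: "'k::real_normed_field seq_op"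
 assumes "0 <= C" "!!x. x \<in> lp p ==> lp_norm q (T x) <= C * lp_norm p x"
 shows "op_norm p q T <= C"
proof -
 have "(SUP x\<in>lp_ball p. ennreal (lp_norm q (T x))) <= ennreal C"
 proof (rule SUP_least)
  fix x :: "'k seq" assume "x \<in> lp_ball p"
  then have "x \<in> lp p" "lp_norm p x <= 1" by (auto simp: lp_ball_def)
  then show "ennreal (lp_norm q (T x)) <= ennreal C"
   using order_trans[OF assms(2)[of x] mult_left_mono[of "lp_norm p x" 1 C]] assms(1) by (intro ennreal_leI) auto
 qed
 then have "op_norm p q T <= enn2real (ennreal C)"
  unfolding op_norm_def by (intro enn2real_mono) auto
 then show ?thesis using assms(1) by simp
qed

lemma op_norm_bound:
 fixes T :: "'k::real_normed_field seq_op"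
 assumes "0 < p" "0 < q" "T \<in> bounded_ops p q" "x \<in> lp p"
 shows "lp_norm q (T x) <= op_norm p q T * lp_norm p x"
proof (cases "x = 0")
 case True
 then show ?thesis using ops_0[OF assms(3)] by simp
next
 case False
 then have n: "lp_norm p x > 0" using lp_norm_pos[OF assms(4,1)] by simp
 define c :: 'k where "c = of_real (1 / lp_norm p x)"
 have c: "norm c = 1 / lp_norm p x" using n by (simp add: c_def norm_divide)
 obtain C where C: "C > 0" "!!x. x \<in> lp p ==> lp_norm q (T x) <= C * lp_norm p x"
  using ops_bound[OF assms(3)] by metis
 have b: "seq_scale c x \<in> lp_ball p"
  using lp_scale[OF assms(1,4), of c] c n by (simp add: lp_ball_def)
 have "ennreal (lp_norm q (T (seq_scale c x))) <= (SUP x\<in>lp_ball p. ennreal (lp_norm q (T x)))"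
  by (rule SUP_upper[OF b])
 moreover have "(SUP x\<in>lp_ball p. ennreal (lp_norm q (T x))) <= ennreal C"
 proof (rule SUP_least)
  fix x :: "'k seq" assume "x \<in> lp_ball p"
  then have "x \<in> lp p" "lp_norm p x <= 1" by (auto simp: lp_ball_def)
  then show "ennreal (lp_norm q (T x)) <= ennreal C"
   using order_trans[OF C(2)[of x] mult_left_mono[of "lp_norm p x" 1 C]] C(1) by (intro ennreal_leI) auto
 qed
 ultimately have "lp_norm q (T (seq_scale c x)) <= op_norm p q T"
  unfolding op_norm_def using enn2real_mono[of "ennreal (lp_norm q (T (seq_scale c x)))"]
  by (metis enn2real_ennreal ennreal_less_top le_less_trans lp_norm_nonneg)
 moreover have "lp_norm q (T (seq_scale c x)) = lp_norm q (T x) / lp_norm p x"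
  using ops_scale[OF assms(3,4)] lp_scale(2)[OF assms(2) ops_in[OF assms(3,4)], of c] c by simp
 ultimately show ?thesis using n by (simp add: field_simps)
qed

lemma op_norm_minus_commute: "op_norm p q (S - T) = op_norm p q (T - S)"
 unfolding op_norm_def by (simp add: lp_norm_minus_commute)

lemma Metric_space_lp:
 assumes "1 <= p"
 shows "Metric_space (lp p :: 'k::real_normed_field seq set) (%x y. lp_norm p (x - y))"
proof
 fix x y z :: "'k seq"
 show "0 <= lp_norm p (x - y)" by simp
 show "lp_norm p (x - y) = lp_norm p (y - x)" by (rule lp_norm_minus_commute)
 assume xy: "x \<in> lp p" "y \<in> lp p"
 show "lp_norm p (x - y) = 0 \<longleftrightarrow> x = y"
  using lp_norm_eq_0[OF lp_diff(1)[OF assms xy]] assms by simp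
 assume z: "z \<in> lp p"
 show "lp_norm p (x - z) <= lp_norm p (x - y) + lp_norm p (y - z)"
  using lp_add(2)[OF assms lp_diff(1)[OF assms xy] lp_diff(1)[OF assms xy(2) z]] by simp
qed

lemma Metric_space_ops:
 assumes "1 <= p" "1 <= q"
 shows "Metric_space (bounded_ops p q :: 'k::real_normed_field seq_op set) (%S T. op_norm p q (S - T))"
proof
 fix S T U :: "'k seq_op"
 show "0 <= op_norm p q (S - T)" by (simp add: op_norm_def)
 show "op_norm p q (S - T) = op_norm p q (T - S)" by (rule op_norm_minus_commute)
 assume ST: "S \<in> bounded_ops p q" "T \<in> bounded_ops p q"
 have D: "S - T \<in> bounded_ops p q" by (rule bounded_ops_diff[OF assms(2) ST])
 show "op_norm p q (S - T) = 0 \<longleftrightarrow> S = T"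
 proof
  assume z: "op_norm p q (S - T) = 0"
  have "S x = T x" for x
  proof (cases "x \<in> lp p")
   case True
   have "lp_norm q ((S - T) x) <= 0" using op_norm_bound[OF _ _ D True] assms z by simp
   then have "(S - T) x = 0"
    using lp_norm_eq_0[OF ops_in[OF D True]] assms by (simp add: order_antisym)
   then show ?thesis by simp
  qed (use ops_out ST in metis)
  then show "S = T" by auto
 next
  assume "S = T"
  then have "op_norm p q (S - T) <= 0" by (intro op_norm_le) auto
  moreover have "0 <= op_norm p q (S - T)" by (simp add: op_norm_def)
  ultimately show "op_norm p q (S - T) = 0" by linarith
 qed
 assume U: "U \<in> bounded_ops p q"
 have E: "T - U \<in> bounded_ops p q" by (rule bounded_ops_diff[OF assms(2) ST(2) U])
 show "op_norm p q (S - U) <= op_norm p q (S - T) + op_norm p q (T - U)"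
 proof (rule op_norm_le)
  show "0 <= op_norm p q (S - T) + op_norm p q (T - U)" by (simp add: op_norm_def)
  fix x :: "'k seq" assume x: "x \<in> lp p"
  have "(S - U) x = (S - T) x + (T - U) x" by simp
  then have "lp_norm q ((S - U) x) <= lp_norm q ((S - T) x) + lp_norm q ((T - U) x)"
   using lp_add(2)[OF assms(2) ops_in[OF D x] ops_in[OF E x]] by metis
  also have "\<dots> <= op_norm p q (S - T) * lp_norm p x + op_norm p q (T - U) * lp_norm p x"
   using op_norm_bound[OF _ _ D x] op_norm_bound[OF _ _ E x] assms by (intro add_mono) auto
  finally show "lp_norm q ((S - U) x) <= (op_norm p q (S - T) + op_norm p q (T - U)) * lp_norm p x"
   by (simp add: algebra_simps)
 qed
qed

text \<open>
 Membership in the norm closure of \<open>J\<close>, expressed without the operator norm so that the topology is met only once.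
\<close>

definition op_approx :: "real => real => 'k::real_normed_field seq_op set => 'k seq_op => bool" where
 "op_approx p q J T \<longleftrightarrow>
  (\<forall>e>0. \<exists>S\<in>J. \<forall>x\<in>lp p. lp_norm q (S x - T x) <= e * lp_norm p x)"

lemma op_approx_iff:
 fixes J :: "'k::real_normed_field seq_op set"
 assumes "1 <= p" "1 <= q" "J \<subseteq> bounded_ops p q" "T \<in> bounded_ops p q"
 shows "op_approx p q J T \<longleftrightarrow> (\<forall>e>0. \<exists>S\<in>J. op_norm p q (T - S) < e)"
proof
 assume L: "op_approx p q J T"
 show "\<forall>e>0. \<exists>S\<in>J. op_norm p q (T - S) < e"
 proof (intro allI impI)
  fix e :: real assume e: "e > 0"
  then obtain S where S: "S \<in> J" "\<forall>x\<in>lp p. lp_norm q (S x - T x) <= e / 2 * lp_norm p x"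
   using L unfolding op_approx_def by (meson half_gt_zero)
  have "op_norm p q (T - S) <= e / 2"
   using S(2) e by (intro op_norm_le) (auto simp: lp_norm_minus_commute[of q "T _"])
  then show "\<exists>S\<in>J. op_norm p q (T - S) < e" using S(1) e by (intro bexI[of _ S]) auto
 qed
next
 assume R: "\<forall>e>0. \<exists>S\<in>J. op_norm p q (T - S) < e"
 show "op_approx p q J T" unfolding op_approx_def
 proof (intro allI impI)
  fix e :: real assume "e > 0"
  then obtain S where S: "S \<in> J" "op_norm p q (T - S) < e" using R by blast
  have D: "T - S \<in> bounded_ops p q" using bounded_ops_diff assms S by blast
  have "lp_norm q (S x - T x) <= e * lp_norm p x" if "x \<in> lp p" for x
  proof -
   have "lp_norm q (S x - T x) = lp_norm q ((T - S) x)" by (simp add: lp_norm_minus_commute)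
   also have "\<dots> <= op_norm p q (T - S) * lp_norm p x"
    using op_norm_bound[OF _ _ D that] assms by simp
   also have "\<dots> <= e * lp_norm p x" using S by (intro mult_right_mono) auto
   finally show ?thesis .
  qed
  then show "\<exists>S\<in>J. \<forall>x\<in>lp p. lp_norm q (S x - T x) <= e * lp_norm p x" using S by blast
 qed
qed

lemma closedin_op_topology:
 fixes J :: "'k::real_normed_field seq_op set"
 assumes "1 <= p" "1 <= q"
 shows "closedin (op_topology p q) J \<longleftrightarrow>
  J \<subseteq> bounded_ops p q \<and> (\<forall>T\<in>bounded_ops p q. op_approx p q J T --> T \<in> J)"
proof -
 interpret Metric_space "bounded_ops p q :: 'k seq_op set" "%S T. op_norm p q (S - T)"
  by (rule Metric_space_ops[OF assms])
 show ?thesis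
  unfolding op_topology_def closedin_metric
  using op_approx_iff[OF assms, of J]
  by (auto simp: disjnt_iff in_mball) (meson less_le_not_le linorder_not_less subsetD)+
qed

lemma closure_op_topology:
 fixes J :: "'k::real_normed_field seq_op set"
 assumes "1 <= p" "1 <= q" "J \<subseteq> bounded_ops p q"
 shows "op_topology p q closure_of J = {T \<in> bounded_ops p q. op_approx p q J T}"
proof -
 interpret Metric_space "bounded_ops p q :: 'k seq_op set" "%S T. op_norm p q (S - T)"
  by (rule Metric_space_ops[OF assms(1,2)])
 show ?thesis
  unfolding op_topology_def metric_closure_of
  using op_approx_iff[OF assms] assms(3) unfolding in_mball by (auto; meson subsetD)
qed

section \<open>Closed ideals\<close>

text \<open>
 Ideals need to be closed under approximation only; the topological part of the definition is absorbed here.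
\<close>

lemma closed_idealI:
 fixes J :: "'k::real_normed_field seq_op set"
 assumes "1 <= p" "1 <= q" "J \<subseteq> bounded_ops p q" "0 \<in> J"
  "!!S T. S \<in> J ==> T \<in> J ==> S + T \<in> J"
  "!!c T. T \<in> J ==> op_scale c T \<in> J"
  "!!A T B. A \<in> bounded_ops q q ==> T \<in> J ==> B \<in> bounded_ops p p ==> A \<circ> T \<circ> B \<in> J"
  "!!T. T \<in> bounded_ops p q ==> op_approx p q J T ==> T \<in> J"
 shows "closed_ideal p q J"
 unfolding closed_ideal_def op_ideal_def closedin_op_topology[OF assms(1,2)]
 using assms by (auto intro!: oper.subspaceI)

lemma closed_ideal_0: "closed_ideal p q J ==> 0 \<in> J"
 and closed_ideal_sub: "closed_ideal p q J ==> J \<subseteq> bounded_ops p q"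
 and closed_ideal_add: "closed_ideal p q J ==> S \<in> J ==> T \<in> J ==> S + T \<in> J"
 and closed_ideal_scale: "closed_ideal p q J ==> T \<in> J ==> op_scale c T \<in> J"
 and closed_ideal_mult: "closed_ideal p q J ==> A \<in> bounded_ops q q ==> T \<in> J ==>
  B \<in> bounded_ops p p ==> A \<circ> T \<circ> B \<in> J"
 unfolding closed_ideal_def op_ideal_def
 by (auto simp: oper.subspace_0 oper.subspace_add oper.subspace_scale)

lemma closed_ideal_sum:
 assumes "closed_ideal p q J" "!!a. a \<in> A ==> f a \<in> J"
 shows "sum f A \<in> J"
 using assms closed_ideal_def[of p q J] op_ideal_def[of p q J] by (auto intro: oper.subspace_sum)

lemma ops_bound_dense:
 fixes R :: "'k::real_normed_field seq_op"
 assumes "1 <= p" "1 <= q" "R \<in> bounded_ops p q"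
  and le: "!!M x. lp_norm q (R (restr {..<M} x)) <= C * lp_norm p (restr {..<M} x)"
  and x: "x \<in> lp p" "0 <= C"
 shows "lp_norm q (R x) <= C * lp_norm p x"
proof (rule field_le_epsilon)
 fix e :: real assume e: "e > 0"
 obtain D where D: "D > 0" "!!x. x \<in> lp p ==> lp_norm q (R x) <= D * lp_norm p x"
  using ops_bound[OF assms(3)] by metis
 obtain M where M: "lp_norm p (restr {M..} x) < e / D"
  using lp_tail[OF _ x(1), of "e / D"] e D(1) assms(1) by auto
 have m: "restr {..<M} x \<in> lp p" "restr {M..} x \<in> lp p" using lp_restr(1)[OF _ x(1)] assms by auto
 have "x = restr {..<M} x + restr {M..} x" by (auto simp: restr_def fun_eq_iff)
 then have "R x = R (restr {..<M} x) + R (restr {M..} x)" using ops_add[OF assms(3) m] by simp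
 then have "lp_norm q (R x) <= lp_norm q (R (restr {..<M} x)) + lp_norm q (R (restr {M..} x))"
  using lp_add(2)[OF assms(2) ops_in[OF assms(3) m(1)] ops_in[OF assms(3) m(2)]] by simp
 also have "\<dots> <= C * lp_norm p x + D * (e / D)"
 proof (rule add_mono)
  show "lp_norm q (R (restr {..<M} x)) <= C * lp_norm p x"
   using order_trans[OF le[of M x] mult_left_mono[OF lp_restr(2)[OF _ x(1)] x(2)]] assms(1) by simp
  show "lp_norm q (R (restr {M..} x)) <= D * (e / D)"
   using D(2)[OF m(2)] mult_left_mono[OF less_imp_le[OF M], of D] D(1) by linarith
 qed
 finally show "lp_norm q (R x) <= C * lp_norm p x + e" using D(1) by simp
qed

text \<open>It suffices to test approximation on finitely supported sequences.\<close>

lemma closed_ideal_limit: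
 fixes T :: "'k::real_normed_field seq_op"
 assumes "1 <= p" "1 <= q" "closed_ideal p q J" "T \<in> bounded_ops p q"
  and ap: "!!e. e > 0 ==> \<exists>S\<in>J. \<forall>M x. lp_norm q (S (restr {..<M} x) - T (restr {..<M} x)) <= e * lp_norm p (restr {..<M} x)"
 shows "T \<in> J"
proof -
 have "op_approx p q J T"
  unfolding op_approx_def
 proof (intro allI impI)
  fix e :: real assume e: "e > 0"
  obtain S where S: "S \<in> J" "!!M x. lp_norm q (S (restr {..<M} x) - T (restr {..<M} x)) <= e * lp_norm p (restr {..<M} x)"
   using ap[OF e] by blast
  have "S - T \<in> bounded_ops p q" using closed_ideal_sub[OF assms(3)] S(1) bounded_ops_diff assms by blast
  from ops_bound_dense[OF assms(1,2) this] S(2) e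
  have "lp_norm q (S x - T x) <= e * lp_norm p x" if "x \<in> lp p" for x
   using that by (metis fun_diff_def less_imp_le)
  then show "\<exists>S\<in>J. \<forall>x\<in>lp p. lp_norm q (S x - T x) <= e * lp_norm p x" using S(1) by blast
 qed
 then show ?thesis
  using assms(3,4) closedin_op_topology[OF assms(1,2)] by (auto simp: closed_ideal_def)
qed

lemma closed_ideal_bounded_ops:
 assumes "1 <= p" "1 <= q"
 shows "closed_ideal p q (bounded_ops p q)"
 by (rule closed_idealI[OF assms])
  (auto simp: bounded_ops_add assms bounded_ops_scale intro!: bounded_ops_comp)

lemma generated_ideal_least: "closed_ideal p q J ==> M \<subseteq> J ==> generated_ideal p q M \<subseteq> J"
 by (auto simp: generated_ideal_def)

lemma generated_ideal_sup: "M \<subseteq> generated_ideal p q M"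
 by (auto simp: generated_ideal_def)

lemma closed_ideal_generated:
 fixes M :: "'k::real_normed_field seq_op set"
 assumes "1 <= p" "1 <= q" "M \<subseteq> bounded_ops p q"
 shows "closed_ideal p q (generated_ideal p q M)"
proof (rule closed_idealI[OF assms(1,2)])
 show "generated_ideal p q M \<subseteq> bounded_ops p q"
  by (rule generated_ideal_least[OF closed_ideal_bounded_ops[OF assms(1,2)] assms(3)])
 fix T :: "'k seq_op"
 assume T: "T \<in> bounded_ops p q" "op_approx p q (generated_ideal p q M) T"
 have "T \<in> J" if "closed_ideal p q J" "M \<subseteq> J" for J
 proof -
  have "op_approx p q J T"
   using T(2) generated_ideal_least[OF that] unfolding op_approx_def by (meson subsetD)
  then show ?thesis
   using that T(1) closedin_op_topology[OF assms(1,2)] by (auto simp: closed_ideal_def)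
 qed
 then show "T \<in> generated_ideal p q M" by (auto simp: generated_ideal_def)
qed (auto simp: generated_ideal_def intro: closed_ideal_0 closed_ideal_add closed_ideal_scale closed_ideal_mult)

section \<open>Tails of operators\<close>

lemma lp_scale_unit:
 assumes "0 < p"
 shows "seq_scale c (unit i) \<in> lp p" "lp_norm p (seq_scale c (unit i)) = norm c"
 using lp_scale[OF assms unit_lp(1)[OF assms], of c i] unit_lp(2)[OF assms, of i, where 'k='a] by auto

lemma lp_norm_restr_le_sum:
 assumes "1 <= q"
 shows "lp_norm q (restr {..<m} y) <= (\<Sum>i<m. norm (y i))"
proof -
 have "lp_norm q (\<Sum>i<m. seq_scale (y i) (unit i)) <= (\<Sum>i<m. lp_norm q (seq_scale (y i) (unit i)))"
  using lp_sum[OF assms, of "{..<m}" "%i. seq_scale (y i) (unit i)"] lp_scale_unit(1)[of q] assms by auto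
 then show ?thesis using assms by (simp add: restr_finite_eq_sum lp_scale_unit(2))
qed

lemma column_tail:
 fixes T :: "'k::real_normed_field seq_op"
 assumes "1 <= p" "1 <= q" "T \<in> bounded_ops p q" "0 < e"
 shows "\<exists>M. \<forall>n\<ge>M. \<forall>x. lp_norm q (restr {n..} (T (restr {..<m} x))) <= e * lp_norm p (restr {..<m} x)"
proof -
 have "\<exists>M. \<forall>n\<ge>M. lp_norm q (restr {n..} (T (unit i))) < e / (real m + 1)" for i
  by (rule lp_tail) (use assms ops_in[OF assms(3) unit_lp(1)] in auto)
 then obtain N where N: "!!i n. n >= N i ==> lp_norm q (restr {n..} (T (unit i))) < e / (real m + 1)"
  by metis
 define M where "M = Max (insert 0 (N ` {..<m}))"
 have M: "N i <= M" if "i < m" for i using that by (auto simp: M_def)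
 have "lp_norm q (restr {n..} (T (restr {..<m} x))) <= e * lp_norm p (restr {..<m} x)" if n: "n >= M" for n x
 proof -
  let ?x = "restr {..<m} x"
  have xl: "?x \<in> lp p" using lp_restr_finite(1)[of p "{..<m}"] assms by auto
  have u: "seq_scale (x i) (unit i) \<in> lp p" for i
   by (rule lp_scale_unit(1)) (use assms in simp)
  have Tu: "T (unit i) \<in> lp q" for i using ops_in[OF assms(3)] unit_lp(1)[of p i] assms by auto
  have su: "seq_scale (x i) (restr {n..} (T (unit i))) \<in> lp q" for i
   by (rule lp_scale(1)[OF _ lp_restr(1)[OF _ Tu]]) (use assms in auto)
  have eq: "restr {n..} (T ?x) = (\<Sum>i<m. seq_scale (x i) (restr {n..} (T (unit i))))"
   unfolding restr_finite_eq_sum[OF finite_lessThan]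
   by (subst ops_sum[OF assms(3,1)]) (use u assms ops_scale[OF assms(3) unit_lp(1)] in \<open>auto simp: restr_sum\<close>)
  have "lp_norm q (\<Sum>i<m. seq_scale (x i) (restr {n..} (T (unit i)))) \<le>
   (\<Sum>i<m. lp_norm q (seq_scale (x i) (restr {n..} (T (unit i)))))"
   using lp_sum[OF assms(2), of "{..<m}" "%i. seq_scale (x i) (restr {n..} (T (unit i)))"]
    su by auto
  also have "\<dots> <= (\<Sum>i<m. lp_norm p ?x * (e / (real m + 1)))"
  proof (rule sum_mono)
   fix i assume i: "i \<in> {..<m}"
   have "lp_norm q (seq_scale (x i) (restr {n..} (T (unit i)))) = norm (x i) * lp_norm q (restr {n..} (T (unit i)))"
    by (rule lp_scale(2)[OF _ lp_restr(1)[OF _ Tu]]) (use assms in auto)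
   also have "\<dots> <= lp_norm p ?x * (e / (real m + 1))"
    using lp_norm_component[OF xl, of i] N[of i n] M[of i] n i assms
    by (intro mult_mono) (auto simp: restr_def)
   finally show "lp_norm q (seq_scale (x i) (restr {n..} (T (unit i)))) <= lp_norm p ?x * (e / (real m + 1))" .
  qed
  also have "\<dots> <= e * lp_norm p ?x"
  proof -
   have "real m * e / (real m + 1) <= e" using assms(4) by (simp add: field_simps)
   from mult_left_mono[OF this, of "lp_norm p ?x"] show ?thesis by (simp add: field_simps)
  qed
  finally show ?thesis unfolding eq .
 qed
 then show ?thesis by blast
qed

text \<open>
 If \<open>f\<close> were at least \<open>e\<close> on normalised vectors arbitrarily far out, the sum of \<open>n\<close> disjoint ones would give \<open>n e \<le> C n^(1/p)\<close>, which is impossible for large \<open>n\<close> because \<open>p > 1\<close>.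
\<close>

lemma functional_tail:
 fixes f :: "'k::real_normed_field seq => 'k"
 assumes p: "1 < p"
  and add: "!!x y. x \<in> lp p ==> y \<in> lp p ==> f (x + y) = f x + f y"
  and scale: "!!c x. x \<in> lp p ==> f (seq_scale c x) = c * f x"
  and bound: "!!x. x \<in> lp p ==> norm (f x) <= C * lp_norm p x"
  and e: "0 < e"
 shows "\<exists>M. \<forall>x\<in>lp p. norm (f (restr {M..} x)) <= e * lp_norm p x"
proof (rule ccontr)
 assume "\<not> ?thesis"
 then have neg: "\<exists>x\<in>lp p. norm (f (restr {M..} x)) > e * lp_norm p x" for M
  by (meson not_le)
 have C: "C >= 0"
  using order_trans[OF norm_ge_zero bound[OF unit_lp(1), of 0]] unit_lp(2)[of p 0, where 'k='k] p by simp
 have fin: "\<exists>y N. y = restr {M..<N} y \<and> f y = 1 \<and> lp_norm p y <= 1 / e" for M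
 proof -
  obtain x where x: "x \<in> lp p" "norm (f (restr {M..} x)) > e * lp_norm p x" using neg by blast
  define d where "d = norm (f (restr {M..} x)) - e * lp_norm p x"
  have d: "d > 0" using x by (simp add: d_def)
  obtain N where N: "lp_norm p (restr {N..} x) < d / (C + 1)"
   using lp_tail[OF _ x(1), of "d / (C + 1)"] d C p by auto
  define N' where "N' = max M N"
  have lps: "restr S x \<in> lp p" for S using lp_restr(1)[OF _ x(1)] p by simp
  have "restr {M..} x = restr {M..<N'} x + restr {N'..} x"
   by (auto simp: restr_def fun_eq_iff N'_def)
  then have "f (restr {M..} x) = f (restr {M..<N'} x) + f (restr {N'..} x)"
   using add lps by simp
  then have "norm (f (restr {M..} x)) <= norm (f (restr {M..<N'} x)) + norm (f (restr {N'..} x))"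
   by (simp add: norm_triangle_ineq)
  moreover have "norm (f (restr {N'..} x)) < d"
  proof -
   have "lp_norm p (restr {N'..} x) <= lp_norm p (restr {N..} x)"
    using lp_restr_mono[OF _ x(1)] p by (auto simp: N'_def)
   then have "lp_norm p (restr {N'..} x) < d / (C + 1)" using N by linarith
   then have "(C + 1) * lp_norm p (restr {N'..} x) < d" using C by (simp add: field_simps)
   moreover have "C * lp_norm p (restr {N'..} x) <= (C + 1) * lp_norm p (restr {N'..} x)"
    by (intro mult_right_mono) auto
   ultimately show ?thesis using bound[OF lps, of "{N'..}"] by linarith
  qed
  ultimately have gt: "norm (f (restr {M..<N'} x)) > e * lp_norm p x" by (simp add: d_def)
  then have nz: "norm (f (restr {M..<N'} x)) > 0" using e by (smt (verit) lp_norm_nonneg mult_nonneg_nonneg)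
  define c where "c = inverse (f (restr {M..<N'} x))"
  let ?y = "seq_scale c (restr {M..<N'} x)"
  have "f ?y = 1" using scale[OF lps] nz by (simp add: c_def)
  moreover have "lp_norm p ?y <= 1 / e"
  proof -
   have "lp_norm p ?y = norm c * lp_norm p (restr {M..<N'} x)" using lp_scale(2)[OF _ lps] p by simp
   also have "\<dots> <= norm c * lp_norm p x" using lp_restr(2)[OF _ x(1)] p by (intro mult_left_mono) auto
   also have "\<dots> = lp_norm p x / norm (f (restr {M..<N'} x))" by (simp add: c_def norm_inverse divide_inverse)
   also have "\<dots> <= 1 / e" using gt nz e by (simp add: pos_divide_le_eq pos_le_divide_eq field_simps)
   finally show ?thesis .
  qed
  moreover have "?y = restr {M..<N'} ?y" by simp
  ultimately show ?thesis by blast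
 qed
 have many: "\<exists>z N. z = restr {..<N} z \<and> f z = of_nat n \<and> lp_norm p z powr p <= real n * (1 / e) powr p" for n
 proof (induction n)
  case 0
  have "f 0 = 0" using scale[of 0 0] by simp
  then have "(0 :: 'k seq) = restr {..<0} 0 \<and> f 0 = of_nat 0 \<and> lp_norm p (0 :: 'k seq) powr p <= real 0 * (1 / e) powr p"
   using p by simp
  then show ?case by blast
 next
  case (Suc n)
  then obtain z N where z: "z = restr {..<N} z" "f z = of_nat n" "lp_norm p z powr p <= real n * (1 / e) powr p" by blast
  obtain y M where y: "y = restr {N..<M} y" "f y = 1" "lp_norm p y <= 1 / e" using fin by blast
  have zl: "z \<in> lp p" and yl: "y \<in> lp p"
   by (subst z(1), rule lp_restr_finite, use p in auto)
    (subst y(1), rule lp_restr_finite, use p in auto)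
  have z0: "z i = 0" if "\<not> i < N" for i by (subst z(1)) (use that in \<open>simp add: restr_def\<close>)
  have y0: "y i = 0" if "i < N \<or> \<not> i < M" for i by (subst y(1)) (use that in \<open>auto simp: restr_def\<close>)
  have s: "restr {..<N} (z + y) = z" "restr (- {..<N}) (z + y) = y"
   using z0 y0 by (auto simp: restr_def fun_eq_iff)
  have "lp_norm p (z + y) powr p = lp_norm p z powr p + lp_norm p y powr p"
   using lp_norm_split[of p "z + y" "{..<N}"] lp_add(1)[OF _ zl yl] p s by simp
  also have "\<dots> <= real n * (1 / e) powr p + (1 / e) powr p"
   using z(3) y(3) p by (intro add_mono powr_mono2) auto
  finally have "lp_norm p (z + y) powr p <= real (Suc n) * (1 / e) powr p" by (simp add: algebra_simps)
  moreover have "f (z + y) = of_nat (Suc n)" using add[OF zl yl] z(2) y(2) by simp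
  moreover have "z + y = restr {..<max N M} (z + y)"
   using z0 y0 by (auto simp: restr_def fun_eq_iff less_max_iff_disj)
  ultimately show ?case by blast
 qed
 have le: "real n <= C * (real n powr (1 / p) * (1 / e))" for n
 proof -
  obtain z N where z: "z = restr {..<N} z" "f z = of_nat n" "lp_norm p z powr p <= real n * (1 / e) powr p"
   using many by blast
  have zl: "z \<in> lp p" by (subst z(1), rule lp_restr_finite, use p in auto)
  have "lp_norm p z <= real n powr (1 / p) * (1 / e)"
   by (rule le_powr_cancel[of _ p]) (use z(3) p e in \<open>simp_all add: powr_mult powr_powr powr_divide\<close>)
  then have "C * lp_norm p z <= C * (real n powr (1 / p) * (1 / e))" using C by (rule mult_left_mono)
  then show ?thesis using bound[OF zl] z(2) by simp
 qed
 obtain n where n0: "real n > (C * (1 / e)) powr (1 / (1 - 1 / p)) + 1" using reals_Archimedean2 by blast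
 have n: "real n powr (1 - 1 / p) > C * (1 / e)" "n > 0"
 proof -
  have "C * (1 / e) = ((C * (1 / e)) powr (1 / (1 - 1 / p))) powr (1 - 1 / p)" using p C e by (simp add: powr_powr)
  also have "\<dots> < real n powr (1 - 1 / p)" using n0 p by (intro powr_less_mono2) auto
  finally show "real n powr (1 - 1 / p) > C * (1 / e)" .
  have "(0::real) <= (C * (1 / e)) powr (1 / (1 - 1 / p))" by (rule powr_ge_zero)
  then have "0 < real n" using n0 by linarith
  then show "n > 0" by simp
 qed
 have "real n = real n powr (1 - 1 / p) * real n powr (1 / p)" using n by (simp flip: powr_add)
 also have "\<dots> > C * (1 / e) * real n powr (1 / p)" using n by (intro mult_strict_right_mono) auto
 finally show False using le[of n] by (simp add: mult_ac)
qed

text \<open>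
 Dual to the previous tail estimates: finitely many output coordinates depend, up to \<open>e\<close>, on finitely many input coordinates. Together they make the off-diagonal part of a sparse block decomposition small.
\<close>

lemma row_tail:
 fixes T :: "'k::real_normed_field seq_op"
 assumes "1 < p" "1 <= q" "T \<in> bounded_ops p q" "0 < e"
 shows "\<exists>M. \<forall>n\<ge>M. \<forall>x\<in>lp p. lp_norm q (restr {..<m} (T (restr {n..} x))) <= e * lp_norm p x"
proof -
 obtain C where C: "C > 0" "!!x. x \<in> lp p ==> lp_norm q (T x) <= C * lp_norm p x"
  using ops_bound[OF assms(3)] by metis
 have lps: "restr S x \<in> lp p" if "x \<in> lp p" for S and x :: "'k seq" using lp_restr(1)[OF _ that] assms by simp
 have "\<exists>M. \<forall>x\<in>lp p. norm (T (restr {M..} x) i) <= e / (real m + 1) * lp_norm p x" for i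
 proof (rule functional_tail[OF assms(1), of "%x. T x i" C])
  fix x y :: "'k seq" and c assume x: "x \<in> lp p"
  show "T (seq_scale c x) i = c * T x i" using ops_scale[OF assms(3) x, of c] by (simp add: seq_scale_def)
  show "norm (T x i) <= C * lp_norm p x"
   using order_trans[OF lp_norm_component[OF ops_in[OF assms(3) x]] C(2)[OF x]] assms by simp
  assume "y \<in> lp p"
  then show "T (x + y) i = T x i + T y i" using ops_add[OF assms(3) x] by simp
 qed (use assms in auto)
 then obtain N where N: "!!i x. x \<in> lp p ==> norm (T (restr {N i..} x) i) <= e / (real m + 1) * lp_norm p x" by metis
 define M where "M = Max (insert 0 (N ` {..<m}))"
 have M: "N i <= M" if "i < m" for i using that by (auto simp: M_def)
 have "lp_norm q (restr {..<m} (T (restr {n..} x))) <= e * lp_norm p x" if n: "n >= M" and x: "x \<in> lp p" for n x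
 proof -
  let ?y = "T (restr {n..} x)"
  have "lp_norm q (restr {..<m} ?y) <= (\<Sum>i<m. norm (?y i))" by (rule lp_norm_restr_le_sum[OF assms(2)])
  moreover have "\<dots> <= (\<Sum>i<m. e / (real m + 1) * lp_norm p x)"
  proof (rule sum_mono)
   fix i assume i: "i \<in> {..<m}"
   have "restr {N i..} (restr {n..} x) = restr {n..} x"
    using M[of i] n i by (auto simp: restr_def fun_eq_iff)
   then have "norm (?y i) <= e / (real m + 1) * lp_norm p (restr {n..} x)" using N[OF lps[OF x], of i "{n..}"] by simp
   also have "\<dots> <= e / (real m + 1) * lp_norm p x" using lp_restr(2)[OF _ x] assms by (intro mult_left_mono) auto
   finally show "norm (?y i) <= e / (real m + 1) * lp_norm p x" .
  qed
  moreover have "\<dots> <= e * lp_norm p x"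
  proof -
   have "real m * e / (real m + 1) <= e" using assms(4) by (simp add: field_simps)
   from mult_left_mono[OF this, of "lp_norm p x"] show ?thesis by (simp add: field_simps)
  qed
  ultimately show ?thesis by linarith
 qed
 then show ?thesis by blast
qed

section \<open>Compact operators\<close>

lemma mcomplete_lp:
 assumes "1 <= p"
 shows "Metric_space.mcomplete (lp p :: 'k::{real_normed_field,euclidean_space} seq set) (%x y. lp_norm p (x - y))"
proof -
 interpret Metric_space "lp p :: 'k seq set" "%x y. lp_norm p (x - y)" by (rule Metric_space_lp[OF assms])
 show ?thesis unfolding mcomplete_def
 proof (intro allI impI)
  fix \<sigma> :: "nat => 'k seq" assume "MCauchy \<sigma>"
  then have s: "!!n. \<sigma> n \<in> lp p"
   and c: "!!e. e > 0 ==> \<exists>N. \<forall>n n'. N <= n --> N <= n' --> lp_norm p (\<sigma> n - \<sigma> n') < e"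
   by (auto simp: MCauchy_def)
  have "Cauchy (%n. \<sigma> n i)" for i
  proof (rule metric_CauchyI)
   fix e :: real assume "e > 0"
   then obtain N where N: "!!n n'. N <= n ==> N <= n' ==> lp_norm p (\<sigma> n - \<sigma> n') < e" using c by blast
   have le: "norm ((\<sigma> n - \<sigma> n') i) <= lp_norm p (\<sigma> n - \<sigma> n')" for n n'
    by (rule lp_norm_component[OF lp_diff(1)]) (use s assms in auto)
   have "dist (\<sigma> m i) (\<sigma> n i) < e" if "m >= N" "n >= N" for m n
    using le_less_trans[OF le N[OF that]] by (simp add: dist_norm)
   then show "\<exists>M. \<forall>m\<ge>M. \<forall>n\<ge>M. dist (\<sigma> m i) (\<sigma> n i) < e" by blast
  qed
  then have "\<forall>i. \<exists>l. (%n. \<sigma> n i) \<longlonglongrightarrow> l" by (simp add: Cauchy_convergent_iff convergent_def)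
  then obtain l where l: "!!i. (%n. \<sigma> n i) \<longlonglongrightarrow> l i" by metis
  have near: "\<exists>N. \<forall>n\<ge>N. \<sigma> n - l \<in> lp p \<and> lp_norm p (\<sigma> n - l) <= e" if e: "e > 0" for e
  proof -
   obtain N where N: "!!n n'. N <= n ==> N <= n' ==> lp_norm p (\<sigma> n - \<sigma> n') < e" using c[OF e] by blast
   have "\<sigma> n - l \<in> lp p \<and> lp_norm p (\<sigma> n - l) <= e" if n: "n >= N" for n
   proof -
    have "(\<Sum>i<K. norm ((\<sigma> n - l) i) powr p) <= e powr p" for K
    proof (rule LIMSEQ_le_const2)
     show "(%m. \<Sum>i<K. norm (\<sigma> n i - \<sigma> m i) powr p) \<longlonglongrightarrow> (\<Sum>i<K. norm ((\<sigma> n - l) i) powr p)"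
      unfolding fun_diff_def using assms
      by (intro tendsto_sum tendsto_powr' tendsto_norm tendsto_diff tendsto_const l) auto
     have "(\<Sum>i<K. norm (\<sigma> n i - \<sigma> m i) powr p) <= e powr p" if "m >= N" for m
     proof -
      have d: "\<sigma> n - \<sigma> m \<in> lp p" using lp_diff(1) s assms by blast
      have "(\<Sum>i<K. norm ((\<sigma> n - \<sigma> m) i) powr p) <= lp_norm p (\<sigma> n - \<sigma> m) powr p"
       using lp_sum_le[OF d] assms by simp
      also have "\<dots> <= e powr p" using N[OF n that] assms by (intro powr_mono2) auto
      finally show ?thesis by simp
     qed
     then show "\<exists>N. \<forall>m\<ge>N. (\<Sum>i<K. norm (\<sigma> n i - \<sigma> m i) powr p) <= e powr p" by blast
    qed
    from lp_leI[where x="\<sigma> n - l", OF _ _ this] show ?thesis using assms e by auto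
   qed
   then show ?thesis by blast
  qed
  obtain N where "\<sigma> N - l \<in> lp p" using near[of 1] by auto
  then have "\<sigma> N - (\<sigma> N - l) \<in> lp p" using lp_diff(1) s assms by blast
  then have ll: "l \<in> lp p" by simp
  have "limitin mtopology \<sigma> l sequentially"
   unfolding limitin_metric eventually_sequentially
  proof (intro conjI allI impI ll)
   fix e :: real assume e: "e > 0"
   then obtain N where N: "!!n. n >= N ==> lp_norm p (\<sigma> n - l) <= e / 2" using near[of "e/2"] by auto
   have "\<sigma> n \<in> lp p \<and> lp_norm p (\<sigma> n - l) < e" if "n >= N" for n
    using N[OF that] s e by auto
   then show "\<exists>N. \<forall>n\<ge>N. \<sigma> n \<in> lp p \<and> lp_norm p (\<sigma> n - l) < e" by blast
  qed
  then show "\<exists>x. limitin mtopology \<sigma> x sequentially" by blast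
 qed
qed

text \<open>
 A bounded set in \<open>\<ell>\<^sub>q\<close> is relatively compact iff its tails are uniformly small, since the head lives in a finite-dimensional space over a locally compact field. All later arguments about compactness use this form.
\<close>

lemma compact_ops_iff:
 fixes T :: "'k::{real_normed_field,euclidean_space} seq_op"
 assumes "1 <= p" "1 <= q"
 shows "T \<in> compact_ops p q \<longleftrightarrow> T \<in> bounded_ops p q \<and>
  (\<forall>e>0. \<exists>m. \<forall>x\<in>lp p. lp_norm q (restr {m..} (T x)) <= e * lp_norm p x)"
proof -
 interpret Metric_space "lp q :: 'k seq set" "%x y. lp_norm q (x - y)" by (rule Metric_space_lp[OF assms(2)])
 have "T \<in> compact_ops p q \<longleftrightarrow> T \<in> bounded_ops p q \<and> mtotally_bounded (T ` lp_ball p)"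
  using mtotally_bounded_eq_compact_closure_of[OF mcomplete_lp[OF assms(2)], of "T ` lp_ball p"] ops_in[of T p q]
  by (auto simp: compact_ops_def lp_topology_def lp_ball_def)
 moreover have "mtotally_bounded (T ` lp_ball p) \<longleftrightarrow>
  (\<forall>e>0. \<exists>m. \<forall>x\<in>lp p. lp_norm q (restr {m..} (T x)) <= e * lp_norm p x)" (is "?L \<longleftrightarrow> ?R")
  if T: "T \<in> bounded_ops p q"
 proof
  assume L: ?L
  show ?R
  proof (intro allI impI)
   fix e :: real assume e: "e > 0"
   then obtain K where K: "finite K" "K \<subseteq> T ` lp_ball p" "T ` lp_ball p \<subseteq> (\<Union>x\<in>K. mball x (e / 2))"
    using L unfolding mtotally_bounded_def by (meson half_gt_zero)
   have Kl: "y \<in> lp q" if "y \<in> K" for y using that K(2) ops_in[OF T] by (auto simp: lp_ball_def)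
   have "\<forall>y\<in>K. \<exists>M. \<forall>m\<ge>M. lp_norm q (restr {m..} y) < e / 2"
    using lp_tail[OF _ Kl, of _ "e/2"] assms e by auto
   then obtain M where M: "!!y m. y \<in> K ==> m >= M y ==> lp_norm q (restr {m..} y) < e / 2" by metis
   define m where "m = Max (insert 0 (M ` K))"
   have m: "M y <= m" if "y \<in> K" for y using that K(1) by (auto simp: m_def)
   have ball: "lp_norm q (restr {m..} (T x)) <= e" if x: "x \<in> lp_ball p" for x
   proof -
    obtain y where y: "y \<in> K" "T x \<in> mball y (e / 2)" using K(3) x by blast
    have Tx: "T x \<in> lp q" and d: "lp_norm q (y - T x) < e / 2" using y by (auto simp: in_mball)
    have yl: "y \<in> lp q" using Kl y by blast
    have "restr {m..} (T x) = restr {m..} y - restr {m..} (y - T x)" by simp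
    then have "lp_norm q (restr {m..} (T x)) <= lp_norm q (restr {m..} y) + lp_norm q (restr {m..} (y - T x))"
     using lp_diff(2)[OF assms(2) lp_restr(1)[OF _ yl] lp_restr(1)[OF _ lp_diff(1)[OF assms(2) yl Tx]]] assms
     by (metis less_le_trans zero_less_one)
    moreover have "lp_norm q (restr {m..} (y - T x)) <= lp_norm q (y - T x)"
     using lp_restr(2)[OF _ lp_diff(1)[OF assms(2) yl Tx]] assms by simp
    ultimately show ?thesis using M[OF y(1) m[OF y(1)]] d by linarith
   qed
   have "lp_norm q (restr {m..} (T x)) <= e * lp_norm p x" if x: "x \<in> lp p" for x
   proof (cases "x = 0")
    case True
    then show ?thesis using ops_0[OF T] by simp
   next
    case False
    then have n: "lp_norm p x > 0" using lp_norm_pos[OF x] assms by simp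
    define c :: 'k where "c = of_real (1 / lp_norm p x)"
    have c: "norm c = 1 / lp_norm p x" using n by (simp add: c_def norm_divide)
    have "seq_scale c x \<in> lp_ball p" using lp_scale[OF _ x, of c] c n assms by (simp add: lp_ball_def)
    from ball[OF this] have "norm c * lp_norm q (restr {m..} (T x)) <= e"
     using ops_scale[OF T x, of c] lp_scale(2)[OF _ lp_restr(1)[OF _ ops_in[OF T x]], of c] assms by simp
    then show ?thesis using c n by (simp add: field_simps)
   qed
   then show "\<exists>m. \<forall>x\<in>lp p. lp_norm q (restr {m..} (T x)) <= e * lp_norm p x" by blast
  qed
 next
  assume R: ?R
  obtain C where C: "C > 0" "!!x. x \<in> lp p ==> lp_norm q (T x) <= C * lp_norm p x"
   using ops_bound[OF T] by metis
  show ?L unfolding mtotally_bounded_def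
  proof (intro allI impI)
   fix e :: real assume e: "e > 0"
   then obtain m where m: "!!x. x \<in> lp p ==> lp_norm q (restr {m..} (T x)) <= e / 5 * lp_norm p x"
    using R by (metis zero_less_divide_iff zero_less_numeral)
   define d where "d = e / (5 * (real m + 1))"
   have d: "d > 0" using e by (simp add: d_def)
   obtain N where N: "finite N" "cball (0::'k) C \<subseteq> (\<Union>x\<in>N. ball x d)"
    using compact_cball[of "0::'k" C] d unfolding compact_eq_totally_bounded by metis
   define G where "G = {f :: nat => 'k. (\<forall>i. (i \<in> {..<m} --> f i \<in> N) \<and> (i \<notin> {..<m} --> f i = 0))}"
   have G: "finite G" unfolding G_def by (rule finite_set_of_finite_funs) (use N in auto)
   define near where "near f x \<longleftrightarrow> x \<in> lp_ball p \<and> (\<forall>i<m. norm (T x i - f i) < d)" for f x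
   define K where "K = (%f. T (SOME x. near f x)) ` {f \<in> G. \<exists>x. near f x}"
   have someN: "near f (SOME x. near f x)" if "\<exists>x. near f x" for f using that by (rule someI_ex)
   show "\<exists>K. finite K \<and> K \<subseteq> T ` lp_ball p \<and> T ` lp_ball p \<subseteq> (\<Union>x\<in>K. mball x e)"
   proof (intro exI[of _ K] conjI subsetI)
    show "finite K" using G by (simp add: K_def)
    show "y \<in> T ` lp_ball p" if "y \<in> K" for y
     using that someN by (auto simp: K_def near_def)
    fix y assume "y \<in> T ` lp_ball p"
    then obtain x where x: "x \<in> lp_ball p" "y = T x" by blast
    have xl: "x \<in> lp p" "lp_norm p x <= 1" using x by (auto simp: lp_ball_def)
    have "\<exists>g\<in>N. norm (T x i - g) < d" for i
    proof -
     have "norm (T x i) <= C"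
      using order_trans[OF lp_norm_component[OF ops_in[OF T xl(1)]] C(2)[OF xl(1)], of i]
       mult_left_mono[OF xl(2), of C] C(1) assms by linarith
     then have "T x i \<in> cball 0 C" by simp
     then have "T x i \<in> (\<Union>x\<in>N. ball x d)" using N(2) by blast
     then show ?thesis by (auto simp: dist_norm norm_minus_commute)
    qed
    then obtain g where g: "!!i. g i \<in> N" "!!i. norm (T x i - g i) < d" by metis
    define f where "f = (%i. if i < m then g i else 0)"
    have fG: "f \<in> G" "near f x" using g x by (auto simp: f_def G_def near_def)
    define x' where "x' = (SOME x. near f x)"
    have x': "near f x'" "T x' \<in> K" using someN[of f] fG by (auto simp: x'_def K_def)
    have x'l: "x' \<in> lp p" "lp_norm p x' <= 1" using x' by (auto simp: near_def lp_ball_def)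
    define z where "z = T x' - T x"
    have zl: "z \<in> lp q" unfolding z_def by (rule lp_diff(1)[OF assms(2) ops_in[OF T x'l(1)] ops_in[OF T xl(1)]])
    have "lp_norm q z <= lp_norm q (restr {..<m} z) + lp_norm q (restr {m..} z)"
    proof -
     have "z = restr {..<m} z + restr {m..} z" by (auto simp: restr_def fun_eq_iff)
     then show ?thesis using lp_add(2)[OF assms(2) lp_restr(1)[OF _ zl] lp_restr(1)[OF _ zl]] assms
      by (metis less_le_trans zero_less_one)
    qed
    moreover have "lp_norm q (restr {..<m} z) <= 2 * e / 5"
    proof -
     have "lp_norm q (restr {..<m} z) <= (\<Sum>i<m. norm (z i))" by (rule lp_norm_restr_le_sum[OF assms(2)])
     moreover have "\<dots> <= (\<Sum>i<m. 2 * d)"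
     proof (rule sum_mono)
      fix i assume i: "i \<in> {..<m}"
      have "norm (z i) <= norm (T x' i - f i) + norm (T x i - f i)"
       unfolding z_def by (simp add: norm_triangle_sub dist_norm[symmetric] dist_triangle2)
      also have "\<dots> <= 2 * d" using x'(1) fG(2) i unfolding near_def by (smt (verit) lessThan_iff)
      finally show "norm (z i) <= 2 * d" .
     qed
     moreover have "\<dots> <= 2 * e / 5" using e by (simp add: d_def field_simps)
     ultimately show ?thesis by linarith
    qed
    moreover have "lp_norm q (restr {m..} z) <= 2 * e / 5"
    proof -
     have "restr {m..} z = restr {m..} (T x') - restr {m..} (T x)" by (simp add: z_def)
     then have "lp_norm q (restr {m..} z) <= lp_norm q (restr {m..} (T x')) + lp_norm q (restr {m..} (T x))"
      using lp_diff(2)[OF assms(2) lp_restr(1)[OF _ ops_in[OF T x'l(1)]] lp_restr(1)[OF _ ops_in[OF T xl(1)]]] assms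
      by (metis less_le_trans zero_less_one)
     also have "\<dots> <= e / 5 * lp_norm p x' + e / 5 * lp_norm p x" using m x'l xl by (intro add_mono) auto
     also have "\<dots> <= e / 5 * 1 + e / 5 * 1" using x'l xl e by (intro add_mono mult_left_mono) auto
     finally show ?thesis by simp
    qed
    ultimately have "lp_norm q z < e" using e by simp
    then show "y \<in> (\<Union>x\<in>K. mball x e)"
     using x' x ops_in[OF T x'l(1)] ops_in[OF T xl(1)] by (auto simp: in_mball z_def)
   qed
  qed
 qed
 ultimately show ?thesis by blast
qed

lemma seq_scale_apply: "seq_scale c x i = c * x i"
 by (simp add: seq_scale_def)

lemma lp_norm_restr_mono_tail:
 assumes "1 <= p" "x \<in> lp p" "m <= n"
 shows "lp_norm p (restr {n..} x) <= lp_norm p (restr {m..} x)"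
 by (rule lp_restr_mono) (use assms in auto)

lemma closed_ideal_compact_ops:
 fixes p q :: real
 assumes "1 <= p" "1 <= q"
 shows "closed_ideal p q (compact_ops p q :: 'k::{real_normed_field,euclidean_space} seq_op set)"
proof -
 note iff = compact_ops_iff[OF assms, where 'k='k]
 show ?thesis
 proof (rule closed_idealI[OF assms])
  show "compact_ops p q \<subseteq> (bounded_ops p q :: 'k seq_op set)" by (auto simp: compact_ops_def)
  show "0 \<in> (compact_ops p q :: 'k seq_op set)"
   unfolding iff by (auto intro!: exI[of _ 0])
 next
  fix S T :: "'k seq_op"
  assume S: "S \<in> compact_ops p q" and T: "T \<in> compact_ops p q"
  have bS: "S \<in> bounded_ops p q" and bT: "T \<in> bounded_ops p q" using S T by (auto simp: iff)
  show "S + T \<in> compact_ops p q" unfolding iff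
  proof (intro conjI allI impI)
   show "S + T \<in> bounded_ops p q" by (rule bounded_ops_add[OF assms(2) bS bT])
   fix e :: real assume e: "e > 0"
   then obtain m n where m: "!!x. x \<in> lp p ==> lp_norm q (restr {m..} (S x)) <= e / 2 * lp_norm p x"
    and n: "!!x. x \<in> lp p ==> lp_norm q (restr {n..} (T x)) <= e / 2 * lp_norm p x"
    using S T unfolding iff by (meson half_gt_zero)
   have "lp_norm q (restr {max m n..} ((S + T) x)) <= e * lp_norm p x" if x: "x \<in> lp p" for x
   proof -
    have Sx: "S x \<in> lp q" "T x \<in> lp q" using ops_in bS bT x by blast+
    have "lp_norm q (restr {max m n..} ((S + T) x)) <= lp_norm q (restr {max m n..} (S x)) + lp_norm q (restr {max m n..} (T x))"
     using lp_add(2)[OF assms(2) lp_restr(1)[OF _ Sx(1), of "{max m n..}"] lp_restr(1)[OF _ Sx(2), of "{max m n..}"]] assms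
     by (simp add: plus_fun_def[of S T])
    also have "\<dots> <= e / 2 * lp_norm p x + e / 2 * lp_norm p x"
     using order_trans[OF lp_norm_restr_mono_tail[OF assms(2) Sx(1)] m[OF x], of "max m n"]
      order_trans[OF lp_norm_restr_mono_tail[OF assms(2) Sx(2)] n[OF x], of "max m n"] by (intro add_mono) auto
    finally show ?thesis by (simp add: field_simps)
   qed
   then show "\<exists>m. \<forall>x\<in>lp p. lp_norm q (restr {m..} ((S + T) x)) <= e * lp_norm p x" by blast
  qed
 next
  fix c and T :: "'k seq_op"
  assume T: "T \<in> compact_ops p q"
  have bT: "T \<in> bounded_ops p q" using T by (auto simp: iff)
  show "op_scale c T \<in> compact_ops p q" unfolding iff
  proof (intro conjI allI impI)
   show "op_scale c T \<in> bounded_ops p q" by (rule bounded_ops_scale[OF assms(2) bT])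
   fix e :: real assume e: "e > 0"
   have "e / (norm c + 1) > 0" using e by (simp add: add_nonneg_pos)
   then obtain m where m: "!!x. x \<in> lp p ==> lp_norm q (restr {m..} (T x)) <= e / (norm c + 1) * lp_norm p x"
    using T unfolding iff by meson
   have "lp_norm q (restr {m..} (op_scale c T x)) <= e * lp_norm p x" if x: "x \<in> lp p" for x
   proof -
    have "lp_norm q (restr {m..} (op_scale c T x)) = norm c * lp_norm q (restr {m..} (T x))"
     using lp_scale(2)[OF _ lp_restr(1)[OF _ ops_in[OF bT x]], of c "{m..}"] assms by (simp add: op_scale_def)
    also have "\<dots> <= (norm c + 1) * (e / (norm c + 1) * lp_norm p x)"
     by (intro mult_mono m x) auto
    also have "\<dots> = e * lp_norm p x" by (simp add: add_nonneg_eq_0_iff)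
    finally show ?thesis .
   qed
   then show "\<exists>m. \<forall>x\<in>lp p. lp_norm q (restr {m..} (op_scale c T x)) <= e * lp_norm p x" by blast
  qed
 next
  fix A T B :: "'k seq_op"
  assume A: "A \<in> bounded_ops q q" and T: "T \<in> compact_ops p q" and B: "B \<in> bounded_ops p p"
  have bT: "T \<in> bounded_ops p q" using T by (auto simp: iff)
  obtain a where a: "a > 0" "!!x. x \<in> lp q ==> lp_norm q (A x) <= a * lp_norm q x" using ops_bound[OF A] by metis
  obtain b where b: "b > 0" "!!x. x \<in> lp p ==> lp_norm p (B x) <= b * lp_norm p x" using ops_bound[OF B] by metis
  obtain t where t: "t > 0" "!!x. x \<in> lp p ==> lp_norm q (T x) <= t * lp_norm p x" using ops_bound[OF bT] by metis
  show "A \<circ> T \<circ> B \<in> compact_ops p q" unfolding iff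
  proof (intro conjI allI impI)
   show "A \<circ> T \<circ> B \<in> bounded_ops p q" by (intro bounded_ops_comp[OF bounded_ops_comp[OF A bT] B])
   fix e :: real assume e: "e > 0"
   then have "e / (2 * a * b) > 0" using a b by simp
   then obtain m where m: "!!x. x \<in> lp p ==> lp_norm q (restr {m..} (T x)) <= e / (2 * a * b) * lp_norm p x"
    using T unfolding iff by meson
   have "e / (2 * t * b) > 0" using e t b by simp
   from column_tail[OF assms(2,2) A this, of m]
   obtain M where M: "!!x. lp_norm q (restr {M..} (A (restr {..<m} x))) <= e / (2 * t * b) * lp_norm q (restr {..<m} x)"
    by blast
   have "lp_norm q (restr {M..} ((A \<circ> T \<circ> B) x)) <= e * lp_norm p x" if x: "x \<in> lp p" for x
   proof -
    define y where "y = T (B x)"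
    have Bx: "B x \<in> lp p" and y: "y \<in> lp q" using ops_in[OF B x] ops_in[OF bT] by (auto simp: y_def)
    have r: "restr S y \<in> lp q" for S using lp_restr(1)[OF _ y] assms by simp
    have Ar: "A (restr S y) \<in> lp q" for S using ops_in[OF A r] .
    have "y = restr {..<m} y + restr {m..} y" by (auto simp: restr_def fun_eq_iff)
    then have "A y = A (restr {..<m} y) + A (restr {m..} y)" using ops_add[OF A r r, of "{..<m}" "{m..}"] by simp
    then have "lp_norm q (restr {M..} (A y)) <= lp_norm q (restr {M..} (A (restr {..<m} y))) + lp_norm q (restr {M..} (A (restr {m..} y)))"
     using lp_add(2)[OF assms(2) lp_restr(1)[OF _ Ar] lp_restr(1)[OF _ Ar]] assms by simp
    also have "lp_norm q (restr {M..} (A (restr {..<m} y))) <= e / (2 * t * b) * (t * (b * lp_norm p x))"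
    proof -
     have "lp_norm q (restr {..<m} y) <= lp_norm q y" using lp_restr(2)[OF _ y] assms by simp
     also have "\<dots> <= t * lp_norm p (B x)" unfolding y_def by (rule t(2)[OF Bx])
     also have "\<dots> <= t * (b * lp_norm p x)" using b(2)[OF x] t(1) by (intro mult_left_mono) auto
     finally show ?thesis using e t b by (intro order_trans[OF M] mult_left_mono) auto
    qed
    also have "lp_norm q (restr {M..} (A (restr {m..} y))) <= a * (e / (2 * a * b) * (b * lp_norm p x))"
    proof -
     have "lp_norm q (restr {m..} y) <= e / (2 * a * b) * lp_norm p (B x)" unfolding y_def by (rule m[OF Bx])
     also have "\<dots> <= e / (2 * a * b) * (b * lp_norm p x)" using b(2)[OF x] a b e by (intro mult_left_mono) auto
     finally have "a * lp_norm q (restr {m..} y) <= a * (e / (2 * a * b) * (b * lp_norm p x))" using a by simp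
     then show ?thesis using lp_restr(2)[OF _ Ar, of "{M..}" "{m..}"] a(2)[OF r, of "{m..}"] assms by linarith
    qed
    also have "e / (2 * t * b) * (t * (b * lp_norm p x)) + a * (e / (2 * a * b) * (b * lp_norm p x)) = e * lp_norm p x"
     using a b t by (simp add: field_simps)
    finally show ?thesis by (simp add: y_def)
   qed
   then show "\<exists>m. \<forall>x\<in>lp p. lp_norm q (restr {m..} ((A \<circ> T \<circ> B) x)) <= e * lp_norm p x" by blast
  qed
 next
  fix T :: "'k seq_op"
  assume bT: "T \<in> bounded_ops p q" and ap: "op_approx p q (compact_ops p q) T"
  show "T \<in> compact_ops p q" unfolding iff
  proof (intro conjI allI impI bT)
   fix e :: real assume e: "e > 0"
   then obtain S where S: "S \<in> compact_ops p q" "!!x. x \<in> lp p ==> lp_norm q (S x - T x) <= e / 2 * lp_norm p x"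
    using ap unfolding op_approx_def by (meson half_gt_zero)
   have bS: "S \<in> bounded_ops p q" using S(1) by (auto simp: iff)
   obtain m where m: "!!x. x \<in> lp p ==> lp_norm q (restr {m..} (S x)) <= e / 2 * lp_norm p x"
    using S(1) e unfolding iff by (meson half_gt_zero)
   have "lp_norm q (restr {m..} (T x)) <= e * lp_norm p x" if x: "x \<in> lp p" for x
   proof -
    have d: "S x - T x \<in> lp q" "S x \<in> lp q" using lp_diff(1)[OF assms(2) ops_in[OF bS x] ops_in[OF bT x]] ops_in[OF bS x] by auto
    have "restr {m..} (T x) = restr {m..} (S x) - restr {m..} (S x - T x)" by simp
    then have "lp_norm q (restr {m..} (T x)) <= lp_norm q (restr {m..} (S x)) + lp_norm q (restr {m..} (S x - T x))"
     using lp_diff(2)[OF assms(2) lp_restr(1)[OF _ d(2)] lp_restr(1)[OF _ d(1)], of "{m..}" "{m..}"] assms by simp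
    also have "\<dots> <= e / 2 * lp_norm p x + e / 2 * lp_norm p x"
     using m[OF x] S(2)[OF x] lp_restr(2)[OF _ d(1), of "{m..}"] assms by (intro add_mono) auto
    finally show ?thesis by (simp add: field_simps)
   qed
   then show "\<exists>m. \<forall>x\<in>lp p. lp_norm q (restr {m..} (T x)) <= e * lp_norm p x" by blast
  qed
 qed
qed

lemma rank_one_bounded_ops:
 fixes g :: "'k::real_normed_field seq => 'k"
 assumes "0 < q" "v \<in> lp q"
  "!!x y. x \<in> lp p ==> y \<in> lp p ==> g (x + y) = g x + g y"
  "!!c x. x \<in> lp p ==> g (seq_scale c x) = c * g x"
  "!!x. x \<in> lp p ==> norm (g x) <= C * lp_norm p x"
  "!!x. x \<notin> lp p ==> g x = 0"
 shows "(%x. seq_scale (g x) v) \<in> bounded_ops p q"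
proof (rule bounded_opsI[where C="C * lp_norm q v"])
 fix x :: "'k seq" assume x: "x \<in> lp p"
 show "seq_scale (g x) v \<in> lp q" by (rule lp_scale(1)[OF assms(1,2)])
 have "lp_norm q (seq_scale (g x) v) = norm (g x) * lp_norm q v" by (rule lp_scale(2)[OF assms(1,2)])
 also have "\<dots> <= C * lp_norm p x * lp_norm q v" by (intro mult_right_mono assms(5)[OF x]) simp
 finally show "lp_norm q (seq_scale (g x) v) <= C * lp_norm q v * lp_norm p x" by (simp add: mult_ac)
 show "seq_scale (g (seq_scale c x)) v = seq_scale c (seq_scale (g x) v)" for c
  using assms(4)[OF x, of c] by (simp add: seq_scale_def mult.assoc)
 show "seq_scale (g (x + y)) v = seq_scale (g x) v + seq_scale (g y) v" if "y \<in> lp p" for y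
  using assms(3)[OF x that] by (simp add: seq.scale_left_distrib)
qed (use assms(6) in auto)

text \<open>
 A nonzero operator has a nonzero matrix entry; multiplying by rank one operators from both sides puts the rows of any operator into \<open>J\<close>, and a compact operator is the limit of the finite sums of its rows.
\<close>

lemma compact_ops_least:
 fixes J :: "'k::{real_normed_field,euclidean_space} seq_op set"
 assumes "1 <= p" "1 <= q" "closed_ideal p q J" "J ~= {0}"
 shows "compact_ops p q \<subseteq> J"
proof
 fix T :: "'k seq_op" assume T: "T \<in> compact_ops p q"
 then have bT: "T \<in> bounded_ops p q" by (simp add: compact_ops_def)
 obtain U where U: "U \<in> J" "U ~= 0" using assms(3,4) closed_ideal_0 by blast
 have bU: "U \<in> bounded_ops p q" using U(1) closed_ideal_sub[OF assms(3)] by blast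
 obtain x0 i0 where nz: "U x0 i0 ~= 0" using U(2) by (metis ext zero_fun_apply)
 have x0: "x0 \<in> lp p" using ops_out[OF bU, of x0] nz by (metis zero_fun_apply)
 obtain t where t: "!!x. x \<in> lp p ==> lp_norm q (T x) <= t * lp_norm p x" using ops_bound[OF bT] by metis
 define R where "R i = (%x. seq_scale (T x i) (unit i))" for i
 have R: "R i \<in> J" for i
 proof -
  define C where "C = (%x. seq_scale (T x i) x0)"
  define D where "D = (%y. seq_scale ((if y \<in> lp q then y i0 else 0) / U x0 i0) (unit i :: 'k seq))"
  have C: "C \<in> bounded_ops p p" unfolding C_def
  proof (rule rank_one_bounded_ops[where C=t])
   fix x y :: "'k seq" and c assume x: "x \<in> lp p"
   show "T (seq_scale c x) i = c * T x i" using ops_scale[OF bT x, of c] by (simp add: seq_scale_def)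
   show "norm (T x i) <= t * lp_norm p x"
    using order_trans[OF lp_norm_component[OF ops_in[OF bT x]] t[OF x]] assms by simp
   show "T (x + y) i = T x i + T y i" if "y \<in> lp p" using ops_add[OF bT x that] by simp
  qed (use assms x0 ops_out[OF bT] in auto)
  have D: "D \<in> bounded_ops q q" unfolding D_def
  proof (rule rank_one_bounded_ops[where C="1 / norm (U x0 i0)"])
   fix x y :: "'k seq" and c assume x: "x \<in> lp q"
   show "(if seq_scale c x \<in> lp q then seq_scale c x i0 else 0) / U x0 i0 = c * ((if x \<in> lp q then x i0 else 0) / U x0 i0)"
    using lp_scale(1)[OF _ x, of c] x assms by (simp add: seq_scale_def)
   show "norm ((if x \<in> lp q then x i0 else 0) / U x0 i0) <= 1 / norm (U x0 i0) * lp_norm q x"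
    using lp_norm_component[OF x, of i0] x assms nz by (simp add: norm_divide divide_right_mono)
   show "(if x + y \<in> lp q then (x + y) i0 else 0) / U x0 i0 =
    (if x \<in> lp q then x i0 else 0) / U x0 i0 + (if y \<in> lp q then y i0 else 0) / U x0 i0" if "y \<in> lp q"
    using lp_add(1)[OF assms(2) x that] x that by (simp add: add_divide_distrib)
  qed (use assms unit_lp(1)[of q i] in auto)
  have "R i x = (D \<circ> U \<circ> C) x" for x
  proof -
   have "U (C x) = seq_scale (T x i) (U x0)" unfolding C_def by (rule ops_scale[OF bU x0])
   moreover have "seq_scale (T x i) (U x0) \<in> lp q" using lp_scale(1)[OF _ ops_in[OF bU x0]] assms by simp
   ultimately have "D (U (C x)) = seq_scale (T x i * U x0 i0 / U x0 i0) (unit i)" by (simp add: D_def seq_scale_def)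
   then show ?thesis using nz by (simp add: R_def)
  qed
  then have "R i = D \<circ> U \<circ> C" by blast
  then show ?thesis using closed_ideal_mult[OF assms(3) D U(1) C] by simp
 qed
 show "T \<in> J"
 proof (rule closed_ideal_limit[OF assms(1-3) bT])
  fix e :: real assume "e > 0"
  then obtain m where m: "!!x. x \<in> lp p ==> lp_norm q (restr {m..} (T x)) <= e * lp_norm p x"
   using T unfolding compact_ops_iff[OF assms(1,2)] by meson
  have "(\<Sum>i<m. R i) \<in> J" by (rule closed_ideal_sum[OF assms(3)]) (rule R)
  moreover have "lp_norm q ((\<Sum>i<m. R i) (restr {..<M} x) - T (restr {..<M} x)) <= e * lp_norm p (restr {..<M} x)" for M x
  proof -
   let ?x = "restr {..<M} x"
   have x: "?x \<in> lp p" by (rule lp_restr_finite) (use assms in auto)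
   have "(\<Sum>i<m. R i) ?x = restr {..<m} (T ?x)"
    unfolding sum_fun_apply R_def restr_finite_eq_sum[OF finite_lessThan] ..
   moreover have "restr {..<m} y - y = - restr {m..} y" for y :: "'k seq" by (auto simp: restr_def fun_eq_iff)
   ultimately have e: "(\<Sum>i<m. R i) ?x - T ?x = - restr {m..} (T ?x)" by (simp only:)
   show ?thesis unfolding e lp_uminus(2) by (rule m[OF x])
  qed
  ultimately show "\<exists>S\<in>J. \<forall>M x. lp_norm q (S (restr {..<M} x) - T (restr {..<M} x)) <= e * lp_norm p (restr {..<M} x)"
   by blast
 qed
qed

section \<open>Block operators\<close>

definition seq_linear :: "('k::real_normed_field seq => 'k seq) => bool" where
 "seq_linear f \<longleftrightarrow> (\<forall>x y. f (x + y) = f x + f y) \<and> (\<forall>c x. f (seq_scale c x) = seq_scale c (f x))"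

lemma seq_linear_add: "seq_linear f ==> f (x + y) = f x + f y"
 and seq_linear_scale: "seq_linear f ==> f (seq_scale c x) = seq_scale c (f x)"
 by (auto simp: seq_linear_def)

lemma seq_linear_0: "seq_linear f ==> f 0 = 0"
 using seq_linear_scale[of f 0 0] by simp

lemma seq_linear_comp: "seq_linear f ==> seq_linear g ==> seq_linear (%x. f (g x))"
 by (simp add: seq_linear_def)

lemma seq_linear_restr: "seq_linear (restr S)"
 by (simp add: seq_linear_def)

lemma seq_linear_ops_restr:
 assumes "T \<in> bounded_ops p q" "0 < p" "finite S"
 shows "seq_linear (%x. T (restr S x))"
 using ops_add[OF assms(1) lp_restr_finite(1)[OF assms(2,3)] lp_restr_finite(1)[OF assms(2,3)]]
  ops_scale[OF assms(1) lp_restr_finite(1)[OF assms(2,3)]]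
 by (simp add: seq_linear_def)

definition block_op :: "real => (nat => nat set) => (nat => 'k::real_normed_field seq_op) => 'k seq_op" where
 "block_op p R G x = (%i. if x \<in> lp p \<and> (\<exists>j. i \<in> R j) then G (THE j. i \<in> R j) x i else 0)"

text \<open>
 Operators \<open>G j\<close> that read only the coordinates in \<open>D j\<close> and write only into \<open>R j\<close>. As \<open>p \<le> q\<close>, the norm of their sum is controlled by the largest of the norms rather than by their sum.
\<close>

locale block_data =
 fixes p q K :: real and D R :: "nat => nat set" and G :: "nat => 'k::real_normed_field seq_op"
 assumes pq: "1 <= p" "p <= q" and K: "0 <= K"
  and disD: "disjoint_family D" and disR: "disjoint_family R"
  and finR: "finite (R j)"
  and lin: "seq_linear (G j)"
  and ran: "restr (R j) (G j x) = G j x"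
  and bd: "x \<in> lp p ==> lp_norm q (G j x) <= K * lp_norm p (restr (D j) x)"
begin

lemma the_block: "i \<in> R j ==> (THE j. i \<in> R j) = j"
 using disR by (auto simp: disjoint_family_on_def)

lemma block_op_apply: "x \<in> lp p ==> i \<in> R j ==> block_op p R G x i = G j x i"
 using the_block[of i j] by (auto simp: block_op_def)

lemma block_op_eq_sum:
 assumes "x \<in> lp p" "finite J" "!!j. j \<notin> J ==> G j x = 0"
 shows "block_op p R G x = (\<Sum>j\<in>J. G j x)"
proof
 fix i
 have out: "G j x i = 0" if "i \<notin> R j" for j
  using fun_cong[OF ran[of j x], of i] that by (simp add: restr_def)
 show "block_op p R G x i = (\<Sum>j\<in>J. G j x) i"
 proof (cases "\<exists>j. i \<in> R j")
  case True
  then obtain j where j: "i \<in> R j" by blast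
  then have o: "G k x i = 0" if "k ~= j" for k
   using out[of k] that disR by (auto simp: disjoint_family_on_def)
  have "(\<Sum>k\<in>J. G k x i) = (\<Sum>k\<in>J. if k = j then G j x i else 0)"
   by (rule sum.cong) (use o in auto)
  also have "\<dots> = G j x i" using assms(2) assms(3)[of j] by auto
  finally show ?thesis using block_op_apply[OF assms(1) j] by (simp add: sum_fun_apply)
 next
  case False
  then show ?thesis using out by (simp add: sum_fun_apply block_op_def)
 qed
qed

lemma block_op_norm:
 assumes x: "x \<in> lp p"
 shows "block_op p R G x \<in> lp q" "lp_norm q (block_op p R G x) <= K * lp_norm p x"
proof -
 let ?y = "block_op p R G x"
 have q: "0 < q" "0 < p" using pq by auto
 have "(\<Sum>i<N. norm (?y i) powr q) <= (K * lp_norm p x) powr q" for N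
 proof -
  define J where "J = (%i. THE j. i \<in> R j) ` {i. i < N \<and> (\<exists>j. i \<in> R j)}"
  have J: "finite J" by (simp add: J_def)
  have cov: "i \<in> (\<Union>j\<in>J. R j)" if "i < N" "i \<in> R j" for i j
   using that the_block[of i j] by (auto simp: J_def)
  have fU: "finite (\<Union>j\<in>J. R j)" using J finR by auto
  have "(\<Sum>i<N. norm (?y i) powr q) <= (\<Sum>i\<in>(\<Union>j\<in>J. R j) \<union> {..<N}. norm (?y i) powr q)"
   by (rule sum_mono2) (use fU in auto)
  also have "\<dots> = (\<Sum>i\<in>(\<Union>j\<in>J. R j). norm (?y i) powr q)"
   by (rule sum.mono_neutral_right) (use fU cov in \<open>auto simp: block_op_def\<close>)
  also have "\<dots> = (\<Sum>j\<in>J. \<Sum>i\<in>R j. norm (?y i) powr q)"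
   by (rule sum.UNION_disjoint) (use J finR disR in \<open>auto simp: disjoint_family_on_def\<close>)
  also have "\<dots> = (\<Sum>j\<in>J. lp_norm q (G j x) powr q)"
  proof (rule sum.cong)
   fix j
   have "lp_norm q (G j x) powr q = (\<Sum>i\<in>R j. norm (G j x i) powr q)"
    by (subst ran[symmetric]) (rule lp_restr_finite(2)[OF q(1) finR])
   then show "(\<Sum>i\<in>R j. norm (?y i) powr q) = lp_norm q (G j x) powr q"
    using block_op_apply[OF x] by simp
  qed simp
  also have "\<dots> <= (\<Sum>j\<in>J. K powr q * (lp_norm p x powr (q - p) * lp_norm p (restr (D j) x) powr p))"
  proof (rule sum_mono)
   fix j
   have le: "lp_norm p (restr (D j) x) <= lp_norm p x" by (rule lp_restr(2)[OF q(2) x])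
   have "lp_norm q (G j x) powr q <= (K * lp_norm p (restr (D j) x)) powr q"
    using bd[OF x, of j] q by (intro powr_mono2) auto
   also have "\<dots> = K powr q * (lp_norm p (restr (D j) x) powr (q - p) * lp_norm p (restr (D j) x) powr p)"
    using K by (simp add: powr_mult flip: powr_add)
   also have "\<dots> <= K powr q * (lp_norm p x powr (q - p) * lp_norm p (restr (D j) x) powr p)"
    using le pq by (intro mult_left_mono mult_right_mono powr_mono2) auto
   finally show "lp_norm q (G j x) powr q <= K powr q * (lp_norm p x powr (q - p) * lp_norm p (restr (D j) x) powr p)" .
  qed
  also have "\<dots> = K powr q * (lp_norm p x powr (q - p) * (\<Sum>j\<in>J. lp_norm p (restr (D j) x) powr p))"
   by (simp add: sum_distrib_left)
  also have "\<dots> <= K powr q * (lp_norm p x powr (q - p) * lp_norm p x powr p)"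
  proof (intro mult_left_mono)
   have "(\<Sum>j\<in>J. lp_norm p (restr (D j) x) powr p) <= lp_norm p (restr (\<Union>j\<in>J. D j) x) powr p"
    by (rule lp_disjoint_sum_le[OF q(2) x J]) (use disD in \<open>auto simp: disjoint_family_on_def\<close>)
   also have "\<dots> <= lp_norm p x powr p"
    using lp_restr(2)[OF q(2) x] q by (intro powr_mono2) auto
   finally show "(\<Sum>j\<in>J. lp_norm p (restr (D j) x) powr p) <= lp_norm p x powr p" .
  qed auto
  also have "\<dots> = (K * lp_norm p x) powr q" using K by (simp add: powr_mult flip: powr_add)
  finally show ?thesis .
 qed
 from lp_leI[OF q(1) _ this] show "?y \<in> lp q" "lp_norm q ?y <= K * lp_norm p x" using K by auto
qed

lemma block_op_bounded_ops: "block_op p R G \<in> bounded_ops p q"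
proof (rule bounded_opsI[where C=K])
 fix x :: "'k seq" assume x: "x \<in> lp p"
 show "block_op p R G x \<in> lp q" "lp_norm q (block_op p R G x) <= K * lp_norm p x"
  by (rule block_op_norm[OF x])+
 show "block_op p R G (seq_scale c x) = seq_scale c (block_op p R G x)" for c
 proof
  fix i
  show "block_op p R G (seq_scale c x) i = seq_scale c (block_op p R G x) i"
   using x lp_scale(1)[OF _ x, of c] pq
   by (simp add: block_op_def seq_linear_scale[OF lin] seq_scale_apply)
 qed
 show "block_op p R G (x + y) = block_op p R G x + block_op p R G y" if "y \<in> lp p" for y
  using x that lp_add(1)[OF pq(1) x that]
  by (auto simp: block_op_def fun_eq_iff seq_linear_add[OF lin])
qed (auto simp: block_op_def fun_eq_iff)

end

section \<open>Assembling local copies\<close>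

text \<open>
 A factorisation of the identity of the Hilbert space with coordinates \<open>Q\<close> as \<open>w T u\<close>, with both factors bounded by \<open>K\<close> and living on the coordinates in \<open>V\<close>.
\<close>

definition local_copy ::
 "'k::real_normed_field seq_op => real => real => real => nat set => nat set => 'k seq_op => 'k seq_op => bool" where
 "local_copy T p q K Q V u w \<longleftrightarrow> seq_linear u \<and> seq_linear w \<and>
  (\<forall>a. u a = u (restr Q a)) \<and> (\<forall>a. restr V (u a) = u a) \<and>
  (\<forall>y. w y = w (restr V y)) \<and> (\<forall>y. restr Q (w y) = w y) \<and>
  (\<forall>a. lp_norm p (u a) <= K * lp_norm 2 (restr Q a)) \<and>
  (\<forall>y. lp_norm 2 (w y) <= K * lp_norm q (restr V y)) \<and>
  (\<forall>a. w (T (u a)) = restr Q a)"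

lemma local_copy_mono:
 fixes T :: "'k::real_normed_field seq_op"
 assumes "local_copy T p q K Q V u w" "V \<subseteq> V'" "finite V'" "0 <= K" "0 < q"
 shows "local_copy T p q K Q V' u w"
proof -
 have 1: "restr V' (u a) = u a" for a
 proof -
  have "u a = restr V (u a)" using assms(1) by (simp add: local_copy_def)
  then have "restr V' (u a) = restr (V' \<inter> V) (u a)" by (metis restr_simps(5))
  then show ?thesis using assms(1,2) by (simp add: Int_absorb1 local_copy_def)
 qed
 have 2: "w y = w (restr V' y)" for y
 proof -
  have "w (restr V' y) = w (restr V (restr V' y))" using assms(1) unfolding local_copy_def by blast
  also have "\<dots> = w (restr V y)" using assms(2) by (simp add: Int_absorb2)
  also have "\<dots> = w y" using assms(1) unfolding local_copy_def by metis
  finally show ?thesis ..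
 qed
 have 3: "lp_norm 2 (w y) <= K * lp_norm q (restr V' y)" for y
 proof -
  have "lp_norm q (restr V (restr V' y)) <= lp_norm q (restr V' y)"
   by (rule lp_restr(2)[OF assms(5) lp_restr_finite(1)[OF assms(5,3)]])
  then have "K * lp_norm q (restr V y) <= K * lp_norm q (restr V' y)"
   using assms(2,4) by (simp add: Int_absorb2 mult_left_mono)
  moreover have "lp_norm 2 (w y) <= K * lp_norm q (restr V y)" using assms(1) by (simp add: local_copy_def)
  ultimately show ?thesis by linarith
 qed
 show ?thesis using assms(1) 1 2 3 unfolding local_copy_def by blast
qed

text \<open>
 Copies exist beyond every coordinate, so that infinitely many can be chosen with disjoint supports.
\<close>

definition has_local_copies :: "'k::real_normed_field seq_op => real => real => real => nat set => bool" where
 "has_local_copies T p q K Q \<longleftrightarrow> (\<forall>m. \<exists>M u w. local_copy T p q K Q {m..<M} u w)"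

lemma local_copy_step:
 fixes T :: "'k::real_normed_field seq_op"
 assumes "1 < p" "1 <= q" "T \<in> bounded_ops p q" "0 <= K" "has_local_copies T p q K Q" "0 < e"
 shows "\<exists>n'\<ge>n. \<exists>u w. local_copy T p q K Q {n..<n'} u w \<and>
  (\<forall>a. lp_norm q (restr (- {n..<n'}) (T (u a))) <= e * lp_norm p (u a))"
proof -
 obtain m where m: "!!n' x. n' >= m ==> x \<in> lp p ==> lp_norm q (restr {..<n} (T (restr {n'..} x))) <= e / 2 * lp_norm p x"
  using row_tail[OF assms(1-3), of "e / 2" n] assms(6) by auto
 obtain M u w where c: "local_copy T p q K Q {max m n..<M} u w"
  using assms(5) unfolding has_local_copies_def by blast
 have "1 <= p" "0 < e / 2" using assms by auto
 from column_tail[OF this(1) assms(2,3) this(2), of M]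
 obtain N where N: "!!n' x. n' >= N ==> lp_norm q (restr {n'..} (T (restr {..<M} x))) <= e / 2 * lp_norm p (restr {..<M} x)"
  by blast
 define n' where "n' = max N (max M n)"
 have c': "local_copy T p q K Q {n..<n'} u w"
  by (rule local_copy_mono[OF c]) (use assms in \<open>auto simp: n'_def\<close>)
 have "lp_norm q (restr (- {n..<n'}) (T (u a))) <= e * lp_norm p (u a)" for a
 proof -
  have ua: "u a = restr {max m n..<M} (u a)" using c by (simp add: local_copy_def)
  have ul: "u a \<in> lp p" by (subst ua, rule lp_restr_finite) (use assms in auto)
  have Tl: "T (u a) \<in> lp q" by (rule ops_in[OF assms(3) ul])
  have u1: "restr {max m n..} (u a) = u a" "restr {..<M} (u a) = u a"
   by (subst ua, subst restr_simps(5), subst (2) ua, rule arg_cong[where f="%S. restr S (u a)"], auto)+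
  have "- {n..<n'} = {..<n} \<union> {n'..}" by (auto simp: n'_def)
  then have "restr (- {n..<n'}) (T (u a)) = restr {..<n} (T (u a)) + restr {n'..} (T (u a))"
   by (subst restr_Un_disjoint[symmetric]) (auto simp: n'_def)
  then have "lp_norm q (restr (- {n..<n'}) (T (u a))) <= lp_norm q (restr {..<n} (T (u a))) + lp_norm q (restr {n'..} (T (u a)))"
   using lp_add(2)[OF assms(2) lp_restr(1)[OF _ Tl] lp_restr(1)[OF _ Tl], of "{..<n}" "{n'..}"] assms by simp
  also have "lp_norm q (restr {..<n} (T (u a))) <= e / 2 * lp_norm p (u a)"
   using m[of "max m n", OF _ ul] u1 by simp
  also have "lp_norm q (restr {n'..} (T (u a))) <= e / 2 * lp_norm p (u a)"
   using N[of n' "u a"] u1 by (simp add: n'_def)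
  finally show ?thesis by (simp add: field_simps)
 qed
 with c' show ?thesis by (intro exI[of _ n']) (auto simp: n'_def)
qed

lemma disjoint_finite_touch:
 assumes "disjoint_family D" "finite S"
 shows "finite {j. D j \<inter> S ~= ({} :: nat set)}"
proof -
 have "{j. D j \<inter> S ~= {}} \<subseteq> (%i. THE j. i \<in> D j) ` S"
 proof
  fix j assume "j \<in> {j. D j \<inter> S ~= {}}"
  then obtain i where i: "i \<in> D j" "i \<in> S" by blast
  then have "(THE j. i \<in> D j) = j" using assms(1) by (auto simp: disjoint_family_on_def)
  then show "j \<in> (%i. THE j. i \<in> D j) ` S" using i by force
 qed
 then show ?thesis using assms(2) finite_subset by blast
qed

lemma disjoint_intervals:
 fixes f :: "nat => nat"
 assumes "mono f"
 shows "disjoint_family (%j. {f j..<f (Suc j)})"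
proof -
 have "{f j..<f (Suc j)} \<inter> {f k..<f (Suc k)} = {}" if "j < k" for j k
  using monoD[OF assms, of "Suc j" k] that by auto
 then show ?thesis
  unfolding disjoint_family_on_def by (metis Int_commute linorder_neqE_nat)
qed

text \<open>
 With \<open>u\<^sub>j\<close>, \<open>w\<^sub>j\<close> far apart copies of the spaces on \<open>Q j\<close>, the operator \<open>(\<Sum>j. R\<^sub>j A w\<^sub>j) T (\<Sum>j. u\<^sub>j B D\<^sub>j)\<close> lies in \<open>J\<close> and its diagonal is the stated block operator. Its off-diagonal terms contain \<open>w\<^sub>j T u\<^sub>k\<close> with \<open>j \<noteq> k\<close>, and the tail estimates make them as small as desired.
\<close>

lemma assemble_local_copies:
 fixes T :: "'k::real_normed_field seq_op"
 assumes pq: "1 < p" "p <= 2" "2 <= q"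
  and T: "T \<in> bounded_ops p q" and A: "A \<in> bounded_ops 2 q" and B: "B \<in> bounded_ops p 2"
  and D: "disjoint_family D" "!!j. finite (D j)"
  and R: "disjoint_family R" "!!j. finite (R j)"
  and Q: "!!j. finite (Q j)" "!!j. has_local_copies T p q K (Q j)" and K: "0 <= K"
  and J: "closed_ideal p q J" "T \<in> J"
 shows "block_op p R (%j x. restr (R j) (A (restr (Q j) (B (restr (D j) x))))) \<in> J"
  (is "?S \<in> J")
proof -
 have pos: "0 < p" "0 < q" "1 <= p" "1 <= q" "p <= q" using pq by auto
 obtain a where a: "a > 0" "!!x. x \<in> lp 2 ==> lp_norm q (A x) <= a * lp_norm 2 x" using ops_bound[OF A] by metis
 obtain b where b: "b > 0" "!!x. x \<in> lp p ==> lp_norm 2 (B x) <= b * lp_norm p x" using ops_bound[OF B] by metis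
 define g where "g j x = restr (Q j) (B (restr (D j) x))" for j x
 define h where "h j x = restr (R j) (A (restr (Q j) x))" for j x
 have gl: "seq_linear (g j)" for j
  unfolding g_def by (intro seq_linear_comp[OF seq_linear_restr] seq_linear_ops_restr[OF B] pos D)
 have hl: "seq_linear (h j)" for j
  unfolding h_def by (intro seq_linear_comp[OF seq_linear_restr] seq_linear_ops_restr[OF A] Q) simp
 have g2: "lp_norm 2 (g j x) <= b * lp_norm p (restr (D j) x)" for j x
 proof -
  have "restr (D j) x \<in> lp p" by (rule lp_restr_finite(1)[OF pos(1) D(2)])
  then show ?thesis
   using lp_restr(2)[OF _ ops_in[OF B], of "restr (D j) x" "Q j"] b(2)[of "restr (D j) x"] by (simp add: g_def)
 qed
 have h2: "lp_norm q (h j x) <= a * lp_norm 2 (restr (Q j) x)" for j x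
 proof -
  have "restr (Q j) x \<in> lp 2" by (rule lp_restr_finite(1)[OF _ Q(1)]) simp
  then show ?thesis
   using lp_restr(2)[OF pos(2) ops_in[OF A], of "restr (Q j) x" "R j"] a(2)[of "restr (Q j) x"] by (simp add: h_def)
 qed
 have S_eq: "?S = block_op p R (%j x. h j (g j x))"
  by (simp add: g_def h_def)
 interpret S: block_data p q "a * b" D R "%j x. h j (g j x)"
 proof
  show "seq_linear (%x. h j (g j x))" for j by (rule seq_linear_comp[OF hl gl])
  show "restr (R j) (h j (g j x)) = h j (g j x)" for j x by (simp add: h_def)
  fix j x
  have "lp_norm 2 (restr (Q j) (g j x)) = lp_norm 2 (g j x)" by (simp add: g_def)
  then have "lp_norm q (h j (g j x)) <= a * lp_norm 2 (g j x)" using h2[of j "g j x"] by simp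
  also have "\<dots> <= a * (b * lp_norm p (restr (D j) x))" using g2 a by (intro mult_left_mono) auto
  finally show "lp_norm q (h j (g j x)) <= a * b * lp_norm p (restr (D j) x)" by simp
 qed (use pos a b D R in auto)
 show ?thesis unfolding S_eq
 proof (rule closed_ideal_limit[OF pos(3,4) J(1) S.block_op_bounded_ops])
  fix e :: real assume e: "e > 0"
  define \<eta> where "\<eta> = e / (a * K * (K * b) + 1)"
  have \<eta>: "\<eta> > 0" using e a b K by (simp add: \<eta>_def add_nonneg_pos)
  define P where "P j n n' \<longleftrightarrow> n <= n' \<and> (\<exists>u w. local_copy T p q K (Q j) {n..<n'} u w \<and>
   (\<forall>a. lp_norm q (restr (- {n..<n'}) (T (u a))) <= \<eta> / 2 ^ Suc j * lp_norm p (u a)))" for j n n'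
  have "\<exists>n'. P j n n'" for j n
   using local_copy_step[OF pq(1) pos(4) T K Q(2), of "\<eta> / 2 ^ Suc j" n j] \<eta> unfolding P_def by auto
  then have "\<exists>f. \<forall>j. True \<and> P j (f j) (f (Suc j))"
   by (intro dependent_nat_choice) auto
  then obtain f where f: "!!j. P j (f j) (f (Suc j))" by blast
  define V where "V j = {f j..<f (Suc j)}" for j
  have "\<exists>u w. local_copy T p q K (Q j) (V j) u w \<and>
   (\<forall>a. lp_norm q (restr (- V j) (T (u a))) <= \<eta> / 2 ^ Suc j * lp_norm p (u a))" for j
   using f[of j] unfolding P_def V_def by blast
  then obtain u w where uw: "!!j. local_copy T p q K (Q j) (V j) (u j) (w j)"
   and off: "!!j a. lp_norm q (restr (- V j) (T (u j a))) <= \<eta> / 2 ^ Suc j * lp_norm p (u j a)" by metis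
  have "mono f" using f by (auto intro!: incseq_SucI simp: P_def)
  then have V: "disjoint_family V" "!!j. finite (V j)"
   using disjoint_intervals[of f] by (simp_all add: V_def[abs_def])
  have ul: "seq_linear (u j)" and wl: "seq_linear (w j)"
   and uV: "restr (V j) (u j x) = u j x" and wV: "w j x = w j (restr (V j) x)"
   and wQ: "restr (Q j) (w j x) = w j x"
   and un: "lp_norm p (u j x) <= K * lp_norm 2 (restr (Q j) x)"
   and wn: "lp_norm 2 (w j x) <= K * lp_norm q (restr (V j) x)"
   and wTu: "w j (T (u j x)) = restr (Q j) x" for j x
   using uw[of j] unfolding local_copy_def by blast+
  interpret C: block_data p p "K * b" D V "%j x. u j (g j x)"
  proof
   show "seq_linear (%x. u j (g j x))" for j by (rule seq_linear_comp[OF ul gl])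
   fix j x
   have "restr (Q j) (g j x) = g j x" by (simp add: g_def)
   then have "lp_norm p (u j (g j x)) <= K * lp_norm 2 (g j x)" using un[of j "g j x"] by simp
   also have "\<dots> <= K * (b * lp_norm p (restr (D j) x))" using g2 K by (intro mult_left_mono) auto
   finally show "lp_norm p (u j (g j x)) <= K * b * lp_norm p (restr (D j) x)" by simp
  qed (use pos K b D V uV in auto)
  interpret E: block_data q q "a * K" V R "%j x. h j (w j x)"
  proof
   show "seq_linear (%x. h j (w j x))" for j by (rule seq_linear_comp[OF hl wl])
   show "restr (R j) (h j (w j x)) = h j (w j x)" for j x by (simp add: h_def)
   fix j x
   have "lp_norm q (h j (w j x)) <= a * lp_norm 2 (w j x)" using h2[of j "w j x"] wQ by simp
   also have "\<dots> <= a * (K * lp_norm q (restr (V j) x))" using wn a by (intro mult_left_mono) auto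
   finally show "lp_norm q (h j (w j x)) <= a * K * lp_norm q (restr (V j) x)" by simp
  qed (use pos K a R V in auto)
  define c where "c = block_op p V (%j x. u j (g j x))"
  define d where "d = block_op q R (%j x. h j (w j x))"
  have cb: "c \<in> bounded_ops p p" and db: "d \<in> bounded_ops q q"
   unfolding c_def d_def by (rule C.block_op_bounded_ops, rule E.block_op_bounded_ops)
  have "d \<circ> T \<circ> c \<in> J" by (rule closed_ideal_mult[OF J(1) db J(2) cb])
  moreover have "lp_norm q ((d \<circ> T \<circ> c) (restr {..<M} x) - block_op p R (%j x. h j (g j x)) (restr {..<M} x))
   <= e * lp_norm p (restr {..<M} x)" for M x
  proof -
   let ?x = "restr {..<M} x"
   have xl: "?x \<in> lp p" by (rule lp_restr_finite(1)[OF pos(1)]) simp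
   define I where "I = {j. D j \<inter> {..<M} ~= {}}"
   have I: "finite I" unfolding I_def by (rule disjoint_finite_touch[OF D(1)]) simp
   have g0: "g j ?x = 0" if "j \<notin> I" for j
    using that ops_0[OF B] by (simp add: g_def I_def)
   have cx: "c ?x = (\<Sum>j\<in>I. u j (g j ?x))"
    unfolding c_def by (rule C.block_op_eq_sum[OF xl I]) (simp add: g0 seq_linear_0[OF ul])
   have sx: "block_op p R (%j x. h j (g j x)) ?x = (\<Sum>j\<in>I. h j (g j ?x))"
    by (rule S.block_op_eq_sum[OF xl I]) (simp add: g0 seq_linear_0[OF hl])
   have ulp: "u j (g j ?x) \<in> lp p" for j
    by (subst uV[symmetric]) (rule lp_restr_finite(1)[OF pos(1) V(2)])
   define y where "y j = T (u j (g j ?x))" for j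
   have yl: "y j \<in> lp q" for j unfolding y_def by (rule ops_in[OF T ulp])
   have rl: "restr S (y j) \<in> lp q" for S j by (rule lp_restr(1)[OF pos(2) yl])
   have Tc: "T (c ?x) = (\<Sum>j\<in>I. y j)"
    unfolding cx y_def by (rule ops_sum[OF T pos(3) I ulp])
   have dV: "d (restr (V j) (y j)) = h j (g j ?x)" for j
   proof -
    have 0: "w k (restr (V j) (y j)) = 0" if "k ~= j" for k
     using wV[of k "restr (V j) (y j)"] V(1) that
     by (auto simp: disjoint_family_on_def seq_linear_0[OF wl])
    have "d (restr (V j) (y j)) = (\<Sum>k\<in>{j}. h k (w k (restr (V j) (y j))))"
     unfolding d_def by (rule E.block_op_eq_sum[OF rl]) (auto simp: 0 seq_linear_0[OF hl])
    also have "\<dots> = h j (w j (y j))" using wV by simp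
    also have "\<dots> = h j (restr (Q j) (g j ?x))" by (simp add: y_def wTu)
    also have "\<dots> = h j (g j ?x)" by (simp add: g_def)
    finally show ?thesis .
   qed
   have "d (y j) = d (restr (V j) (y j)) + d (restr (- V j) (y j))" for j
   proof -
    have "y j = restr (V j) (y j) + restr (- V j) (y j)" by (auto simp: restr_def fun_eq_iff)
    then show ?thesis using ops_add[OF db rl rl, of "V j" j "- V j" j] by simp
   qed
   then have "(d \<circ> T \<circ> c) ?x - block_op p R (%j x. h j (g j x)) ?x = (\<Sum>j\<in>I. d (restr (- V j) (y j)))"
    unfolding sx comp_apply Tc ops_sum[OF db pos(4) I yl] dV sum_subtractf[symmetric] by simp
   then have "lp_norm q ((d \<circ> T \<circ> c) ?x - block_op p R (%j x. h j (g j x)) ?x) <= (\<Sum>j\<in>I. lp_norm q (d (restr (- V j) (y j))))"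
    using lp_sum[OF pos(4) I, of "%j. d (restr (- V j) (y j))"] ops_in[OF db rl] by simp
   also have "\<dots> <= (\<Sum>j\<in>I. a * K * (K * b) * \<eta> * lp_norm p ?x * (1 / 2) ^ Suc j)"
   proof (rule sum_mono)
    fix j
    have "restr (Q j) (g j ?x) = g j ?x" by (simp add: g_def)
    then have "lp_norm p (u j (g j ?x)) <= K * lp_norm 2 (g j ?x)" using un[of j "g j ?x"] by simp
    also have "\<dots> <= K * (b * lp_norm p ?x)"
     using g2[of j ?x] lp_restr(2)[OF pos(1) xl, of "D j"] b K
     by (intro mult_left_mono) (auto intro: order_trans mult_left_mono)
    finally have n: "lp_norm p (u j (g j ?x)) <= K * (b * lp_norm p ?x)" .
    have "lp_norm q (d (restr (- V j) (y j))) <= a * K * lp_norm q (restr (- V j) (y j))"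
     unfolding d_def by (rule E.block_op_norm(2)[OF rl])
    also have "\<dots> <= a * K * (\<eta> / 2 ^ Suc j * lp_norm p (u j (g j ?x)))"
     unfolding y_def using a K by (intro mult_left_mono off) auto
    also have "\<dots> <= a * K * (\<eta> / 2 ^ Suc j * (K * (b * lp_norm p ?x)))"
     using n \<eta> a K by (intro mult_left_mono) auto
    also have "\<dots> = a * K * (K * b) * \<eta> * lp_norm p ?x * (1 / 2) ^ Suc j"
     by (simp add: power_divide)
    finally show "lp_norm q (d (restr (- V j) (y j))) <= a * K * (K * b) * \<eta> * lp_norm p ?x * (1 / 2) ^ Suc j" .
   qed
   also have "\<dots> = a * K * (K * b) * \<eta> * lp_norm p ?x * (\<Sum>j\<in>I. (1 / 2) ^ Suc j)"
    by (simp add: sum_distrib_left)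
   also have "\<dots> <= a * K * (K * b) * \<eta> * lp_norm p ?x * 1"
   proof (rule mult_left_mono)
    have "(\<Sum>j\<in>I. (1 / 2 :: real) ^ Suc j) <= (\<Sum>j. (1 / 2) ^ Suc j)"
     by (rule sum_le_suminf) (use I power_half_series in \<open>auto simp: sums_iff\<close>)
    then show "(\<Sum>j\<in>I. (1 / 2 :: real) ^ Suc j) <= 1" using power_half_series by (simp add: sums_iff)
    show "0 <= a * K * (K * b) * \<eta> * lp_norm p ?x" using a b K \<eta> by simp
   qed
   also have "\<dots> <= e * lp_norm p ?x"
   proof -
    have "a * K * (K * b) * \<eta> <= (a * K * (K * b) + 1) * \<eta>" using \<eta> by (intro mult_right_mono) auto
    also have "\<dots> = e" using a b K by (simp add: \<eta>_def add_nonneg_eq_0_iff)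
    finally show ?thesis by (simp add: mult_right_mono)
   qed
   finally show ?thesis .
  qed
  ultimately show "\<exists>S\<in>J. \<forall>M x. lp_norm q (S (restr {..<M} x) - block_op p R (%j x. h j (g j x)) (restr {..<M} x))
   <= e * lp_norm p (restr {..<M} x)" by blast
 qed
qed

lemma Young_powr:
 fixes a b s t :: real
 assumes "1 < s" "1 / s + 1 / t = 1" "0 <= a" "0 <= b"
 shows "a * b <= a powr s / s + b powr t / t"
proof -
 have "1 / t = 1 - 1 / s" using assms by simp
 moreover have "0 < 1 - 1 / s" "1 - 1 / s < 1" using assms(1) by auto
 ultimately have "0 < 1 / t" "1 / t < 1" by auto
 then have "1 < t" by (simp add: zero_less_divide_iff divide_less_eq)
 then show ?thesis using Youngs_inequality[of s t a b] assms by simp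
qed

lemma Holder_sum:
 fixes a b :: "'i => real"
 assumes "1 < s" "1 / s + 1 / t = 1" "!!i. i \<in> S ==> 0 <= a i" "!!i. i \<in> S ==> 0 <= b i"
 shows "(\<Sum>i\<in>S. a i * b i) <= (\<Sum>i\<in>S. a i powr s) powr (1 / s) * (\<Sum>i\<in>S. b i powr t) powr (1 / t)"
proof (cases "finite S")
 case fin: True
 define A B where "A = (\<Sum>i\<in>S. a i powr s)" and "B = (\<Sum>i\<in>S. b i powr t)"
 have nn: "0 <= A" "0 <= B" by (auto simp: A_def B_def intro: sum_nonneg)
 have t: "0 < t"
 proof -
  have "1 / t = 1 - 1 / s" "1 / s < 1" using assms by auto
  then have "0 < 1 / t" by simp
  then show ?thesis by (simp only: zero_less_divide_1_iff)
 qed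
 show ?thesis
 proof (cases "A = 0 \<or> B = 0")
  case True
  have "a i * b i = 0" if "i \<in> S" for i
  proof -
   have "a i powr s = 0 \<or> b i powr t = 0"
    using True fin that by (auto simp: A_def B_def sum_nonneg_eq_0_iff)
   then show ?thesis by auto
  qed
  then have "(\<Sum>i\<in>S. a i * b i) = 0" by (intro sum.neutral ballI)
  then show ?thesis by simp
 next
  case False
  define \<alpha> \<beta> where "\<alpha> = A powr (1 / s)" and "\<beta> = B powr (1 / t)"
  have pos: "0 < \<alpha>" "0 < \<beta>" using False nn by (auto simp: \<alpha>_def \<beta>_def)
  have pw: "\<alpha> powr s = A" "\<beta> powr t = B" using nn t assms by (auto simp: \<alpha>_def \<beta>_def)
  have "(\<Sum>i\<in>S. a i / \<alpha> * (b i / \<beta>)) <= (\<Sum>i\<in>S. (a i powr s / A) / s + (b i powr t / B) / t)"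
  proof (rule sum_mono)
   fix i assume "i \<in> S"
   then show "a i / \<alpha> * (b i / \<beta>) <= (a i powr s / A) / s + (b i powr t / B) / t"
    using Young_powr[OF assms(1,2), of "a i / \<alpha>" "b i / \<beta>"] assms(3,4) pos pw by (simp add: powr_divide)
  qed
  also have "\<dots> = (A / A) / s + (B / B) / t"
   by (simp only: sum.distrib A_def B_def sum_divide_distrib)
  also have "\<dots> = 1" using False assms(2) by simp
  finally have "(\<Sum>i\<in>S. a i * b i) / (\<alpha> * \<beta>) <= 1" by (simp add: sum_divide_distrib)
  then show ?thesis using pos unfolding A_def[symmetric] B_def[symmetric] \<alpha>_def[symmetric] \<beta>_def[symmetric]
   by (simp add: divide_le_eq)
 qed
qed simp

lemma Holder_lp_finite:
 fixes v y :: "'k::real_normed_field seq"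
 assumes "1 < q" "1 / q + 1 / t = 1" "finite S"
 shows "(\<Sum>i\<in>S. norm (v i) * norm (y i)) <= lp_norm t (restr S v) * lp_norm q (restr S y)"
proof -
 have t: "0 < t"
 proof -
  have "1 / t = 1 - 1 / q" "1 / q < 1" using assms by auto
  then have "0 < 1 / t" by simp
  then show ?thesis by (simp only: zero_less_divide_1_iff)
 qed
 have eq: "lp_norm s (restr S x) = (\<Sum>i\<in>S. norm (x i) powr s) powr (1 / s)" if "0 < s" for s and x :: "'k seq"
  unfolding lp_restr_finite(2)[OF that assms(3), symmetric] using that by simp
 show ?thesis
  using Holder_sum[OF assms(1,2), of S "%i. norm (y i)" "%i. norm (v i)"] assms
  unfolding eq[OF t] eq[OF less_trans[OF zero_less_one assms(1)]] by (simp add: mult.commute)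
qed

text \<open>
 The coefficients are the extremal ones in Hoelder's inequality.
\<close>

lemma norming_functional:
 fixes v :: "'k::real_normed_field seq"
 assumes "1 < q" "finite S" "restr S v ~= 0"
 obtains c where "(\<Sum>i\<in>S. c i * v i) = 1"
  "!!y. norm (\<Sum>i\<in>S. c i * y i) <= lp_norm q (restr S y) / lp_norm q (restr S v)"
proof -
 define N where "N = lp_norm q (restr S v)"
 have vl: "restr S v \<in> lp q" by (rule lp_restr_finite) (use assms in auto)
 have N: "0 < N" unfolding N_def by (rule lp_norm_pos[OF vl _ assms(3)]) (use assms in auto)
 have Nq: "N powr q = (\<Sum>i\<in>S. norm (v i) powr q)"
  unfolding N_def by (rule lp_restr_finite) (use assms in auto)
 define t where "t = q / (q - 1)"
 have t: "1 / q + 1 / t = 1" "0 < t" using assms(1) by (auto simp: t_def field_simps)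
 define c where "c i = inverse (v i) * of_real (norm (v i) powr q / N powr q)" for i
 have "(\<Sum>i\<in>S. c i * v i) = (\<Sum>i\<in>S. of_real (norm (v i) powr q / N powr q))"
 proof (rule sum.cong)
  fix i
  show "c i * v i = of_real (norm (v i) powr q / N powr q)" by (cases "v i = 0") (use assms(1) in \<open>simp_all add: c_def\<close>)
 qed simp
 also have "\<dots> = of_real (\<Sum>i\<in>S. norm (v i) powr q / N powr q)" by simp
 also have "(\<Sum>i\<in>S. norm (v i) powr q / N powr q) = N powr q / N powr q"
  by (simp only: Nq sum_divide_distrib)
 also have "N powr q / N powr q = 1" using N by simp
 finally have 1: "(\<Sum>i\<in>S. c i * v i) = 1" by simp
 have nc: "norm (c i) = norm (v i) powr (q - 1) / N powr q" for i
 proof (cases "v i = 0")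
  case True
  then show ?thesis using assms(1) by (simp add: c_def)
 next
  case False
  then show ?thesis by (simp add: c_def norm_mult norm_inverse powr_diff divide_inverse)
 qed
 have 2: "norm (\<Sum>i\<in>S. c i * y i) <= lp_norm q (restr S y) / N" for y
 proof -
  have "norm (\<Sum>i\<in>S. c i * y i) <= (\<Sum>i\<in>S. norm (c i) * norm (y i))"
   by (rule order_trans[OF norm_sum]) (simp add: norm_mult)
  also have "\<dots> <= lp_norm t (restr S c) * lp_norm q (restr S y)"
   by (rule Holder_lp_finite[OF assms(1) t(1) assms(2)])
  also have "lp_norm t (restr S c) = 1 / N"
  proof -
   have "lp_norm t (restr S c) powr t = (\<Sum>i\<in>S. norm (c i) powr t)"
    by (rule lp_restr_finite(2)[OF t(2) assms(2)])
   also have "\<dots> = (\<Sum>i\<in>S. norm (v i) powr q / N powr (q * t))"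
   proof (rule sum.cong)
    fix i
    have "(q - 1) * t = q" using assms(1) by (simp add: t_def)
    then show "norm (c i) powr t = norm (v i) powr q / N powr (q * t)"
     by (simp add: nc powr_divide powr_powr)
   qed simp
   also have "\<dots> = N powr q / N powr (q * t)" by (simp add: Nq sum_divide_distrib)
   also have "\<dots> = N powr (q - q * t)" using N by (simp add: powr_diff)
   also have "q - q * t = - t" using assms(1) by (simp add: t_def field_simps)
   also have "N powr - t = (1 / N) powr t" using N by (simp add: powr_minus_divide powr_divide)
   finally have eq: "lp_norm t (restr S c) powr t = (1 / N) powr t" .
   show ?thesis
    by (rule order_antisym; rule le_powr_cancel[of _ t]) (use eq t N in auto)
  qed
  finally show ?thesis by simp
 qed
 show thesis using that 1 2 by (auto simp: N_def)
qed

section \<open>Non-compact operators\<close>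

text \<open>
 A gliding hump: the uniform tail condition fails, and heads may be removed from domain and range.
\<close>

lemma noncompact_blocks:
 fixes T :: "'k::{real_normed_field,euclidean_space} seq_op"
 assumes "1 <= p" "1 <= q" "T \<in> bounded_ops p q" "T \<notin> compact_ops p q"
 shows "\<exists>d>0. \<forall>m. \<exists>M z. restr {m..<M} z = z \<and> lp_norm p z = 1 \<and> lp_norm q (restr {m..<M} (T z)) > d"
proof -
 have pos: "0 < p" "0 < q" using assms by auto
 obtain e where e: "e > 0" "!!m. \<exists>x\<in>lp p. e * lp_norm p x < lp_norm q (restr {m..} (T x))"
  using assms(3,4) unfolding compact_ops_iff[OF assms(1,2)] by (meson not_le)
 obtain D where D: "D > 0" "!!x. x \<in> lp p ==> lp_norm q (T x) <= D * lp_norm p x" using ops_bound[OF assms(3)] by metis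
 have "\<exists>M z. restr {m..<M} z = z \<and> lp_norm p z = 1 \<and> lp_norm q (restr {m..<M} (T z)) > e / 2" for m
 proof -
  obtain l where l: "!!x n. n >= l ==> lp_norm q (restr {n..} (T (restr {..<m} x))) <= e / 2 * lp_norm p (restr {..<m} x)"
   using column_tail[OF assms(1-3), of "e / 2" m] e by auto
  obtain x where x: "x \<in> lp p" "e * lp_norm p x < lp_norm q (restr {max l m..} (T x))" using e(2) by blast
  have rl: "restr S x \<in> lp p" for S by (rule lp_restr(1)[OF pos(1) x(1)])
  have Tl: "T (restr S x) \<in> lp q" for S by (rule ops_in[OF assms(3) rl])
  have RTl: "restr U (T (restr S x)) \<in> lp q" for S U by (rule lp_restr(1)[OF pos(2) Tl])
  have tri: "lp_norm q (restr U (T (restr S1 x))) <= lp_norm q (restr U (T (restr S2 x))) + lp_norm q (restr U (T (restr S3 x)))"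
   if "S1 = S2 \<union> S3" "S2 \<inter> S3 = {}" for U S1 S2 S3
   using that ops_add[OF assms(3) rl rl, of S2 S3] lp_add(2)[OF assms(2) RTl RTl, of U S2 U S3]
   by (simp add: restr_Un_disjoint)
  have "lp_norm q (restr {max l m..} (T x)) <= lp_norm q (restr {max l m..} (T (restr {..<m} x))) + lp_norm q (restr {max l m..} (T (restr {m..} x)))"
   using tri[of UNIV "{..<m}" "{m..}" "{max l m..}"] by fastforce
  moreover have "e / 2 * lp_norm p (restr {..<m} x) <= e / 2 * lp_norm p x"
   using lp_restr(2)[OF pos(1) x(1)] e by (intro mult_left_mono) auto
  ultimately have y1: "lp_norm q (restr {max l m..} (T (restr {m..} x))) > e / 2 * lp_norm p x"
   using x(2) l[of "max l m" x] by (simp add: field_simps)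
  have "lp_norm q (restr {max l m..} (T (restr {m..} x))) <= lp_norm q (restr {m..} (T (restr {m..} x)))"
   by (rule lp_restr_mono[OF pos(2) Tl]) auto
  then have y2: "lp_norm q (restr {m..} (T (restr {m..} x))) > e / 2 * lp_norm p x" using y1 by linarith
  define g where "g = (lp_norm q (restr {m..} (T (restr {m..} x))) - e / 2 * lp_norm p x) / 2"
  have g: "g > 0" using y2 by (simp add: g_def)
  obtain N where N: "lp_norm p (restr {N..} x) < g / D"
   using lp_tail[OF pos(1) x(1), of "g / D"] g D(1) by auto
  have z1: "lp_norm q (restr {m..} (T (restr {m..<max m N} x))) > e / 2 * lp_norm p x + g"
  proof -
   have "lp_norm q (restr {m..} (T (restr {m..} x))) <= lp_norm q (restr {m..} (T (restr {m..<max m N} x))) + lp_norm q (restr {m..} (T (restr {max m N..} x)))"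
    by (rule tri) auto
   moreover have "lp_norm q (restr {m..} (T (restr {max m N..} x))) < g"
   proof -
    have "lp_norm q (restr {m..} (T (restr {max m N..} x))) <= D * lp_norm p (restr {max m N..} x)"
     by (rule order_trans[OF lp_restr(2)[OF pos(2) Tl] D(2)[OF rl]])
    also have "\<dots> <= D * lp_norm p (restr {N..} x)"
     using D(1) by (intro mult_left_mono lp_restr_mono[OF pos(1) x(1)]) auto
    also have "\<dots> < g" using N D(1) by (simp add: field_simps)
    finally show ?thesis .
   qed
   ultimately show ?thesis by (simp add: g_def field_simps)
  qed
  define z where "z = restr {m..<max m N} x"
  have zl: "z \<in> lp p" "T z \<in> lp q" unfolding z_def using rl Tl by auto
  obtain M where M: "lp_norm q (restr {M..} (T z)) < g" using lp_tail[OF pos(2) zl(2) g] by auto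
  define M' where "M' = max M (max m N)"
  have "lp_norm q (restr {m..<M'} (T z)) > e / 2 * lp_norm p z"
  proof -
   have "restr {m..} (T z) = restr {m..<M'} (T z) + restr {M'..} (T z)"
    by (subst restr_Un_disjoint[symmetric]) (auto simp: M'_def intro!: arg_cong[where f="%S. restr S (T z)"])
   then have "lp_norm q (restr {m..} (T z)) <= lp_norm q (restr {m..<M'} (T z)) + lp_norm q (restr {M'..} (T z))"
    using lp_add(2)[OF assms(2) lp_restr(1)[OF pos(2) zl(2)] lp_restr(1)[OF pos(2) zl(2)]] by simp
   moreover have "lp_norm q (restr {M'..} (T z)) <= lp_norm q (restr {M..} (T z))"
    by (rule lp_restr_mono[OF pos(2) zl(2)]) (auto simp: M'_def)
   moreover have "e / 2 * lp_norm p z <= e / 2 * lp_norm p x"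
    unfolding z_def using lp_restr(2)[OF pos(1) x(1)] e by (intro mult_left_mono) auto
   ultimately show ?thesis using z1 M by (simp add: z_def)
  qed
  moreover from this have zn: "lp_norm p z > 0"
   using lp_norm_pos[OF zl(1) pos(1)] ops_0[OF assms(3)] by (cases "z = 0") auto
  define c :: 'k where "c = of_real (1 / lp_norm p z)"
  have c: "norm c = 1 / lp_norm p z" using zn by (simp add: c_def norm_divide)
  have "lp_norm p (seq_scale c z) = 1" using lp_scale(2)[OF pos(1) zl(1), of c] c zn by simp
  moreover have "lp_norm q (restr {m..<M'} (T (seq_scale c z))) = norm c * lp_norm q (restr {m..<M'} (T z))"
   using ops_scale[OF assms(3) zl(1), of c] lp_scale(2)[OF pos(2) lp_restr(1)[OF pos(2) zl(2)], of c] by simp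
  moreover have "restr {m..<M'} (seq_scale c z) = seq_scale c z"
  proof -
   have "restr {m..<M'} z = z" unfolding z_def restr_simps(5)
    by (rule arg_cong[where f="%S. restr S x"]) (auto simp: M'_def)
   then show ?thesis by simp
  qed
  moreover have "norm c * lp_norm q (restr {m..<M'} (T z)) > e / 2"
   using calculation(1) zn unfolding c by (simp add: field_simps)
  ultimately show ?thesis
   by (intro exI[of _ M'] exI[of _ "seq_scale c z"] conjI) (simp_all only:)
 qed
 then show ?thesis using e(1) by (intro exI[of _ "e / 2"]) auto
qed

lemma noncompact_local_copies:
 fixes T :: "'k::{real_normed_field,euclidean_space} seq_op"
 assumes "1 <= p" "1 < q" "T \<in> bounded_ops p q" "T \<notin> compact_ops p q"
 shows "\<exists>K\<ge>0. \<forall>j. has_local_copies T p q K {j}"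
proof -
 have pos: "0 < p" "0 < q" using assms by auto
 obtain d where d: "d > 0" "!!m. \<exists>M z. restr {m..<M} z = z \<and> lp_norm p z = 1 \<and> lp_norm q (restr {m..<M} (T z)) > d"
  using noncompact_blocks[OF assms(1) _ assms(3,4)] assms(2) by auto
 have "\<exists>M u w. local_copy T p q (1 / d + 1) {j} {m..<M} u w" for j m
 proof -
  obtain M z where z: "restr {m..<M} z = z" "lp_norm p z = 1" "lp_norm q (restr {m..<M} (T z)) > d" using d(2) by blast
  have zl: "z \<in> lp p" by (subst z(1)[symmetric]) (rule lp_restr_finite(1)[OF pos(1) finite_atLeastLessThan])
  have "restr {m..<M} (T z) ~= 0" using z(3) d(1) by auto
  from norming_functional[OF assms(2) finite_atLeastLessThan this]
  obtain c where c: "(\<Sum>i=m..<M. c i * T z i) = 1"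
   "!!y. norm (\<Sum>i=m..<M. c i * y i) <= lp_norm q (restr {m..<M} y) / lp_norm q (restr {m..<M} (T z))" by blast
  define u where "u a = seq_scale (a j) z" for a :: "'k seq"
  define w where "w y = seq_scale (\<Sum>i=m..<M. c i * y i) (unit j)" for y :: "'k seq"
  have uj: "restr {j} a = seq_scale (a j) (unit j)" for a :: "'k seq"
   using restr_finite_eq_sum[of "{j}" a] by simp
  have "local_copy T p q (1 / d + 1) {j} {m..<M} u w"
   unfolding local_copy_def
  proof (intro conjI allI)
   show "seq_linear u" unfolding seq_linear_def u_def
    by (auto simp: seq.scale_left_distrib seq_scale_apply)
   show "seq_linear w" unfolding seq_linear_def w_def
    by (auto simp: seq.scale_left_distrib[symmetric] sum.distrib[symmetric] algebra_simps seq_scale_apply sum_distrib_left)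
   fix a y :: "'k seq"
   show "u a = u (restr {j} a)" by (simp add: u_def restr_def)
   show "restr {m..<M} (u a) = u a" by (simp add: u_def z(1))
   show "w y = w (restr {m..<M} y)" unfolding w_def by (simp add: restr_def)
   show "restr {j} (w y) = w y" by (simp add: w_def restr_def unit_def fun_eq_iff seq_scale_apply)
   have "lp_norm p (u a) = norm (a j)" using lp_scale(2)[OF pos(1) zl, of "a j"] z(2) by (simp add: u_def)
   moreover have "lp_norm 2 (restr {j} a) = norm (a j)" unfolding uj by (rule lp_scale_unit) simp
   ultimately show "lp_norm p (u a) <= (1 / d + 1) * lp_norm 2 (restr {j} a)"
    using d(1) by (simp add: algebra_simps)
   have "lp_norm 2 (w y) = norm (\<Sum>i=m..<M. c i * y i)" unfolding w_def by (rule lp_scale_unit) simp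
   also have "\<dots> <= lp_norm q (restr {m..<M} y) / lp_norm q (restr {m..<M} (T z))" by (rule c(2))
   also have "\<dots> <= lp_norm q (restr {m..<M} y) / d" using z(3) d(1) by (intro divide_left_mono) auto
   also have "\<dots> <= (1 / d + 1) * lp_norm q (restr {m..<M} y)" by (simp add: algebra_simps)
   finally show "lp_norm 2 (w y) <= (1 / d + 1) * lp_norm q (restr {m..<M} y)" .
   show "w (T (u a)) = restr {j} a"
    unfolding uj u_def ops_scale[OF assms(3) zl] w_def
    using c(1) by (simp add: seq_scale_apply mult.left_commute[of _ "a j"] flip: sum_distrib_left)
  qed
  then show ?thesis by blast
 qed
 then show ?thesis using d(1) by (intro exI[of _ "1 / d + 1"]) (auto simp: has_local_copies_def)
qed

text \<open>
 Assembling one-dimensional local copies with the formal identities \<open>\<ell>\<^sub>p \<rightarrow> \<ell>\<^sub>2\<close> and \<open>\<ell>\<^sub>2 \<rightarrow> \<ell>\<^sub>q\<close> as outer factors gives the formal identity.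
\<close>

lemma noncompact_identity:
 fixes J :: "'k::{real_normed_field,euclidean_space} seq_op set"
 assumes "1 < p" "p <= 2" "2 <= q" "closed_ideal p q J" "T \<in> J" "T \<notin> compact_ops p q"
 shows "formal_identity p \<in> J"
proof -
 have T: "T \<in> bounded_ops p q" using assms closed_ideal_sub by blast
 obtain K where K: "K >= 0" "!!j. has_local_copies T p q K {j}"
  using noncompact_local_copies[OF _ _ T assms(6)] assms by auto
 have A: "formal_identity 2 \<in> bounded_ops 2 q" and B: "formal_identity p \<in> bounded_ops p 2"
  using assms by (auto intro!: formal_identity_bounded_ops)
 have "block_op p (%j. {j}) (%j x. restr {j} (formal_identity 2 (restr {j} (formal_identity p (restr {j} x))))) \<in> J"
  by (rule assemble_local_copies[OF assms(1-3) T A B _ _ _ _ _ K(2,1) assms(4,5)]) (auto simp: disjoint_family_on_def)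
 also have "block_op p (%j. {j}) (%j x. restr {j} (formal_identity 2 (restr {j} (formal_identity p (restr {j} x)))))
  = (formal_identity p :: 'k seq_op)"
 proof (intro ext)
  fix x :: "'k seq" and i
  have "restr {j} x \<in> lp s" if "s > 0" for j s by (rule lp_restr_finite(1)[OF that]) simp
  then show "block_op p (%j. {j}) (%j x. restr {j} (formal_identity 2 (restr {j} (formal_identity p (restr {j} x))))) x i
   = formal_identity p x i"
   using assms(1) by (simp add: block_op_def formal_identity_def restr_apply)
 qed
 finally show ?thesis .
qed

section \<open>Operators factoring through Hilbert space\<close>

text \<open>
 Cut \<open>\<ell>\<^sub>2\<close> into consecutive finite blocks that grow fast. Up to a summable error, \<open>B\<close> sends only neighbouring coordinates into a block and \<open>A\<close> sends the block only to neighbouring ones. Within a residue class of block indices modulo 3 the neighbourhoods are disjoint, and each class is covered by the assembling lemma.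
\<close>

lemma local_copies_hilbert:
 fixes J :: "'k::real_normed_field seq_op set"
 assumes pq: "1 < p" "p <= 2" "2 <= q" and J: "closed_ideal p q J" "T \<in> J"
  and K: "0 <= K" "!!m n. has_local_copies T p q K {m..<n}"
  and A: "A \<in> bounded_ops 2 q" and B: "B \<in> bounded_ops p 2"
 shows "A \<circ> B \<in> J"
proof -
 have pos: "0 < p" "0 < q" "1 <= p" "1 <= q" "p <= q" using pq by auto
 have T: "T \<in> bounded_ops p q" using J closed_ideal_sub by blast
 obtain a where a: "a > 0" "!!x. x \<in> lp 2 ==> lp_norm q (A x) <= a * lp_norm 2 x" using ops_bound[OF A] by metis
 obtain b where b: "b > 0" "!!x. x \<in> lp p ==> lp_norm 2 (B x) <= b * lp_norm p x" using ops_bound[OF B] by metis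
 show ?thesis
 proof (rule closed_ideal_limit[OF pos(3,4) J(1) bounded_ops_comp[OF A B]])
  fix \<epsilon> :: real assume \<epsilon>: "\<epsilon> > 0"
  define \<eta> where "\<eta> = \<epsilon> / (8 * (a + b))"
  have \<eta>: "\<eta> > 0" using \<epsilon> a b by (simp add: \<eta>_def)
  define P where "P k n n' \<longleftrightarrow> n < n' \<and>
   (\<forall>x. lp_norm 2 (restr {n'..} (B (restr {..<n} x))) <= \<eta> / 2 ^ k * lp_norm p (restr {..<n} x)) \<and>
   (\<forall>x\<in>lp p. lp_norm 2 (restr {..<n} (B (restr {n'..} x))) <= \<eta> / 2 ^ k * lp_norm p x) \<and>
   (\<forall>x. lp_norm q (restr {n'..} (A (restr {..<n} x))) <= \<eta> / 2 ^ k * lp_norm 2 (restr {..<n} x)) \<and>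
   (\<forall>x\<in>lp 2. lp_norm q (restr {..<n} (A (restr {n'..} x))) <= \<eta> / 2 ^ k * lp_norm 2 x)" for k n n'
  have "\<exists>n'. P k n n'" for k n
  proof -
   have e: "\<eta> / 2 ^ k > 0" using \<eta> by simp
   obtain M1 where M1: "!!n' x. n' >= M1 ==> lp_norm 2 (restr {n'..} (B (restr {..<n} x))) <= \<eta> / 2 ^ k * lp_norm p (restr {..<n} x)"
    using column_tail[OF pos(3) _ B e, of n] by auto
   obtain M2 where M2: "!!n' x. n' >= M2 ==> x \<in> lp p ==> lp_norm 2 (restr {..<n} (B (restr {n'..} x))) <= \<eta> / 2 ^ k * lp_norm p x"
    using row_tail[OF pq(1) _ B e, of n] by auto
   obtain M3 where M3: "!!n' x. n' >= M3 ==> lp_norm q (restr {n'..} (A (restr {..<n} x))) <= \<eta> / 2 ^ k * lp_norm 2 (restr {..<n} x)"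
    using column_tail[OF _ pos(4) A e, of n] by auto
   obtain M4 where M4: "!!n' x. n' >= M4 ==> x \<in> lp 2 ==> lp_norm q (restr {..<n} (A (restr {n'..} x))) <= \<eta> / 2 ^ k * lp_norm 2 x"
    using row_tail[OF _ pos(4) A e, of n] by auto
   define n' where "n' = Max {M1, M2, M3, M4, Suc n}"
   have "n' >= M1" "n' >= M2" "n' >= M3" "n' >= M4" "n' > n" by (auto simp: n'_def Suc_le_eq[symmetric] max_def)
   then have "P k n n'" unfolding P_def using M1 M2 M3 M4 by auto
   then show ?thesis ..
  qed
  then have "\<exists>f. \<forall>k. (k = 0 --> f k = 0) \<and> P k (f k) (f (Suc k))"
   by (intro dependent_nat_choice) auto
  then obtain f where f0: "f 0 = 0" and f: "!!k. P k (f k) (f (Suc k))" by blast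
  have sm: "strict_mono f" using f by (simp add: strict_mono_Suc_iff P_def)
  then have mf: "mono f" by (rule strict_mono_mono)
  have fge: "k <= f k" for k by (rule strict_mono_imp_increasing[OF sm])
  define B1 where "B1 j = {f j..<f (Suc j)}" for j
  define W where "W j = {f (j - 1)..<f (j + 2)}" for j
  define tm where "tm j x = restr (W j) (A (restr (B1 j) (B (restr (W j) x))))" for j x
  have half: "\<eta> / 2 ^ (j - 1) <= 2 * (\<eta> / 2 ^ j)" "\<eta> / 2 ^ Suc j <= \<eta> / 2 ^ j" for j
   using \<eta> by (cases j; simp add: field_simps)+
  have split3: "restr (- W j) x = restr {..<f (j - 1)} x + restr {f (j + 2)..} x" for j and x :: "'k seq"
  proof -
   have "f (j - 1) <= f (j + 2)" by (rule monoD[OF mf]) simp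
   then show ?thesis
    by (subst restr_Un_disjoint[symmetric]) (auto simp: W_def intro!: arg_cong[where f="%S. restr S x"])
  qed
  have three: "2 * x * n + x * n = 3 * x * n" for x n :: real by simp
  have Bdiff: "lp_norm 2 (restr (B1 j) (B (restr (- W j) x))) <= 3 * (\<eta> / 2 ^ j) * lp_norm p x" if x: "x \<in> lp p" for j x
  proof -
   have rl: "restr S x \<in> lp p" for S by (rule lp_restr(1)[OF pos(1) x])
   have Bl: "B (restr S x) \<in> lp 2" for S by (rule ops_in[OF B rl])
   have le1: "lp_norm 2 (restr (B1 j) (B (restr {..<f (j - 1)} x))) <= 2 * (\<eta> / 2 ^ j) * lp_norm p x"
   proof (cases j)
    case 0
    then show ?thesis using f0 ops_0[OF B] \<eta> by simp
   next
    case (Suc i)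
    have "lp_norm 2 (restr (B1 j) (B (restr {..<f i} x))) <= lp_norm 2 (restr {f (Suc i)..} (B (restr {..<f i} x)))"
     by (rule lp_restr_mono[OF _ Bl]) (auto simp: B1_def Suc)
    also have "\<dots> <= \<eta> / 2 ^ i * lp_norm p (restr {..<f i} x)" using f[of i] by (simp add: P_def)
    also have "\<dots> <= 2 * (\<eta> / 2 ^ j) * lp_norm p x"
     using half(1)[of j] lp_restr(2)[OF pos(1) x] \<eta> Suc by (intro mult_mono) auto
    finally show ?thesis using Suc by simp
   qed
   have le2: "lp_norm 2 (restr (B1 j) (B (restr {f (j + 2)..} x))) <= \<eta> / 2 ^ j * lp_norm p x"
   proof -
    have "lp_norm 2 (restr (B1 j) (B (restr {f (j + 2)..} x))) <= lp_norm 2 (restr {..<f (Suc j)} (B (restr {f (j + 2)..} x)))"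
     by (rule lp_restr_mono[OF _ Bl]) (auto simp: B1_def)
    also have "\<dots> <= \<eta> / 2 ^ Suc j * lp_norm p x" using f[of "Suc j"] x by (simp add: P_def)
    also have "\<dots> <= \<eta> / 2 ^ j * lp_norm p x" using half(2) by (intro mult_right_mono) auto
    finally show ?thesis .
   qed
   have "restr (B1 j) (B (restr (- W j) x)) = restr (B1 j) (B (restr {..<f (j - 1)} x)) + restr (B1 j) (B (restr {f (j + 2)..} x))"
    unfolding split3 using ops_add[OF B rl rl] by simp
   then have "lp_norm 2 (restr (B1 j) (B (restr (- W j) x))) <= lp_norm 2 (restr (B1 j) (B (restr {..<f (j - 1)} x))) + lp_norm 2 (restr (B1 j) (B (restr {f (j + 2)..} x)))"
    using lp_add(2)[OF _ lp_restr(1)[OF _ Bl] lp_restr(1)[OF _ Bl]] by simp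
   also have "\<dots> <= 2 * (\<eta> / 2 ^ j) * lp_norm p x + \<eta> / 2 ^ j * lp_norm p x" by (rule add_mono[OF le1 le2])
   finally show ?thesis unfolding three .
  qed
  have Adiff: "lp_norm q (restr (- W j) (A (restr (B1 j) y))) <= 3 * (\<eta> / 2 ^ j) * lp_norm 2 y" if y: "y \<in> lp 2" for j y
  proof -
   have rl: "restr S y \<in> lp 2" for S by (rule lp_restr(1)[OF _ y]) simp
   have Al: "A (restr S y) \<in> lp q" for S by (rule ops_in[OF A rl])
   have r2: "lp_norm 2 (restr S y) <= lp_norm 2 y" for S by (rule lp_restr(2)[OF _ y]) simp
   have le1: "lp_norm q (restr {..<f (j - 1)} (A (restr (B1 j) y))) <= 2 * (\<eta> / 2 ^ j) * lp_norm 2 y"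
   proof (cases j)
    case 0
    then show ?thesis using f0 \<eta> by simp
   next
    case (Suc i)
    have "restr {f (Suc i)..} (restr (B1 j) y) = restr (B1 j) y"
     unfolding restr_simps(5) by (rule arg_cong[where f="%S. restr S y"]) (auto simp: B1_def Suc)
    then have "lp_norm q (restr {..<f i} (A (restr (B1 j) y))) <= \<eta> / 2 ^ i * lp_norm 2 (restr (B1 j) y)"
     using f[of i] rl[of "B1 j"] unfolding P_def by metis
    also have "\<dots> <= 2 * (\<eta> / 2 ^ j) * lp_norm 2 y"
     using half(1)[of j] r2 \<eta> Suc by (intro mult_mono) auto
    finally show ?thesis using Suc by simp
   qed
   have le2: "lp_norm q (restr {f (j + 2)..} (A (restr (B1 j) y))) <= \<eta> / 2 ^ j * lp_norm 2 y"
   proof -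
    have "restr {..<f (Suc j)} (restr (B1 j) y) = restr (B1 j) y"
     unfolding restr_simps(5) by (rule arg_cong[where f="%S. restr S y"]) (auto simp: B1_def)
    then have "lp_norm q (restr {f (j + 2)..} (A (restr (B1 j) y))) <= \<eta> / 2 ^ Suc j * lp_norm 2 (restr (B1 j) y)"
     using f[of "Suc j"] unfolding P_def by (metis add_2_eq_Suc')
    also have "\<dots> <= \<eta> / 2 ^ j * lp_norm 2 y" using half(2) r2 \<eta> by (intro mult_mono) auto
    finally show ?thesis .
   qed
   have "lp_norm q (restr (- W j) (A (restr (B1 j) y))) <= lp_norm q (restr {..<f (j - 1)} (A (restr (B1 j) y))) + lp_norm q (restr {f (j + 2)..} (A (restr (B1 j) y)))"
    unfolding split3 by (rule lp_add(2)[OF pos(4) lp_restr(1)[OF pos(2) Al] lp_restr(1)[OF pos(2) Al]])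
   also have "\<dots> <= 2 * (\<eta> / 2 ^ j) * lp_norm 2 y + \<eta> / 2 ^ j * lp_norm 2 y" by (rule add_mono[OF le1 le2])
   finally show ?thesis unfolding three .
  qed
  have term_diff: "lp_norm q (A (restr (B1 j) (B x)) - tm j x) <= 3 * (a + b) * \<eta> * lp_norm p x * (1 / 2) ^ j"
   if x: "x \<in> lp p" for j x
  proof -
   have rl: "restr S x \<in> lp p" for S by (rule lp_restr(1)[OF pos(1) x])
   have Bl: "B (restr S x) \<in> lp 2" for S by (rule ops_in[OF B rl])
   have RBl: "restr U (B (restr S x)) \<in> lp 2" for S U by (rule lp_restr(1)[OF _ Bl]) simp
   have Al: "A (restr U (B (restr S x))) \<in> lp q" for S U by (rule ops_in[OF A RBl])
   have xs: "x = restr (W j) x + restr (- W j) x" by (auto simp: restr_def fun_eq_iff)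
   have "B x = B (restr (W j) x) + B (restr (- W j) x)" by (subst xs, rule ops_add[OF B rl rl])
   then have "restr (B1 j) (B x) = restr (B1 j) (B (restr (W j) x)) + restr (B1 j) (B (restr (- W j) x))" by simp
   then have "A (restr (B1 j) (B x)) = A (restr (B1 j) (B (restr (W j) x))) + A (restr (B1 j) (B (restr (- W j) x)))"
    using ops_add[OF A RBl RBl] by simp
   then have eq: "A (restr (B1 j) (B x)) - tm j x = restr (- W j) (A (restr (B1 j) (B (restr (W j) x)))) + A (restr (B1 j) (B (restr (- W j) x)))"
    unfolding tm_def restr_compl[symmetric] by simp
   have "lp_norm q (A (restr (B1 j) (B x)) - tm j x) <= lp_norm q (restr (- W j) (A (restr (B1 j) (B (restr (W j) x))))) + lp_norm q (A (restr (B1 j) (B (restr (- W j) x))))"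
    unfolding eq by (rule lp_add(2)[OF pos(4) lp_restr(1)[OF pos(2) Al] Al])
   also have "lp_norm q (restr (- W j) (A (restr (B1 j) (B (restr (W j) x))))) <= 3 * (\<eta> / 2 ^ j) * (b * lp_norm p x)"
   proof -
    have "lp_norm 2 (B (restr (W j) x)) <= b * lp_norm p (restr (W j) x)" by (rule b(2)[OF rl])
    also have "\<dots> <= b * lp_norm p x" using b lp_restr(2)[OF pos(1) x] by (intro mult_left_mono) auto
    finally show ?thesis using \<eta> by (intro order_trans[OF Adiff[OF Bl]] mult_left_mono) auto
   qed
   also have "lp_norm q (A (restr (B1 j) (B (restr (- W j) x)))) <= a * (3 * (\<eta> / 2 ^ j) * lp_norm p x)"
    using a by (intro order_trans[OF a(2)[OF RBl]] mult_left_mono Bdiff x) auto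
   also have "3 * (\<eta> / 2 ^ j) * (b * lp_norm p x) + a * (3 * (\<eta> / 2 ^ j) * lp_norm p x) = 3 * (a + b) * \<eta> * lp_norm p x * (1 / 2) ^ j"
    by (simp add: power_divide field_simps)
   finally show ?thesis by simp
  qed
  define g where "g r j = f (3 * j + r - 1)" for r j
  define S where "S r = block_op p (%j. W (3 * j + r)) (%j. tm (3 * j + r))" for r
  have Wg: "W (3 * j + r) = {g r j..<g r (Suc j)}" for r j
   by (simp add: W_def g_def)
  have disW: "disjoint_family (%j. W (3 * j + r))" for r
   unfolding Wg by (rule disjoint_intervals) (auto simp: g_def mono_def intro!: monoD[OF mf])
  have finW: "finite (W j)" for j by (simp add: W_def)
  have SJ: "S r \<in> J" for r
   unfolding S_def tm_def
   by (rule assemble_local_copies[OF pq T A B disW finW disW finW _ _ K(1) J]) (auto simp: B1_def K(2))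
  have "(\<Sum>r<3. S r) \<in> J" by (rule closed_ideal_sum[OF J(1)]) (rule SJ)
  moreover have "lp_norm q ((\<Sum>r<3. S r) (restr {..<M} x) - (A \<circ> B) (restr {..<M} x)) <= \<epsilon> * lp_norm p (restr {..<M} x)" for M x
  proof -
   let ?x = "restr {..<M} x"
   have xl: "?x \<in> lp p" by (rule lp_restr_finite(1)[OF pos(1)]) simp
   have Bx: "B ?x \<in> lp 2" by (rule ops_in[OF B xl])
   have tm0: "tm j ?x = 0" if "j > M" for j
   proof -
    have "M <= f (j - 1)" using fge[of "j - 1"] that by linarith
    then have "W j \<inter> {..<M} = {}" by (auto simp: W_def)
    then show ?thesis using ops_0[OF A] ops_0[OF B] by (simp add: tm_def)
   qed
   have Ssum: "(\<Sum>r<3. S r) ?x = (\<Sum>j<3*L. tm j ?x)" if L: "L > M" for L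
   proof -
    have "S r ?x = (\<Sum>j<L. tm (3 * j + r) ?x)" for r
    proof -
     interpret block_data p q "a * b" "%j. W (3 * j + r)" "%j. W (3 * j + r)" "%j. tm (3 * j + r)"
     proof
      show "seq_linear (tm (3 * j + r))" for j
       unfolding tm_def using seq_linear_comp[OF seq_linear_restr seq_linear_comp[OF seq_linear_ops_restr[OF A] seq_linear_ops_restr[OF B pos(1) finW]]]
       by (auto simp: B1_def)
      show "restr (W (3 * j + r)) (tm (3 * j + r) x) = tm (3 * j + r) x" for j x by (simp add: tm_def)
      fix j and x :: "'k seq"
      have rl: "restr (W j) x \<in> lp p" for j by (rule lp_restr_finite(1)[OF pos(1) finW])
      have Bl: "B (restr (W j) x) \<in> lp 2" for j by (rule ops_in[OF B rl])
      have RBl: "restr U (B (restr (W j) x)) \<in> lp 2" for j U by (rule lp_restr(1)[OF _ Bl]) simp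
      have "lp_norm q (tm j x) <= a * lp_norm 2 (restr (B1 j) (B (restr (W j) x)))" for j
       unfolding tm_def by (rule order_trans[OF lp_restr(2)[OF pos(2) ops_in[OF A RBl]] a(2)[OF RBl]])
      also have "a * lp_norm 2 (restr (B1 j) (B (restr (W j) x))) <= a * (b * lp_norm p (restr (W j) x))" for j
       using a by (intro mult_left_mono order_trans[OF lp_restr(2)[OF _ Bl] b(2)[OF rl]]) auto
      finally have "lp_norm q (tm j x) <= a * (b * lp_norm p (restr (W j) x))" for j .
      from this[of "3 * j + r"]
      show "lp_norm q (tm (3 * j + r) x) <= a * b * lp_norm p (restr (W (3 * j + r)) x)" by simp
     qed (use pos a b disW finW in auto)
     show ?thesis unfolding S_def by (rule block_op_eq_sum[OF xl]) (use L tm0 in auto)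
    qed
    then have "(\<Sum>r<3. S r) ?x = (\<Sum>r<3. \<Sum>j<L. tm (3 * j + r) ?x)"
     by (simp add: eval_nat_numeral)
    also have "\<dots> = (\<Sum>j<L. \<Sum>r<3. tm (3 * j + r) ?x)" by (rule sum.swap)
    also have "\<dots> = (\<Sum>j<L. \<Sum>i\<in>{j * 3..<j * 3 + 3}. tm i ?x)"
     by (rule sum.cong) (auto simp: eval_nat_numeral mult.commute add.commute)
    also have "\<dots> = (\<Sum>j<3*L. tm j ?x)" by (subst sum.nat_group) (simp add: mult.commute)
    finally show ?thesis .
   qed
   have "lp_norm q ((\<Sum>r<3. S r) ?x - A (B ?x)) <= \<epsilon> * lp_norm p ?x + e'" if e': "e' > 0" for e'
   proof -
    obtain N where N: "lp_norm 2 (restr {N..} (B ?x)) < e' / a"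
     using lp_tail[OF _ Bx, of "e' / a"] e' a(1) by auto
    define L where "L = Suc (max M N)"
    have fL: "N <= f (3 * L)" using fge[of "3 * L"] by (simp add: L_def)
    have rl: "restr U (B ?x) \<in> lp 2" for U by (rule lp_restr(1)[OF _ Bx]) simp
    have "restr {..<f n} (B ?x) = (\<Sum>j<n. restr (B1 j) (B ?x))" for n
    proof (induction n)
     case (Suc n)
     have "{..<f (Suc n)} = {..<f n} \<union> B1 n" using monoD[OF mf, of n "Suc n"] by (auto simp: B1_def)
     moreover have "{..<f n} \<inter> B1 n = {}" by (auto simp: B1_def)
     ultimately have "restr {..<f (Suc n)} (B ?x) = restr {..<f n} (B ?x) + restr (B1 n) (B ?x)"
      by (simp only: restr_Un_disjoint)
     then show ?case using Suc by simp
    next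
     case 0
     have "restr {..<f 0} (B ?x) = 0" using f0 by simp
     then show ?case by simp
    qed
    then have "A (restr {..<f (3 * L)} (B ?x)) = (\<Sum>j<3*L. A (restr (B1 j) (B ?x)))"
     using ops_sum[OF A _ finite_lessThan rl] by simp
    moreover have "B ?x = restr {..<f (3 * L)} (B ?x) + restr {f (3 * L)..} (B ?x)" by (auto simp: restr_def fun_eq_iff)
    then have "A (B ?x) = A (restr {..<f (3 * L)} (B ?x)) + A (restr {f (3 * L)..} (B ?x))"
     using ops_add[OF A rl rl] by metis
    ultimately have AB: "A (B ?x) - (\<Sum>r<3. S r) ?x = (\<Sum>j<3*L. A (restr (B1 j) (B ?x)) - tm j ?x) + A (restr {f (3 * L)..} (B ?x))"
     using Ssum[of L] by (simp add: sum_subtractf L_def)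
    have tl: "A (restr (B1 j) (B ?x)) - tm j ?x \<in> lp q" for j
     unfolding tm_def
     by (intro lp_diff(1)[OF pos(4)] ops_in[OF A] rl lp_restr_finite(1)[OF pos(2) finW])
    have sl: "(\<Sum>j<3*L. A (restr (B1 j) (B ?x)) - tm j ?x) \<in> lp q \<and> lp_norm q (\<Sum>j<3*L. A (restr (B1 j) (B ?x)) - tm j ?x)
     <= (\<Sum>j<3*L. lp_norm q (A (restr (B1 j) (B ?x)) - tm j ?x))"
     by (rule lp_sum[OF pos(4) finite_lessThan tl])
    have "lp_norm q ((\<Sum>r<3. S r) ?x - A (B ?x)) = lp_norm q (A (B ?x) - (\<Sum>r<3. S r) ?x)" by (rule lp_norm_minus_commute)
    also have "\<dots> <= lp_norm q (\<Sum>j<3*L. A (restr (B1 j) (B ?x)) - tm j ?x) + lp_norm q (A (restr {f (3 * L)..} (B ?x)))"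
     unfolding AB by (rule lp_add(2)[OF pos(4)]) (use sl ops_in[OF A rl] in auto)
    also have "lp_norm q (\<Sum>j<3*L. A (restr (B1 j) (B ?x)) - tm j ?x) <= (\<Sum>j<3*L. 3 * (a + b) * \<eta> * lp_norm p ?x * (1 / 2) ^ j)"
     using sl by (intro order_trans[OF conjunct2[OF sl] sum_mono] term_diff xl)
    also have "\<dots> = 3 * (a + b) * \<eta> * lp_norm p ?x * (\<Sum>j<3*L. (1 / 2) ^ j)" by (simp add: sum_distrib_left)
    also have "\<dots> <= 3 * (a + b) * \<eta> * lp_norm p ?x * 2"
    proof (rule mult_left_mono)
     have "(\<Sum>j<3*L. (1 / 2 :: real) ^ j) <= (\<Sum>j. (1 / 2) ^ j)"
      by (rule sum_le_suminf) (auto intro: summable_geometric)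
     then show "(\<Sum>j<3*L. (1 / 2 :: real) ^ j) <= 2" by (simp add: suminf_geometric)
    qed (use a b \<eta> in auto)
    also have "\<dots> <= \<epsilon> * lp_norm p ?x"
    proof -
     have "3 * (a + b) * \<eta> * 2 <= \<epsilon>" using a b \<epsilon> by (simp add: \<eta>_def field_simps)
     from mult_right_mono[OF this, of "lp_norm p ?x"] show ?thesis by (simp only: mult_ac lp_norm_nonneg)
    qed
    also have "lp_norm q (A (restr {f (3 * L)..} (B ?x))) <= e'"
    proof -
     have "lp_norm q (A (restr {f (3 * L)..} (B ?x))) <= a * lp_norm 2 (restr {f (3 * L)..} (B ?x))" by (rule a(2)[OF rl])
     also have "\<dots> <= a * lp_norm 2 (restr {N..} (B ?x))"
      using a fL by (intro mult_left_mono lp_restr_mono[OF _ Bx]) auto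
     also have "\<dots> <= e'" using N a by (simp add: field_simps)
     finally show ?thesis .
    qed
    finally show ?thesis by (simp_all only: add_le_cancel_left add_le_cancel_right)
   qed
   then show ?thesis unfolding comp_apply by (rule field_le_epsilon)
  qed
  ultimately show "\<exists>S\<in>J. \<forall>M x. lp_norm q (S (restr {..<M} x) - (A \<circ> B) (restr {..<M} x)) <= \<epsilon> * lp_norm p (restr {..<M} x)"
   by blast
 qed
qed

section \<open>Finitely strictly singular operators\<close>

definition lin_fun :: "real => ('k::real_normed_field seq => 'k) => bool" where
 "lin_fun p f \<longleftrightarrow> (\<forall>x\<in>lp p. \<forall>y\<in>lp p. f (x + y) = f x + f y) \<and> (\<forall>c. \<forall>x\<in>lp p. f (seq_scale c x) = c * f x)"

lemma lin_fun_add: "lin_fun p f ==> x \<in> lp p ==> y \<in> lp p ==> f (x + y) = f x + f y"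
 and lin_fun_scale: "lin_fun p f ==> x \<in> lp p ==> f (seq_scale c x) = c * f x"
 by (auto simp: lin_fun_def)

lemma lin_fun_0: "lin_fun p f ==> f 0 = 0"
 using lin_fun_scale[of p f 0 0] by simp

lemma lin_fun_coord: "lin_fun p (%x. x i)"
 by (simp add: lin_fun_def seq_scale_apply)

lemma lin_fun_ops: "T \<in> bounded_ops p q ==> lin_fun q f ==> lin_fun p (%x. f (T x))"
 using ops_add[of T p q] ops_scale[of T p q] ops_in[of T p q]
 by (simp add: lin_fun_def)

text \<open>
 ``Dimension at least \<open>n\<close>'', stated through common zeros of fewer than \<open>n\<close> functionals. In this form it passes to kernels and images and is applied to coordinate functionals, without any choice of bases.
\<close>

definition dim_ge :: "real => nat => 'k::real_normed_field seq set => bool" where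
 "dim_ge p n E \<longleftrightarrow> seq.subspace E \<and> E \<subseteq> lp p \<and>
  (\<forall>F. finite F \<and> card F < n \<and> (\<forall>f\<in>F. lin_fun p f) --> (\<exists>x\<in>E. x ~= 0 \<and> (\<forall>f\<in>F. f x = 0)))"

lemma dim_geD:
 assumes "dim_ge p n E" "finite F" "card F < n" "!!f. f \<in> F ==> lin_fun p f"
 obtains x where "x \<in> E" "x ~= 0" "!!f. f \<in> F ==> f x = 0"
proof -
 have fin: "finite F \<and> card F < n \<and> (\<forall>f\<in>F. lin_fun p f)" using assms(2-4) by simp
 have all: "\<forall>F. finite F \<and> card F < n \<and> (\<forall>f\<in>F. lin_fun p f) --> (\<exists>x\<in>E. x ~= 0 \<and> (\<forall>f\<in>F. f x = 0))"
  using assms(1) unfolding dim_ge_def by (elim conjE)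
 have "\<exists>x\<in>E. x ~= 0 \<and> (\<forall>f\<in>F. f x = 0)" by (rule mp[OF spec[OF all, of F] fin])
 then show thesis using that by auto
qed

lemma dim_ge_coords:
 fixes E :: "'k::real_normed_field seq set"
 assumes "dim_ge p n E" "finite I" "card I < n"
 obtains x where "x \<in> E" "x ~= 0" "!!i. i \<in> I ==> x i = 0"
proof -
 let ?F = "(%i x. x i :: 'k) ` I"
 have 1: "finite ?F" using assms(2) by simp
 have 2: "card ?F < n" using card_image_le[OF assms(2), of "%i x. x i :: 'k"] assms(3) by linarith
 have 3: "lin_fun p f" if "f \<in> ?F" for f using that lin_fun_coord by blast
 from dim_geD[OF assms(1) 1 2 3] obtain x where "x \<in> E" "x ~= 0" "!!f. f \<in> ?F ==> f x = 0" by blast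
 then show thesis using that by blast
qed

lemma dim_ge_subspace: "dim_ge p n E ==> seq.subspace E"
 and dim_ge_lp: "dim_ge p n E ==> E \<subseteq> lp p"
 by (auto simp: dim_ge_def)

lemma dim_ge_mono: "dim_ge p n E ==> m <= n ==> dim_ge p m E"
 unfolding dim_ge_def by (meson less_le_trans)

lemma dim_ge_ker:
 assumes "dim_ge p n E" "finite G" "!!g. g \<in> G ==> lin_fun p g" "card G + m <= n"
 shows "dim_ge p m {x \<in> E. \<forall>g\<in>G. g x = 0}"
 unfolding dim_ge_def
proof (intro conjI allI impI)
 have E: "seq.subspace E" "E \<subseteq> lp p" using assms(1) by (auto simp: dim_ge_def)
 show "{x \<in> E. \<forall>g\<in>G. g x = 0} \<subseteq> lp p" using E by auto
 show "seq.subspace {x \<in> E. \<forall>g\<in>G. g x = 0}"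
 proof (rule seq.subspaceI)
  show "0 \<in> {x \<in> E. \<forall>g\<in>G. g x = 0}" using seq.subspace_0[OF E(1)] lin_fun_0[OF assms(3)] by blast
 next
  fix x y assume xy: "x \<in> {x \<in> E. \<forall>g\<in>G. g x = 0}" "y \<in> {x \<in> E. \<forall>g\<in>G. g x = 0}"
  then have l: "x \<in> lp p" "y \<in> lp p" using E(2) by blast+
  have "g (x + y) = 0" if "g \<in> G" for g using lin_fun_add[OF assms(3)[OF that] l] xy that by auto
  moreover have "x + y \<in> E" using seq.subspace_add[OF E(1)] xy by blast
  ultimately show "x + y \<in> {x \<in> E. \<forall>g\<in>G. g x = 0}" by blast
 next
  fix c x assume x: "x \<in> {x \<in> E. \<forall>g\<in>G. g x = 0}"
  then have l: "x \<in> lp p" using E(2) by blast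
  have "g (seq_scale c x) = 0" if "g \<in> G" for g using lin_fun_scale[OF assms(3)[OF that] l, of c] x that by auto
  moreover have "seq_scale c x \<in> E" using seq.subspace_scale[OF E(1)] x by blast
  ultimately show "seq_scale c x \<in> {x \<in> E. \<forall>g\<in>G. g x = 0}" by blast
 qed
 fix F :: "('a seq => 'a) set" assume F: "finite F \<and> card F < m \<and> (\<forall>f\<in>F. lin_fun p f)"
 have "card (F \<union> G) < n" using card_Un_le[of F G] F assms(4) by linarith
 moreover have "finite (F \<union> G)" using F assms(2) by simp
 moreover have "lin_fun p f" if "f \<in> F \<union> G" for f using that F assms(3) by blast
 ultimately obtain x where "x \<in> E" "x ~= 0" "!!f. f \<in> F \<union> G ==> f x = 0"
  using dim_geD[OF assms(1), of "F \<union> G"] by blast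
 then show "\<exists>x\<in>{x \<in> E. \<forall>g\<in>G. g x = 0}. x ~= 0 \<and> (\<forall>f\<in>F. f x = 0)" by auto
qed

lemma subspace_insert_line:
 fixes x0 :: "'k::real_normed_field seq"
 assumes "seq.subspace F"
 shows "seq.subspace {seq_scale a x0 + y | a y. y \<in> F}"
proof (rule seq.subspaceI)
 have "0 = seq_scale 0 x0 + 0" by simp
 then show "0 \<in> {seq_scale a x0 + y | a y. y \<in> F}" using seq.subspace_0[OF assms] by blast
next
 fix u v assume "u \<in> {seq_scale a x0 + y | a y. y \<in> F}" "v \<in> {seq_scale a x0 + y | a y. y \<in> F}"
 then obtain a y b z where *: "u = seq_scale a x0 + y" "y \<in> F" "v = seq_scale b x0 + z" "z \<in> F" by blast
 then have "u + v = seq_scale (a + b) x0 + (y + z)" by (simp add: seq.scale_left_distrib algebra_simps)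
 then show "u + v \<in> {seq_scale a x0 + y | a y. y \<in> F}" using seq.subspace_add[OF assms *(2,4)] by blast
next
 fix c u assume "u \<in> {seq_scale a x0 + y | a y. y \<in> F}"
 then obtain a y where *: "u = seq_scale a x0 + y" "y \<in> F" by blast
 then have "seq_scale c u = seq_scale (c * a) x0 + seq_scale c y" by (simp add: seq.scale_right_distrib)
 then show "seq_scale c u \<in> {seq_scale a x0 + y | a y. y \<in> F}" using seq.subspace_scale[OF assms *(2)] by blast
qed

lemma dim_ge_insert_line:
 fixes x0 :: "'k::real_normed_field seq"
 assumes "1 <= p" "dim_ge p k F" "x0 \<in> lp p" "x0 \<notin> F"
 shows "dim_ge p (Suc k) {seq_scale a x0 + y | a y. y \<in> F}" (is "dim_ge p _ ?E")
 unfolding dim_ge_def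
proof (intro conjI allI impI)
 have F: "seq.subspace F" "F \<subseteq> lp p" using assms(2) by (auto simp: dim_ge_def)
 show "seq.subspace ?E" by (rule subspace_insert_line[OF F(1)])
 show "?E \<subseteq> lp p"
 proof
  fix z assume "z \<in> ?E"
  then obtain a y where z: "z = seq_scale a x0 + y" "y \<in> F" by blast
  have "seq_scale a x0 \<in> lp p" by (rule lp_scale(1)[OF _ assms(3)]) (use assms(1) in auto)
  then show "z \<in> lp p" using lp_add(1)[OF assms(1)] F(2) z by blast
 qed
 fix G :: "('k seq => 'k) set" assume G: "finite G \<and> card G < Suc k \<and> (\<forall>f\<in>G. lin_fun p f)"
 show "\<exists>x\<in>?E. x ~= 0 \<and> (\<forall>f\<in>G. f x = 0)"
 proof (cases "\<forall>f\<in>G. f x0 = 0")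
  case True
  have "x0 = seq_scale 1 x0 + 0" by simp
  then have "x0 \<in> ?E" using seq.subspace_0[OF F(1)] by blast
  moreover have "x0 ~= 0" using seq.subspace_0[OF F(1)] assms(4) by blast
  ultimately show ?thesis using True by blast
 next
  case False
  then obtain g where g: "g \<in> G" "g x0 ~= 0" by blast
  define G' where "G' = (%f x. f x - f x0 / g x0 * g x) ` (G - {g})"
  have "card G' < k"
  proof -
   have "card G' <= card (G - {g})" unfolding G'_def by (rule card_image_le) (use G in auto)
   moreover have "card (G - {g}) < card G" using G g by (meson card_Diff1_less)
   ultimately show ?thesis using G by linarith
  qed
  moreover have "lin_fun p f" if "f \<in> G'" for f
  proof -
   obtain f' where f': "f = (%x. f' x - f' x0 / g x0 * g x)" "f' \<in> G" using \<open>f \<in> G'\<close> by (auto simp: G'_def)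
   have "lin_fun p f'" "lin_fun p g" using f' g G by auto
   then show ?thesis unfolding f'(1) by (auto simp: lin_fun_def algebra_simps add_divide_distrib)
  qed
  moreover have "finite G'" using G by (simp add: G'_def)
  ultimately obtain y where y: "y \<in> F" "y ~= 0" "!!f. f \<in> G' ==> f y = 0"
   using dim_geD[OF assms(2), of G'] by blast
  define c where "c = - (g y / g x0)"
  define x where "x = seq_scale c x0 + y"
  have yl: "y \<in> lp p" using y(1) F(2) by blast
  have xE: "x \<in> ?E" using y(1) unfolding x_def by blast
  have sx: "seq_scale c x0 \<in> lp p" by (rule lp_scale(1)[OF _ assms(3)]) (use assms(1) in auto)
  have fx: "f x = c * f x0 + f y" if "f \<in> G" for f
   using G that unfolding x_def by (simp add: lin_fun_add[OF _ sx yl] lin_fun_scale[OF _ assms(3)])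
  have "f x = 0" if "f \<in> G" for f
  proof (cases "f = g")
   case True
   then show ?thesis using fx[OF g(1)] g by (simp add: c_def)
  next
   case False
   then have "f y - f x0 / g x0 * g y = 0" using y(3)[of "%x. f x - f x0 / g x0 * g x"] that by (auto simp: G'_def)
   then show ?thesis using fx[OF that] by (simp add: c_def algebra_simps)
  qed
  moreover have "x ~= 0"
  proof
   assume "x = 0"
   then have e: "seq_scale c x0 = - y" by (simp add: x_def eq_neg_iff_add_eq_0)
   then have "c ~= 0" using y(2) by auto
   have "x0 = seq_scale (inverse c) (seq_scale c x0)" using \<open>c ~= 0\<close> by simp
   then have "x0 = seq_scale (inverse c) (- y)" using e by simp
   moreover have "- y \<in> F" using seq.subspace_neg[OF F(1) y(1)] .
   ultimately have "x0 \<in> F" using seq.subspace_scale[OF F(1)] by metis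
   then show False using assms(4) by blast
  qed
  ultimately show ?thesis using xE by blast
 qed
qed

lemma dim_ge_span:
 fixes B :: "'k::real_normed_field seq set"
 assumes "1 <= p" "finite B" "seq.independent B" "B \<subseteq> lp p"
 shows "dim_ge p (card B) (seq.span B)"
 using assms(2-4)
proof (induction B rule: finite_induct)
 case empty
 then show ?case by (auto simp: dim_ge_def)
next
 case (insert b B)
 have "b \<notin> seq.span B" "seq.independent B" using insert by (auto simp: seq.independent_insert)
 then have "dim_ge p (Suc (card B)) {seq_scale a b + y | a y. y \<in> seq.span B}"
  using insert by (intro dim_ge_insert_line[OF assms(1)]) auto
 moreover have "{seq_scale a b + y | a y. y \<in> seq.span B} = seq.span (insert b B)"
 proof -
  have "x \<in> {seq_scale a b + y | a y. y \<in> seq.span B} \<longleftrightarrow> (\<exists>k. x - seq_scale k b \<in> seq.span B)" for x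
  proof
   assume "\<exists>k. x - seq_scale k b \<in> seq.span B"
   then obtain k where "x - seq_scale k b \<in> seq.span B" by blast
   moreover have "x = seq_scale k b + (x - seq_scale k b)" by simp
   ultimately show "x \<in> {seq_scale a b + y | a y. y \<in> seq.span B}" by blast
  next
   assume "x \<in> {seq_scale a b + y | a y. y \<in> seq.span B}"
   then obtain a y where "x = seq_scale a b + y" "y \<in> seq.span B" by blast
   then have "x - seq_scale a b \<in> seq.span B" by (simp only: add_diff_cancel_left')
   then show "\<exists>k. x - seq_scale k b \<in> seq.span B" ..
  qed
  then show ?thesis unfolding seq.span_insert by blast
 qed
 ultimately show ?case using insert by simp
qed

lemma dim_imp_dim_ge:
 fixes E :: "'k::real_normed_field seq set"
 assumes "1 <= p" "seq.subspace E" "E \<subseteq> lp p" "seq.dim E = n"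
 shows "dim_ge p n E"
proof (cases "n = 0")
 case True
 then show ?thesis using assms by (simp add: dim_ge_def)
next
 case False
 obtain B where B: "B \<subseteq> E" "seq.independent B" "E \<subseteq> seq.span B" "card B = seq.dim E"
  using seq.basis_exists by blast
 then have "finite B" using False assms(4) by (intro card_ge_0_finite) simp
 then have "dim_ge p (card B) (seq.span B)" using dim_ge_span[OF assms(1)] B assms(3) by blast
 moreover have "seq.span B = E" using B seq.span_subspace[OF B(1,3) assms(2)] by simp
 ultimately show ?thesis using B assms by simp
qed

lemma dim_ge_imp_dim:
 fixes E :: "'k::real_normed_field seq set"
 assumes "dim_ge p n E"
 shows "\<exists>F\<subseteq>E. seq.subspace F \<and> seq.dim F = n"
proof -
 have "\<exists>B C. finite B \<and> seq.independent B \<and> B \<subseteq> E \<and> card B = k \<and> finite C \<and> card C = k \<and>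
  (\<forall>x\<in>seq.span B. (\<forall>i\<in>C. x i = 0) --> x = 0)" if "k <= n" for k
  using that
 proof (induction k)
  case 0
  have "finite ({} :: 'k seq set)" "finite ({} :: nat set)" by auto
  then show ?case using seq.independent_empty by (intro exI[of _ "{} :: 'k seq set"] exI[of _ "{} :: nat set"]) auto
 next
  case (Suc k)
  from Suc.IH[OF Suc_leD[OF Suc.prems]]
  obtain B C where BC: "finite B" "seq.independent B" "B \<subseteq> E" "card B = k" "finite C" "card C = k"
   "\<forall>x\<in>seq.span B. (\<forall>i\<in>C. x i = 0) --> x = 0" by (elim exE conjE)
  have "card C < n" using BC(6) Suc(2) by linarith
  from dim_ge_coords[OF assms BC(5) this]
  obtain x where x: "x \<in> E" "x ~= 0" "!!i. i \<in> C ==> x i = 0" by blast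
  have xC: "\<forall>i\<in>C. x i = 0" using x(3) by blast
  then have nb: "x \<notin> seq.span B" using BC(7) x(2) by blast
  obtain j where j: "x j ~= 0" using x(2) by (metis ext zero_fun_apply)
  then have jC: "j \<notin> C" using xC by blast
  have zero: "z = 0" if z: "z \<in> seq.span (insert x B)" "\<forall>i\<in>insert j C. z i = 0" for z
  proof -
   obtain a where a: "z - seq_scale a x \<in> seq.span B" using z(1) by (auto simp: seq.span_insert)
   have "\<forall>i\<in>C. (z - seq_scale a x) i = 0" using z(2) xC by (simp add: seq_scale_apply)
   then have e: "z - seq_scale a x = 0" using BC(7) a by blast
   then have "z j = a * x j" by (simp add: seq_scale_apply)
   then have "a = 0" using z(2) j by simp
   then show ?thesis using e by simp
  qed
  have ind: "seq.independent (insert x B)" using nb BC(2) by (simp add: seq.independent_insert)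
  have xB: "x \<notin> B" using nb seq.span_base by blast
  show ?case
  proof (intro exI[of _ "insert x B"] exI[of _ "insert j C"] conjI ballI impI)
   show "finite (insert x B)" "card (insert x B) = Suc k" "finite (insert j C)" "card (insert j C) = Suc k"
    using BC(1,4,5,6) xB jC by auto
   show "insert x B \<subseteq> E" using BC(3) x(1) by simp
   show "z = 0" if "z \<in> seq.span (insert x B)" "\<forall>i\<in>insert j C. z i = 0" for z using zero that .
  qed (rule ind)
 qed
 from this[OF order_refl]
 obtain B where B: "finite B" "seq.independent B" "B \<subseteq> E" "card B = n" by (elim exE conjE)
 have "seq.span B \<subseteq> E" using B(3) dim_ge_subspace[OF assms] by (rule seq.span_minimal)
 moreover have "seq.dim (seq.span B) = n" using seq.dim_span_eq_card_independent[OF B(2)] B(4) by simp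
 ultimately show ?thesis using seq.subspace_span by blast
qed

text \<open>
 A minimal subspace of large dimension has dimension exactly \<open>n\<close>, and the infimum is replaced by a single vector. The quantifier over \<open>E\<close> may then range over all subspaces of dimension at least \<open>n\<close>.
\<close>

lemma fss_ops_iff:
 fixes S :: "'k::real_normed_field seq_op"
 assumes "1 <= p" "1 <= q"
 shows "S \<in> fss_ops p q \<longleftrightarrow> S \<in> bounded_ops p q \<and>
  (\<forall>e>0. \<exists>n. \<forall>E. dim_ge p n E --> (\<exists>x\<in>E. x ~= 0 \<and> lp_norm q (S x) <= e * lp_norm p x))"
proof (intro iffI conjI allI impI)
 assume S: "S \<in> fss_ops p q"
 then show bS: "S \<in> bounded_ops p q" by (simp add: fss_ops_def)
 fix e :: real assume "e > 0"
 then obtain n where n: "!!E. E \<subseteq> lp p ==> seq.subspace E ==> seq.dim E = n ==>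
   (INF x\<in>{x\<in>E. lp_norm p x = 1}. ereal (lp_norm q (S x))) < ereal e"
  using S unfolding fss_ops_def by blast
 have "\<exists>x\<in>E. x ~= 0 \<and> lp_norm q (S x) <= e * lp_norm p x" if E: "dim_ge p n E" for E
 proof -
  obtain F where F: "F \<subseteq> E" "seq.subspace F" "seq.dim F = n" using dim_ge_imp_dim[OF E] by blast
  have "(INF x\<in>{x\<in>F. lp_norm p x = 1}. ereal (lp_norm q (S x))) < ereal e"
   by (rule n[OF _ F(2,3)]) (use F(1) dim_ge_lp[OF E] in blast)
  then obtain x where "x \<in> F" "lp_norm p x = 1" "ereal (lp_norm q (S x)) < ereal e"
   unfolding INF_less_iff by blast
  then show ?thesis using F(1) by (intro bexI[of _ x]) auto
 qed
 then show "\<exists>n. \<forall>E. dim_ge p n E --> (\<exists>x\<in>E. x ~= 0 \<and> lp_norm q (S x) <= e * lp_norm p x)" by blast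
next
 assume R: "S \<in> bounded_ops p q \<and>
  (\<forall>e>0. \<exists>n. \<forall>E. dim_ge p n E --> (\<exists>x\<in>E. x ~= 0 \<and> lp_norm q (S x) <= e * lp_norm p x))"
 then have bS: "S \<in> bounded_ops p q" by simp
 have "\<exists>n. \<forall>E. E \<subseteq> lp p \<and> seq.subspace E \<and> seq.dim E = n -->
   (INF x\<in>{x\<in>E. lp_norm p x = 1}. ereal (lp_norm q (S x))) < ereal e" if e: "e > 0" for e
 proof -
  obtain n where n: "!!E. dim_ge p n E ==> \<exists>x\<in>E. x ~= 0 \<and> lp_norm q (S x) <= e / 2 * lp_norm p x"
   using R e by (meson half_gt_zero)
  have "(INF x\<in>{x\<in>E. lp_norm p x = 1}. ereal (lp_norm q (S x))) < ereal e"
   if E: "E \<subseteq> lp p" "seq.subspace E" "seq.dim E = n" for E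
  proof -
   obtain x where x: "x \<in> E" "x ~= 0" "lp_norm q (S x) <= e / 2 * lp_norm p x"
    using n[OF dim_imp_dim_ge[OF assms(1) E(2,1,3)]] by blast
   have xl: "x \<in> lp p" using x(1) E(1) by blast
   then have nx: "lp_norm p x > 0" using lp_norm_pos[OF xl _ x(2)] assms by simp
   define c :: 'k where "c = of_real (1 / lp_norm p x)"
   have c: "norm c = 1 / lp_norm p x" using nx by (simp add: c_def norm_divide)
   have "seq_scale c x \<in> {x\<in>E. lp_norm p x = 1}"
    using seq.subspace_scale[OF E(2) x(1)] lp_scale(2)[OF _ xl, of c] c nx assms by simp
   moreover have "lp_norm q (S (seq_scale c x)) <= e / 2"
   proof -
    have "lp_norm q (S (seq_scale c x)) = lp_norm q (S x) / lp_norm p x"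
     using ops_scale[OF bS xl, of c] lp_scale(2)[OF _ ops_in[OF bS xl], of c] c assms by simp
    then show ?thesis using nx x(3) by (simp add: pos_divide_le_eq)
   qed
   ultimately show ?thesis
    using e unfolding INF_less_iff by (intro bexI[of _ "seq_scale c x"]) auto
  qed
  then show ?thesis by blast
 qed
 then show "S \<in> fss_ops p q" unfolding fss_ops_def using bS by blast
qed

text \<open>
 \<open>E'\<close> is the part of \<open>E\<close> in the kernel of a functional \<open>f\<close> that norms \<open>x0\<close> up to the factor \<open>2\<close>; then \<open>f\<close> recovers the coefficient of \<open>x0\<close>, which separates the line from \<open>E'\<close> with constants independent of the dimension.
\<close>

lemma line_splitting:
 fixes E :: "'k::real_normed_field seq set"
 assumes "1 < p" "dim_ge p (Suc n) E" "x0 \<in> E" "x0 ~= 0"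
 obtains E' where "E' \<subseteq> E" "dim_ge p n E'"
  "!!k F. F \<subseteq> E' ==> dim_ge p k F ==> dim_ge p (Suc k) {seq_scale a x0 + y | a y. y \<in> F}"
  "!!F. F \<subseteq> E' ==> {seq_scale a x0 + y | a y. y \<in> F} \<subseteq> E"
  "!!a y. y \<in> E' ==> norm a * lp_norm p x0 <= 2 * lp_norm p (seq_scale a x0 + y)"
  "!!a y. y \<in> E' ==> lp_norm p y <= 3 * lp_norm p (seq_scale a x0 + y)"
proof -
 have pos: "0 < p" "1 <= p" using assms by auto
 have Es: "seq.subspace E" "E \<subseteq> lp p" using assms(2) by (auto simp: dim_ge_def)
 have x0l: "x0 \<in> lp p" using assms(3) Es by blast
 have nx: "lp_norm p x0 > 0" by (rule lp_norm_pos[OF x0l pos(1) assms(4)])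
 obtain M where M: "lp_norm p (restr {M..} x0) < lp_norm p x0 / 2"
  using lp_tail[OF pos(1) x0l, of "lp_norm p x0 / 2"] nx by auto
 have half: "lp_norm p (restr {..<M} x0) >= lp_norm p x0 / 2"
 proof -
  have "x0 = restr {..<M} x0 + restr {M..} x0" by (auto simp: restr_def fun_eq_iff)
  then have "lp_norm p x0 <= lp_norm p (restr {..<M} x0) + lp_norm p (restr {M..} x0)"
   using lp_add(2)[OF pos(2) lp_restr(1)[OF pos(1) x0l] lp_restr(1)[OF pos(1) x0l]] by metis
  then show ?thesis using M by linarith
 qed
 then have "restr {..<M} x0 ~= 0" using nx by auto
 from norming_functional[OF assms(1) finite_lessThan this]
 obtain c where c: "(\<Sum>i<M. c i * x0 i) = 1"
  "!!y. norm (\<Sum>i<M. c i * y i) <= lp_norm p (restr {..<M} y) / lp_norm p (restr {..<M} x0)" by blast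
 define f where "f y = (\<Sum>i<M. c i * y i)" for y
 have lf: "lin_fun p f" unfolding f_def lin_fun_def
  by (auto simp: algebra_simps sum.distrib seq_scale_apply sum_distrib_left)
 have fb: "norm (f z) * lp_norm p x0 <= 2 * lp_norm p z" if "z \<in> lp p" for z
 proof -
  have "norm (f z) <= lp_norm p (restr {..<M} z) / lp_norm p (restr {..<M} x0)" unfolding f_def by (rule c(2))
  also have "\<dots> <= lp_norm p z / (lp_norm p x0 / 2)"
   using lp_restr(2)[OF pos(1) that] half nx by (intro frac_le) auto
  finally show ?thesis using nx by (simp add: field_simps)
 qed
 define E' where "E' = {x \<in> E. \<forall>g\<in>{f}. g x = 0}"
 have 1: "E' \<subseteq> E" by (auto simp: E'_def)
 have 2: "dim_ge p n E'" unfolding E'_def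
  by (rule dim_ge_ker[OF assms(2)]) (use lf in auto)
 have nE: "x0 \<notin> E'" using c(1) by (auto simp: f_def E'_def)
 have 3: "dim_ge p (Suc k) {seq_scale a x0 + y | a y. y \<in> F}" if "F \<subseteq> E'" "dim_ge p k F" for k F
  by (rule dim_ge_insert_line[OF pos(2) that(2) x0l]) (use nE that(1) in blast)
 have 4: "{seq_scale a x0 + y | a y. y \<in> F} \<subseteq> E" if "F \<subseteq> E'" for F
  using that 1 assms(3) seq.subspace_add[OF Es(1)] seq.subspace_scale[OF Es(1)] by blast
 have 5: "norm a * lp_norm p x0 <= 2 * lp_norm p (seq_scale a x0 + y) \<and> lp_norm p y <= 3 * lp_norm p (seq_scale a x0 + y)"
  if y: "y \<in> E'" for a y
 proof -
  define z where "z = seq_scale a x0 + y"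
  have yl: "y \<in> lp p" using y 1 Es by blast
  have al: "seq_scale a x0 \<in> lp p" "lp_norm p (seq_scale a x0) = norm a * lp_norm p x0" using lp_scale[OF pos(1) x0l] by auto
  have zl: "z \<in> lp p" using lp_add(1)[OF pos(2) al(1) yl] by (simp add: z_def)
  have "f z = a" unfolding z_def using lin_fun_add[OF lf al(1) yl] lin_fun_scale[OF lf x0l, of a] y c(1) by (auto simp: f_def E'_def)
  then have ab: "norm a * lp_norm p x0 <= 2 * lp_norm p z" using fb[OF zl] by simp
  have "y = z - seq_scale a x0" by (simp add: z_def)
  then have "lp_norm p y <= lp_norm p z + norm a * lp_norm p x0" using lp_diff(2)[OF pos(2) zl al(1)] al(2) by simp
  then show ?thesis using ab by (simp add: z_def)
 qed
 show thesis using that[OF 1 2 3 4] 5 by blast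
qed

text \<open>
 Vectors on which \<open>S\<close> is very small are picked one by one, each in the kernels of functionals norming the previous ones. By the previous lemma the coefficients of a combination are controlled, so \<open>S\<close> stays small on the span. This turns one vector per subspace into a subspace of given dimension, as needed for sums.
\<close>

lemma fss_large_subspace:
 fixes S :: "'k::real_normed_field seq_op"
 assumes "1 < p" "1 <= q" "S \<in> fss_ops p q" "0 < e"
 shows "\<exists>n. \<forall>E. dim_ge p n E --> (\<exists>F\<subseteq>E. dim_ge p k F \<and> (\<forall>x\<in>F. lp_norm q (S x) <= e * lp_norm p x))"
 using assms(4)
proof (induction k arbitrary: e)
 case 0
 have bS: "S \<in> bounded_ops p q" using assms(3) by (simp add: fss_ops_def)
 have "\<exists>F\<subseteq>E. dim_ge p 0 F \<and> (\<forall>x\<in>F. lp_norm q (S x) <= e * lp_norm p x)" if "dim_ge p 0 E" for E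
 proof (intro exI[of _ "{0}"] conjI)
  show "{0} \<subseteq> E" using seq.subspace_0[OF dim_ge_subspace[OF that]] by blast
  show "dim_ge p 0 ({0} :: 'k seq set)" by (simp add: dim_ge_def seq.subspace_single_0)
  show "\<forall>x\<in>{0}. lp_norm q (S x) <= e * lp_norm p x" using ops_0[OF bS] by simp
 qed
 then show ?case by blast
next
 case (Suc k)
 have pos: "0 < p" "1 <= p" "0 < q" using assms by auto
 have bS: "S \<in> bounded_ops p q" using assms(3) by (simp add: fss_ops_def)
 define d where "d = e / 5"
 have d: "d > 0" using Suc by (simp add: d_def)
 obtain n1 where n1: "!!E. dim_ge p n1 E ==> \<exists>x\<in>E. x ~= 0 \<and> lp_norm q (S x) <= d * lp_norm p x"
  using assms(3) d unfolding fss_ops_iff[OF pos(2) assms(2)] by blast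
 obtain n2 where n2: "!!E. dim_ge p n2 E ==> \<exists>F\<subseteq>E. dim_ge p k F \<and> (\<forall>x\<in>F. lp_norm q (S x) <= d * lp_norm p x)"
  using Suc(1)[OF d] by blast
 have "\<exists>F\<subseteq>E. dim_ge p (Suc k) F \<and> (\<forall>x\<in>F. lp_norm q (S x) <= e * lp_norm p x)" if E: "dim_ge p (max n1 (Suc n2)) E" for E
 proof -
  obtain x0 where x0: "x0 \<in> E" "x0 ~= 0" "lp_norm q (S x0) <= d * lp_norm p x0"
   using n1[of E] dim_ge_mono[OF E, of n1] by auto
  have x0l: "x0 \<in> lp p" using x0 dim_ge_lp[OF E] by blast
  have E2: "dim_ge p (Suc n2) E" by (rule dim_ge_mono[OF E]) simp
  obtain E' where E': "E' \<subseteq> E" "dim_ge p n2 E'"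
   "!!k F. F \<subseteq> E' ==> dim_ge p k F ==> dim_ge p (Suc k) {seq_scale a x0 + y | a y. y \<in> F}"
   "!!F. F \<subseteq> E' ==> {seq_scale a x0 + y | a y. y \<in> F} \<subseteq> E"
   "!!a y. y \<in> E' ==> norm a * lp_norm p x0 <= 2 * lp_norm p (seq_scale a x0 + y)"
   "!!a y. y \<in> E' ==> lp_norm p y <= 3 * lp_norm p (seq_scale a x0 + y)"
   by (rule line_splitting[OF assms(1) E2 x0(1,2)], rule that)
  obtain F where F: "F \<subseteq> E'" "dim_ge p k F" "!!x. x \<in> F ==> lp_norm q (S x) <= d * lp_norm p x"
   using n2[OF E'(2)] by blast
  have "lp_norm q (S z) <= e * lp_norm p z" if zF: "z \<in> {seq_scale a x0 + y | a y. y \<in> F}" for z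
  proof -
   obtain a y where z: "z = seq_scale a x0 + y" "y \<in> F" using zF by blast
   have yl: "y \<in> lp p" using z(2) dim_ge_lp[OF F(2)] by blast
   have al: "seq_scale a x0 \<in> lp p" using lp_scale[OF pos(1) x0l] by auto
   have ab: "norm a * lp_norm p x0 <= 2 * lp_norm p z" and yb: "lp_norm p y <= 3 * lp_norm p z"
    using E'(5,6)[of y a] F(1) z by auto
   have "S z = S (seq_scale a x0) + S y" unfolding z(1) by (rule ops_add[OF bS al yl])
   then have "lp_norm q (S z) <= lp_norm q (S (seq_scale a x0)) + lp_norm q (S y)"
    using lp_add(2)[OF assms(2) ops_in[OF bS al] ops_in[OF bS yl]] by simp
   also have "lp_norm q (S (seq_scale a x0)) = norm a * lp_norm q (S x0)"
    unfolding ops_scale[OF bS x0l] by (rule lp_scale(2)[OF pos(3) ops_in[OF bS x0l]])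
   also have "\<dots> <= d * (2 * lp_norm p z)"
   proof -
    have "norm a * lp_norm q (S x0) <= norm a * (d * lp_norm p x0)" by (intro mult_left_mono x0(3)) auto
    also have "\<dots> = d * (norm a * lp_norm p x0)" by simp
    also have "\<dots> <= d * (2 * lp_norm p z)" using d ab by (intro mult_left_mono) auto
    finally show ?thesis .
   qed
   also have "lp_norm q (S y) <= d * (3 * lp_norm p z)"
    using F(3)[OF z(2)] mult_left_mono[OF yb, of d] d by linarith
   finally show ?thesis by (simp add: d_def)
  qed
  then show ?thesis using E'(3)[OF F(1,2)] E'(4)[OF F(1)]
   by (intro exI[of _ "{seq_scale a x0 + y | a y. y \<in> F}"] conjI ballI)
 qed
 then show ?case by blast
qed

text \<open>A finite-dimensional subspace is uniformly approximated by finitely supported sequences.\<close>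

lemma uniform_tail_subspace:
 fixes E :: "'k::real_normed_field seq set"
 assumes "1 < p" "dim_ge p n E"
 shows "\<exists>F\<subseteq>E. dim_ge p n F \<and> (\<forall>e>0. \<exists>M. \<forall>x\<in>F. lp_norm p (restr {M..} x) <= e * lp_norm p x)"
 using assms(2)
proof (induction n arbitrary: E)
 case 0
 show ?case
 proof (intro exI[of _ "{0}"] conjI)
  show "{0} \<subseteq> E" using seq.subspace_0[OF dim_ge_subspace[OF 0]] by blast
  show "dim_ge p 0 ({0} :: 'k seq set)" by (simp add: dim_ge_def seq.subspace_single_0)
  have "lp_norm p (restr {0..} (0 :: 'k seq)) <= e * lp_norm p (0 :: 'k seq)" for e
   by (simp only: restr_simps lp_norm_0)
  then show "\<forall>e>0. \<exists>M. \<forall>x\<in>{0 :: 'k seq}. lp_norm p (restr {M..} x) <= e * lp_norm p x" by blast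
 qed
next
 case (Suc n)
 have pos: "0 < p" "1 <= p" using assms by auto
 obtain x0 where x0: "x0 \<in> E" "x0 ~= 0" by (rule dim_ge_coords[OF Suc(2), of "{}"]) auto
 have x0l: "x0 \<in> lp p" using x0 dim_ge_lp[OF Suc(2)] by blast
 have nx: "lp_norm p x0 > 0" by (rule lp_norm_pos[OF x0l pos(1) x0(2)])
 obtain E' where E': "E' \<subseteq> E" "dim_ge p n E'"
  "!!k F. F \<subseteq> E' ==> dim_ge p k F ==> dim_ge p (Suc k) {seq_scale a x0 + y | a y. y \<in> F}"
  "!!F. F \<subseteq> E' ==> {seq_scale a x0 + y | a y. y \<in> F} \<subseteq> E"
  "!!a y. y \<in> E' ==> norm a * lp_norm p x0 <= 2 * lp_norm p (seq_scale a x0 + y)"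
  "!!a y. y \<in> E' ==> lp_norm p y <= 3 * lp_norm p (seq_scale a x0 + y)"
  by (rule line_splitting[OF assms(1) Suc(2) x0], rule that)
 obtain F where F: "F \<subseteq> E'" "dim_ge p n F" "!!e. e > 0 ==> \<exists>M. \<forall>x\<in>F. lp_norm p (restr {M..} x) <= e * lp_norm p x"
  using Suc(1)[OF E'(2)] by blast
 have "\<exists>M. \<forall>z\<in>{seq_scale a x0 + y | a y. y \<in> F}. lp_norm p (restr {M..} z) <= e * lp_norm p z" if e: "e > 0" for e
 proof -
  obtain M1 where M1: "!!x. x \<in> F ==> lp_norm p (restr {M1..} x) <= e / 6 * lp_norm p x" using F(3)[of "e / 6"] e by auto
  obtain M2 where M2: "lp_norm p (restr {M2..} x0) < e / 4 * lp_norm p x0"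
   using lp_tail[OF pos(1) x0l, of "e / 4 * lp_norm p x0"] nx e by auto
  have "lp_norm p (restr {max M1 M2..} z) <= e * lp_norm p z" if zF: "z \<in> {seq_scale a x0 + y | a y. y \<in> F}" for z
  proof -
   obtain a y where z: "z = seq_scale a x0 + y" "y \<in> F" using zF by blast
   have yl: "y \<in> lp p" using z(2) dim_ge_lp[OF F(2)] by blast
   have rl: "restr S x0 \<in> lp p" "restr S y \<in> lp p" for S using lp_restr(1)[OF pos(1)] x0l yl by auto
   have ab: "norm a * lp_norm p x0 <= 2 * lp_norm p z" and yb: "lp_norm p y <= 3 * lp_norm p z"
    using E'(5,6)[of y a] F(1) z by auto
   have "lp_norm p (restr {max M1 M2..} z) <= lp_norm p (seq_scale a (restr {max M1 M2..} x0)) + lp_norm p (restr {max M1 M2..} y)"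
    unfolding z(1) restr_simps by (rule lp_add(2)[OF pos(2) lp_scale(1)[OF pos(1) rl(1)] rl(2)])
   also have "lp_norm p (seq_scale a (restr {max M1 M2..} x0)) = norm a * lp_norm p (restr {max M1 M2..} x0)"
    by (rule lp_scale(2)[OF pos(1) rl(1)])
   also have "\<dots> <= norm a * (e / 4 * lp_norm p x0)"
    using M2 lp_norm_restr_mono_tail[OF pos(2) x0l, of M2 "max M1 M2"] by (intro mult_left_mono) auto
   also have "\<dots> = e / 4 * (norm a * lp_norm p x0)" by simp
   also have "\<dots> <= e / 4 * (2 * lp_norm p z)" using e ab by (intro mult_left_mono) auto
   also have "lp_norm p (restr {max M1 M2..} y) <= e / 6 * (3 * lp_norm p z)"
    using lp_norm_restr_mono_tail[OF pos(2) yl, of M1 "max M1 M2"] M1[OF z(2)] mult_left_mono[OF yb, of "e / 6"] e by linarith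
   finally show ?thesis by simp
  qed
  then show ?thesis by blast
 qed
 then show ?case using E'(3)[OF F(1,2)] E'(4)[OF F(1)]
  by (intro exI[of _ "{seq_scale a x0 + y | a y. y \<in> F}"] conjI allI impI)
qed

lemma dim_ge_image:
 fixes B :: "'k::real_normed_field seq_op"
 assumes "B \<in> bounded_ops p r" "dim_ge p n E" "!!x. x \<in> E ==> B x = 0 ==> x = 0"
 shows "dim_ge r n (B ` E)"
 unfolding dim_ge_def
proof (intro conjI allI impI)
 have E: "seq.subspace E" "E \<subseteq> lp p" using assms(2) by (auto simp: dim_ge_def)
 show "B ` E \<subseteq> lp r" using E ops_in[OF assms(1)] by blast
 show "seq.subspace (B ` E)"
 proof (rule seq.subspaceI)
  have "B 0 = 0" by (rule ops_0[OF assms(1)])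
  then show "0 \<in> B ` E" using seq.subspace_0[OF E(1)] by (metis image_eqI)
 next
  fix u v assume "u \<in> B ` E" "v \<in> B ` E"
  then obtain x y where *: "u = B x" "v = B y" "x \<in> E" "y \<in> E" by blast
  then have "x \<in> lp p" "y \<in> lp p" using E(2) by blast+
  then have "u + v = B (x + y)" using ops_add[OF assms(1), of x y] * by simp
  then show "u + v \<in> B ` E" using seq.subspace_add[OF E(1) *(3,4)] by blast
 next
  fix c u assume "u \<in> B ` E"
  then obtain x where *: "u = B x" "x \<in> E" by blast
  then have "seq_scale c u = B (seq_scale c x)" using ops_scale[OF assms(1), of x c] E(2) by auto
  then show "seq_scale c u \<in> B ` E" using seq.subspace_scale[OF E(1) *(2)] by blast
 qed
 fix F :: "('k seq => 'k) set" assume F: "finite F \<and> card F < n \<and> (\<forall>f\<in>F. lin_fun r f)"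
 let ?G = "(%f x. f (B x)) ` F"
 have "card ?G < n" using card_image_le[of F "%f x. f (B x)"] F by linarith
 moreover have "lin_fun p g" if g: "g \<in> ?G" for g
 proof -
  obtain f where "g = (%x. f (B x))" "f \<in> F" using g by blast
  then show ?thesis using lin_fun_ops[OF assms(1), of f] F by simp
 qed
 moreover have "finite ?G" using F by simp
 ultimately obtain x where x: "x \<in> E" "x ~= 0" "!!g. g \<in> ?G ==> g x = 0"
  using dim_geD[OF assms(2), of ?G] by blast
 have "B x ~= 0" using assms(3)[OF x(1)] x(2) by blast
 moreover have "\<forall>f\<in>F. f (B x) = 0" using x(3) by blast
 ultimately show "\<exists>y\<in>B ` E. y ~= 0 \<and> (\<forall>f\<in>F. f y = 0)" using x(1) by blast
qed

text \<open>
 For a sum, first find a large subspace on which one operator is small and then a vector in it on which the other is small. For a product with an operator on the right, that operator is either not injective on \<open>E\<close> or preserves its dimension.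
\<close>

lemma closed_ideal_fss_ops:
 assumes "1 < p" "1 <= q"
 shows "closed_ideal p q (fss_ops p q :: 'k::real_normed_field seq_op set)"
proof -
 have pos: "1 <= p" "0 < p" "0 < q" using assms by auto
 note iff = fss_ops_iff[OF pos(1) assms(2), where 'k='k]
 show ?thesis
 proof (rule closed_idealI[OF pos(1) assms(2)])
  show "fss_ops p q \<subseteq> (bounded_ops p q :: 'k seq_op set)" by (auto simp: fss_ops_def)
  have "\<exists>x\<in>E. x ~= 0 \<and> lp_norm q ((0 :: 'k seq_op) x) <= e * lp_norm p x" if "dim_ge p 1 E" "e > 0" for E e
   using dim_geD[OF that(1), of "{}"] that(2) by fastforce
  then show "0 \<in> (fss_ops p q :: 'k seq_op set)" unfolding iff by (auto intro!: exI[of _ 1])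
 next
  fix S T :: "'k seq_op" assume S: "S \<in> fss_ops p q" and T: "T \<in> fss_ops p q"
  have b: "S \<in> bounded_ops p q" "T \<in> bounded_ops p q" using S T by (auto simp: fss_ops_def)
  show "S + T \<in> fss_ops p q" unfolding iff
  proof (intro conjI allI impI)
   show "S + T \<in> bounded_ops p q" by (rule bounded_ops_add[OF assms(2) b])
   fix e :: real assume e: "e > 0"
   then obtain k where k: "!!E. dim_ge p k E ==> \<exists>x\<in>E. x ~= 0 \<and> lp_norm q (T x) <= e / 2 * lp_norm p x"
    using T unfolding iff by (meson half_gt_zero)
   obtain n where n: "!!E. dim_ge p n E ==> \<exists>F\<subseteq>E. dim_ge p k F \<and> (\<forall>x\<in>F. lp_norm q (S x) <= e / 2 * lp_norm p x)"
    using fss_large_subspace[OF assms S, of "e / 2" k] e by auto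
   have "\<exists>x\<in>E. x ~= 0 \<and> lp_norm q ((S + T) x) <= e * lp_norm p x" if E: "dim_ge p n E" for E
   proof -
    obtain F where F: "F \<subseteq> E" "dim_ge p k F" "!!x. x \<in> F ==> lp_norm q (S x) <= e / 2 * lp_norm p x" using n[OF E] by blast
    obtain x where x: "x \<in> F" "x ~= 0" "lp_norm q (T x) <= e / 2 * lp_norm p x" using k[OF F(2)] by blast
    have xl: "x \<in> lp p" using x(1) dim_ge_lp[OF F(2)] by blast
    have "lp_norm q ((S + T) x) <= lp_norm q (S x) + lp_norm q (T x)"
     unfolding plus_fun_apply[of S T x] by (rule lp_add(2)[OF assms(2) ops_in[OF b(1) xl] ops_in[OF b(2) xl]])
    also have "\<dots> <= e * lp_norm p x" using F(3)[OF x(1)] x(3) by (simp add: field_simps)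
    finally show ?thesis using x F(1) by blast
   qed
   then show "\<exists>n. \<forall>E. dim_ge p n E --> (\<exists>x\<in>E. x ~= 0 \<and> lp_norm q ((S + T) x) <= e * lp_norm p x)" by blast
  qed
 next
  fix c and T :: "'k seq_op" assume T: "T \<in> fss_ops p q"
  have b: "T \<in> bounded_ops p q" using T by (auto simp: fss_ops_def)
  show "op_scale c T \<in> fss_ops p q" unfolding iff
  proof (intro conjI allI impI)
   show "op_scale c T \<in> bounded_ops p q" by (rule bounded_ops_scale[OF assms(2) b])
   fix e :: real assume e: "e > 0"
   have e': "e / (norm c + 1) > 0" using e by (simp add: add_nonneg_pos)
   then obtain n where n: "!!E. dim_ge p n E ==> \<exists>x\<in>E. x ~= 0 \<and> lp_norm q (T x) <= e / (norm c + 1) * lp_norm p x"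
    using T unfolding iff by meson
   have "\<exists>x\<in>E. x ~= 0 \<and> lp_norm q (op_scale c T x) <= e * lp_norm p x" if E: "dim_ge p n E" for E
   proof -
    obtain x where x: "x \<in> E" "x ~= 0" "lp_norm q (T x) <= e / (norm c + 1) * lp_norm p x" using n[OF E] by blast
    have xl: "x \<in> lp p" using x(1) dim_ge_lp[OF E] by blast
    have "lp_norm q (op_scale c T x) = norm c * lp_norm q (T x)"
     unfolding op_scale_def by (rule lp_scale(2)[OF pos(3) ops_in[OF b xl]])
    also have "\<dots> <= (norm c + 1) * (e / (norm c + 1) * lp_norm p x)" by (intro mult_mono x(3)) auto
    also have "\<dots> = e * lp_norm p x" by (simp add: add_nonneg_eq_0_iff)
    finally show ?thesis using x by blast
   qed
   then show "\<exists>n. \<forall>E. dim_ge p n E --> (\<exists>x\<in>E. x ~= 0 \<and> lp_norm q (op_scale c T x) <= e * lp_norm p x)" by blast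
  qed
 next
  fix A T B :: "'k seq_op"
  assume A: "A \<in> bounded_ops q q" and T: "T \<in> fss_ops p q" and B: "B \<in> bounded_ops p p"
  have bT: "T \<in> bounded_ops p q" using T by (auto simp: fss_ops_def)
  obtain a where a: "a > 0" "!!x. x \<in> lp q ==> lp_norm q (A x) <= a * lp_norm q x" using ops_bound[OF A] by metis
  obtain b where b: "b > 0" "!!x. x \<in> lp p ==> lp_norm p (B x) <= b * lp_norm p x" using ops_bound[OF B] by metis
  show "A \<circ> T \<circ> B \<in> fss_ops p q" unfolding iff
  proof (intro conjI allI impI)
   show "A \<circ> T \<circ> B \<in> bounded_ops p q" by (intro bounded_ops_comp[OF bounded_ops_comp[OF A bT] B])
   fix e :: real assume e: "e > 0"
   then have e': "e / (a * b) > 0" using a b by simp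
   then obtain n where n: "!!E. dim_ge p n E ==> \<exists>x\<in>E. x ~= 0 \<and> lp_norm q (T x) <= e / (a * b) * lp_norm p x"
    using T unfolding iff by meson
   have "\<exists>x\<in>E. x ~= 0 \<and> lp_norm q ((A \<circ> T \<circ> B) x) <= e * lp_norm p x" if E: "dim_ge p n E" for E
   proof (cases "\<exists>x\<in>E. x ~= 0 \<and> B x = 0")
    case True
    then obtain x where x: "x \<in> E" "x ~= 0" "B x = 0" by blast
    then have "(A \<circ> T \<circ> B) x = 0" using ops_0[OF A] ops_0[OF bT] by simp
    then show ?thesis using x e by (intro bexI[of _ x]) auto
   next
    case False
    then have "dim_ge p n (B ` E)" by (intro dim_ge_image[OF B E]) blast
    then obtain x where x: "x \<in> E" "B x ~= 0" "lp_norm q (T (B x)) <= e / (a * b) * lp_norm p (B x)" using n by blast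
    have xl: "x \<in> lp p" using x(1) dim_ge_lp[OF E] by blast
    have "lp_norm q (A (T (B x))) <= a * lp_norm q (T (B x))" by (rule a(2)[OF ops_in[OF bT ops_in[OF B xl]]])
    also have "\<dots> <= a * (e / (a * b) * (b * lp_norm p x))"
    proof -
     have "e / (a * b) * lp_norm p (B x) <= e / (a * b) * (b * lp_norm p x)"
      using e' by (intro mult_left_mono b(2)[OF xl]) auto
     then show ?thesis using x(3) a by (intro mult_left_mono) auto
    qed
    also have "\<dots> = e * lp_norm p x" using a b by simp
    finally show ?thesis using x ops_0[OF B] by (intro bexI[of _ x]) auto
   qed
   then show "\<exists>n. \<forall>E. dim_ge p n E --> (\<exists>x\<in>E. x ~= 0 \<and> lp_norm q ((A \<circ> T \<circ> B) x) <= e * lp_norm p x)" by blast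
  qed
 next
  fix T :: "'k seq_op" assume bT: "T \<in> bounded_ops p q" and ap: "op_approx p q (fss_ops p q) T"
  show "T \<in> fss_ops p q" unfolding iff
  proof (intro conjI allI impI bT)
   fix e :: real assume e: "e > 0"
   then obtain S where S: "S \<in> fss_ops p q" "!!x. x \<in> lp p ==> lp_norm q (S x - T x) <= e / 2 * lp_norm p x"
    using ap unfolding op_approx_def by (meson half_gt_zero)
   have bS: "S \<in> bounded_ops p q" using S(1) by (auto simp: fss_ops_def)
   obtain n where n: "!!E. dim_ge p n E ==> \<exists>x\<in>E. x ~= 0 \<and> lp_norm q (S x) <= e / 2 * lp_norm p x"
    using S(1) e unfolding iff by (meson half_gt_zero)
   have "\<exists>x\<in>E. x ~= 0 \<and> lp_norm q (T x) <= e * lp_norm p x" if E: "dim_ge p n E" for E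
   proof -
    obtain x where x: "x \<in> E" "x ~= 0" "lp_norm q (S x) <= e / 2 * lp_norm p x" using n[OF E] by blast
    have xl: "x \<in> lp p" using x(1) dim_ge_lp[OF E] by blast
    have d: "S x - T x \<in> lp q" using lp_diff(1)[OF assms(2) ops_in[OF bS xl] ops_in[OF bT xl]] .
    have "T x = S x - (S x - T x)" by simp
    then have "lp_norm q (T x) <= lp_norm q (S x) + lp_norm q (S x - T x)"
     using lp_diff(2)[OF assms(2) ops_in[OF bS xl] d] by simp
    also have "\<dots> <= e * lp_norm p x" using S(2)[OF xl] x(3) by (simp add: field_simps)
    finally show ?thesis using x by blast
   qed
   then show "\<exists>n. \<forall>E. dim_ge p n E --> (\<exists>x\<in>E. x ~= 0 \<and> lp_norm q (T x) <= e * lp_norm p x)" by blast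
  qed
 qed
qed

subsection \<open>Flat vectors\<close>

text \<open>
 Milman's lemma: start with a vector whose largest modulus is attained on a set \<open>I\<close>; if \<open>I\<close> is small, a nonzero element of \<open>E\<close> vanishing on \<open>I\<close> can be added until the maximum is attained at a further coordinate.
\<close>

lemma flat_vector:
 fixes E :: "'k::real_normed_field seq set"
 assumes "0 < p" "dim_ge p n E" "k <= n"
 shows "\<exists>x\<in>E. \<exists>I. finite I \<and> k <= card I \<and> (\<forall>i\<in>I. norm (x i) = 1) \<and> (\<forall>i. norm (x i) <= 1)"
 using assms(3)
proof (induction k)
 case 0
 have "0 \<in> E" by (rule seq.subspace_0[OF dim_ge_subspace[OF assms(2)]])
 then show ?case by (intro bexI[of _ 0] exI[of _ "{}"]) auto
next
 case (Suc k)
 then obtain x I where x: "x \<in> E" "finite I" "k <= card I" "!!i. i \<in> I ==> norm (x i) = 1" "!!i. norm (x i) <= 1"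
  by auto
 show ?case
 proof (cases "k < card I \<or> (\<exists>i. i \<notin> I \<and> norm (x i) = 1)")
  case True
  then show ?thesis
  proof
   assume "k < card I"
   then show ?thesis using x by (intro bexI[of _ x] exI[of _ I]) auto
  next
   assume "\<exists>i. i \<notin> I \<and> norm (x i) = 1"
   then obtain i where "i \<notin> I" "norm (x i) = 1" by blast
   then show ?thesis using x by (intro bexI[of _ x] exI[of _ "insert i I"]) auto
  qed
 next
  case False
  then have cI: "card I = k" and lt: "norm (x i) < 1" if "i \<notin> I" for i
   using x(3) x(5)[of i] that by (auto simp: less_le)
  have cI: "card I = k" using False x(3) by auto
  have "card I < n" using cI Suc(2) by linarith
  from dim_ge_coords[OF assms(2) x(2) this]
  obtain y where y: "y \<in> E" "y ~= 0" and yI: "!!i. i \<in> I ==> y i = 0" by blast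
  obtain i0 where i0: "y i0 ~= 0" using y(2) by (metis ext zero_fun_apply)
  then have i0I: "i0 \<notin> I" using yI by blast
  define R where "R = 2 / norm (y i0)"
  have R: "R > 0" using i0 by (simp add: R_def)
  have xl: "x \<in> lp p" and yl: "y \<in> lp p" using x(1) y(1) dim_ge_lp[OF assms(2)] by auto
  obtain M1 where M1: "!!m. m >= M1 ==> lp_norm p (restr {m..} x) < 1 / 2" using lp_tail[OF assms(1) xl, of "1/2"] by auto
  obtain M2 where M2: "!!m. m >= M2 ==> lp_norm p (restr {m..} y) < 1 / (2 * R)"
   using lp_tail[OF assms(1) yl, of "1 / (2 * R)"] R by auto
  define M where "M = max M1 M2"
  have far: "norm (x i + of_real t * y i) < 1" if i: "i >= M" and t: "0 <= t" "t <= R" for i t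
  proof -
   have "norm (restr {M..} x i) <= lp_norm p (restr {M..} x)" by (rule lp_norm_component[OF lp_restr(1)[OF assms(1) xl] assms(1)])
   then have 1: "norm (x i) < 1 / 2" using M1[of M] i by (simp add: restr_apply M_def)
   have "norm (restr {M..} y i) <= lp_norm p (restr {M..} y)" by (rule lp_norm_component[OF lp_restr(1)[OF assms(1) yl] assms(1)])
   then have "norm (y i) < 1 / (2 * R)" using M2[of M] i by (simp add: restr_apply M_def)
   then have "R * norm (y i) < 1 / 2" using R by (simp add: field_simps)
   moreover have "t * norm (y i) <= R * norm (y i)" using t by (intro mult_right_mono) auto
   ultimately have "norm (of_real t * y i) < 1 / 2" using t by (simp add: norm_mult)
   then show ?thesis using 1 norm_triangle_ineq[of "x i" "of_real t * y i"] by linarith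
  qed
  define g where "g i t = norm (x i + of_real t * y i)" for i t
  have gc: "continuous_on A (g i)" for A i unfolding g_def by (intro continuous_intros)
  define A where "A = {0..R} \<inter> (\<Union>i\<in>{..<M} - I. g i -` {1..})"
  have "closed (g i -` {1..})" for i
   by (rule continuous_closed_vimage[OF closed_atLeast]) (use gc[of UNIV i] in \<open>simp add: continuous_on_eq_continuous_at\<close>)
  then have "compact A" unfolding A_def by (intro compact_Int_closed compact_Icc closed_UN) auto
  moreover have "R \<in> A"
  proof -
   have "norm (of_real R * y i0) - norm (x i0) <= norm (of_real R * y i0 + x i0)"
    by (rule norm_diff_ineq)
   moreover have "norm (of_real R * y i0) = 2" using i0 by (simp add: norm_mult R_def norm_divide)
   ultimately have "g i0 R >= 1" using x(5)[of i0] by (simp add: g_def add.commute)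
   moreover have "i0 < M" using far[of i0 R] R calculation by (force simp: g_def)
   ultimately show ?thesis using R i0I by (auto simp: A_def)
  qed
  ultimately obtain t where t: "t \<in> A" "!!s. s \<in> A ==> t <= s" using compact_attains_inf[of A] by auto
  obtain j where j: "j < M" "j \<notin> I" "g j t >= 1" and tR: "0 <= t" "t <= R" using t(1) by (auto simp: A_def)
  have "t ~= 0" using j lt[OF j(2)] by (auto simp: g_def)
  then have tpos: "0 < t" using tR by simp
  have le1: "g i t <= 1" for i
  proof (cases "i \<in> I \<or> i >= M")
   case True
   then show ?thesis using yI x(4)[of i] far[of i t] tR by (auto simp: g_def)
  next
   case False
   have 1: "g i s <= 1" if s: "s \<in> {0..<t}" for s
   proof (rule ccontr)
    assume "\<not> g i s <= 1"
    then have "1 <= g i s" "i \<in> {..<M} - I" using False by auto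
    then have "s \<in> A" using s tR unfolding A_def by auto
    then show False using t(2)[of s] s by auto
   qed
   have 2: "t \<in> closure {0..<t}" using tpos by simp
   show ?thesis by (rule continuous_le_on_closure[OF gc 2 1])
  qed
  define z where "z = x + seq_scale (of_real t) y"
  have zg: "norm (z i) = g i t" for i by (simp add: z_def g_def seq_scale_apply)
  have "z \<in> E" unfolding z_def using x(1) y(1) dim_ge_subspace[OF assms(2)]
   by (intro seq.subspace_add seq.subspace_scale) auto
  moreover have "Suc k <= card (insert j I)" using j(2) x(2) cI by simp
  moreover have "norm (z i) = 1" if "i \<in> insert j I" for i
  proof (cases "i = j")
   case True
   then show ?thesis using j(3) le1[of j] zg by simp
  next
   case False
   then have "i \<in> I" using that by simp
   then show ?thesis using yI[of i] x(4)[of i] by (simp add: z_def seq_scale_apply)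
  qed
  ultimately show ?thesis using x(2) le1 zg by (intro bexI[of _ z] exI[of _ "insert j I"]) auto
 qed
qed

text \<open>
 A vector with \<open>\<bar>x\<^sub>i\<bar> \<le> 1\<close> and at least \<open>k\<close> coordinates of modulus \<open>1\<close> satisfies \<open>\<parallel>x\<parallel>\<^sub>p^p \<ge> k\<close>, while \<open>\<parallel>x\<parallel>\<^sub>r^r \<le> \<parallel>x\<parallel>\<^sub>p^p\<close>.
\<close>

lemma flat_inclusion:
 assumes "0 < p" "p < r" "0 < e"
 shows "\<exists>n. \<forall>E :: 'k::real_normed_field seq set. dim_ge p n E -->
  (\<exists>x\<in>E. x ~= 0 \<and> lp_norm r x <= e * lp_norm p x)"
proof -
 define s where "s = 1 / p - 1 / r"
 have s: "s > 0" using assms by (simp add: s_def field_simps)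
 obtain n where n: "real n > (1 / e) powr (1 / s) + 1" using reals_Archimedean2 by blast
 have n0: "(0::real) <= (1 / e) powr (1 / s)" by simp
 then have n1: "real n > 1" "n > 0" using n by (simp, linarith) (use n n0 in \<open>cases n; simp\<close>)
 have ne: "real n powr - s <= e"
 proof -
  have "1 / e = ((1 / e) powr (1 / s)) powr s" using s assms by (simp add: powr_powr)
  also have "\<dots> <= real n powr s" using n s by (intro powr_mono2) auto
  finally have "1 / e <= real n powr s" .
  moreover have "real n powr s > 0" using n1 by simp
  ultimately show ?thesis using assms by (simp add: powr_minus field_simps)
 qed
 have "\<exists>x\<in>E. x ~= 0 \<and> lp_norm r x <= e * lp_norm p x" if E: "dim_ge p n E" for E :: "'k seq set"
 proof -
  obtain x I where x: "x \<in> E" "finite I" "n <= card I" "!!i. i \<in> I ==> norm (x i) = 1" "!!i. norm (x i) <= 1"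
   using flat_vector[OF assms(1) E order_refl] by blast
  have xl: "x \<in> lp p" using x(1) dim_ge_lp[OF E] by blast
  define N where "N = lp_norm p x"
  have "real n <= (\<Sum>i\<in>I. norm (x i) powr p)" using x(3,4) by simp
  also have "\<dots> <= N powr p" unfolding N_def by (rule lp_sum_le[OF xl assms(1) x(2)])
  finally have nN: "real n <= N powr p" .
  then have N: "N > 0" using n1 assms(1) by (smt (verit) N_def lp_norm_nonneg powr_0 zero_less_one)
  have "lp_norm r x powr r <= N powr p"
   using lp_norm_interpolate(2)[OF assms(1) _ xl x(5)] assms by (simp add: N_def)
  also have "\<dots> <= (e * N) powr r"
  proof -
   have "N powr p = (N powr p) powr (- (s * r)) * N powr r"
    using N assms by (simp add: powr_powr s_def field_simps flip: powr_add)
   also have "(N powr p) powr (- (s * r)) <= real n powr (- (s * r))"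
    using nN n1 s assms by (intro powr_mono2') auto
   also have "real n powr (- (s * r)) = (real n powr - s) powr r" by (simp add: powr_powr)
   also have "\<dots> <= e powr r" using ne assms by (intro powr_mono2) auto
   finally show ?thesis using assms N by (simp add: powr_mult mult_right_mono)
  qed
  finally have "lp_norm r x <= e * N" by (rule le_powr_cancel) (use assms N in auto)
  moreover have "x ~= 0" using N by (auto simp: N_def)
  ultimately show ?thesis using x(1) by (auto simp: N_def)
 qed
 then show ?thesis by blast
qed

lemma formal_identity_fss:
 assumes "1 <= p" "p < q"
 shows "(formal_identity p :: 'k::real_normed_field seq_op) \<in> fss_ops p q"
proof -
 have b: "(formal_identity p :: 'k seq_op) \<in> bounded_ops p q" using assms by (intro formal_identity_bounded_ops) auto
 have id: "formal_identity p x = x" if "dim_ge p n E" "x \<in> E" for n E and x :: "'k seq"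
  using dim_ge_lp[OF that(1)] that(2) by (auto simp: formal_identity_def)
 have "\<exists>n. \<forall>E :: 'k seq set. dim_ge p n E --> (\<exists>x\<in>E. x ~= 0 \<and> lp_norm q (formal_identity p x) <= e * lp_norm p x)"
  if "e > 0" for e
  using flat_inclusion[OF _ assms(2) that, where 'k='k] assms id by (metis (no_types, opaque_lifting) less_le_trans zero_less_one)
 then show ?thesis using fss_ops_iff[of p q] b assms by auto
qed

section \<open>Hermitian forms\<close>

text \<open>
 Conjugation, defined uniformly for the real and the complex scalars by \<open>c kcnj c = \<bar>c\<bar>^2\<close>; additivity follows because multiplication by a scalar is a multiple of an isometry.
\<close>

definition kcnj :: "'k::{real_normed_field,euclidean_space} => 'k" where
 "kcnj c = of_real ((norm c)\<^sup>2) * inverse c"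

lemma inner_mult_mult:
 fixes c x y :: "'k::{real_normed_field,euclidean_space}"
 shows "(c * x) \<bullet> (c * y) = (norm c)\<^sup>2 * (x \<bullet> y)"
proof -
 have "(c * x) \<bullet> (c * y) = ((norm (c * (x + y)))\<^sup>2 - (norm (c * x))\<^sup>2 - (norm (c * y))\<^sup>2) / 2"
  unfolding distrib_left by (rule dot_norm)
 also have "\<dots> = (norm c)\<^sup>2 * (((norm (x + y))\<^sup>2 - (norm x)\<^sup>2 - (norm y)\<^sup>2) / 2)"
  by (simp only: norm_mult power_mult_distrib right_diff_distrib times_divide_eq_right)
 finally show ?thesis by (simp only: dot_norm)
qed

lemma inner_mult_kcnj:
 fixes c x y :: "'k::{real_normed_field,euclidean_space}"
 shows "(c * x) \<bullet> y = x \<bullet> (kcnj c * y)"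
proof (cases "c = 0")
 case False
 then have "(c * x) \<bullet> y = (c * x) \<bullet> (c * (inverse c * y))" by (simp flip: mult.assoc)
 also have "\<dots> = (norm c)\<^sup>2 * (x \<bullet> (inverse c * y))" by (rule inner_mult_mult)
 also have "\<dots> = x \<bullet> ((norm c)\<^sup>2 *\<^sub>R (inverse c * y))" by simp
 finally show ?thesis by (simp add: kcnj_def scaleR_conv_of_real mult.assoc)
qed (simp add: kcnj_def)

lemma kcnj_mult: "kcnj (c * d) = kcnj c * kcnj d"
 by (simp add: kcnj_def norm_mult power_mult_distrib)

lemma kcnj_add:
 fixes c d :: "'k::{real_normed_field,euclidean_space}"
 shows "kcnj (c + d) = kcnj c + kcnj d"
proof -
 have "z \<bullet> kcnj (c + d) = z \<bullet> (kcnj c + kcnj d)" for z :: 'k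
  using inner_mult_kcnj[of "c + d" z 1] inner_mult_kcnj[of c z 1] inner_mult_kcnj[of d z 1]
  by (simp add: distrib_right inner_add_left inner_add_right)
 then show ?thesis using vector_eq_ldot by blast
qed

lemma kcnj_0 [simp]: "kcnj 0 = 0"
 by (simp add: kcnj_def)

lemma kcnj_of_real [simp]: "kcnj (of_real r) = of_real r"
 by (cases "r = 0") (simp_all add: kcnj_def power2_eq_square)

lemma kcnj_1 [simp]: "kcnj 1 = 1"
 using kcnj_of_real[of 1] by simp

lemma kcnj_sum: "kcnj (sum f A) = (\<Sum>a\<in>A. kcnj (f a))"
 by (induction A rule: infinite_finite_induct) (auto simp: kcnj_add)

lemma mult_kcnj: "c * kcnj c = of_real ((norm c)\<^sup>2)"
 by (cases "c = 0") (simp_all add: kcnj_def)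

lemma norm_kcnj [simp]: "norm (kcnj c) = norm c"
 by (cases "c = 0") (simp_all add: kcnj_def norm_mult norm_inverse power2_eq_square)

lemma kcnj_kcnj [simp]: "kcnj (kcnj c) = c"
 by (cases "c = 0") (simp_all add: kcnj_def norm_mult norm_inverse norm_divide power2_eq_square field_simps)

definition herm :: "(nat => real) => nat set => 'k::{real_normed_field,euclidean_space} seq => 'k seq => 'k" where
 "herm \<Phi> V x y = (\<Sum>j\<in>V. of_real (\<Phi> j) * x j * kcnj (y j))"

lemma herm_add_left: "herm \<Phi> V (x + y) z = herm \<Phi> V x z + herm \<Phi> V y z"
 by (simp add: herm_def algebra_simps sum.distrib)

lemma herm_scale_left: "herm \<Phi> V (seq_scale c x) z = c * herm \<Phi> V x z"
 by (simp add: herm_def seq_scale_apply sum_distrib_left mult_ac)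

lemma herm_kcnj: "kcnj (herm \<Phi> V x y) = herm \<Phi> V y x"
 by (simp add: herm_def kcnj_sum kcnj_mult mult_ac)

lemma herm_diff_left: "herm \<Phi> V (x - y) z = herm \<Phi> V x z - herm \<Phi> V y z"
 by (simp add: herm_def algebra_simps sum_subtractf)

lemma kcnj_diff: "kcnj (c - d) = kcnj c - kcnj d"
 using kcnj_add[of "c - d" d] by simp

lemma herm_diff_right: "herm \<Phi> V z (x - y) = herm \<Phi> V z x - herm \<Phi> V z y"
 by (simp add: herm_def kcnj_diff algebra_simps sum_subtractf)

lemma herm_sum_left: "herm \<Phi> V (\<Sum>i\<in>Q. seq_scale (a i) (f i)) z = (\<Sum>i\<in>Q. a i * herm \<Phi> V (f i) z)"
proof (induction Q rule: infinite_finite_induct)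
 case (insert i Q)
 have "herm \<Phi> V (seq_scale (a i) (f i) + (\<Sum>i\<in>Q. seq_scale (a i) (f i))) z = a i * herm \<Phi> V (f i) z + (\<Sum>i\<in>Q. a i * herm \<Phi> V (f i) z)"
  using insert by (simp only: herm_add_left herm_scale_left)
 then show ?case unfolding sum.insert[OF insert(1,2)] .
qed (simp_all add: herm_def)

lemma herm_self: "herm \<Phi> V x x = of_real (\<Sum>j\<in>V. \<Phi> j * (norm (x j))\<^sup>2)"
 by (simp add: herm_def mult.assoc mult_kcnj)

lemma herm_parseval:
 assumes "finite Q" "!!i l. i \<in> Q ==> l \<in> Q ==> herm \<Phi> V (f i) (f l) = (if i = l then 1 else 0)"
 shows "(\<Sum>j\<in>V. \<Phi> j * (norm ((\<Sum>i\<in>Q. seq_scale (a i) (f i)) j))\<^sup>2) = (\<Sum>i\<in>Q. (norm (a i :: 'k::{real_normed_field,euclidean_space}))\<^sup>2)"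
proof -
 let ?z = "\<Sum>i\<in>Q. seq_scale (a i) (f i)"
 have 1: "herm \<Phi> V (f i) ?z = kcnj (a i)" if "i \<in> Q" for i
 proof -
  have "herm \<Phi> V ?z (f i) = (\<Sum>l\<in>Q. a l * (if l = i then 1 else 0))"
   unfolding herm_sum_left using assms(2) that by (intro sum.cong) auto
  also have "\<dots> = (\<Sum>l\<in>Q. if l = i then a l else 0)" by (rule sum.cong) auto
  also have "\<dots> = a i" unfolding sum.delta[OF assms(1)] using that by simp
  finally show ?thesis using herm_kcnj[of \<Phi> V ?z "f i"] by simp
 qed
 have "herm \<Phi> V ?z ?z = (\<Sum>i\<in>Q. a i * kcnj (a i))" by (subst herm_sum_left) (simp add: 1)
 also have "\<dots> = of_real (\<Sum>i\<in>Q. (norm (a i))\<^sup>2)" by (simp add: mult_kcnj)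
 finally show ?thesis unfolding herm_self of_real_eq_iff .
qed

lemma herm_bessel:
 fixes f :: "nat => 'k::{real_normed_field,euclidean_space} seq"
 assumes "finite Q" "!!i l. i \<in> Q ==> l \<in> Q ==> herm \<Phi> V (f i) (f l) = (if i = l then 1 else 0)"
  and "!!j. j \<in> V ==> 0 <= \<Phi> j"
 shows "(\<Sum>i\<in>Q. (norm (herm \<Phi> V y (f i)))\<^sup>2) <= (\<Sum>j\<in>V. \<Phi> j * (norm (y j))\<^sup>2)"
proof -
 define c where "c i = herm \<Phi> V y (f i)" for i
 define z where "z = (\<Sum>i\<in>Q. seq_scale (c i) (f i))"
 have cc: "(\<Sum>i\<in>Q. c i * kcnj (c i)) = of_real (\<Sum>i\<in>Q. (norm (c i))\<^sup>2)" by (simp add: mult_kcnj)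
 have zy: "herm \<Phi> V z y = of_real (\<Sum>i\<in>Q. (norm (c i))\<^sup>2)"
  unfolding z_def herm_sum_left cc[symmetric] by (simp add: c_def herm_kcnj)
 have yz: "herm \<Phi> V y z = of_real (\<Sum>i\<in>Q. (norm (c i))\<^sup>2)"
  using arg_cong[OF zy, of kcnj] by (simp only: herm_kcnj kcnj_of_real)
 have zz: "herm \<Phi> V z z = of_real (\<Sum>i\<in>Q. (norm (c i))\<^sup>2)"
  unfolding herm_self of_real_eq_iff z_def by (rule herm_parseval[OF assms(1,2)])
 have "herm \<Phi> V (y - z) (y - z) = herm \<Phi> V y y - herm \<Phi> V y z - (herm \<Phi> V z y - herm \<Phi> V z z)"
  unfolding herm_diff_left[of _ _ y z "y - z"] herm_diff_right[of _ _ y y z] herm_diff_right[of _ _ z y z] ..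
 then have "of_real (\<Sum>j\<in>V. \<Phi> j * (norm ((y - z) j))\<^sup>2) = (of_real (\<Sum>j\<in>V. \<Phi> j * (norm (y j))\<^sup>2) - of_real (\<Sum>i\<in>Q. (norm (c i))\<^sup>2) :: 'k)"
  by (simp only: zy yz zz herm_self[of \<Phi> V "y - z"] herm_self[of \<Phi> V y] diff_self diff_zero)
 then have "(\<Sum>j\<in>V. \<Phi> j * (norm ((y - z) j))\<^sup>2) = (\<Sum>j\<in>V. \<Phi> j * (norm (y j))\<^sup>2) - (\<Sum>i\<in>Q. (norm (c i))\<^sup>2)"
  unfolding of_real_diff[symmetric] of_real_eq_iff .
 moreover have "0 <= (\<Sum>j\<in>V. \<Phi> j * (norm ((y - z) j))\<^sup>2)" using assms(3) by (intro sum_nonneg) simp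
 ultimately show ?thesis by (simp add: c_def)
qed

section \<open>Rademacher averages\<close>

text \<open>
 The expectation of \<open>F (z + \<Sum> \<plusminus> v)\<close> over independent signs; the recursion averages out one sign at a time, which is the form in which all the estimates are proved.
\<close>

fun rav :: "('a::ab_group_add => real) => 'a list => 'a => real" where
 "rav F [] z = F z"
| "rav F (v # vs) z = (rav F vs (z + v) + rav F vs (z - v)) / 2"

lemma rav_mono_on:
 assumes "!!x. x \<in> E ==> F x <= G x" "!!x y. x \<in> E ==> y \<in> E ==> x + y \<in> E" "!!x y. x \<in> E ==> y \<in> E ==> x - y \<in> E"
  "set vs \<subseteq> E" "z \<in> E"
 shows "rav F vs z <= rav G vs z"
 using assms(4,5)
proof (induction vs arbitrary: z)
 case (Cons v vs)
 have "rav F vs (z + v) <= rav G vs (z + v)" "rav F vs (z - v) <= rav G vs (z - v)"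
  using Cons assms(2,3) by auto
 then show ?case by simp
qed (use assms(1) in auto)

lemma rav_mono: "(!!x. F x <= G x) ==> rav F vs z <= rav G vs z"
 by (rule rav_mono_on[where E=UNIV]) auto

lemma rav_add: "rav (%x. F x + G x) vs z = rav F vs z + rav G vs z"
 by (induction vs arbitrary: z) (auto simp: field_simps)

lemma rav_cmult: "rav (%x. c * F x) vs z = c * rav F vs z"
 by (induction vs arbitrary: z) (auto simp: field_simps)

lemma rav_const: "rav (%x. c) vs z = c"
 by (induction vs arbitrary: z) auto

lemma rav_sum: "rav (%x. \<Sum>j\<in>J. F j x) vs z = (\<Sum>j\<in>J. rav (F j) vs z)"
 by (induction vs arbitrary: z) (auto simp: sum.distrib simp flip: sum_divide_distrib)

lemma rav_map_on:
 assumes "!!x y. x \<in> E ==> y \<in> E ==> x + y \<in> E \<and> x - y \<in> E \<and> L (x + y) = L x + L y \<and> L (x - y) = L x - L y"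
  "set vs \<subseteq> E" "z \<in> E"
 shows "rav (%x. F (L x)) vs z = rav F (map L vs) (L z)"
 using assms(2,3) by (induction vs arbitrary: z) (use assms(1) in auto)

lemma two_point_smooth:
 fixes m :: real
 assumes "1 <= m"
 shows "\<exists>C\<ge>0. \<forall>d. 0 <= d \<and> d <= 1 --> ((1 + d) powr m + (1 - d) powr m) / 2 <= 1 + C * d\<^sup>2"
proof (intro exI[of _ "m\<^sup>2 * exp m / 2"] conjI allI impI)
 fix d :: real assume d: "0 <= d \<and> d <= 1"
 have le: "(1 + x) powr m <= exp (m * x)" if "- 1 <= x" for x :: real
 proof (cases "x = - 1")
  case False
  then have "ln (1 + x) <= x" using that ln_add_one_self_le_self2[of x] by simp
  then show ?thesis using that False assms by (simp add: powr_def)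
 qed simp
 define t where "t = m * d"
 have t: "0 <= t" "t <= m" using d assms by (auto simp: t_def mult_left_le)
 have "exp t - 1 <= t * exp t"
 proof -
  have "exp (- t) >= 1 - t" using exp_ge_add_one_self[of "- t"] by simp
  then have "exp t * (1 - exp (- t)) <= exp t * t" by (intro mult_left_mono) auto
  then show ?thesis by (simp add: right_diff_distrib mult.commute flip: exp_add)
 qed
 then have "(exp t - 1)\<^sup>2 <= (t * exp t)\<^sup>2" using t by (intro power_mono) auto
 then have "exp (- t) * (exp t - 1)\<^sup>2 <= exp (- t) * (t * exp t)\<^sup>2" by (intro mult_left_mono) auto
 moreover have "exp (- t) * (exp t - 1)\<^sup>2 = exp t + exp (- t) - 2"
  by (simp add: power2_eq_square algebra_simps exp_minus)
 moreover have "exp (- t) * (t * exp t)\<^sup>2 = t\<^sup>2 * exp t"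
  by (simp add: power2_eq_square algebra_simps exp_minus)
 moreover have "t\<^sup>2 * exp t <= t\<^sup>2 * exp m" using t by (intro mult_left_mono) auto
 ultimately have "exp t + exp (- t) <= 2 + t\<^sup>2 * exp m" by linarith
 moreover have "(1 + d) powr m + (1 - d) powr m <= exp t + exp (- t)"
  using le[of d] le[of "- d"] d by (simp add: t_def)
 ultimately show "((1 + d) powr m + (1 - d) powr m) / 2 <= 1 + m\<^sup>2 * exp m / 2 * d\<^sup>2"
  by (simp add: t_def power_mult_distrib algebra_simps)
qed simp

text \<open>
 One sign at a time: \<open>two_point_smooth\<close> applied to the squared norm shows that averaging over \<open>\<plusminus> v\<close> costs at most \<open>C \<bar>v\<bar>^2\<close> inside the power.
\<close>

lemma khintchine_upper:
 assumes "2 <= s"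
 shows "\<exists>C\<ge>1. \<forall>(vs :: 'a::real_inner list) z.
  rav (%x. norm x powr s) vs z <= ((norm z)\<^sup>2 + C * (\<Sum>v\<leftarrow>vs. (norm v)\<^sup>2)) powr (s / 2)"
proof -
 define m where "m = s / 2"
 have m: "1 <= m" using assms by (simp add: m_def)
 obtain C0 where C0: "C0 >= 0" "!!d. 0 <= d ==> d <= 1 ==> ((1 + d) powr m + (1 - d) powr m) / 2 <= 1 + C0 * d\<^sup>2"
  using two_point_smooth[OF m] by blast
 define C where "C = 1 + 4 * C0"
 have step: "(((norm (z + v))\<^sup>2 + \<sigma>) powr m + ((norm (z - v))\<^sup>2 + \<sigma>) powr m) / 2 <= ((norm z)\<^sup>2 + C * (norm v)\<^sup>2 + \<sigma>) powr m"
  if \<sigma>: "0 <= \<sigma>" for z v :: 'a and \<sigma>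
 proof -
  define S t where "S = (norm z)\<^sup>2 + (norm v)\<^sup>2 + \<sigma>" and "t = 2 * (z \<bullet> v)"
  have S0: "0 <= S" using \<sigma> by (simp add: S_def)
  have e1: "(norm (z + v))\<^sup>2 + \<sigma> = S + t" "(norm (z - v))\<^sup>2 + \<sigma> = S - t"
   unfolding S_def t_def power2_norm_eq_inner by (simp_all add: inner_simps inner_commute algebra_simps)
  have tv: "\<bar>t\<bar> <= 2 * (norm z * norm v)" unfolding t_def using Cauchy_Schwarz_ineq2[of z v] by simp
  also have "\<dots> <= (norm z)\<^sup>2 + (norm v)\<^sup>2" using sum_squares_bound[of "norm z" "norm v"] by simp
  finally have tS: "\<bar>t\<bar> <= S" using \<sigma> by (simp add: S_def)
  have t2: "t\<^sup>2 <= 4 * S * (norm v)\<^sup>2"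
  proof -
   have "t\<^sup>2 <= (2 * (norm z * norm v))\<^sup>2" using tv by (metis abs_ge_zero power2_abs power_mono)
   also have "\<dots> = 4 * (norm z)\<^sup>2 * (norm v)\<^sup>2" by (simp add: power_mult_distrib)
   also have "\<dots> <= 4 * S * (norm v)\<^sup>2" using \<sigma> by (intro mult_right_mono) (auto simp: S_def)
   finally show ?thesis .
  qed
  show ?thesis
  proof (cases "S = 0")
   case True
   then have "(norm z)\<^sup>2 = 0" "(norm v)\<^sup>2 = 0" "\<sigma> = 0" using \<sigma> by (auto simp: S_def add_nonneg_eq_0_iff)
   then show ?thesis by simp
  next
   case False
   then have Sp: "S > 0" using S0 by simp
   define d where "d = \<bar>t\<bar> / S"
   have d: "0 <= d" "d <= 1" using tS Sp by (auto simp: d_def)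
   have "(S + t) powr m + (S - t) powr m = (S + \<bar>t\<bar>) powr m + (S - \<bar>t\<bar>) powr m" by (auto simp: abs_if)
   also have "\<dots> = S powr m * ((1 + d) powr m + (1 - d) powr m)"
   proof -
    have e: "S + \<bar>t\<bar> = S * (1 + d)" "S - \<bar>t\<bar> = S * (1 - d)" using Sp by (auto simp: d_def field_simps)
    have "(S * (1 + d)) powr m = S powr m * (1 + d) powr m" "(S * (1 - d)) powr m = S powr m * (1 - d) powr m"
     using Sp d by (simp_all add: powr_mult)
    then show ?thesis unfolding e by (simp only: distrib_left)
   qed
   finally have "((S + t) powr m + (S - t) powr m) / 2 = S powr m * (((1 + d) powr m + (1 - d) powr m) / 2)" by simp
   also have "\<dots> <= S powr m * (1 + C0 * d\<^sup>2)" using C0(2)[OF d] by (intro mult_left_mono) auto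
   also have "\<dots> <= S powr m * (1 + C0 * d\<^sup>2) powr m"
   proof -
    have "1 + C0 * d\<^sup>2 >= 1" using C0(1) by simp
    then have "(1 + C0 * d\<^sup>2) powr 1 <= (1 + C0 * d\<^sup>2) powr m" by (intro powr_mono m) auto
    then show ?thesis using \<open>1 + C0 * d\<^sup>2 >= 1\<close> by (intro mult_left_mono) auto
   qed
   also have "\<dots> = (S * (1 + C0 * d\<^sup>2)) powr m" using Sp C0(1) by (simp add: powr_mult)
   also have "\<dots> <= (S + 4 * C0 * (norm v)\<^sup>2) powr m"
   proof (rule powr_mono2)
    have "S * d\<^sup>2 = t\<^sup>2 / S" using Sp by (simp add: d_def power_divide power2_eq_square)
    also have "\<dots> <= 4 * (norm v)\<^sup>2" using t2 Sp by (simp add: pos_divide_le_eq mult_ac)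
    finally have "C0 * (S * d\<^sup>2) <= C0 * (4 * (norm v)\<^sup>2)" using C0(1) by (rule mult_left_mono)
    then show "S * (1 + C0 * d\<^sup>2) <= S + 4 * C0 * (norm v)\<^sup>2" by (simp add: algebra_simps)
   qed (use m Sp C0 in auto)
   also have "S + 4 * C0 * (norm v)\<^sup>2 = (norm z)\<^sup>2 + C * (norm v)\<^sup>2 + \<sigma>" by (simp add: S_def C_def algebra_simps)
   finally show ?thesis unfolding e1 .
  qed
 qed
 have C1: "C >= 1" using C0(1) by (simp add: C_def)
 have "rav (%x. norm x powr s) vs z <= ((norm z)\<^sup>2 + C * (\<Sum>v\<leftarrow>vs. (norm v)\<^sup>2)) powr m" for vs :: "'a list" and z
 proof (induction vs arbitrary: z)
  case Nil
  have "norm z powr s = (norm z powr 2) powr m" unfolding powr_powr by (simp add: m_def)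
  also have "norm z powr 2 = (norm z)\<^sup>2" by (simp add: powr_numeral)
  finally show ?case by simp
 next
  case (Cons v vs)
  have "0 <= C * (\<Sum>v\<leftarrow>vs. (norm v)\<^sup>2)" using C1 by (intro mult_nonneg_nonneg sum_list_nonneg) auto
  from step[OF this, of z v] Cons[of "z + v"] Cons[of "z - v"]
  show ?case by (simp add: algebra_simps)
 qed
 then show ?thesis using C1 by (auto simp: m_def)
qed

lemma rav_norm_square:
 "rav (%x. (norm x)\<^sup>2) vs (z :: 'a::real_inner) = (norm z)\<^sup>2 + (\<Sum>v\<leftarrow>vs. (norm v)\<^sup>2)"
proof (induction vs arbitrary: z)
 case (Cons v vs)
 have "(norm (z + v))\<^sup>2 + (norm (z - v))\<^sup>2 = 2 * (norm z)\<^sup>2 + 2 * (norm v)\<^sup>2"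
  unfolding power2_norm_eq_inner by (simp add: inner_simps inner_commute)
 then show ?case using Cons by simp
qed simp

text \<open>
 Interpolation between the known second moment and the bound for the fourth moment, through \<open>u^2 \<le> K^(2 - p) u^p + u^4 / K^2\<close>.
\<close>

lemma khintchine_lower:
 assumes "0 < p" "p < 2"
 shows "\<exists>c>0. \<forall>(vs :: 'a::real_inner list). c * (\<Sum>v\<leftarrow>vs. (norm v)\<^sup>2) powr (p / 2) <= rav (%x. norm x powr p) vs 0"
proof -
 obtain C where C: "C >= 1" "!!(vs :: 'a list) z. rav (%x. norm x powr 4) vs z <= ((norm z)\<^sup>2 + C * (\<Sum>v\<leftarrow>vs. (norm v)\<^sup>2)) powr 2"
  using khintchine_upper[of 4, where 'a='a] by auto
 define c where "c = (2 * C) powr (p - 2) / 2"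
 have "c * (\<Sum>v\<leftarrow>vs. (norm v)\<^sup>2) powr (p / 2) <= rav (%x. norm x powr p) vs 0" for vs :: "'a list"
 proof -
  define A where "A = (\<Sum>v\<leftarrow>vs. (norm v)\<^sup>2)"
  have A0: "A >= 0" unfolding A_def by (intro sum_list_nonneg) auto
  show ?thesis
  proof (cases "A = 0")
   case True
   have "rav (%x. 0) vs 0 <= rav (%x. norm x powr p) vs 0" by (rule rav_mono) simp
   then show ?thesis using True by (simp add: A_def rav_const)
  next
   case False
   then have Ap: "A > 0" using A0 by simp
   define K where "K = 2 * C * sqrt A"
   have K: "K > 0" using C(1) Ap by (simp add: K_def)
   have K2: "K\<^sup>2 = 4 * C\<^sup>2 * A" using Ap by (simp add: K_def power_mult_distrib)
   have pw: "u\<^sup>2 <= K powr (2 - p) * u powr p + (1 / K\<^sup>2) * u powr 4" if u: "u >= 0" for u :: real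
   proof (cases "u <= K")
    case True
    have "u\<^sup>2 = u powr (2 - p) * u powr p" using u by (cases "u = 0") (auto simp flip: powr_add)
    also have "\<dots> <= K powr (2 - p) * u powr p" using True u assms by (intro mult_right_mono powr_mono2) auto
    finally show ?thesis by (simp add: add_increasing2)
   next
    case False
    then have "K\<^sup>2 <= u\<^sup>2" using K by (intro power_mono) auto
    then have "K\<^sup>2 * u\<^sup>2 <= u\<^sup>2 * u\<^sup>2" by (intro mult_right_mono) auto
    moreover have "u powr 4 = u\<^sup>2 * u\<^sup>2" using u by (simp add: power_add[symmetric])
    ultimately have "u\<^sup>2 <= (1 / K\<^sup>2) * u powr 4" using K by (simp add: field_simps)
    then show ?thesis by (simp add: add_increasing)
   qed
   have "A = rav (%x. (norm x)\<^sup>2) vs (0 :: 'a)" by (simp add: rav_norm_square A_def)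
   also have "\<dots> <= rav (%x. K powr (2 - p) * norm x powr p + (1 / K\<^sup>2) * norm x powr 4) vs 0"
    by (rule rav_mono) (rule pw, simp)
   also have "\<dots> = K powr (2 - p) * rav (%x. norm x powr p) vs 0 + (1 / K\<^sup>2) * rav (%x. norm x powr 4) vs 0"
    by (simp only: rav_add rav_cmult)
   also have "(1 / K\<^sup>2) * rav (%x. norm x powr 4) vs 0 <= (1 / K\<^sup>2) * (C * A)\<^sup>2"
    using C(2)[of vs 0] C(1) A0 by (intro mult_left_mono) (auto simp: A_def powr_numeral)
   also have "(1 / K\<^sup>2) * (C * A)\<^sup>2 = A / 4"
    unfolding K2 using C(1) Ap by (simp add: power2_eq_square)
   finally have le: "A / 2 <= K powr (2 - p) * rav (%x. norm x powr p) vs 0" using Ap by simp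
   have "c * A powr (p / 2) = K powr (p - 2) * (A / 2)"
   proof -
    have "K powr (p - 2) = (2 * C) powr (p - 2) * (sqrt A) powr (p - 2)" using C(1) Ap by (simp add: K_def powr_mult)
    also have "(sqrt A) powr (p - 2) = A powr (p / 2 - 1)" using Ap by (simp add: powr_half_sqrt[symmetric] powr_powr field_simps)
    also have "\<dots> = A powr (p / 2) / A" using Ap by (simp add: powr_diff)
    finally show ?thesis using Ap by (simp add: c_def)
   qed
   also have "\<dots> <= K powr (p - 2) * (K powr (2 - p) * rav (%x. norm x powr p) vs 0)" by (intro mult_left_mono le) auto
   also have "\<dots> = rav (%x. norm x powr p) vs 0" using K by (simp flip: powr_add mult.assoc)
   finally show ?thesis by (simp add: A_def)
  qed
 qed
 moreover have "c > 0" using C(1) by (simp add: c_def)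
 ultimately show ?thesis by blast
qed

text \<open>
 Minkowski's inequality in \<open>\<ell>\<^sub>s\<close> with \<open>s = q / r \<ge> 1\<close>, applied to the vectors \<open>(a\<^sub>i\<^sub>j^r)\<^sub>j\<close>.
\<close>

lemma mixed_Minkowski:
 fixes a :: "'i => nat => real"
 assumes "0 < r" "r <= q" "finite I" "finite J" "!!i j. 0 <= a i j"
 shows "(\<Sum>j\<in>J. (\<Sum>i\<in>I. a i j powr r) powr (q / r)) <= (\<Sum>i\<in>I. (\<Sum>j\<in>J. a i j powr q) powr (r / q)) powr (q / r)"
proof -
 define s where "s = q / r"
 have s: "1 <= s" "0 < s" using assms by (auto simp: s_def)
 define v where "v i = restr J (%j. a i j powr r)" for i
 have vl: "v i \<in> lp s" for i unfolding v_def by (rule lp_restr_finite(1)[OF s(2) assms(4)])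
 have "sum v I = restr J (%j. \<Sum>i\<in>I. a i j powr r)" unfolding v_def by (auto simp: restr_def sum_fun_apply fun_eq_iff)
 then have 1: "lp_norm s (sum v I) powr s = (\<Sum>j\<in>J. (\<Sum>i\<in>I. a i j powr r) powr s)"
  using lp_restr_finite(2)[OF s(2) assms(4), of "%j. \<Sum>i\<in>I. a i j powr r"] by (simp add: sum_nonneg)
 have 2: "lp_norm s (v i) = (\<Sum>j\<in>J. a i j powr q) powr (r / q)" for i
 proof -
  have "lp_norm s (v i) powr s = (\<Sum>j\<in>J. a i j powr q)"
   unfolding v_def lp_restr_finite(2)[OF s(2) assms(4)] using assms(1) by (simp add: powr_powr s_def)
  then have "(\<Sum>j\<in>J. a i j powr q) powr (1 / s) = lp_norm s (v i)" using s by (metis lp_norm_nonneg powr_inverse_powr(2) less_irrefl)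
  then show ?thesis by (simp add: s_def)
 qed
 have "lp_norm s (sum v I) powr s <= (\<Sum>i\<in>I. lp_norm s (v i)) powr s"
  using lp_sum[OF s(1) assms(3) vl] s by (intro powr_mono2) auto
 then show ?thesis unfolding 1 2 by (simp add: s_def)
qed

section \<open>Square functions and change of density\<close>

lemma tangent_powr:
 fixes a b s :: real
 assumes "1 < s" "0 <= a" "0 <= b"
 shows "a powr s - b powr s <= s * a powr (s - 1) * (a - b)"
proof -
 define t where "t = s / (s - 1)"
 have t: "1 / s + 1 / t = 1" using assms by (simp add: t_def field_simps)
 have "b * a powr (s - 1) <= b powr s / s + (a powr (s - 1)) powr t / t"
  by (rule Young_powr[OF assms(1) t]) (use assms in auto)
 also have "(a powr (s - 1)) powr t = a powr s" using assms(1) by (simp add: powr_powr t_def)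
 finally have "s * (b * a powr (s - 1)) <= s * (b powr s / s + a powr s / t)" using assms(1) by (intro mult_left_mono) auto
 also have "\<dots> = b powr s + (s - 1) * a powr s" using assms(1) by (simp add: t_def field_simps)
 finally have 1: "s * b * a powr (s - 1) <= b powr s + (s - 1) * a powr s" by (simp add: mult_ac)
 have "a powr (s - 1) * a = a powr s"
 proof (cases "a = 0")
  case False
  have "a powr (s - 1) * a powr 1 = a powr (s - 1 + 1)" by (rule powr_add[symmetric])
  then show ?thesis using assms False by simp
 qed (use assms in simp)
 moreover have "s * a powr (s - 1) * (a - b) = s * (a powr (s - 1) * a) - s * b * a powr (s - 1)" by (simp add: algebra_simps)
 ultimately have eq: "s * a powr (s - 1) * (a - b) = s * a powr s - s * b * a powr (s - 1)" by simp
 show ?thesis unfolding eq using 1 by (simp add: left_diff_distrib)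
qed

text \<open>
 \<open>\<Phi>\<close> is a multiple of \<open>g^(s - 1)\<close> for an almost minimiser \<open>g\<close> of the \<open>\<ell>\<^sub>s\<close> norm on the convex set \<open>G\<close>. Minimality along segments gives the lower bound on \<open>G\<close> and Hoelder's inequality the upper one. Taking only an almost minimiser costs the factor \<open>2\<close>.
\<close>

lemma convex_set_density:
 fixes G :: "(nat => real) set"
 assumes s: "1 < s" and V: "finite V" and ne: "G ~= {}"
  and nn: "!!g j. g \<in> G ==> 0 <= g j" and bd: "!!g j. g \<in> G ==> g j <= B"
  and conv: "!!g g' t. g \<in> G ==> g' \<in> G ==> 0 <= t ==> t <= 1 ==> (%j. (1 - t) * g j + t * g' j) \<in> G"
  and low: "!!g. g \<in> G ==> \<kappa> <= (\<Sum>j\<in>V. g j powr s)" and \<kappa>: "0 < \<kappa>"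
 shows "\<exists>\<Phi>. (\<forall>j. 0 <= \<Phi> j) \<and> (\<forall>g\<in>G. \<kappa> powr (1 / s) / 2 <= (\<Sum>j\<in>V. \<Phi> j * g j)) \<and>
  (\<forall>h. (\<forall>j. 0 <= h j) --> (\<Sum>j\<in>V. \<Phi> j * h j) <= (\<Sum>j\<in>V. h j powr s) powr (1 / s))"
proof -
 define F where "F g = (\<Sum>j\<in>V. g j powr s)" for g :: "nat => real"
 define \<iota> where "\<iota> = Inf (F ` G)"
 have bdd: "bdd_below (F ` G)" using low by (auto simp: F_def bdd_below_def)
 have \<iota>: "\<iota> <= F g" if "g \<in> G" for g unfolding \<iota>_def using that bdd by (intro cInf_lower) auto
 obtain g00 where g00: "g00 \<in> G" using ne by blast
 have B0: "0 <= B" using nn[OF g00, of 0] bd[OF g00, of 0] by linarith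
 define \<omega> where "\<omega> = \<kappa> / (4 * (real (card V) + 1) * (B + 1))"
 have \<omega>: "\<omega> > 0" using \<kappa> B0 by (simp add: \<omega>_def)
 have "uniformly_continuous_on {0..B} (%x. x powr (s - 1))"
  by (intro compact_uniformly_continuous continuous_on_powr') (use s in \<open>auto intro!: continuous_intros\<close>)
 then obtain \<rho> where \<rho>: "\<rho> > 0" "!!x y. x \<in> {0..B} ==> y \<in> {0..B} ==> \<bar>y - x\<bar> < \<rho> ==> \<bar>y powr (s - 1) - x powr (s - 1)\<bar> < \<omega>"
  unfolding uniformly_continuous_on_def dist_real_def using \<omega> by (metis (no_types, lifting))
 define t where "t = min 1 (\<rho> / (2 * (B + 1)))"
 have t: "0 < t" "t <= 1" "t * B < \<rho>"
 proof -
  show "0 < t" "t <= 1" using \<rho>(1) B0 by (auto simp: t_def)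
  have "t * B <= \<rho> / (2 * (B + 1)) * B" using B0 by (intro mult_right_mono) (auto simp: t_def)
  also have "\<dots> <= \<rho> / (2 * (B + 1)) * (B + 1)" using \<rho>(1) B0 by (intro mult_left_mono) auto
  also have "\<dots> = \<rho> / 2"
  proof -
   have "x / (2 * y) * y = x / 2" if "y ~= 0" for x y :: real using that by simp
   then show ?thesis using B0 by (metis add_nonneg_eq_0_iff zero_le_one zero_neq_one)
  qed
  also have "\<dots> < \<rho>" using \<rho>(1) by simp
  finally show "t * B < \<rho>" .
 qed
 define \<eta> where "\<eta> = t * s * \<kappa> / 4"
 have \<eta>: "\<eta> > 0" using t s \<kappa> by (simp add: \<eta>_def)
 obtain g where g: "g \<in> G" "F g < \<iota> + \<eta>"
  using cInf_lessD[of "F ` G" "\<iota> + \<eta>"] ne \<eta> by (auto simp: \<iota>_def)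
 have Fg: "\<kappa> <= F g" using low[OF g(1)] by (simp add: F_def)
 have key: "F g / 2 <= (\<Sum>j\<in>V. g j powr (s - 1) * g' j)" if g': "g' \<in> G" for g'
 proof -
  define k where "k j = (1 - t) * g j + t * g' j" for j
  have kG: "k \<in> G" unfolding k_def by (rule conv[OF g(1) g']) (use t in auto)
  have kd: "k j - g j = t * (g' j - g j)" for j by (simp add: k_def algebra_simps)
  have gB: "g j \<in> {0..B}" "g' j \<in> {0..B}" "k j \<in> {0..B}" for j using nn bd g(1) g' kG by auto
  have dB: "\<bar>g' j - g j\<bar> <= B" for j using gB[of j] by auto
  have "- \<eta> <= F k - F g" using \<iota>[OF kG] g(2) by linarith
  also have "F k - F g = (\<Sum>j\<in>V. k j powr s - g j powr s)" by (simp add: F_def sum_subtractf)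
  also have "\<dots> <= (\<Sum>j\<in>V. s * k j powr (s - 1) * (k j - g j))"
   by (intro sum_mono tangent_powr s) (use gB in auto)
  also have "\<dots> = t * s * (\<Sum>j\<in>V. k j powr (s - 1) * (g' j - g j))"
   by (simp add: kd sum_distrib_left mult_ac)
  also have "- \<eta> = t * s * (- (\<kappa> / 4))" by (simp add: \<eta>_def)
  finally have 1: "- (\<kappa> / 4) <= (\<Sum>j\<in>V. k j powr (s - 1) * (g' j - g j))"
   by (rule mult_left_le_imp_le) (use t s in simp)
  have "(\<Sum>j\<in>V. k j powr (s - 1) * (g' j - g j)) - (\<Sum>j\<in>V. g j powr (s - 1) * (g' j - g j))
   = (\<Sum>j\<in>V. (k j powr (s - 1) - g j powr (s - 1)) * (g' j - g j))"
   by (simp add: sum_subtractf[symmetric] left_diff_distrib)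
  also have "\<dots> <= (\<Sum>j\<in>V. \<omega> * B)"
  proof (rule sum_mono)
   fix j
   have "\<bar>k j - g j\<bar> < \<rho>"
    unfolding kd abs_mult using le_less_trans[OF mult_left_mono[OF dB[of j], of t] t(3)] t(1) by simp
   then have "\<bar>k j powr (s - 1) - g j powr (s - 1)\<bar> <= \<omega>" using \<rho>(2)[OF gB(1) gB(3), of j j] by simp
   then have "\<bar>(k j powr (s - 1) - g j powr (s - 1)) * (g' j - g j)\<bar> <= \<omega> * B"
    unfolding abs_mult using dB \<omega> by (intro mult_mono) auto
   then show "(k j powr (s - 1) - g j powr (s - 1)) * (g' j - g j) <= \<omega> * B" by linarith
  qed
  also have "\<dots> = real (card V) * B * \<omega>" by simp
  also have "\<dots> <= (real (card V) + 1) * (B + 1) * \<omega>" using B0 \<omega> by (intro mult_right_mono mult_mono) auto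
  also have "\<dots> = \<kappa> / 4"
  proof -
   have "x * y * (\<kappa> / (4 * x * y)) = \<kappa> / 4" if "x > 0" "y > 0" for x y :: real using that by simp
   from this[of "real (card V) + 1" "B + 1"] show ?thesis unfolding \<omega>_def using B0 by (simp only: add_nonneg_pos of_nat_0_le_iff zero_less_one)
  qed
  finally have 2: "- (\<kappa> / 2) <= (\<Sum>j\<in>V. g j powr (s - 1) * (g' j - g j))" using 1 by linarith
  have "g j powr (s - 1) * g j = g j powr s" for j
  proof (cases "g j = 0")
   case False
   have "g j powr (s - 1) * g j powr 1 = g j powr (s - 1 + 1)" by (rule powr_add[symmetric])
   then show ?thesis using gB(1)[of j] False by simp
  qed (use s in simp)
  then have "(\<Sum>j\<in>V. g j powr (s - 1) * (g' j - g j)) = (\<Sum>j\<in>V. g j powr (s - 1) * g' j) - F g"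
   by (simp add: right_diff_distrib sum_subtractf F_def)
  then show ?thesis using 2 Fg by linarith
 qed
 define r where "r = s / (s - 1)"
 have r: "1 / s + 1 / r = 1" "1 < r" using s by (auto simp: r_def field_simps)
 define N where "N = F g powr (1 / r)"
 have N: "N > 0" using Fg \<kappa> by (simp add: N_def)
 define \<Phi> where "\<Phi> j = g j powr (s - 1) / N" for j
 show ?thesis
 proof (intro exI[of _ \<Phi>] conjI allI ballI impI)
  show "0 <= \<Phi> j" for j using N by (simp add: \<Phi>_def)
  fix g' assume g': "g' \<in> G"
  have "\<kappa> powr (1 / s) / 2 <= F g powr (1 / s) / 2" using Fg \<kappa> s by (intro divide_right_mono powr_mono2) auto
  also have "F g powr (1 / s) = F g / N"
  proof -
   have "1 / s = 1 - 1 / r" using r by linarith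
   then show ?thesis using Fg \<kappa> by (simp add: N_def powr_diff)
  qed
  also have "F g / N / 2 <= (\<Sum>j\<in>V. g j powr (s - 1) * g' j) / N"
   using divide_right_mono[OF key[OF g'], of N] N by simp
  also have "\<dots> = (\<Sum>j\<in>V. \<Phi> j * g' j)" by (simp add: \<Phi>_def sum_divide_distrib)
  finally show "\<kappa> powr (1 / s) / 2 <= (\<Sum>j\<in>V. \<Phi> j * g' j)" .
 next
  fix h :: "nat => real" assume h: "\<forall>j. 0 <= h j"
  have "(\<Sum>j\<in>V. \<Phi> j * h j) = (\<Sum>j\<in>V. h j * g j powr (s - 1)) / N"
   by (simp add: \<Phi>_def sum_divide_distrib mult.commute)
  also have "(\<Sum>j\<in>V. h j * g j powr (s - 1)) <= (\<Sum>j\<in>V. h j powr s) powr (1 / s) * (\<Sum>j\<in>V. (g j powr (s - 1)) powr r) powr (1 / r)"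
   by (rule Holder_sum[OF s r(1)]) (use h in auto)
  also have "(\<Sum>j\<in>V. (g j powr (s - 1)) powr r) = F g" using s by (simp add: powr_powr r_def F_def)
  finally show "(\<Sum>j\<in>V. \<Phi> j * h j) <= (\<Sum>j\<in>V. h j powr s) powr (1 / s)"
   using N by (simp add: N_def divide_right_mono)
 qed
qed

lemma sum_list_nth_lessThan: "(\<Sum>x\<leftarrow>xs. f x) = (\<Sum>l<length xs. f (xs ! l) :: real)"
 by (simp add: sum_list_sum_nth atLeast0LessThan)

text \<open>
 The squares \<open>\<Sum> \<bar>T x\<bar>^2\<close> over finite families with \<open>\<Sum> \<parallel>x\<parallel>\<^sub>p^2 = 1\<close> form a convex set. Khintchine's inequality in \<open>\<ell>\<^sub>p\<close> (exponent below \<open>2\<close>) and in \<open>\<ell>\<^sub>q\<close> (above \<open>2\<close>) transfers the lower bound of \<open>T\<close> from vectors to square functions, so that this set stays away from \<open>0\<close>. The density from the previous lemma, with \<open>s = q / 2\<close>, makes \<open>T\<close> bounded below into a weighted \<open>\<ell>\<^sub>2\<close> whose norm is at most that of \<open>\<ell>\<^sub>q\<close>.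
\<close>

lemma bounded_below_density:
 fixes T :: "'k::{real_normed_field,euclidean_space} seq_op"
 assumes pq: "1 < p" "p < 2" "2 < q" and T: "T \<in> bounded_ops p q" and d: "0 < d"
 shows "\<exists>c>0. \<forall>E U V. seq.subspace E \<and> finite U \<and> finite V \<and> (\<forall>x\<in>E. restr U x = x) \<and>
  (\<forall>x\<in>E. d * lp_norm p x <= lp_norm q (restr V (T x))) -->
  (\<exists>\<Phi>. (\<forall>j. 0 <= \<Phi> j) \<and> (\<forall>x\<in>E. c * (lp_norm p x)\<^sup>2 <= (\<Sum>j\<in>V. \<Phi> j * (norm (T x j))\<^sup>2)) \<and>
   (\<forall>y. (\<Sum>j\<in>V. \<Phi> j * (norm (y j :: 'k))\<^sup>2) <= (lp_norm q (restr V y))\<^sup>2))"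
proof -
 have pos: "0 < p" "0 < q" "1 <= p" "1 <= q" using pq by auto
 obtain C where C: "C >= 1" "!!(vs :: 'k list) z. rav (%x. norm x powr q) vs z <= ((norm z)\<^sup>2 + C * (\<Sum>v\<leftarrow>vs. (norm v)\<^sup>2)) powr (q / 2)"
  using khintchine_upper[of q, where 'a='k] pq by auto
 obtain c where c: "c > 0" "!!(vs :: 'k list). c * (\<Sum>v\<leftarrow>vs. (norm v)\<^sup>2) powr (p / 2) <= rav (%x. norm x powr p) vs 0"
  using khintchine_lower[OF pos(1) pq(2), where 'a='k] by auto
 obtain D where D: "D > 0" "!!x. x \<in> lp p ==> lp_norm q (T x) <= D * lp_norm p x" using ops_bound[OF T] by metis
 define L where "L = (c / 2) powr (1 / p)"
 have L: "L > 0" "L powr p = c / 2" using c(1) pos by (auto simp: L_def)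
 define \<kappa> where "\<kappa> = d powr q * (c / 2 * L powr (q - p)) / C powr (q / 2)"
 have \<kappa>: "\<kappa> > 0" using d c L C(1) by (simp add: \<kappa>_def)
 define cc where "cc = \<kappa> powr (1 / (q / 2)) / 2"
 have main: "\<exists>\<Phi>. (\<forall>j. 0 <= \<Phi> j) \<and> (\<forall>x\<in>E. cc * (lp_norm p x)\<^sup>2 <= (\<Sum>j\<in>V. \<Phi> j * (norm (T x j))\<^sup>2)) \<and>
   (\<forall>y. (\<Sum>j\<in>V. \<Phi> j * (norm (y j :: 'k))\<^sup>2) <= (lp_norm q (restr V y))\<^sup>2)"
  if E: "seq.subspace E" "finite U" "finite V" "!!x. x \<in> E ==> restr U x = x"
   "!!x. x \<in> E ==> d * lp_norm p x <= lp_norm q (restr V (T x))" for E :: "'k seq set" and U V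
 proof (cases "E = {0}")
  case True
  then show ?thesis by (intro exI[of _ "%_. 0"]) auto
 next
  case False
  then obtain e where e: "e \<in> E" "e ~= 0" using seq.subspace_0[OF E(1)] by blast
  have El: "x \<in> lp p" if "x \<in> E" for x
   by (subst E(4)[OF that, symmetric]) (rule lp_restr_finite(1)[OF pos(1) E(2)])
  have Ecl: "x + y \<in> E \<and> x - y \<in> E" if "x \<in> E" "y \<in> E" for x y
   using seq.subspace_add[OF E(1) that] seq.subspace_diff[OF E(1) that] by blast
  define G where "G = {(%j. \<Sum>x\<leftarrow>xs. (norm (T x j))\<^sup>2) | xs. set xs \<subseteq> E \<and> (\<Sum>x\<leftarrow>xs. (lp_norm p x)\<^sup>2) = 1}"
  have single: "(%j. (norm (T x j))\<^sup>2 / (lp_norm p x)\<^sup>2) \<in> G" if "x \<in> E" "x ~= 0" for x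
  proof -
   have n: "lp_norm p x > 0" by (rule lp_norm_pos[OF El[OF that(1)] pos(1) that(2)])
   define a :: 'k where "a = of_real (1 / lp_norm p x)"
   have a: "norm a = 1 / lp_norm p x" using n by (simp add: a_def norm_divide)
   have "(%j. (norm (T x j))\<^sup>2 / (lp_norm p x)\<^sup>2) = (%j. \<Sum>x\<leftarrow>[seq_scale a x]. (norm (T x j))\<^sup>2)"
    using ops_scale[OF T El[OF that(1)], of a] by (simp add: seq_scale_apply norm_mult a power_divide power_mult_distrib)
   moreover have "(\<Sum>x\<leftarrow>[seq_scale a x]. (lp_norm p x)\<^sup>2) = 1"
    using lp_scale(2)[OF pos(1) El[OF that(1)], of a] a n by simp
   moreover have "set [seq_scale a x] \<subseteq> E" using seq.subspace_scale[OF E(1) that(1)] by simp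
   ultimately show ?thesis unfolding G_def by blast
  qed
  have nn: "0 <= g j" if "g \<in> G" for g j using that by (auto simp: G_def intro!: sum_list_nonneg)
  have bd: "g j <= D\<^sup>2" if gG: "g \<in> G" for g j
  proof -
   obtain xs where xs: "set xs \<subseteq> E" "(\<Sum>x\<leftarrow>xs. (lp_norm p x)\<^sup>2) = 1" "g = (%j. \<Sum>x\<leftarrow>xs. (norm (T x j))\<^sup>2)"
    using gG unfolding G_def by blast
   have "(\<Sum>x\<leftarrow>xs. (norm (T x j))\<^sup>2) <= (\<Sum>x\<leftarrow>xs. D\<^sup>2 * (lp_norm p x)\<^sup>2)"
   proof (rule sum_list_mono)
    fix x assume "x \<in> set xs"
    then have xl: "x \<in> lp p" using xs El by blast
    have "norm (T x j) <= D * lp_norm p x" by (rule order_trans[OF lp_norm_component[OF ops_in[OF T xl] pos(2)] D(2)[OF xl]])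
    then have "(norm (T x j))\<^sup>2 <= (D * lp_norm p x)\<^sup>2" by (intro power_mono) auto
    then show "(norm (T x j))\<^sup>2 <= D\<^sup>2 * (lp_norm p x)\<^sup>2" by (simp add: power_mult_distrib)
   qed
   also have "\<dots> = D\<^sup>2" using xs(2) by (simp add: sum_list_const_mult)
   finally show ?thesis using xs(3) by simp
  qed
  have conv: "(%j. (1 - t) * g j + t * g' j) \<in> G" if g: "g \<in> G" "g' \<in> G" and t: "0 <= t" "t <= 1" for g g' t
  proof -
   obtain xs where xs: "set xs \<subseteq> E" "(\<Sum>x\<leftarrow>xs. (lp_norm p x)\<^sup>2) = 1" "g = (%j. \<Sum>x\<leftarrow>xs. (norm (T x j))\<^sup>2)"
    using g unfolding G_def by blast
   obtain ys where ys: "set ys \<subseteq> E" "(\<Sum>x\<leftarrow>ys. (lp_norm p x)\<^sup>2) = 1" "g' = (%j. \<Sum>x\<leftarrow>ys. (norm (T x j))\<^sup>2)"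
    using g unfolding G_def by blast
   have scale: "(\<Sum>x\<leftarrow>map (seq_scale (of_real (sqrt r))) zs. (norm (T x j))\<^sup>2) = r * (\<Sum>x\<leftarrow>zs. (norm (T x j))\<^sup>2)"
    "(\<Sum>x\<leftarrow>map (seq_scale (of_real (sqrt r))) zs. (lp_norm p x)\<^sup>2) = r * (\<Sum>x\<leftarrow>zs. (lp_norm p x)\<^sup>2)"
    "set (map (seq_scale (of_real (sqrt r))) zs) \<subseteq> E" if r: "0 <= r" and zs: "set zs \<subseteq> E" for r zs j
   proof -
    have sc: "(norm (T (seq_scale (of_real (sqrt r)) x) j))\<^sup>2 = r * (norm (T x j))\<^sup>2"
     "(lp_norm p (seq_scale (of_real (sqrt r) :: 'k) x))\<^sup>2 = r * (lp_norm p x)\<^sup>2" if "x \<in> E" for x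
     using ops_scale[OF T El[OF that]] lp_scale(2)[OF pos(1) El[OF that]] r
     by (simp_all add: seq_scale_apply norm_mult power_mult_distrib)
    show "(\<Sum>x\<leftarrow>map (seq_scale (of_real (sqrt r))) zs. (norm (T x j))\<^sup>2) = r * (\<Sum>x\<leftarrow>zs. (norm (T x j))\<^sup>2)"
     using zs by (induction zs) (auto simp: sc algebra_simps)
    show "(\<Sum>x\<leftarrow>map (seq_scale (of_real (sqrt r))) zs. (lp_norm p x)\<^sup>2) = r * (\<Sum>x\<leftarrow>zs. (lp_norm p x)\<^sup>2)"
     using zs by (induction zs) (auto simp: sc algebra_simps)
    show "set (map (seq_scale (of_real (sqrt r))) zs) \<subseteq> E"
     using zs seq.subspace_scale[OF E(1)] by auto
   qed
   define ws where "ws = map (seq_scale (of_real (sqrt (1 - t)))) xs @ map (seq_scale (of_real (sqrt t))) ys"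
   have t': "0 <= 1 - t" using t by simp
   have 1: "(%j. (1 - t) * g j + t * g' j) = (%j. \<Sum>x\<leftarrow>ws. (norm (T x j))\<^sup>2)"
    unfolding ws_def map_append sum_list_append scale(1)[OF t' xs(1)] scale(1)[OF t(1) ys(1)] xs(3) ys(3) ..
   have 2: "(\<Sum>x\<leftarrow>ws. (lp_norm p x)\<^sup>2) = 1"
    unfolding ws_def map_append sum_list_append scale(2)[OF t' xs(1)] scale(2)[OF t(1) ys(1)] xs(2) ys(2) by simp
   have 3: "set ws \<subseteq> E" unfolding ws_def set_append using scale(3)[OF t' xs(1)] scale(3)[OF t(1) ys(1)] by blast
   show ?thesis unfolding G_def using 1 2 3 by blast
  qed
  have low: "\<kappa> <= (\<Sum>j\<in>V. g j powr (q / 2))" if gG: "g \<in> G" for g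
  proof -
   obtain xs where xs: "set xs \<subseteq> E" "(\<Sum>x\<leftarrow>xs. (lp_norm p x)\<^sup>2) = 1" "g = (%j. \<Sum>x\<leftarrow>xs. (norm (T x j))\<^sup>2)"
    using gG unfolding G_def by blast
   have zE: "0 \<in> E" by (rule seq.subspace_0[OF E(1)])
   define I where "I = {..<length xs}"
   \<comment> \<open>lower square function estimate in the domain\<close>
   have "1 <= (\<Sum>i\<in>U. (\<Sum>x\<leftarrow>xs. (norm (x i))\<^sup>2) powr (p / 2))"
   proof -
    have "(\<Sum>l\<in>I. (\<Sum>i\<in>U. norm ((xs ! l) i) powr p) powr (2 / p)) <= (\<Sum>i\<in>U. (\<Sum>l\<in>I. norm ((xs ! l) i) powr 2) powr (p / 2)) powr (2 / p)"
     by (rule mixed_Minkowski[where a="%i l. norm ((xs ! l) i)"]) (use pq E(2) in \<open>auto simp: I_def\<close>)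
    moreover have "(\<Sum>i\<in>U. norm ((xs ! l) i) powr p) powr (2 / p) = (lp_norm p (xs ! l))\<^sup>2" if "l \<in> I" for l
    proof -
     have "xs ! l \<in> E" using xs(1) that by (auto simp: I_def)
     then have "(\<Sum>i\<in>U. norm ((xs ! l) i) powr p) = lp_norm p (xs ! l) powr p"
      using lp_restr_finite(2)[OF pos(1) E(2), of "xs ! l"] E(4) by simp
     then show ?thesis using pos by (simp add: powr_powr powr_numeral)
    qed
    ultimately have "(\<Sum>l\<in>I. (lp_norm p (xs ! l))\<^sup>2) <= (\<Sum>i\<in>U. (\<Sum>l\<in>I. norm ((xs ! l) i) powr 2) powr (p / 2)) powr (2 / p)" by simp
    then have "1 powr (2 / p) <= (\<Sum>i\<in>U. (\<Sum>x\<leftarrow>xs. (norm (x i))\<^sup>2) powr (p / 2)) powr (2 / p)"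
     using xs(2) by (simp add: sum_list_nth_lessThan I_def powr_numeral)
    then show ?thesis by (rule le_powr_cancel) (use pos in \<open>auto intro: sum_nonneg\<close>)
   qed
   then have "c <= c * (\<Sum>i\<in>U. (\<Sum>x\<leftarrow>xs. (norm (x i))\<^sup>2) powr (p / 2))" using c(1) by simp
   also have "\<dots> = (\<Sum>i\<in>U. c * (\<Sum>v\<leftarrow>map (%x. x i) xs. (norm v)\<^sup>2) powr (p / 2))"
    by (simp add: sum_distrib_left comp_def)
   also have "\<dots> <= (\<Sum>i\<in>U. rav (%x. norm x powr p) (map (%x. x i) xs) 0)" by (intro sum_mono c(2))
   also have "\<dots> = (\<Sum>i\<in>U. rav (%x. norm (x i) powr p) xs 0)"
   proof (intro sum.cong refl)
    fix i
    have "rav (%x. norm (x i) powr p) xs 0 = rav (%x. norm x powr p) (map (%x. x i) xs) ((0 :: 'k seq) i)"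
     by (rule rav_map_on[where E=UNIV]) auto
    then show "rav (%x. norm x powr p) (map (%x. x i) xs) 0 = rav (%x. norm (x i) powr p) xs 0"
     unfolding zero_fun_apply by (rule sym)
   qed
   also have "\<dots> = rav (%x. \<Sum>i\<in>U. norm (x i) powr p) xs 0" by (simp add: rav_sum)
   also have "\<dots> <= rav (%x. lp_norm p x powr p) xs 0"
   proof (rule rav_mono_on[where E=E])
    show "(\<Sum>i\<in>U. norm (x i) powr p) <= lp_norm p x powr p" if "x \<in> E" for x
     by (rule lp_sum_le[OF El[OF that] pos(1) E(2)])
   qed (use Ecl xs zE in auto)
   also have "\<dots> <= rav (%x. c / 2 + L powr (p - q) * lp_norm p x powr q) xs 0"
   proof (rule rav_mono)
    fix x :: "'k seq"
    show "lp_norm p x powr p <= c / 2 + L powr (p - q) * lp_norm p x powr q"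
    proof (cases "lp_norm p x <= L")
     case True
     then have "lp_norm p x powr p <= L powr p" using pos by (intro powr_mono2) auto
     then show ?thesis using L by (simp add: add_increasing2)
    next
     case False
     then have "lp_norm p x powr (p - q) <= L powr (p - q)" using L pq by (intro powr_mono2') auto
     then have "lp_norm p x powr (p - q) * lp_norm p x powr q <= L powr (p - q) * lp_norm p x powr q" by (rule mult_right_mono) simp
     then show ?thesis using c(1) by (simp add: add_increasing flip: powr_add)
    qed
   qed
   also have "\<dots> = c / 2 + L powr (p - q) * rav (%x. lp_norm p x powr q) xs 0" by (simp only: rav_add rav_cmult rav_const)
   finally have "c / 2 <= L powr (p - q) * rav (%x. lp_norm p x powr q) xs 0" by simp
   then have "L powr (q - p) * (c / 2) <= L powr (q - p) * (L powr (p - q) * rav (%x. lp_norm p x powr q) xs 0)" by (rule mult_left_mono) simp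
   also have "\<dots> = rav (%x. lp_norm p x powr q) xs 0" using L by (simp flip: mult.assoc powr_add)
   finally have 1: "c / 2 * L powr (q - p) <= rav (%x. lp_norm p x powr q) xs 0" by (simp add: mult.commute)
   \<comment> \<open>transfer through the lower bound of the operator\<close>
   have "d powr q * (c / 2 * L powr (q - p)) <= d powr q * rav (%x. lp_norm p x powr q) xs 0" using 1 by (rule mult_left_mono) simp
   also have "\<dots> = rav (%x. d powr q * lp_norm p x powr q) xs 0" by (simp only: rav_cmult)
   also have "\<dots> <= rav (%x. \<Sum>j\<in>V. norm (T x j) powr q) xs 0"
   proof (rule rav_mono_on[where E=E])
    fix x assume "x \<in> E"
    then have "(d * lp_norm p x) powr q <= lp_norm q (restr V (T x)) powr q" using E(5) d pos by (intro powr_mono2) auto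
    then show "d powr q * lp_norm p x powr q <= (\<Sum>j\<in>V. norm (T x j) powr q)"
     using d unfolding lp_restr_finite(2)[OF pos(2) E(3)] by (simp add: powr_mult)
   qed (use Ecl xs zE in auto)
   also have "\<dots> = (\<Sum>j\<in>V. rav (%x. norm x powr q) (map (%x. T x j) xs) (T 0 j))"
    unfolding rav_sum
   proof (intro sum.cong refl)
    fix j
    show "rav (%x. norm (T x j) powr q) xs 0 = rav (%x. norm x powr q) (map (%x. T x j) xs) (T 0 j)"
    proof (rule rav_map_on[where E=E and L="%x. T x j" and z="0 :: 'k seq"])
     fix x y assume xy: "x \<in> E" "y \<in> E"
     show "x + y \<in> E \<and> x - y \<in> E \<and> T (x + y) j = T x j + T y j \<and> T (x - y) j = T x j - T y j"
      using Ecl[OF xy] ops_add[OF T El[OF xy(1)] El[OF xy(2)]] ops_diff[OF T pos(3) El[OF xy(1)] El[OF xy(2)]] by simp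
    next
     show "set xs \<subseteq> E" "0 \<in> E" by (rule xs(1), rule zE)
    qed
   qed
   also have "\<dots> <= (\<Sum>j\<in>V. (C * g j) powr (q / 2))"
   proof (rule sum_mono)
    fix j
    have T0: "T 0 j = 0" using ops_0[OF T] by simp
    show "rav (%x. norm x powr q) (map (%x. T x j) xs) (T 0 j) <= (C * g j) powr (q / 2)"
     using C(2)[of "map (%x. T x j) xs" 0] unfolding T0 xs(3) by (simp add: comp_def)
   qed
   also have "\<dots> = C powr (q / 2) * (\<Sum>j\<in>V. g j powr (q / 2))"
    using C(1) nn[OF gG] by (simp add: powr_mult sum_distrib_left)
   finally show ?thesis using C(1) by (simp add: \<kappa>_def pos_divide_le_eq mult.commute)
  qed
  have "1 < q / 2" using pq by simp
  moreover have "G ~= {}" using single[OF e] by blast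
  ultimately have "\<exists>\<Phi>. (\<forall>j. 0 <= \<Phi> j) \<and> (\<forall>g\<in>G. \<kappa> powr (1 / (q / 2)) / 2 <= (\<Sum>j\<in>V. \<Phi> j * g j)) \<and>
   (\<forall>h. (\<forall>j. 0 <= h j) --> (\<Sum>j\<in>V. \<Phi> j * h j) <= (\<Sum>j\<in>V. h j powr (q / 2)) powr (1 / (q / 2)))"
   using convex_set_density[of "q / 2" V G "D\<^sup>2" \<kappa>] E(3) nn bd conv low \<kappa> by blast
  then obtain \<Phi> where \<Phi>: "!!j. 0 <= \<Phi> j" "!!g. g \<in> G ==> cc <= (\<Sum>j\<in>V. \<Phi> j * g j)"
   "!!h. (!!j. 0 <= h j) ==> (\<Sum>j\<in>V. \<Phi> j * h j) <= (\<Sum>j\<in>V. h j powr (q / 2)) powr (1 / (q / 2))"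
   unfolding cc_def by blast
  have "cc * (lp_norm p x)\<^sup>2 <= (\<Sum>j\<in>V. \<Phi> j * (norm (T x j))\<^sup>2)" if x: "x \<in> E" for x
  proof (cases "x = 0")
   case True
   then show ?thesis using ops_0[OF T] by simp
  next
   case False
   have n: "lp_norm p x > 0" by (rule lp_norm_pos[OF El[OF x] pos(1) False])
   have "cc <= (\<Sum>j\<in>V. \<Phi> j * ((norm (T x j))\<^sup>2 / (lp_norm p x)\<^sup>2))" by (rule \<Phi>(2)[OF single[OF x False]])
   also have "\<dots> = (\<Sum>j\<in>V. \<Phi> j * (norm (T x j))\<^sup>2) / (lp_norm p x)\<^sup>2" by (simp add: sum_divide_distrib)
   finally show ?thesis using n by (simp add: field_simps)
  qed
  moreover have "(\<Sum>j\<in>V. \<Phi> j * (norm (y j))\<^sup>2) <= (lp_norm q (restr V y))\<^sup>2" for y :: "'k seq"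
  proof -
   have "(\<Sum>j\<in>V. \<Phi> j * (norm (y j))\<^sup>2) <= (\<Sum>j\<in>V. ((norm (y j))\<^sup>2) powr (q / 2)) powr (1 / (q / 2))"
    by (rule \<Phi>(3)) simp
   also have "(\<Sum>j\<in>V. ((norm (y j))\<^sup>2) powr (q / 2)) = lp_norm q (restr V y) powr q"
    unfolding lp_restr_finite(2)[OF pos(2) E(3)]
   proof (intro sum.cong refl)
    fix j
    have "((norm (y j))\<^sup>2) powr (q / 2) = (norm (y j) powr 2) powr (q / 2)" by (simp add: powr_numeral)
    then show "((norm (y j))\<^sup>2) powr (q / 2) = norm (y j) powr q" unfolding powr_powr by simp
   qed
   also have "(lp_norm q (restr V y) powr q) powr (1 / (q / 2)) = (lp_norm q (restr V y))\<^sup>2"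
    using pos by (simp add: powr_powr powr_numeral)
   finally show ?thesis .
  qed
  ultimately show ?thesis using \<Phi>(1) by blast
 qed
 have "cc > 0" using \<kappa> by (simp add: cc_def)
 then show ?thesis using main by (intro exI[of _ cc]) blast
qed

lemma lp_norm_2_square: "finite S ==> (lp_norm 2 (restr S x))\<^sup>2 = (\<Sum>i\<in>S. (norm (x i))\<^sup>2)"
 using lp_restr_finite(2)[of 2 S x] by (simp add: powr_numeral)

lemma nonfss_finite_blocks:
 fixes T :: "'k::real_normed_field seq_op"
 assumes pq: "1 < p" "1 <= q" and T: "T \<in> bounded_ops p q" "T \<notin> fss_ops p q"
 shows "\<exists>d>0. \<forall>n m. \<exists>N E. dim_ge p n E \<and>
  (\<forall>x\<in>E. restr {m..<N} x = x \<and> d * lp_norm p x <= lp_norm q (restr {m..<N} (T x)))"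
proof -
 have pos: "0 < p" "0 < q" "1 <= p" using pq by auto
 obtain e where e: "e > 0" "!!n. \<exists>E. dim_ge p n E \<and> (\<forall>x\<in>E. x ~= 0 --> e * lp_norm p x < lp_norm q (T x))"
 proof -
  have "\<not> (\<forall>e>0. \<exists>n. \<forall>E. dim_ge p n E --> (\<exists>x\<in>E. x ~= 0 \<and> lp_norm q (T x) <= e * lp_norm p x))"
   using T unfolding fss_ops_iff[OF pos(3) pq(2)] by simp
  then obtain e where e: "e > 0" "!!n. \<not> (\<forall>E. dim_ge p n E --> (\<exists>x\<in>E. x ~= 0 \<and> lp_norm q (T x) <= e * lp_norm p x))"
   by auto
  have "\<exists>E. dim_ge p n E \<and> (\<forall>x\<in>E. x ~= 0 --> e * lp_norm p x < lp_norm q (T x))" for n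
  proof -
   obtain E where E: "dim_ge p n E" "\<not> (\<exists>x\<in>E. x ~= 0 \<and> lp_norm q (T x) <= e * lp_norm p x)" using e(2)[of n] by blast
   have "e * lp_norm p x < lp_norm q (T x)" if "x \<in> E" "x ~= 0" for x
   proof -
    have "\<not> lp_norm q (T x) <= e * lp_norm p x" using E(2) that by blast
    then show ?thesis by simp
   qed
   then show ?thesis using E(1) by (intro exI[of _ E] conjI ballI impI)
  qed
  from that[OF e(1) this] show thesis .
 qed
 obtain D where D: "D > 0" "!!x. x \<in> lp p ==> lp_norm q (T x) <= D * lp_norm p x" using ops_bound[OF T(1)] by metis
 have "\<exists>N E. dim_ge p n E \<and> (\<forall>x\<in>E. restr {m..<N} x = x \<and> e / 4 * lp_norm p x <= lp_norm q (restr {m..<N} (T x)))" for n m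
 proof -
  from e(2)[of "(n + m) + m"]
  obtain E0 where E0: "dim_ge p ((n + m) + m) E0" "\<forall>x\<in>E0. x ~= 0 --> e * lp_norm p x < lp_norm q (T x)"
   by (elim exE conjE)
  let ?C = "(%i x. x i :: 'k) ` {..<m}"
  have cC: "card ?C <= m" using card_image_le[of "{..<m}" "%i x. x i :: 'k"] by simp
  define E1 where "E1 = {x \<in> E0. \<forall>g\<in>?C. g x = 0}"
  have E1: "dim_ge p (n + m) E1" unfolding E1_def
   by (rule dim_ge_ker[OF E0(1)]) (use cC lin_fun_coord in auto)
  from uniform_tail_subspace[OF pq(1) E1]
  obtain F where F: "F \<subseteq> E1" "dim_ge p (n + m) F" "\<forall>e>0. \<exists>M. \<forall>x\<in>F. lp_norm p (restr {M..} x) <= e * lp_norm p x"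
   by (elim exE conjE)
  define \<tau> where "\<tau> = min (1 / 2) (e / (4 * D))"
  have \<tau>: "\<tau> > 0" "\<tau> <= 1 / 2" "D * \<tau> <= e / 4"
  proof -
   have "D * \<tau> <= D * (e / (4 * D))" using D(1) by (intro mult_left_mono) (auto simp: \<tau>_def)
   then show "D * \<tau> <= e / 4" using D(1) by simp
  qed (use e(1) D(1) in \<open>auto simp: \<tau>_def\<close>)
  obtain M where M: "!!x. x \<in> F ==> lp_norm p (restr {M..} x) <= \<tau> * lp_norm p x"
   using F(3)[rule_format, OF \<tau>(1)] by blast
  have Fl: "x \<in> lp p" if "x \<in> F" for x using that dim_ge_lp[OF F(2)] by blast
  have Pin: "(proj p {..<M} :: 'k seq_op) \<in> bounded_ops p p" using pos by (intro proj_bounded_ops) auto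
  have Px: "proj p {..<M} x = restr {..<M} x" if "x \<in> F" for x using Fl[OF that] by (simp add: proj_def)
  define F' where "F' = proj p {..<M} ` F"
  have F': "dim_ge p (n + m) F'" unfolding F'_def
  proof (rule dim_ge_image[OF Pin F(2)])
   fix x assume x: "x \<in> F" "proj p {..<M} x = 0"
   then have "restr {..<M} x = 0" using Px by simp
   moreover have "x = restr {..<M} x + restr {M..} x" by (auto simp: restr_def fun_eq_iff)
   ultimately have "x = restr {M..} x" by simp
   then have "lp_norm p x <= \<tau> * lp_norm p x" using M[OF x(1)] by simp
   also have "\<dots> <= 1 / 2 * lp_norm p x" using \<tau> by (intro mult_right_mono) auto
   finally have "lp_norm p x = 0" using lp_norm_nonneg[of p x] by linarith
   then show "x = 0" using lp_norm_eq_0[OF Fl[OF x(1)] pos(1)] by simp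
  qed
  have supp: "restr {m..<M} x = x" if xF: "x \<in> F'" for x
  proof -
   obtain y where y: "x = restr {..<M} y" "y \<in> F" using xF Px by (auto simp: F'_def)
   have "y i = 0" if "i < m" for i
   proof -
    have "y \<in> E1" using y F(1) by blast
    then show ?thesis using that by (simp add: E1_def)
   qed
   then show ?thesis unfolding y(1) by (auto simp: restr_def fun_eq_iff)
  qed
  have low: "e / 2 * lp_norm p x <= lp_norm q (T x)" if xF: "x \<in> F'" for x
  proof -
   obtain y where y: "x = restr {..<M} y" "y \<in> F" using xF Px by (auto simp: F'_def)
   have yl: "y \<in> lp p" using Fl y by blast
   have rl: "restr S y \<in> lp p" for S by (rule lp_restr(1)[OF pos(1) yl])
   have "y \<in> E0" using y F(1) by (auto simp: E1_def)
   then have yb: "e * lp_norm p y <= lp_norm q (T y)" using E0(2) by (cases "y = 0") (auto simp: less_imp_le)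
   have "y = restr {..<M} y + restr {M..} y" by (auto simp: restr_def fun_eq_iff)
   then have "T y = T x + T (restr {M..} y)" unfolding y(1) using ops_add[OF T(1) rl rl] by metis
   then have "lp_norm q (T y) <= lp_norm q (T x) + lp_norm q (T (restr {M..} y))"
    using lp_add(2)[OF pq(2) ops_in[OF T(1) rl] ops_in[OF T(1) rl]] y(1) by simp
   moreover have "lp_norm q (T (restr {M..} y)) <= e / 4 * lp_norm p y"
   proof -
    have "lp_norm q (T (restr {M..} y)) <= D * lp_norm p (restr {M..} y)" by (rule D(2)[OF rl])
    also have "\<dots> <= D * (\<tau> * lp_norm p y)" using D(1) M[OF y(2)] by (intro mult_left_mono) auto
    also have "\<dots> = D * \<tau> * lp_norm p y" by simp
    also have "\<dots> <= e / 4 * lp_norm p y" using \<tau>(3) by (intro mult_right_mono) auto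
    finally show ?thesis .
   qed
   ultimately have "e * lp_norm p y - e / 4 * lp_norm p y <= lp_norm q (T x)" using yb by linarith
   moreover have "e / 2 * lp_norm p x <= e / 2 * lp_norm p y"
    unfolding y(1) using e(1) lp_restr(2)[OF pos(1) yl] by (intro mult_left_mono) auto
   moreover have "e / 2 * lp_norm p y <= e * lp_norm p y - e / 4 * lp_norm p y"
    using e(1) mult_nonneg_nonneg[of e "lp_norm p y"] by simp
   ultimately show ?thesis by linarith
  qed
  let ?H = "(%i x. T x i) ` {..<m}"
  have cH: "card ?H <= m" using card_image_le[of "{..<m}" "%i x. T x i"] by simp
  have linH: "lin_fun p g" if g: "g \<in> ?H" for g
  proof -
   obtain i where "g = (%x. T x i)" using g by blast
   then show ?thesis using lin_fun_ops[OF T(1) lin_fun_coord[of q i]] by simp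
  qed
  define E where "E = {x \<in> F'. \<forall>g\<in>?H. g x = 0}"
  have E: "dim_ge p n E" unfolding E_def
   by (rule dim_ge_ker[OF F' _ linH]) (use cH in auto)
  have "0 < e / 4" using e(1) by simp
  from column_tail[OF pos(3) pq(2) T(1) this, of M]
  obtain N where N: "!!k x. k >= N ==> lp_norm q (restr {k..} (T (restr {..<M} x))) <= e / 4 * lp_norm p (restr {..<M} x)" by blast
  define N' where "N' = max m (max M N)"
  have "restr {m..<N'} x = x \<and> e / 4 * lp_norm p x <= lp_norm q (restr {m..<N'} (T x))" if xE: "x \<in> E" for x
  proof
   have xF: "x \<in> F'" using xE by (simp add: E_def)
   have x0: "x i = 0" if "i < m \<or> M <= i" for i
    by (subst supp[OF xF, symmetric]) (use that in \<open>auto simp: restr_def\<close>)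
   then show "restr {m..<N'} x = x" by (auto simp: restr_def fun_eq_iff N'_def less_max_iff_disj)
   have xM: "restr {..<M} x = x" using x0 by (auto simp: restr_def fun_eq_iff)
   have xl: "x \<in> lp p" using xF dim_ge_lp[OF F'] by blast
   have Tl: "T x \<in> lp q" by (rule ops_in[OF T(1) xl])
   have "T x i = 0" if "i < m" for i using xE that by (simp add: E_def)
   then have "T x = restr {m..<N'} (T x) + restr {N'..} (T x)" by (auto simp: restr_def fun_eq_iff N'_def)
   then have "lp_norm q (T x) <= lp_norm q (restr {m..<N'} (T x)) + lp_norm q (restr {N'..} (T x))"
    using lp_add(2)[OF pq(2) lp_restr(1)[OF pos(2) Tl] lp_restr(1)[OF pos(2) Tl]] by metis
   moreover have "lp_norm q (restr {N'..} (T x)) <= e / 4 * lp_norm p x" using N[of N' x] xM by (simp add: N'_def)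
   ultimately show "e / 4 * lp_norm p x <= lp_norm q (restr {m..<N'} (T x))" using low[OF xF] by linarith
  qed
  then show ?thesis using E by blast
 qed
 then show ?thesis using e(1) by (intro exI[of _ "e / 4"]) auto
qed

text \<open>
 Gram--Schmidt, realised by choosing each vector in the common kernel of the functionals given by the earlier ones.
\<close>

lemma orthonormal_system:
 fixes T :: "'k::{real_normed_field,euclidean_space} seq_op"
 assumes T: "T \<in> bounded_ops p q" and E: "dim_ge p n E" and Q: "finite Q" "card Q <= n"
  and low: "!!x. x \<in> E ==> x ~= 0 ==> 0 < (\<Sum>j\<in>V. \<Phi> j * (norm (T x j))\<^sup>2)"
 shows "\<exists>x :: nat => 'k seq. (\<forall>i\<in>Q. x i \<in> E) \<and>
  (\<forall>i\<in>Q. \<forall>l\<in>Q. herm \<Phi> V (T (x i)) (T (x l)) = (if i = l then 1 else 0))"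
 using Q
proof (induction Q rule: finite_induct)
 case (insert k Q)
 then obtain x where x: "!!i. i \<in> Q ==> x i \<in> E"
  "!!i l. i \<in> Q ==> l \<in> Q ==> herm \<Phi> V (T (x i)) (T (x l)) = (if i = l then 1 else 0)" by auto
 let ?G = "(%l y. herm \<Phi> V (T y) (T (x l))) ` Q"
 have 1: "finite ?G" using insert by simp
 have 2: "card ?G < n" using card_image_le[of Q "%l y. herm \<Phi> V (T y) (T (x l))"] insert by simp
 have 3: "lin_fun p g" if g: "g \<in> ?G" for g
 proof -
  obtain l where "g = (%y. herm \<Phi> V (T y) (T (x l)))" using g by blast
  moreover have "lin_fun q (%y. herm \<Phi> V y (T (x l)))" by (simp add: lin_fun_def herm_add_left herm_scale_left)
  ultimately show ?thesis using lin_fun_ops[OF T, of "%y. herm \<Phi> V y (T (x l))"] by simp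
 qed
 from dim_geD[OF E 1 2 3] obtain y where y: "y \<in> E" "y ~= 0" "!!g. g \<in> ?G ==> g y = 0" by blast
 have yl: "y \<in> lp p" using y(1) dim_ge_lp[OF E] by blast
 define S where "S = (\<Sum>j\<in>V. \<Phi> j * (norm (T y j))\<^sup>2)"
 have S: "S > 0" unfolding S_def by (rule low[OF y(1,2)])
 define c :: 'k where "c = of_real (1 / sqrt S)"
 define z where "z = seq_scale c y"
 have zE: "z \<in> E" unfolding z_def by (rule seq.subspace_scale[OF dim_ge_subspace[OF E] y(1)])
 have Tz: "T z = seq_scale c (T y)" unfolding z_def by (rule ops_scale[OF T yl])
 have z0: "herm \<Phi> V (T z) (T (x l)) = 0" if "l \<in> Q" for l
 proof -
  have "herm \<Phi> V (T y) (T (x l)) = 0" using y(3)[of "%y. herm \<Phi> V (T y) (T (x l))"] that by blast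
  then show ?thesis by (simp add: Tz herm_scale_left)
 qed
 then have z0': "herm \<Phi> V (T (x l)) (T z) = 0" if "l \<in> Q" for l
  using herm_kcnj[of \<Phi> V "T z" "T (x l)"] that by simp
 have z1: "herm \<Phi> V (T z) (T z) = 1"
 proof -
  have "herm \<Phi> V (T z) (T z) = c * kcnj (c * herm \<Phi> V (T y) (T y))"
   unfolding Tz herm_scale_left using herm_kcnj[of \<Phi> V "seq_scale c (T y)" "T y"] by (simp add: herm_scale_left)
  also have "herm \<Phi> V (T y) (T y) = of_real S" by (simp only: herm_self S_def)
  also have "c * kcnj (c * of_real S) = of_real (1 / sqrt S * (1 / sqrt S * S))"
   unfolding c_def of_real_mult[symmetric] kcnj_of_real ..
  also have "1 / sqrt S * (1 / sqrt S * S) = 1" using S by (simp add: real_div_sqrt)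
  finally show ?thesis by simp
 qed
 show ?case
 proof (intro exI[of _ "x(k := z)"] conjI ballI)
  fix i l assume i: "i \<in> insert k Q"
  show "(x(k := z)) i \<in> E" using i x(1) zE by auto
  assume l: "l \<in> insert k Q"
  show "herm \<Phi> V (T ((x(k := z)) i)) (T ((x(k := z)) l)) = (if i = l then 1 else 0)"
   using i l x(2) z0 z0' z1 insert(2) by auto
 qed
qed simp

text \<open>
 For a system orthonormal in the weighted \<open>\<ell>\<^sub>2\<close>, \<open>u\<close> maps coefficients to combinations and \<open>w\<close> takes weighted inner products with the images. The lower bound of \<open>T\<close> bounds \<open>u\<close>, and Bessel's inequality with the upper estimate of the weight bounds \<open>w\<close>.
\<close>

lemma nonfss_local_copies:
 fixes T :: "'k::{real_normed_field,euclidean_space} seq_op"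
 assumes pq: "1 < p" "p < 2" "2 < q" and T: "T \<in> bounded_ops p q" "T \<notin> fss_ops p q"
 shows "\<exists>K\<ge>0. \<forall>Q. finite Q --> has_local_copies T p q K Q"
proof -
 have pos: "0 < p" "0 < q" "1 <= p" "1 <= q" using pq by auto
 obtain d where d: "d > 0" "!!n m. \<exists>N E. dim_ge p n E \<and>
  (\<forall>x\<in>E. restr {m..<N} x = x \<and> d * lp_norm p x <= lp_norm q (restr {m..<N} (T x)))"
  using nonfss_finite_blocks[OF pq(1) pos(4) T] by blast
 from bounded_below_density[OF pq T(1) d(1)]
 obtain c where c: "c > 0" "\<forall>E U V. seq.subspace E \<and> finite U \<and> finite V \<and> (\<forall>x\<in>E. restr U x = x) \<and>
  (\<forall>x\<in>E. d * lp_norm p x <= lp_norm q (restr V (T x))) -->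
  (\<exists>\<Phi>. (\<forall>j. 0 <= \<Phi> j) \<and> (\<forall>x\<in>E. c * (lp_norm p x)\<^sup>2 <= (\<Sum>j\<in>V. \<Phi> j * (norm (T x j))\<^sup>2)) \<and>
   (\<forall>y. (\<Sum>j\<in>V. \<Phi> j * (norm (y j :: 'k))\<^sup>2) <= (lp_norm q (restr V y))\<^sup>2))"
  by (elim exE conjE)
 define K where "K = 1 / sqrt c + 1"
 have K: "1 <= K" "1 / sqrt c <= K" using c(1) by (auto simp: K_def)
 have "\<exists>N u w. local_copy T p q K Q {m..<N} u w" if Q: "finite Q" for Q m
 proof -
  obtain N E where E: "dim_ge p (card Q) E" "!!x. x \<in> E ==> restr {m..<N} x = x"
   "!!x. x \<in> E ==> d * lp_norm p x <= lp_norm q (restr {m..<N} (T x))" using d(2) by meson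
  define V where "V = {m..<N}"
  have V: "finite V" by (simp add: V_def)
  obtain \<Phi> where \<Phi>: "!!j. 0 <= \<Phi> j" "!!x. x \<in> E ==> c * (lp_norm p x)\<^sup>2 <= (\<Sum>j\<in>V. \<Phi> j * (norm (T x j))\<^sup>2)"
   "!!y :: 'k seq. (\<Sum>j\<in>V. \<Phi> j * (norm (y j))\<^sup>2) <= (lp_norm q (restr V y))\<^sup>2"
  proof -
   have "seq.subspace E \<and> finite V \<and> finite V \<and> (\<forall>x\<in>E. restr V x = x) \<and>
    (\<forall>x\<in>E. d * lp_norm p x <= lp_norm q (restr V (T x)))"
    using dim_ge_subspace[OF E(1)] V E(2,3) unfolding V_def[symmetric] by simp
   from mp[OF spec[OF spec[OF spec[OF c(2), of E], of V], of V] this]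
   obtain \<Phi> where "\<forall>j. 0 <= \<Phi> j" "\<forall>x\<in>E. c * (lp_norm p x)\<^sup>2 <= (\<Sum>j\<in>V. \<Phi> j * (norm (T x j))\<^sup>2)"
    "\<forall>y :: 'k seq. (\<Sum>j\<in>V. \<Phi> j * (norm (y j))\<^sup>2) <= (lp_norm q (restr V y))\<^sup>2" by (elim exE conjE)
   then show thesis using that[of \<Phi>] by simp
  qed
  have El: "x \<in> lp p" if "x \<in> E" for x using that dim_ge_lp[OF E(1)] by blast
  have "0 < (\<Sum>j\<in>V. \<Phi> j * (norm (T x j))\<^sup>2)" if "x \<in> E" "x ~= 0" for x
  proof -
   have "0 < c * (lp_norm p x)\<^sup>2" using c(1) lp_norm_pos[OF El[OF that(1)] pos(1) that(2)] by simp
   then show ?thesis using \<Phi>(2)[OF that(1)] by linarith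
  qed
  from orthonormal_system[OF T(1) E(1) Q order_refl this]
  obtain \<xi> :: "nat => 'k seq" where \<xi>: "!!i. i \<in> Q ==> \<xi> i \<in> E"
   "!!i l. i \<in> Q ==> l \<in> Q ==> herm \<Phi> V (T (\<xi> i)) (T (\<xi> l)) = (if i = l then 1 else 0)" by blast
  define u where "u a = (\<Sum>i\<in>Q. seq_scale (a i) (\<xi> i))" for a :: "'k seq"
  define w where "w y = (%i. if i \<in> Q then herm \<Phi> V y (T (\<xi> i)) else 0)" for y :: "'k seq"
  have uE: "u a \<in> E" for a
   unfolding u_def using dim_ge_subspace[OF E(1)] \<xi>(1) by (intro seq.subspace_sum seq.subspace_scale) auto
  have Tu: "T (u a) = (\<Sum>i\<in>Q. seq_scale (a i) (T (\<xi> i)))" for a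
  proof -
   have sl: "seq_scale (a i) (\<xi> i) \<in> lp p" if "i \<in> Q" for i by (rule lp_scale(1)[OF pos(1) El[OF \<xi>(1)[OF that]]])
   have "T (u a) = (\<Sum>i\<in>Q. T (seq_scale (a i) (\<xi> i)))" unfolding u_def by (rule ops_sum[OF T(1) pos(3) Q sl])
   then show ?thesis using ops_scale[OF T(1) El[OF \<xi>(1)]] by simp
  qed
  have "local_copy T p q K Q V u w"
   unfolding local_copy_def
  proof (intro conjI allI)
   show "seq_linear u" unfolding seq_linear_def u_def
   proof (intro conjI allI)
    fix x y :: "'k seq" and c :: 'k
    show "(\<Sum>i\<in>Q. seq_scale ((x + y) i) (\<xi> i)) = (\<Sum>i\<in>Q. seq_scale (x i) (\<xi> i)) + (\<Sum>i\<in>Q. seq_scale (y i) (\<xi> i))"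
     unfolding sum.distrib[symmetric] plus_fun_apply seq.scale_left_distrib ..
    show "(\<Sum>i\<in>Q. seq_scale (seq_scale c x i) (\<xi> i)) = seq_scale c (\<Sum>i\<in>Q. seq_scale (x i) (\<xi> i))"
     unfolding seq.scale_sum_right seq_scale_apply seq.scale_scale ..
   qed
   show "seq_linear w" unfolding seq_linear_def w_def
    by (auto simp: fun_eq_iff herm_add_left herm_scale_left seq_scale_apply)
   fix a y :: "'k seq"
   show "u a = u (restr Q a)" unfolding u_def by (intro sum.cong) (auto simp: restr_def)
   show "restr V (u a) = u a" unfolding V_def by (rule E(2)[OF uE])
   show "w y = w (restr V y)" unfolding w_def herm_def by (auto simp: restr_def intro!: ext sum.cong)
   show "restr Q (w y) = w y" by (auto simp: w_def restr_def)
   have par: "(\<Sum>j\<in>V. \<Phi> j * (norm (T (u a) j))\<^sup>2) = (lp_norm 2 (restr Q a))\<^sup>2"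
    unfolding lp_norm_2_square[OF Q] Tu by (rule herm_parseval[OF Q \<xi>(2)])
   show "lp_norm p (u a) <= K * lp_norm 2 (restr Q a)"
   proof -
    have "c * (lp_norm p (u a))\<^sup>2 <= (lp_norm 2 (restr Q a))\<^sup>2" using \<Phi>(2)[OF uE, of a] par by simp
    then have "(sqrt c * lp_norm p (u a))\<^sup>2 <= (lp_norm 2 (restr Q a))\<^sup>2" using c(1) by (simp add: power_mult_distrib)
    then have "sqrt c * lp_norm p (u a) <= lp_norm 2 (restr Q a)" by (rule power2_le_imp_le) simp
    then have "lp_norm p (u a) <= 1 / sqrt c * lp_norm 2 (restr Q a)" using c(1) by (simp add: field_simps)
    also have "\<dots> <= K * lp_norm 2 (restr Q a)" using K(2) by (intro mult_right_mono) auto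
    finally show ?thesis .
   qed
   have wl: "w y = restr Q (%i. herm \<Phi> V y (T (\<xi> i)))" by (auto simp: w_def restr_def)
   show "lp_norm 2 (w y) <= K * lp_norm q (restr V y)"
   proof -
    have "(lp_norm 2 (w y))\<^sup>2 = (\<Sum>i\<in>Q. (norm (herm \<Phi> V y (T (\<xi> i))))\<^sup>2)" unfolding wl by (rule lp_norm_2_square[OF Q])
    also have "\<dots> <= (\<Sum>j\<in>V. \<Phi> j * (norm (y j))\<^sup>2)" by (rule herm_bessel[OF Q \<xi>(2) \<Phi>(1)])
    also have "\<dots> <= (lp_norm q (restr V y))\<^sup>2" by (rule \<Phi>(3))
    finally have "lp_norm 2 (w y) <= lp_norm q (restr V y)" by (rule power2_le_imp_le) simp
    also have "\<dots> <= K * lp_norm q (restr V y)" using mult_right_mono[OF K(1), of "lp_norm q (restr V y)"] by simp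
    finally show ?thesis .
   qed
   show "w (T (u a)) = restr Q a"
   proof
    fix i
    have "herm \<Phi> V (T (u a)) (T (\<xi> i)) = a i" if i: "i \<in> Q"
    proof -
     have "herm \<Phi> V (T (u a)) (T (\<xi> i)) = (\<Sum>l\<in>Q. if l = i then a l else 0)"
      unfolding Tu herm_sum_left using \<xi>(2)[OF _ i] by (intro sum.cong) auto
     then show ?thesis using sum.delta[OF Q, of i a] i by simp
    qed
    then show "w (T (u a)) i = restr Q a i" by (simp add: w_def restr_def)
   qed
  qed
  then show ?thesis unfolding V_def by blast
 qed
 then show ?thesis using K(1) unfolding has_local_copies_def by (intro exI[of _ K]) auto
qed

section \<open>The Hilbert ideal\<close>

definition hilbert_factorable :: "real => real => 'k::real_normed_field seq_op set" where
 "hilbert_factorable p q = {A \<circ> B | A B. A \<in> bounded_ops 2 q \<and> B \<in> bounded_ops p 2}"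

lemma hilbert_ideal_eq:
 assumes "1 <= p" "1 <= q"
 shows "(hilbert_ideal p q :: 'k::real_normed_field seq_op set) = {T \<in> bounded_ops p q. op_approx p q (hilbert_factorable p q) T}"
proof -
 have "(hilbert_factorable p q :: 'k seq_op set) \<subseteq> bounded_ops p q"
  unfolding hilbert_factorable_def using bounded_ops_comp by blast
 from closure_op_topology[OF assms this] show ?thesis by (simp add: hilbert_ideal_def hilbert_factorable_def)
qed

lemma hilbert_factorable_subset:
 assumes "1 <= p" "1 <= q"
 shows "(hilbert_factorable p q :: 'k::real_normed_field seq_op set) \<subseteq> hilbert_ideal p q"
proof
 fix T :: "'k seq_op" assume T: "T \<in> hilbert_factorable p q"
 then have "T \<in> bounded_ops p q" unfolding hilbert_factorable_def using bounded_ops_comp by blast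
 moreover have "op_approx p q (hilbert_factorable p q) T"
  unfolding op_approx_def
 proof (intro allI impI bexI[OF _ T] ballI)
  fix e :: real and x :: "'k seq" assume "e > 0"
  then show "lp_norm q (T x - T x) <= e * lp_norm p x" by simp
 qed
 ultimately show "T \<in> hilbert_ideal p q" unfolding hilbert_ideal_eq[OF assms] by blast
qed

lemma nonfss_hilbert:
 fixes J :: "'k::{real_normed_field,euclidean_space} seq_op set"
 assumes pq: "1 < p" "p < 2" "2 < q" and J: "closed_ideal p q J" "T \<in> J" "T \<notin> fss_ops p q"
 shows "hilbert_ideal p q \<subseteq> J"
proof -
 have pos: "1 <= p" "1 <= q" using pq by auto
 have T: "T \<in> bounded_ops p q" using J closed_ideal_sub by blast
 obtain K where K: "0 <= K" "!!Q. finite Q ==> has_local_copies T p q K Q"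
  using nonfss_local_copies[OF pq T J(3)] by blast
 have "hilbert_factorable p q \<subseteq> J"
 proof
  fix S :: "'k seq_op" assume "S \<in> hilbert_factorable p q"
  then obtain A B where S: "S = A \<circ> B" "A \<in> bounded_ops 2 q" "B \<in> bounded_ops p 2" by (auto simp: hilbert_factorable_def)
  show "S \<in> J" unfolding S(1)
   by (rule local_copies_hilbert[OF pq(1) _ _ J(1,2) K(1) K(2) S(2,3)]) (use pq in auto)
 qed
 then have "op_approx p q J S" if "op_approx p q (hilbert_factorable p q) S" for S
  using that unfolding op_approx_def by (meson subsetD)
 then show ?thesis
  using J(1) unfolding hilbert_ideal_eq[OF pos] closed_ideal_def closedin_op_topology[OF pos] by blast
qed

text \<open>
 Together with \<open>pull\<close>, the isometric copies of \<open>\<ell>\<^sub>2\<close> on the even and on the odd coordinates; they show that the sum of two operators through \<open>\<ell>\<^sub>2\<close> factors through \<open>\<ell>\<^sub>2\<close>.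
\<close>

definition push :: "real => (nat => nat) => 'k::real_normed_field seq_op" where
 "push s \<phi> x = (if x \<in> lp s then (%i. if i \<in> range \<phi> then x (inv \<phi> i) else 0) else 0)"

definition pull :: "real => (nat => nat) => 'k::real_normed_field seq_op" where
 "pull s \<phi> x = (if x \<in> lp s then (%i. x (\<phi> i)) else 0)"

lemma push_bounded_ops:
 assumes "1 <= s" "inj \<phi>"
 shows "(push s \<phi> :: 'k::real_normed_field seq_op) \<in> bounded_ops s s"
proof (rule bounded_opsI[where C=1])
 fix x :: "'k seq" assume x: "x \<in> lp s"
 have "(\<Sum>i<N. norm (push s \<phi> x i) powr s) <= lp_norm s x powr s" for N
 proof -
  have "(\<Sum>i<N. norm (push s \<phi> x i) powr s) = (\<Sum>i\<in>{i. i < N \<and> i \<in> range \<phi>}. norm (x (inv \<phi> i)) powr s)"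
   using x assms by (intro sum.mono_neutral_cong_right) (auto simp: push_def)
  also have "\<dots> = (\<Sum>i\<in>inv \<phi> ` {i. i < N \<and> i \<in> range \<phi>}. norm (x i) powr s)"
  proof -
   have "inj_on (inv \<phi>) {i. i < N \<and> i \<in> range \<phi>}" by (rule inj_on_subset[OF inj_on_inv_into[of "range \<phi>" \<phi> UNIV]]) auto
   then show ?thesis by (simp add: sum.reindex)
  qed
  also have "\<dots> <= lp_norm s x powr s" by (rule lp_sum_le[OF x]) (use assms in auto)
  finally show ?thesis .
 qed
 from lp_leI[OF _ _ this] show "push s \<phi> x \<in> lp s" "lp_norm s (push s \<phi> x) <= 1 * lp_norm s x" using assms by auto
 show "push s \<phi> (seq_scale c x) = seq_scale c (push s \<phi> x)" for c
  using x lp_scale(1)[OF _ x, of c] assms by (auto simp: push_def seq_scale_apply fun_eq_iff)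
 show "push s \<phi> (x + y) = push s \<phi> x + push s \<phi> y" if "y \<in> lp s" for y
  using x that lp_add(1)[OF assms(1) x that] by (auto simp: push_def fun_eq_iff)
qed (simp add: push_def)

lemma pull_bounded_ops:
 assumes "1 <= s" "inj \<phi>"
 shows "(pull s \<phi> :: 'k::real_normed_field seq_op) \<in> bounded_ops s s"
proof (rule bounded_opsI[where C=1])
 fix x :: "'k seq" assume x: "x \<in> lp s"
 have "(\<Sum>i<N. norm (pull s \<phi> x i) powr s) <= lp_norm s x powr s" for N
 proof -
  have "(\<Sum>i<N. norm (pull s \<phi> x i) powr s) = (\<Sum>i\<in>\<phi> ` {..<N}. norm (x i) powr s)"
   using x inj_on_subset[OF assms(2)] by (simp add: pull_def sum.reindex)
  also have "\<dots> <= lp_norm s x powr s" by (rule lp_sum_le[OF x]) (use assms in auto)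
  finally show ?thesis .
 qed
 from lp_leI[OF _ _ this] show "pull s \<phi> x \<in> lp s" "lp_norm s (pull s \<phi> x) <= 1 * lp_norm s x" using assms by auto
 show "pull s \<phi> (seq_scale c x) = seq_scale c (pull s \<phi> x)" for c
  using x lp_scale(1)[OF _ x, of c] assms by (auto simp: pull_def seq_scale_apply fun_eq_iff)
 show "pull s \<phi> (x + y) = pull s \<phi> x + pull s \<phi> y" if "y \<in> lp s" for y
  using x that lp_add(1)[OF assms(1) x that] by (auto simp: pull_def fun_eq_iff)
qed (simp add: pull_def)

lemma pull_push:
 fixes x :: "'k::real_normed_field seq"
 assumes "1 <= s" "inj \<phi>" "x \<in> lp s"
 shows "pull s \<phi> (push s \<phi> x) = x"
 using ops_in[OF push_bounded_ops[OF assms(1,2)] assms(3)] assms by (simp add: pull_def push_def)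

lemma pull_push_disjoint:
 fixes x :: "'k::real_normed_field seq"
 assumes "1 <= s" "inj \<phi>" "x \<in> lp s" "range \<psi> \<inter> range \<phi> = {}"
 shows "pull s \<psi> (push s \<phi> x) = 0"
proof -
 have "\<psi> i \<notin> range \<phi>" for i using assms(4) by blast
 then show ?thesis
  using ops_in[OF push_bounded_ops[OF assms(1,2)] assms(3)] assms by (simp add: pull_def push_def fun_eq_iff)
qed

lemma hilbert_factorable_add:
 fixes S T :: "'k::real_normed_field seq_op"
 assumes "1 <= p" "1 <= q" "S \<in> hilbert_factorable p q" "T \<in> hilbert_factorable p q"
 shows "S + T \<in> hilbert_factorable p q"
proof -
 obtain A B where S: "S = A \<circ> B" "A \<in> bounded_ops 2 q" "B \<in> bounded_ops p 2" using assms(3) by (auto simp: hilbert_factorable_def)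
 obtain A' B' where T: "T = A' \<circ> B'" "A' \<in> bounded_ops 2 q" "B' \<in> bounded_ops p 2" using assms(4) by (auto simp: hilbert_factorable_def)
 define e o' where "e i = 2 * i" and "o' i = Suc (2 * i)" for i :: nat
 have inj: "inj e" "inj o'" by (auto simp: e_def o'_def inj_def)
 have dis: "range e \<inter> range o' = {}" "range o' \<inter> range e = {}" unfolding e_def o'_def by (auto, presburger+)
 have two: "(1::real) <= 2" by simp
 note pb = push_bounded_ops[OF two inj(1), where 'k='k] push_bounded_ops[OF two inj(2), where 'k='k]
  pull_bounded_ops[OF two inj(1), where 'k='k] pull_bounded_ops[OF two inj(2), where 'k='k]
 define C where "C = (A \<circ> pull 2 e) + (A' \<circ> pull 2 o')"
 define D where "D = (push 2 e \<circ> B) + (push 2 o' \<circ> B')"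
 have C: "C \<in> bounded_ops 2 q" unfolding C_def by (intro bounded_ops_add[OF assms(2)] bounded_ops_comp[OF S(2)] bounded_ops_comp[OF T(2)] pb)
 have D: "D \<in> bounded_ops p 2" unfolding D_def by (intro bounded_ops_add[OF two] bounded_ops_comp[OF _ S(3)] bounded_ops_comp[OF _ T(3)] pb)
 have "(S + T) x = (C \<circ> D) x" for x
 proof (cases "x \<in> lp p")
  case True
  have b: "B x \<in> lp 2" "B' x \<in> lp 2" using ops_in S(3) T(3) True by blast+
  have pl: "push 2 e (B x) \<in> lp 2" "push 2 o' (B' x) \<in> lp 2" using ops_in pb b by blast+
  have Dx: "D x = push 2 e (B x) + push 2 o' (B' x)" by (simp add: D_def)
  have "pull 2 e (D x) = B x" unfolding Dx ops_add[OF pb(3) pl]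
   using pull_push[OF two inj(1) b(1)] pull_push_disjoint[OF two inj(2) b(2) dis(1)] by simp
  moreover have "pull 2 o' (D x) = B' x" unfolding Dx ops_add[OF pb(4) pl]
   using pull_push[OF two inj(2) b(2)] pull_push_disjoint[OF two inj(1) b(1) dis(2)] by simp
  ultimately show ?thesis by (simp add: C_def S(1) T(1))
 next
  case False
  then have z: "B x = 0" "B' x = 0" "D x = 0" using ops_out S(3) T(3) D by blast+
  have "A (0 :: 'k seq) = 0" "A' (0 :: 'k seq) = 0" "C (0 :: 'k seq) = 0" using ops_0 S(2) T(2) C by blast+
  then show ?thesis unfolding S(1) T(1) plus_fun_apply[of "A \<circ> B"] comp_apply z by simp
 qed
 then have "S + T = C \<circ> D" by blast
 then show ?thesis using C D by (auto simp: hilbert_factorable_def)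
qed

lemma closed_ideal_hilbert:
 assumes "1 <= p" "1 <= q"
 shows "closed_ideal p q (hilbert_ideal p q :: 'k::real_normed_field seq_op set)"
proof (rule closed_idealI[OF assms])
 let ?H = "hilbert_factorable p q :: 'k seq_op set"
 have Hb: "T \<in> bounded_ops p q" if "T \<in> ?H" for T using that unfolding hilbert_factorable_def using bounded_ops_comp by blast
 have q: "0 < q" using assms by simp
 note eq = hilbert_ideal_eq[OF assms, where 'k='k]
 show "hilbert_ideal p q \<subseteq> (bounded_ops p q :: 'k seq_op set)" unfolding eq by blast
 have "(0 :: 'k seq_op) = 0 \<circ> 0" by (auto simp: fun_eq_iff)
 then have "(0 :: 'k seq_op) \<in> ?H" unfolding hilbert_factorable_def using zero_bounded_ops by blast
 then show "0 \<in> (hilbert_ideal p q :: 'k seq_op set)" using hilbert_factorable_subset[OF assms] by blast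
 fix S T :: "'k seq_op" assume T: "T \<in> hilbert_ideal p q"
 have bT: "T \<in> bounded_ops p q" and aT: "!!e. e > 0 ==> \<exists>T'\<in>?H. \<forall>x\<in>lp p. lp_norm q (T' x - T x) <= e * lp_norm p x"
  using T unfolding eq op_approx_def by blast+
 {
  assume S: "S \<in> hilbert_ideal p q"
  have bS: "S \<in> bounded_ops p q" and aS: "!!e. e > 0 ==> \<exists>T'\<in>?H. \<forall>x\<in>lp p. lp_norm q (T' x - S x) <= e * lp_norm p x"
   using S unfolding eq op_approx_def by blast+
  show "S + T \<in> hilbert_ideal p q" unfolding eq op_approx_def mem_Collect_eq
  proof (intro conjI allI impI bounded_ops_add[OF assms(2) bS bT])
   fix e :: real assume e: "e > 0"
   obtain S' where S': "S' \<in> ?H" "!!x. x \<in> lp p ==> lp_norm q (S' x - S x) <= e / 2 * lp_norm p x" using aS[of "e / 2"] e by auto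
   obtain T' where T': "T' \<in> ?H" "!!x. x \<in> lp p ==> lp_norm q (T' x - T x) <= e / 2 * lp_norm p x" using aT[of "e / 2"] e by auto
   have "lp_norm q ((S' + T') x - (S + T) x) <= e * lp_norm p x" if x: "x \<in> lp p" for x
   proof -
    have d: "S' x - S x \<in> lp q" "T' x - T x \<in> lp q"
     using lp_diff(1)[OF assms(2)] ops_in[OF Hb[OF S'(1)] x] ops_in[OF Hb[OF T'(1)] x] ops_in[OF bS x] ops_in[OF bT x] by auto
    have e1: "(S' + T') x - (S + T) x = (S' x - S x) + (T' x - T x)" by simp
    show ?thesis unfolding e1 using lp_add(2)[OF assms(2) d] S'(2)[OF x] T'(2)[OF x] by linarith
   qed
   then show "\<exists>U\<in>?H. \<forall>x\<in>lp p. lp_norm q (U x - (S + T) x) <= e * lp_norm p x"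
    using hilbert_factorable_add[OF assms S'(1) T'(1)] by blast
  qed
 }
 show "op_scale c T \<in> hilbert_ideal p q" for c unfolding eq op_approx_def mem_Collect_eq
 proof (intro conjI allI impI bounded_ops_scale[OF assms(2) bT])
  fix e :: real assume e: "e > 0"
  then have e': "e / (norm c + 1) > 0" by (simp add: add_nonneg_pos)
  obtain T' where T': "T' \<in> ?H" "!!x. x \<in> lp p ==> lp_norm q (T' x - T x) <= e / (norm c + 1) * lp_norm p x" using aT[OF e'] by auto
  obtain A B where AB: "T' = A \<circ> B" "A \<in> bounded_ops 2 q" "B \<in> bounded_ops p 2" using T'(1) by (auto simp: hilbert_factorable_def)
  have "op_scale c T' = op_scale c A \<circ> B" by (auto simp: AB(1) op_scale_def)
  then have "op_scale c T' \<in> ?H" using bounded_ops_scale[OF assms(2) AB(2), of c] AB(3) by (auto simp: hilbert_factorable_def)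
  moreover have "lp_norm q (op_scale c T' x - op_scale c T x) <= e * lp_norm p x" if x: "x \<in> lp p" for x
  proof -
   have d: "T' x - T x \<in> lp q" using lp_diff(1)[OF assms(2) ops_in[OF Hb[OF T'(1)] x] ops_in[OF bT x]] .
   have e1: "op_scale c T' x - op_scale c T x = seq_scale c (T' x - T x)" by (simp add: op_scale_def seq.scale_right_diff_distrib)
   have "lp_norm q (seq_scale c (T' x - T x)) = norm c * lp_norm q (T' x - T x)" by (rule lp_scale(2)[OF q d])
   also have "\<dots> <= (norm c + 1) * (e / (norm c + 1) * lp_norm p x)" by (intro mult_mono T'(2)[OF x]) auto
   also have "\<dots> = e * lp_norm p x" by (simp add: add_nonneg_eq_0_iff)
   finally show ?thesis unfolding e1 .
  qed
  ultimately show "\<exists>U\<in>?H. \<forall>x\<in>lp p. lp_norm q (U x - op_scale c T x) <= e * lp_norm p x" by blast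
 qed
 fix C D :: "'k seq_op" assume C: "C \<in> bounded_ops q q" and D: "D \<in> bounded_ops p p"
 obtain a where a: "a > 0" "!!x. x \<in> lp q ==> lp_norm q (C x) <= a * lp_norm q x" using ops_bound[OF C] by metis
 obtain b where b: "b > 0" "!!x. x \<in> lp p ==> lp_norm p (D x) <= b * lp_norm p x" using ops_bound[OF D] by metis
 show "C \<circ> T \<circ> D \<in> hilbert_ideal p q" unfolding eq op_approx_def mem_Collect_eq
 proof (intro conjI allI impI bounded_ops_comp[OF bounded_ops_comp[OF C bT] D])
  fix e :: real assume e: "e > 0"
  then have e': "e / (a * b) > 0" using a b by simp
  obtain T' where T': "T' \<in> ?H" "!!x. x \<in> lp p ==> lp_norm q (T' x - T x) <= e / (a * b) * lp_norm p x" using aT[OF e'] by auto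
  obtain A B where AB: "T' = A \<circ> B" "A \<in> bounded_ops 2 q" "B \<in> bounded_ops p 2" using T'(1) by (auto simp: hilbert_factorable_def)
  have "C \<circ> T' \<circ> D = (C \<circ> A) \<circ> (B \<circ> D)" by (auto simp: AB(1))
  then have "C \<circ> T' \<circ> D \<in> ?H" using bounded_ops_comp[OF C AB(2)] bounded_ops_comp[OF AB(3) D] unfolding hilbert_factorable_def by blast
  moreover have "lp_norm q ((C \<circ> T' \<circ> D) x - (C \<circ> T \<circ> D) x) <= e * lp_norm p x" if x: "x \<in> lp p" for x
  proof -
   have Dx: "D x \<in> lp p" by (rule ops_in[OF D x])
   have l: "T' (D x) \<in> lp q" "T (D x) \<in> lp q" using ops_in[OF Hb[OF T'(1)] Dx] ops_in[OF bT Dx] by auto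
   have e1: "(C \<circ> T' \<circ> D) x - (C \<circ> T \<circ> D) x = C (T' (D x) - T (D x))" using ops_diff[OF C assms(2) l] by simp
   have "lp_norm q (C (T' (D x) - T (D x))) <= a * lp_norm q (T' (D x) - T (D x))" by (rule a(2)[OF lp_diff(1)[OF assms(2) l]])
   also have "\<dots> <= a * (e / (a * b) * (b * lp_norm p x))"
    using a e' by (intro mult_left_mono order_trans[OF T'(2)[OF Dx]] b(2)[OF x]) auto
   also have "\<dots> = e * lp_norm p x" using a b by simp
   finally show ?thesis unfolding e1 .
  qed
  ultimately show "\<exists>U\<in>?H. \<forall>x\<in>lp p. lp_norm q (U x - (C \<circ> T \<circ> D) x) <= e * lp_norm p x" by blast
 qed
next
 let ?H = "hilbert_factorable p q :: 'k seq_op set"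
 note eq = hilbert_ideal_eq[OF assms, where 'k='k]
 fix T :: "'k seq_op" assume T: "T \<in> bounded_ops p q" "op_approx p q (hilbert_ideal p q) T"
 have "op_approx p q ?H T" unfolding op_approx_def
 proof (intro allI impI)
  fix e :: real assume e: "e > 0"
  obtain S where S: "S \<in> hilbert_ideal p q" "!!x. x \<in> lp p ==> lp_norm q (S x - T x) <= e / 2 * lp_norm p x"
   using T(2) e unfolding op_approx_def by (meson half_gt_zero)
  obtain S' where S': "S' \<in> ?H" "!!x. x \<in> lp p ==> lp_norm q (S' x - S x) <= e / 2 * lp_norm p x"
   using S(1) e unfolding eq op_approx_def by (force dest: spec[of _ "e / 2"])
  have bS: "S \<in> bounded_ops p q" using S(1) unfolding eq by blast
  have bS': "S' \<in> bounded_ops p q" using S'(1) unfolding hilbert_factorable_def using bounded_ops_comp by blast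
  have "lp_norm q (S' x - T x) <= e * lp_norm p x" if x: "x \<in> lp p" for x
  proof -
   have d: "S' x - S x \<in> lp q" "S x - T x \<in> lp q"
    using lp_diff(1)[OF assms(2)] ops_in[OF bS x] ops_in[OF bS' x] ops_in[OF T(1) x] by auto
   have e1: "S' x - T x = (S' x - S x) + (S x - T x)" by simp
   show ?thesis unfolding e1 using lp_add(2)[OF assms(2) d] S'(2)[OF x] S(2)[OF x] by linarith
  qed
  then show "\<exists>U\<in>?H. \<forall>x\<in>lp p. lp_norm q (U x - T x) <= e * lp_norm p x" using S'(1) by blast
 qed
 then show "T \<in> hilbert_ideal p q" unfolding eq using T(1) by blast
qed

section \<open>A two-point inequality\<close>

text \<open>
 Since \<open>f s \<le> 0 \<le> f 0\<close>, the derivative, and with it \<open>g\<close>, is nonpositive somewhere before \<open>s\<close> and hence from there on.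
\<close>

lemma sign_change_integrate:
 fixes f g k :: "real => real"
 assumes "!!t. 0 <= t ==> t < 1 ==> (f has_real_derivative k t * g t) (at t)"
  and "!!t. 0 < t ==> t < 1 ==> 0 <= k t"
  and "!!s t. 0 < s ==> s < t ==> t < 1 ==> g s <= 0 ==> g t <= 0"
  and "f 0 >= 0" "0 < s" "s < t" "t < 1" "f s <= 0" "!!t. 0 < t ==> t < 1 ==> 0 < k t"
 shows "f t <= 0"
proof -
 obtain z where z: "0 < z" "z < s" "f s - f 0 = (s - 0) * (k z * g z)"
  using MVT2[of 0 s f "%t. k t * g t"] assms(1,5,6,7) by auto
 have "(s - 0) * (k z * g z) <= 0" using z(3) assms(4,8) by linarith
 then have "g z <= 0" using assms(5) assms(9)[of z] z(1,2) assms(6,7)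
  by (auto simp: mult_le_0_iff)
 then have neg: "g y <= 0" if "z < y" "y < 1" for y using assms(3)[of z y] z(1) that by simp
 obtain w where w: "s < w" "w < t" "f t - f s = (t - s) * (k w * g w)"
  using MVT2[of s t f "%t. k t * g t"] assms(1,5,6,7) by auto
 have "k w * g w <= 0" using neg[of w] assms(2)[of w] w z assms(5,7) by (simp add: mult_nonneg_nonpos)
 then have "(t - s) * (k w * g w) <= 0" using assms(6) by (simp add: mult_nonneg_nonpos)
 then show ?thesis using w(3) assms(8) by linarith
qed

text \<open>
 If \<open>f\<close> dropped below zero, \<open>g\<close> would be negative somewhere and nonpositive afterwards, and \<open>f\<close> could not return to \<open>f 1 \<ge> 0\<close>.
\<close>

lemma sign_change_from_right:
 fixes f g k :: "real => real"
 assumes der: "!!t. 0 < t ==> t < 1 ==> (f has_real_derivative k t * g t) (at t)"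
  and k: "!!t. 0 < t ==> t < 1 ==> 0 < k t"
  and sc: "!!s t. 0 < s ==> s < t ==> t < 1 ==> g s <= 0 ==> g t <= 0"
  and cont: "!!a. 0 < a ==> continuous_on {a..1} f" and f1: "f 1 >= 0"
  and st: "0 <= s" "s < t" "t < 1" and fs: "f s >= 0" "s = 0 ==> continuous_on {0..1} f"
 shows "f t >= 0"
proof (rule ccontr)
 assume "\<not> 0 <= f t"
 then have ft: "f t < 0" by simp
 have "continuous_on {s..t} f"
 proof (cases "s = 0")
  case True
  then show ?thesis using fs(2) st by (auto intro: continuous_on_subset)
 next
  case False
  then show ?thesis using cont[of s] st by (auto intro: continuous_on_subset)
 qed
 moreover have dif: "f differentiable (at x)" if "0 < x" "x < 1" for x
  using der[OF that] real_differentiable_def by blast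
 ultimately have "\<exists>l z. s < z \<and> z < t \<and> DERIV f z :> l \<and> f t - f s = (t - s) * l"
  by (intro MVT) (use st in auto)
 then obtain l z where z: "s < z" "z < t" "DERIV f z :> l" "f t - f s = (t - s) * l" by blast
 have "l = k z * g z" using z der[of z] st by (auto intro: DERIV_unique)
 then have "(t - s) * (k z * g z) < 0" using z(4) ft fs by simp
 then have "g z < 0" using k[of z] z st by (simp add: mult_less_0_iff zero_less_mult_iff)
 then have neg: "g y <= 0" if "z < y" "y < 1" for y using sc[of z y] z st that by simp
 have "\<exists>l w. t < w \<and> w < 1 \<and> DERIV f w :> l \<and> f 1 - f t = (1 - t) * l"
  by (intro MVT cont dif) (use st in auto)
 then obtain l w where w: "t < w" "w < 1" "DERIV f w :> l" "f 1 - f t = (1 - t) * l" by blast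
 have "l = k w * g w" using w der[of w] st by (auto intro: DERIV_unique)
 moreover have "k w * g w <= 0" using neg[of w] k[of w] w z st by (simp add: mult_nonneg_nonpos)
 ultimately have "f 1 - f t <= 0" using w(4) st by (simp add: mult_nonneg_nonpos)
 then show False using f1 ft by simp
qed

text \<open>
 The logarithm \<open>h\<close> of the quotient of the two sides vanishes at \<open>0\<close> and \<open>1\<close>, so it suffices that \<open>h\<close> first increases and then decreases. The sign of its derivative is that of \<open>- K\<close>, the sign of the derivative of \<open>K\<close> is that of \<open>m\<close>, that of \<open>m\<close> is governed by \<open>n\<close>, and \<open>n\<close> is decreasing; so each of these functions changes sign at most once.
\<close>

lemma Clarkson_two_point:
 fixes q p t :: real
 assumes q: "2 < q" and p: "p = q / (q - 1)" and t: "0 <= t" "t <= 1"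
 shows "((1 + t) powr q + (1 - t) powr q) / 2 <= (1 + t powr p) powr (q - 1)"
proof -
 define c where "c = q - 1"
 have c: "c > 1" using q by (simp add: c_def)
 have pc: "p = 1 + 1 / c" "p * c = q" "1 < p" using q by (auto simp: p c_def field_simps)
 define P where "P t = (1 + t) powr c" for t :: real
 define Q where "Q t = (1 - t) powr c" for t :: real
 have Pd: "(P has_real_derivative c * P t / (1 + t)) (at t)" if "0 <= t" "t < 1" for t
  unfolding P_def using that by (auto intro!: derivative_eq_intros simp: powr_diff field_simps)
 have Qd: "(Q has_real_derivative - (c * Q t / (1 - t))) (at t)" if "0 <= t" "t < 1" for t
  unfolding Q_def using that by (auto intro!: derivative_eq_intros simp: powr_diff field_simps)
 have PQ0: "P t > 0" "Q t > 0" if "0 <= t" "t < 1" for t using that by (auto simp: P_def Q_def)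
 have PQlt: "Q t < P t" if "0 < t" "t < 1" for t
  unfolding P_def Q_def using that c by (intro powr_less_mono2) auto
 \<comment> \<open>\<open>n\<close>, \<open>m\<close>, \<open>K\<close> carry the signs of successive derivatives, starting from the innermost\<close>
 define n where "n t = 2 * c * (1 + t\<^sup>2) / (1 - t\<^sup>2) - (P t / Q t + Q t / P t)" for t
 define m where "m t = 4 * c\<^sup>2 * t / (1 - t\<^sup>2) - (P t / Q t - Q t / P t)" for t
 define K where "K t = c * ln (P t - Q t) - c * ln (P t + Q t) - ln t" for t
 have sq: "1 - t\<^sup>2 > 0" "1 - t\<^sup>2 = (1 - t) * (1 + t)" if "0 <= t" "t < 1" for t :: real
  using that by (auto simp: power2_eq_square algebra_simps) (smt (verit) mult_less_cancel_left1 mult_le_one)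
 have Rd: "((%t. P t / Q t) has_real_derivative 2 * c / (1 - t\<^sup>2) * (P t / Q t)) (at t)"
  "((%t. Q t / P t) has_real_derivative - (2 * c / (1 - t\<^sup>2) * (Q t / P t))) (at t)" if "0 <= t" "t < 1" for t
 proof -
  note d = DERIV_divide[OF Pd[OF that] Qd[OF that]] DERIV_divide[OF Qd[OF that] Pd[OF that]]
  have nz: "P t ~= 0" "Q t ~= 0" "1 + t ~= 0" "1 - t ~= 0" using PQ0[OF that] that by auto
  show "((%t. P t / Q t) has_real_derivative 2 * c / (1 - t\<^sup>2) * (P t / Q t)) (at t)"
   by (rule DERIV_cong[OF d(1)]) (use nz sq(2)[OF that] in \<open>simp_all add: divide_simps\<close>, simp add: algebra_simps)
  show "((%t. Q t / P t) has_real_derivative - (2 * c / (1 - t\<^sup>2) * (Q t / P t))) (at t)"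
   by (rule DERIV_cong[OF d(2)]) (use nz sq(2)[OF that] in \<open>simp_all add: divide_simps\<close>, simp add: algebra_simps)
 qed
 have nd: "(n has_real_derivative 2 * c / (1 - t\<^sup>2) * (4 * t / (1 - t\<^sup>2) - (P t / Q t - Q t / P t))) (at t)"
  if "0 <= t" "t < 1" for t
 proof -
  have "((%t. 2 * c * (1 + t\<^sup>2) / (1 - t\<^sup>2)) has_real_derivative 2 * c / (1 - t\<^sup>2) * (4 * t / (1 - t\<^sup>2))) (at t)"
   using sq(1)[OF that] by (auto intro!: derivative_eq_intros simp: field_simps power2_eq_square)
  from DERIV_diff[OF this DERIV_add[OF Rd(1)[OF that] Rd(2)[OF that]]]
  show ?thesis unfolding n_def by (rule DERIV_cong) (simp add: algebra_simps)
 qed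
 have nle: "4 * t / (1 - t\<^sup>2) - (P t / Q t - Q t / P t) <= 0" if "0 <= t" "t < 1" for t
 proof -
  define u where "u = (1 + t) / (1 - t)"
  have u: "u >= 1" using that by (simp add: u_def)
  have R: "P t / Q t = u powr c" "Q t / P t = 1 / u powr c" using that by (auto simp: P_def Q_def u_def powr_divide)
  have "u powr 1 <= u powr c" using u c by (intro powr_mono) auto
  then have uc: "u <= u powr c" using u by simp
  then have "1 / u powr c <= 1 / u" using u by (intro divide_left_mono) auto
  moreover have "u - 1 / u = 4 * t / (1 - t\<^sup>2)"
   using that sq(2)[OF that] by (simp add: u_def divide_simps) (simp add: algebra_simps)
  ultimately show ?thesis unfolding R using uc by linarith
 qed
 have nsc: "n y <= 0" if "0 < s" "s < y" "y < 1" "n s <= 0" for s y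
 proof -
  have "\<exists>z. s < z \<and> z < y \<and> n y - n s = (y - s) * (2 * c / (1 - z\<^sup>2) * (4 * z / (1 - z\<^sup>2) - (P z / Q z - Q z / P z)))"
   by (rule MVT2[OF that(2)]) (use nd that in auto)
  then obtain z where z: "s < z" "z < y" "n y - n s = (y - s) * (2 * c / (1 - z\<^sup>2) * (4 * z / (1 - z\<^sup>2) - (P z / Q z - Q z / P z)))"
   by blast
  have "(y - s) * (2 * c / (1 - z\<^sup>2) * (4 * z / (1 - z\<^sup>2) - (P z / Q z - Q z / P z))) <= 0"
   using nle[of z] sq(1)[of z] z that c
   by (intro mult_nonneg_nonpos[OF _ mult_nonneg_nonpos]) (simp_all add: zero_le_divide_iff)
  then show ?thesis using z(3) that(4) by linarith
 qed
 have md: "(m has_real_derivative 2 * c / (1 - t\<^sup>2) * n t) (at t)" if "0 <= t" "t < 1" for t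
 proof -
  have "((%t. 4 * c\<^sup>2 * t / (1 - t\<^sup>2)) has_real_derivative 2 * c / (1 - t\<^sup>2) * (2 * c * (1 + t\<^sup>2) / (1 - t\<^sup>2))) (at t)"
   using sq(1)[OF that] by (auto intro!: derivative_eq_intros simp: field_simps power2_eq_square)
  from DERIV_diff[OF this DERIV_diff[OF Rd(1)[OF that] Rd(2)[OF that]]]
  show ?thesis unfolding m_def n_def
   by (rule DERIV_cong) (simp only: right_diff_distrib distrib_left diff_minus_eq_add)
 qed
 have msc: "m y <= 0" if "0 < s" "s < y" "y < 1" "m s <= 0" for s y
 proof (rule sign_change_integrate[OF md _ nsc _ that])
  show "0 <= 2 * c / (1 - t\<^sup>2)" "0 < 2 * c / (1 - t\<^sup>2)" if "0 < t" "t < 1" for t :: real using sq(1)[of t] that c by auto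
  show "0 <= m 0" by (simp add: m_def P_def Q_def)
 qed auto
 have Kd: "(K has_real_derivative P t * Q t / (t * ((P t)\<^sup>2 - (Q t)\<^sup>2)) * m t) (at t)" if "0 < t" "t < 1" for t
 proof -
  have t': "0 <= t" "t < 1" using that by auto
  have pos: "P t - Q t > 0" "P t + Q t > 0" "P t > 0" "Q t > 0" using PQlt[OF that] PQ0[OF t'] by auto
  have d: "(K has_real_derivative c * (1 / (P t - Q t) * (c * P t / (1 + t) - - (c * Q t / (1 - t)))) -
   c * (1 / (P t + Q t) * (c * P t / (1 + t) + - (c * Q t / (1 - t)))) - 1 / t) (at t)"
   unfolding K_def
  proof (intro DERIV_diff DERIV_cmult)
   show "((%t. ln (P t - Q t)) has_real_derivative 1 / (P t - Q t) * (c * P t / (1 + t) - - (c * Q t / (1 - t)))) (at t)"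
    by (rule DERIV_chain'[OF DERIV_diff[OF Pd[OF t'] Qd[OF t']] DERIV_ln_divide[OF pos(1)]])
   show "((%t. ln (P t + Q t)) has_real_derivative 1 / (P t + Q t) * (c * P t / (1 + t) + - (c * Q t / (1 - t)))) (at t)"
    by (rule DERIV_chain'[OF DERIV_add[OF Pd[OF t'] Qd[OF t']] DERIV_ln_divide[OF pos(2)]])
   show "(ln has_real_derivative 1 / t) (at t)" by (rule DERIV_ln_divide[OF that(1)])
  qed
  have nz: "P t - Q t ~= 0" "P t + Q t ~= 0" "P t ~= 0" "Q t ~= 0" "1 + t ~= 0" "1 - t ~= 0" "t ~= 0"
   using pos that by auto
  have f: "(P t)\<^sup>2 - (Q t)\<^sup>2 = (P t - Q t) * (P t + Q t)" by (simp add: power2_eq_square algebra_simps)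
  show ?thesis
   by (rule DERIV_cong[OF d]) (unfold m_def f sq(2)[OF t'], use nz in \<open>simp add: divide_simps\<close>, simp add: algebra_simps power2_eq_square)
 qed
 have PQc: "continuous_on {0..1} P" "continuous_on {0..1} Q"
  unfolding P_def Q_def using c by (intro continuous_on_powr' continuous_intros; auto)+
 have Kcont: "continuous_on {a..1} K" if "0 < a" for a
 proof -
  have "P t - Q t > 0" "P t + Q t > 0" "t > 0" if "t \<in> {a..1}" for t
  proof -
   show "t > 0" using that \<open>0 < a\<close> by auto
   have "(1 - t) powr c < (1 + t) powr c" using that \<open>0 < a\<close> c by (intro powr_less_mono2) auto
   then show "P t - Q t > 0" by (simp add: P_def Q_def)
   have "P t > 0" using that \<open>0 < a\<close> by (auto simp: P_def)
   then show "P t + Q t > 0" by (simp add: Q_def add_pos_nonneg)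
  qed
  moreover have "continuous_on {a..1} P" "continuous_on {a..1} Q"
   using PQc that by (auto intro: continuous_on_subset)
  ultimately show ?thesis unfolding K_def by (intro continuous_intros) (force+)
 qed
 have Ksc: "K y >= 0" if "0 < s" "s < y" "y < 1" "K s >= 0" for s y
 proof (rule sign_change_from_right[OF Kd _ msc Kcont, where s = s and t = y])
  show "0 < P t * Q t / (t * ((P t)\<^sup>2 - (Q t)\<^sup>2))" if "0 < t" "t < 1" for t
  proof -
   have "(Q t)\<^sup>2 < (P t)\<^sup>2" using PQlt[OF that] PQ0[of t] that by (intro power_strict_mono) auto
   then show ?thesis using PQ0[of t] that by simp
  qed
  show "0 <= K 1" using c by (simp add: K_def P_def Q_def)
 qed (use that in auto)
 \<comment> \<open>the denominator is written through \<open>P\<close>, \<open>Q\<close> since \<open>(1 + t)^q = (1 + t) P t\<close>\<close>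
 define h where "h t = c * ln (1 + t powr p) - ln (((1 + t) * P t + (1 - t) * Q t) / 2)" for t
 define r where "r t = (P t - Q t) / (P t + Q t)" for t
 have hd: "(h has_real_derivative q / ((1 + t * t powr (1 / c)) * (1 + t * r t)) * (t powr (1 / c) - r t)) (at t)" if "0 < t" "t < 1" for t
 proof -
  have t': "0 <= t" "t < 1" using that by auto
  have pos: "P t - Q t > 0" "P t + Q t > 0" "P t > 0" "Q t > 0" using PQlt[OF that] PQ0[OF t'] by auto
  define \<tau> where "\<tau> = t powr (1 / c)"
  have \<tau>: "t powr p = t * \<tau>" "t powr (p - 1) = \<tau>" "\<tau> > 0" using that by (auto simp: pc(1) \<tau>_def powr_add)
  define L where "L = (1 + t) * P t + (1 - t) * Q t"
  have L: "L > 0" unfolding L_def using pos that by (intro add_pos_pos mult_pos_pos) auto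
  have d1: "((%t. c * ln (1 + t powr p)) has_real_derivative c * (p * \<tau> / (1 + t * \<tau>))) (at t)"
   using that \<tau> by (auto intro!: derivative_eq_intros simp: add_pos_pos)
  have dL: "((%t. (1 + t) * P t + (1 - t) * Q t) has_real_derivative q * (P t - Q t)) (at t)"
  proof -
   have "((%t. (1 + t) * P t + (1 - t) * Q t) has_real_derivative
    (0 + 1) * P t + c * P t / (1 + t) * (1 + t) + ((0 - 1) * Q t + - (c * Q t / (1 - t)) * (1 - t))) (at t)"
    by (intro DERIV_add DERIV_mult DERIV_diff DERIV_const DERIV_ident Pd Qd t')
   moreover have "(0 + 1) * P t + c * P t / (1 + t) * (1 + t) + ((0 - 1) * Q t + - (c * Q t / (1 - t)) * (1 - t)) = q * (P t - Q t)"
   proof -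
    have "c * P t / (1 + t) * (1 + t) = c * P t" "c * Q t / (1 - t) * (1 - t) = c * Q t" using that by auto
    then show ?thesis unfolding mult_minus_left c_def by (simp only:) (simp add: algebra_simps)
   qed
   ultimately show ?thesis by simp
  qed
  have "((%t. ln (((1 + t) * P t + (1 - t) * Q t) / 2)) has_real_derivative 1 / (L / 2) * (q * (P t - Q t) / 2)) (at t)"
   using L unfolding L_def by (intro DERIV_chain'[OF DERIV_cdivide[OF dL] DERIV_ln_divide]) simp
  from DERIV_diff[OF d1 this]
  have d: "(h has_real_derivative c * (p * \<tau> / (1 + t * \<tau>)) - 1 / (L / 2) * (q * (P t - Q t) / 2)) (at t)" unfolding h_def .
  have rL: "L = (P t + Q t) * (1 + t * r t)" "P t - Q t = (P t + Q t) * r t" using pos by (auto simp: L_def r_def field_simps)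
  have nz: "1 + t * r t ~= 0" "1 + t * \<tau> ~= 0" "P t + Q t ~= 0" using L pos \<tau> that rL(1) by (auto simp: add_pos_pos mult_eq_0_iff add_eq_0_iff_both_eq_0 add_nonneg_eq_0_iff)
  have "c * (p * \<tau> / (1 + t * \<tau>)) - 1 / (L / 2) * (q * (P t - Q t) / 2) = q * (\<tau> / (1 + t * \<tau>) - r t / (1 + t * r t))"
  proof -
   have "1 / (L / 2) * (q * (P t - Q t) / 2) = q * (r t / (1 + t * r t))"
   proof -
    have "1 / (s * w / 2) * (q * (s * x) / 2) = q * (x / w)" if "s ~= 0" "w ~= 0" for s w x :: real
     using that by (simp add: field_simps)
    from this[OF nz(3,1)] show ?thesis unfolding rL .
   qed
   moreover have "c * (p * \<tau> / (1 + t * \<tau>)) = q * (\<tau> / (1 + t * \<tau>))" unfolding pc(2)[symmetric] by simp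
   ultimately show ?thesis by (simp only: right_diff_distrib)
  qed
  also have "\<dots> = q / ((1 + t * \<tau>) * (1 + t * r t)) * (\<tau> - r t)"
  proof -
   have "\<tau> * (1 + t * r t) - r t * (1 + t * \<tau>) = \<tau> - r t" by (simp add: algebra_simps)
   then show ?thesis using diff_frac_eq[OF nz(2,1), of \<tau> "r t"] by simp
  qed
  finally show ?thesis using d by (simp add: \<tau>_def)
 qed
 have rpos: "r t > 0" if "0 < t" "t < 1" for t using PQlt[OF that] PQ0[of t] that by (simp add: r_def)
 have rK: "t powr (1 / c) - r t <= 0 \<longleftrightarrow> 0 <= K t" if "0 < t" "t < 1" for t
 proof -
  have pos: "P t - Q t > 0" "P t + Q t > 0" using PQlt[OF that] PQ0[of t] that by auto
  have "t powr (1 / c) <= r t \<longleftrightarrow> ln (t powr (1 / c)) <= ln (r t)" using rpos[OF that] that by (intro ln_le_cancel_iff[symmetric]) auto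
  also have "\<dots> \<longleftrightarrow> ln t <= c * ln (r t)" using that c by (simp add: ln_powr field_simps)
  also have "c * ln (r t) = c * ln (P t - Q t) - c * ln (P t + Q t)" using pos by (simp add: r_def ln_div algebra_simps)
  finally show ?thesis by (simp add: K_def algebra_simps)
 qed
 have Lpos: "(1 + t) * P t + (1 - t) * Q t > 0" if "0 <= t" "t <= 1" for t
  using that by (intro add_pos_nonneg mult_pos_pos) (auto simp: P_def Q_def)
 have hcont: "continuous_on {0..1} h"
 proof -
  have pcont: "continuous_on {0..1} (%t::real. t powr p)"
   using pc(3) by (intro continuous_on_powr' continuous_intros) auto
  have nz: "1 + x powr p ~= 0" "((1 + x) * P x + (1 - x) * Q x) / 2 ~= 0" if "x \<in> {0..1}" for x
  proof -
   show "1 + x powr p ~= 0" using powr_ge_zero[of x p] by linarith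
  qed (use Lpos[of x] that in auto)
  show ?thesis unfolding h_def
   by (intro continuous_on_diff continuous_on_mult continuous_on_ln continuous_on_add continuous_on_divide
     continuous_on_const continuous_on_id PQc pcont ballI nz) auto
 qed
 have h0: "h 0 = 0" by (simp add: h_def P_def Q_def)
 have h1: "h 1 = 0"
 proof -
  have "c * ln 2 = ln (2 * 2 powr c / 2)" by (simp add: ln_powr)
  then show ?thesis using c by (simp add: h_def P_def Q_def)
 qed
 have hnn: "h t >= 0" if "0 <= t" "t <= 1" for t
 proof (cases "t = 0 \<or> t = 1")
  case False
  then have t: "0 < t" "t < 1" using that by auto
  show ?thesis
  proof (rule sign_change_from_right[OF hd, where s = 0 and t = t])
   show "0 < q / ((1 + t * t powr (1 / c)) * (1 + t * r t))" if "0 < t" "t < 1" for t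
   proof -
    have "0 < t * t powr (1 / c)" "0 < t * r t" using that rpos[OF that] by (auto intro!: mult_pos_pos)
    then show ?thesis using q by (intro divide_pos_pos mult_pos_pos) auto
   qed
   show "y powr (1 / c) - r y <= 0" if "0 < s" "s < y" "y < 1" "s powr (1 / c) - r s <= 0" for s y
    using rK[of s] rK[of y] Ksc[of s y] that by auto
   show "continuous_on {a..1} h" if "0 < a" for a using hcont that by (auto intro: continuous_on_subset)
  qed (use t h0 h1 hcont in auto)
 qed (use h0 h1 in auto)
 have "ln (((1 + t) * P t + (1 - t) * Q t) / 2) <= ln ((1 + t powr p) powr c)"
  using hnn[OF t] by (simp add: h_def ln_powr add_pos_nonneg)
 then have "((1 + t) * P t + (1 - t) * Q t) / 2 <= (1 + t powr p) powr c"
 proof (subst (asm) ln_le_cancel_iff)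
  have "1 + t powr p > 0" using powr_ge_zero[of t p] by linarith
  then show "0 < (1 + t powr p) powr c" by simp
 qed (use Lpos[OF t] in auto)
 moreover have "(1 + t) * P t = (1 + t) powr q" using t by (simp add: P_def c_def powr_diff)
 moreover have "(1 - t) * Q t = (1 - t) powr q"
  using t q by (cases "t = 1") (auto simp: Q_def c_def powr_diff)
 ultimately show ?thesis by (simp add: c_def)
qed

text \<open>
 At \<open>\<alpha> = 1\<close> the left-hand side is \<open>2^(1/q) < sqrt 2\<close>, so continuity suffices.
\<close>

lemma weights_near_one:
 fixes q :: real
 assumes "2 < q"
 shows "\<exists>\<alpha>. 0 < \<alpha> \<and> \<alpha> < 1 \<and> 2 * (\<alpha> / 2) powr (1 - 1 / q) + sqrt 2 * (1 - \<alpha>) powr (1 - 1 / q) < sqrt 2"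
proof -
 let ?f = "%\<alpha>::real. 2 * (\<alpha> / 2) powr (1 - 1 / q) + sqrt 2 * (1 - \<alpha>) powr (1 - 1 / q)"
 have cont: "continuous_on {1/2..1} ?f"
  using assms by (intro continuous_on_add continuous_on_mult continuous_on_const continuous_on_powr'
    continuous_on_divide continuous_on_id continuous_on_diff) auto
 have "2 * (1 / 2) powr (1 - 1 / q) = 2 powr (1 / q)" by (simp add: powr_divide powr_diff)
 also have "\<dots> < 2 powr (1 / 2)" using assms by (intro powr_less_mono) (auto simp: field_simps)
 finally have f1: "?f 1 < sqrt 2" by (simp add: powr_half_sqrt)
 from continuous_on_tendsto_compose[OF cont, of "%\<alpha>. \<alpha>" 1 "at_left 1"]
 have "(?f \<longlongrightarrow> ?f 1) (at_left 1)"
  by (simp add: eventually_at_left_field) (metis (no_types, lifting) dense_ge_bounded divide_less_eq_numeral1(1) less_imp_le one_less_numeral_iff mult_numeral_1 numeral_One order.strict_trans2 semiring_norm(76) zero_less_one)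
 then have "eventually (%\<alpha>. ?f \<alpha> < sqrt 2) (at_left 1)" using f1 by (rule order_tendstoD)
 moreover have "eventually (%\<alpha>. \<alpha> \<in> {0<..<1}) (at_left (1::real))" by (rule eventually_at_left_real) simp
 ultimately have "eventually (%\<alpha>. ?f \<alpha> < sqrt 2 \<and> \<alpha> \<in> {0<..<1}) (at_left 1)" by (rule eventually_conj)
 then obtain \<alpha> where "?f \<alpha> < sqrt 2 \<and> \<alpha> \<in> {0<..<1}" using eventually_happens'[OF trivial_limit_at_left_real] by blast
 then show ?thesis by (intro exI[of _ \<alpha>]) auto
qed

text \<open>
 For \<open>r = p\<close> Clarkson's inequality gives this strictly away from \<open>t = 0\<close>, since \<open>1 + t^q < (1 + t^p)^(q - 1)\<close>; by uniform continuity it survives for \<open>r\<close> slightly above \<open>p\<close>. Near \<open>t = 0\<close> the left-hand side is \<open>1 + O(t^2)\<close> whereas the right-hand side exceeds \<open>1 + t^r\<close> with \<open>r < 2\<close>.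
\<close>

lemma perturbed_two_point:
 fixes q p \<alpha> :: real
 assumes q: "2 < q" and p: "p = q / (q - 1)" and \<alpha>: "0 < \<alpha>" "\<alpha> < 1"
 shows "\<exists>r. p < r \<and> r < 2 \<and> (\<forall>t. 0 <= t \<and> t <= 1 -->
  \<alpha> * (((1 + t) powr q + (1 - t) powr q) / 2) + (1 - \<alpha>) * (1 + t powr q) <= (1 + t powr r) powr (q / r))"
proof -
 have p1: "1 < p" "p < 2" "q / p = q - 1" using q by (auto simp: p field_simps)
 define L where "L t = \<alpha> * (((1 + t) powr q + (1 - t) powr q) / 2) + (1 - \<alpha>) * (1 + t powr q)" for t
 define F where "F = (%(r, t). (1 + t powr r) powr (q / r))"
 define \<rho> where "\<rho> = (2 + p) / 2"
 have \<rho>: "p < \<rho>" "\<rho> < 2" using p1 by (auto simp: \<rho>_def)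
 obtain C where C: "C >= 0" "!!d. 0 <= d ==> d <= 1 ==> ((1 + d) powr q + (1 - d) powr q) / 2 <= 1 + C * d\<^sup>2"
  using two_point_smooth[of q] q by auto
 define \<delta> where "\<delta> = (1 / (C + 1)) powr (1 / (2 - \<rho>))"
 have \<delta>: "0 < \<delta>" "\<delta> powr (2 - \<rho>) = 1 / (C + 1)" using C(1) \<rho> by (auto simp: \<delta>_def powr_powr)
 have small: "L t <= F (r, t)" if t: "0 <= t" "t <= 1" "t <= \<delta>" and r: "p < r" "r <= \<rho>" for r t
 proof (cases "t = 0")
  case True
  then show ?thesis by (simp add: L_def F_def)
 next
  case False
  then have t0: "t > 0" using t by simp
  have t2: "t powr q <= t\<^sup>2" using t t0 q powr_mono'[of 2 q t] by simp
  have "t powr (2 - \<rho>) <= \<delta> powr (2 - \<rho>)" using t \<rho> by (intro powr_mono2) auto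
  then have "(C + 1) * t powr (2 - \<rho>) <= 1" using \<delta>(2) C(1) by (simp add: field_simps)
  then have "(C + 1) * t powr (2 - \<rho>) * t powr \<rho> <= 1 * t powr \<rho>" by (intro mult_right_mono) auto
  then have C2: "(C + 1) * t\<^sup>2 <= t powr \<rho>" using t0 by (simp add: powr_diff mult.assoc)
  have "L t <= \<alpha> * (1 + (C + 1) * t\<^sup>2) + (1 - \<alpha>) * (1 + (C + 1) * t\<^sup>2)"
  proof -
   have "1 + C * t\<^sup>2 <= 1 + (C + 1) * t\<^sup>2" "1 + t\<^sup>2 <= 1 + (C + 1) * t\<^sup>2" using C(1) by (auto simp: algebra_simps)
   then show ?thesis unfolding L_def using C(2)[of t] t t2 \<alpha> by (intro add_mono mult_left_mono) auto
  qed
  also have "\<dots> = 1 + (C + 1) * t\<^sup>2" by (simp add: algebra_simps)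
  also have "\<dots> <= 1 + t powr \<rho>" using C2 by simp
  also have "\<dots> <= 1 + t powr r" using t t0 r by (intro add_left_mono powr_mono') auto
  also have "\<dots> = (1 + t powr r) powr 1" using powr_ge_zero[of t r] by (simp add: add_pos_nonneg)
  also have "\<dots> <= (1 + t powr r) powr (q / r)" using r p1 \<rho> q by (intro powr_mono) (auto simp: field_simps)
  finally show ?thesis by (simp add: F_def)
 qed
 show ?thesis
 proof (cases "\<delta> <= 1")
  case False
  then have "p < \<rho> \<and> \<rho> < 2 \<and> (\<forall>t. 0 <= t \<and> t <= 1 --> L t <= F (\<rho>, t))" using small \<rho> by auto
  then show ?thesis unfolding L_def F_def by auto
 next
  case True
  have "compact ({p..\<rho>} \<times> {\<delta>..1})" by (intro compact_Times compact_Icc)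
  moreover have "continuous_on ({p..\<rho>} \<times> {\<delta>..1}) F"
  proof -
   have "1 + snd x powr fst x ~= 0" for x :: "real \<times> real" using powr_ge_zero[of "snd x" "fst x"] by linarith
   then show ?thesis unfolding F_def split_def using \<delta>(1) p1
    by (intro continuous_intros ballI) auto
  qed
  ultimately have uc: "uniformly_continuous_on ({p..\<rho>} \<times> {\<delta>..1}) F" by (rule compact_uniformly_continuous[rotated])
  define G where "G t = F (p, t) - L t" for t
  have "continuous_on {\<delta>..1} G"
  proof -
   have "continuous_on {\<delta>..1} (%t. F (p, t))"
    by (rule continuous_on_compose2[OF \<open>continuous_on _ F\<close>]) (use \<rho> in \<open>auto intro!: continuous_intros\<close>)
   moreover have "continuous_on {\<delta>..1} L" unfolding L_def using q \<delta>(1)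
    by (intro continuous_on_add continuous_on_mult continuous_on_const continuous_on_powr'
     continuous_on_divide continuous_on_id continuous_on_diff) auto
   ultimately show ?thesis unfolding G_def by (intro continuous_on_diff)
  qed
  then obtain t0 where t0: "t0 \<in> {\<delta>..1}" "!!t. t \<in> {\<delta>..1} ==> G t0 <= G t"
   using continuous_attains_inf[of "{\<delta>..1}" G] True by auto
  have Gpos: "G t > 0" if "t \<in> {\<delta>..1}" for t
  proof -
   have t: "0 < t" "0 <= t" "t <= 1" using that \<delta>(1) by auto
   have "1 + t powr q < (1 + t powr p) powr (q - 1)"
   proof -
    have "1 + t powr q <= 1 + t powr p" using t q p1 by (intro add_left_mono powr_mono') auto
    also have "\<dots> = (1 + t powr p) powr 1" using powr_ge_zero[of t p] by (simp add: add_pos_nonneg)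
    also have "\<dots> < (1 + t powr p) powr (q - 1)" using q t by (intro powr_less_mono) auto
    finally show ?thesis .
   qed
   then have "(1 - \<alpha>) * (1 + t powr q) < (1 - \<alpha>) * (1 + t powr p) powr (q - 1)" using \<alpha> by simp
   moreover have "\<alpha> * (((1 + t) powr q + (1 - t) powr q) / 2) <= \<alpha> * (1 + t powr p) powr (q - 1)"
    using Clarkson_two_point[OF q p t(2,3)] \<alpha> by (intro mult_left_mono) auto
   ultimately have "L t < \<alpha> * (1 + t powr p) powr (q - 1) + (1 - \<alpha>) * (1 + t powr p) powr (q - 1)" unfolding L_def by linarith
   then show ?thesis by (simp add: G_def F_def p1(3) algebra_simps)
  qed
  obtain d where d: "d > 0" "!!x x'. x \<in> {p..\<rho>} \<times> {\<delta>..1} ==> x' \<in> {p..\<rho>} \<times> {\<delta>..1} ==> dist x' x < d ==> dist (F x') (F x) < G t0"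
   using uc Gpos[OF t0(1)] unfolding uniformly_continuous_on_def by metis
  define r where "r = p + min (d / 2) (\<rho> - p)"
  have r: "p < r" "r <= \<rho>" "\<bar>r - p\<bar> < d" using \<rho> d(1) by (auto simp: r_def min_def)
  have "L t <= F (r, t)" if t: "0 <= t" "t <= 1" for t
  proof (cases "t <= \<delta>")
   case True
   then show ?thesis using small t r by blast
  next
   case False
   then have tt: "t \<in> {\<delta>..1}" using t by simp
   have "dist (F (r, t)) (F (p, t)) < G t0"
    by (rule d(2)) (use r tt \<rho> in \<open>auto simp: dist_Pair_Pair dist_real_def\<close>)
   then have "F (p, t) - F (r, t) < G t" using t0(2)[OF tt] by (simp add: dist_real_def)
   then show ?thesis by (simp add: G_def)
  qed
  then have "p < r \<and> r < 2 \<and> (\<forall>t. 0 <= t \<and> t <= 1 --> L t <= F (r, t))" using r \<rho> by auto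
  then show ?thesis unfolding L_def F_def by auto
 qed
qed

text \<open>
 For given norms, \<open>\<bar>x + y\<bar>^2\<close> and \<open>\<bar>x - y\<bar>^2\<close> have a fixed sum and are the farthest apart for collinear vectors; \<open>u \<mapsto> u^(q/2)\<close> is convex.
\<close>

lemma powr_two_point_norm:
 fixes x y :: "'a::real_inner"
 assumes "2 <= q"
 shows "norm (x + y) powr q + norm (x - y) powr q <= (norm x + norm y) powr q + \<bar>norm x - norm y\<bar> powr q"
proof -
 define M where "M = 2 * norm x * norm y"
 define T where "T = 2 * (x \<bullet> y)"
 define S where "S = (norm x)\<^sup>2 + (norm y)\<^sup>2"
 have T: "\<bar>T\<bar> <= M" using Cauchy_Schwarz_ineq2[of x y] by (simp add: T_def M_def)
 have SM: "S + M = (norm x + norm y)\<^sup>2" "S - M = \<bar>norm x - norm y\<bar>\<^sup>2"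
  by (auto simp: S_def M_def power2_eq_square algebra_simps)
 have ST: "S + T = (norm (x + y))\<^sup>2" "S - T = (norm (x - y))\<^sup>2"
  by (auto simp: S_def T_def power2_norm_eq_inner inner_add_left inner_add_right inner_diff_left inner_diff_right inner_commute)
 have sq: "(z\<^sup>2) powr (q / 2) = z powr q" if "z >= 0" for z :: real
  using that by (cases "z = 0") (simp_all add: powr_powr flip: powr_numeral)
 define l where "l = (if M = 0 then 0 else (M - T) / (2 * M))"
 have l: "0 <= l" "l <= 1" "T = (1 - 2 * l) * M"
  using T by (auto simp: l_def field_simps split: if_splits)
 have e: "S + T = (1 - l) * (S + M) + l * (S - M)" "S - T = (1 - (1 - l)) * (S + M) + (1 - l) * (S - M)"
  unfolding l(3) by (auto simp: algebra_simps)
 have nn: "0 <= S + M" "0 <= S - M" unfolding SM by auto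
 have "(S + T) powr (q / 2) <= (1 - l) * (S + M) powr (q / 2) + l * (S - M) powr (q / 2)"
  unfolding e using convex_powr[of "q / 2" "S + M" "S - M" l] assms nn l by simp
 moreover have "(S - T) powr (q / 2) <= l * (S + M) powr (q / 2) + (1 - l) * (S - M) powr (q / 2)"
  unfolding e using convex_powr[of "q / 2" "S + M" "S - M" "1 - l"] assms nn l by simp
 ultimately have "(S + T) powr (q / 2) + (S - T) powr (q / 2) <= (S + M) powr (q / 2) + (S - M) powr (q / 2)"
  by (simp add: algebra_simps)
 then show ?thesis unfolding ST SM by (simp only: sq norm_ge_zero abs_ge_zero add_nonneg_nonneg)
qed

section \<open>Tensor powers of a contractive matrix\<close>

text \<open>
 The rows are \<open>u (1, 1)\<close>, \<open>u (1, -1)\<close>, \<open>v (1, 0)\<close>, \<open>v (0, 1)\<close>. With columns of norm one, the first two rows alone are contractive into \<open>\<ell>\<^sub>q\<close> only from \<open>\<ell>\<^sub>r\<close> with \<open>r \<le> q / (q - 1)\<close>; the admixture of the identity allows a larger \<open>r\<close>.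
\<close>

definition base :: "real => real => nat => nat => real" where
 "base u v a b = (if a < 2 then (if a = 1 \<and> b = 1 then - u else u) else if b = a - 2 then v else 0)"

lemma sum_lessThan_2: "sum f {..<2::nat} = f 0 + f 1"
 and sum_lessThan_4: "sum f {..<4::nat} = f 0 + f 1 + f 2 + f 3"
 by (simp_all add: eval_nat_numeral)

lemma base_contractive:
 fixes x :: "'k::{real_normed_field,euclidean_space} seq"
 assumes q: "2 < q" and \<alpha>: "0 < \<alpha>" "\<alpha> < 1" and r: "0 < r"
  and le: "!!t. 0 <= t ==> t <= 1 ==>
   \<alpha> * (((1 + t) powr q + (1 - t) powr q) / 2) + (1 - \<alpha>) * (1 + t powr q) <= (1 + t powr r) powr (q / r)"
 shows "(\<Sum>a<4. norm (\<Sum>b<2. of_real (base ((\<alpha> / 2) powr (1 / q)) ((1 - \<alpha>) powr (1 / q)) a b) * x b) powr q)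
  <= (\<Sum>b<2. norm (x b) powr r) powr (q / r)"
proof -
 define u where "u = (\<alpha> / 2) powr (1 / q)"
 define v where "v = (1 - \<alpha>) powr (1 / q)"
 have uv: "u powr q = \<alpha> / 2" "v powr q = 1 - \<alpha>" "u >= 0" "v >= 0" using q \<alpha> by (auto simp: u_def v_def powr_powr)
 have hom: "\<alpha> * (((a + b) powr q + (a - b) powr q) / 2) + (1 - \<alpha>) * (a powr q + b powr q) <= (a powr r + b powr r) powr (q / r)"
  if ab: "0 <= b" "b <= a" for a b :: real
 proof (cases "a = 0")
  case False
  then have a: "a > 0" using ab by simp
  define t where "t = b / a"
  have t: "0 <= t" "t <= 1" "b = a * t" using a ab by (auto simp: t_def)
  have e: "a + b = a * (1 + t)" "a - b = a * (1 - t)" using t(3) by (auto simp: algebra_simps)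
  have "\<alpha> * (((a + b) powr q + (a - b) powr q) / 2) + (1 - \<alpha>) * (a powr q + b powr q)
   = a powr q * (\<alpha> * (((1 + t) powr q + (1 - t) powr q) / 2) + (1 - \<alpha>) * (1 + t powr q))"
   unfolding e using a t by (simp add: powr_mult) (simp add: algebra_simps add_divide_distrib)
  also have "\<dots> <= a powr q * (1 + t powr r) powr (q / r)" using le[OF t(1,2)] by (intro mult_left_mono) auto
  also have "\<dots> = (a powr r * (1 + t powr r)) powr (q / r)" using r by (simp add: powr_mult powr_powr)
  also have "a powr r * (1 + t powr r) = a powr r + b powr r" using a t by (simp add: powr_mult algebra_simps)
  finally show ?thesis .
 qed (use ab q in auto)
 have "(\<Sum>a<4. norm (\<Sum>b<2. of_real (base u v a b) * x b) powr q)
  = norm (of_real u * (x 0 + x 1)) powr q + norm (of_real u * (x 0 - x 1)) powr q + norm (of_real v * x 0) powr q + norm (of_real v * x 1) powr q"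
  unfolding sum_lessThan_4 sum_lessThan_2 by (simp add: base_def algebra_simps)
 also have "\<dots> = \<alpha> / 2 * (norm (x 0 + x 1) powr q + norm (x 0 - x 1) powr q) + (1 - \<alpha>) * (norm (x 0) powr q + norm (x 1) powr q)"
  by (simp add: norm_mult powr_mult uv) (simp add: algebra_simps)
 also have "\<dots> <= \<alpha> / 2 * ((norm (x 0) + norm (x 1)) powr q + \<bar>norm (x 0) - norm (x 1)\<bar> powr q) + (1 - \<alpha>) * (norm (x 0) powr q + norm (x 1) powr q)"
  using powr_two_point_norm[of q "x 0" "x 1"] q \<alpha> by (intro add_right_mono mult_left_mono) auto
 also have "\<dots> <= (norm (x 0) powr r + norm (x 1) powr r) powr (q / r)"
 proof (cases "norm (x 1) <= norm (x 0)")
  case True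
  then show ?thesis using hom[of "norm (x 1)" "norm (x 0)"] by simp
 next
  case False
  then have "\<bar>norm (x 0) - norm (x 1)\<bar> = norm (x 1) - norm (x 0)" by simp
  then show ?thesis using hom[of "norm (x 0)" "norm (x 1)"] False by (simp add: add.commute)
 qed
 finally show ?thesis unfolding sum_lessThan_2 u_def v_def by simp
qed

lemma sum_lessThan_mult:
 fixes f :: "nat => 'a::comm_monoid_add"
 shows "(\<Sum>i<m * k. f i) = (\<Sum>i<m. \<Sum>b<k. f (i * k + b))"
proof -
 have "sum f {i * k..<i * k + k} = (\<Sum>b<k. f (i * k + b))" for i
  by (rule sum.reindex_bij_witness[of _ "%b. i * k + b" "%j. j - i * k"]) auto
 then show ?thesis by (simp flip: sum.nat_group)
qed

text \<open>
 The \<open>n\<close>-th tensor power of a matrix with four rows and two columns; the digits of \<open>j\<close> in base 4 and of \<open>i\<close> in base 2 are the multi-indices.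
\<close>

primrec tens :: "(nat => nat => real) => nat => nat => nat => real" where
 "tens t 0 = (%j i. 1)"
| "tens t (Suc n) = (%j i. t (j mod 4) (i mod 2) * tens t n (j div 4) (i div 2))"

text \<open>
 Apply \<open>t\<close> in one tensor factor and the induction hypothesis in the others; Minkowski's inequality, valid as \<open>r \<le> q\<close>, interchanges the two norms in between.
\<close>

lemma tens_contractive:
 fixes x :: "'k::real_normed_field seq"
 assumes r: "0 < r" "r <= q" and K: "0 <= K"
  and t: "!!x :: 'k seq. (\<Sum>a<4. norm (\<Sum>b<2. of_real (t a b) * x b) powr q) <= K * (\<Sum>b<2. norm (x b) powr r) powr (q / r)"
 shows "(\<Sum>j<4^n. norm (\<Sum>i<2^n. of_real (tens t n j i) * x i) powr q) <= K ^ n * (\<Sum>i<2^n. norm (x i) powr r) powr (q / r)"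
proof (induction n arbitrary: x)
 case 0
 then show ?case using r by (simp add: powr_powr lessThan_Suc)
next
 case (Suc n)
 define y where "y j b = (\<Sum>i<2^n. of_real (tens t n j i) * x (i * 2 + b))" for j b
 have row: "(\<Sum>i<2^Suc n. of_real (tens t (Suc n) (j * 4 + a) i) * x i) = (\<Sum>b<2. of_real (t a b) * y j b)" if "a < 4" for j a
 proof -
  have "(\<Sum>i<2^Suc n. of_real (tens t (Suc n) (j * 4 + a) i) * x i)
   = (\<Sum>i<2^n. \<Sum>b<2. of_real (tens t (Suc n) (j * 4 + a) (i * 2 + b)) * x (i * 2 + b))"
   unfolding power_Suc2 by (rule sum_lessThan_mult)
  also have "\<dots> = (\<Sum>i<2^n. \<Sum>b<2. of_real (t a b) * (of_real (tens t n j i) * x (i * 2 + b)))"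
   using that by (intro sum.cong refl) (simp add: mult.assoc)
  also have "\<dots> = (\<Sum>b<2. of_real (t a b) * y j b)" unfolding y_def sum_distrib_left by (rule sum.swap)
  finally show ?thesis .
 qed
 have "(\<Sum>j<4^Suc n. norm (\<Sum>i<2^Suc n. of_real (tens t (Suc n) j i) * x i) powr q)
  = (\<Sum>j<4^n. \<Sum>a<4. norm (\<Sum>i<2^Suc n. of_real (tens t (Suc n) (j * 4 + a) i) * x i) powr q)"
  unfolding power_Suc2 by (rule sum_lessThan_mult)
 also have "\<dots> = (\<Sum>j<4^n. \<Sum>a<4. norm (\<Sum>b<2. of_real (t a b) * y j b) powr q)"
  by (intro sum.cong refl) (simp only: row lessThan_iff)
 also have "\<dots> <= (\<Sum>j<4^n. K * (\<Sum>b<2. norm (y j b) powr r) powr (q / r))"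
  by (intro sum_mono t)
 also have "\<dots> = K * (\<Sum>j<4^n. (\<Sum>b<2. norm (y j b) powr r) powr (q / r))" by (simp add: sum_distrib_left)
 also have "\<dots> <= K * (\<Sum>b<2. (\<Sum>j<4^n. norm (y j b) powr q) powr (r / q)) powr (q / r)"
  using mixed_Minkowski[of r q "{..<2::nat}" "{..<4^n}" "%b j. norm (y j b)"] r K by (intro mult_left_mono) auto
 also have "\<dots> <= K * ((K ^ n) powr (r / q) * (\<Sum>i<2^Suc n. norm (x i) powr r)) powr (q / r)"
 proof -
  have "(\<Sum>j<4^n. norm (y j b) powr q) powr (r / q) <= (K ^ n) powr (r / q) * (\<Sum>i<2^n. norm (x (i * 2 + b)) powr r)" for b
  proof -
   have "(\<Sum>j<4^n. norm (y j b) powr q) <= K ^ n * (\<Sum>i<2^n. norm (x (i * 2 + b)) powr r) powr (q / r)"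
    unfolding y_def by (rule Suc.IH)
   then have "(\<Sum>j<4^n. norm (y j b) powr q) powr (r / q) <= (K ^ n * (\<Sum>i<2^n. norm (x (i * 2 + b)) powr r) powr (q / r)) powr (r / q)"
    using r by (intro powr_mono2 sum_nonneg) auto
   also have "\<dots> = (K ^ n) powr (r / q) * (\<Sum>i<2^n. norm (x (i * 2 + b)) powr r)"
    using r K by (simp add: powr_mult powr_powr sum_nonneg)
   finally show ?thesis .
  qed
  then have "(\<Sum>b<2. (\<Sum>j<4^n. norm (y j b) powr q) powr (r / q)) <= (\<Sum>b<2. (K ^ n) powr (r / q) * (\<Sum>i<2^n. norm (x (i * 2 + b)) powr r))"
   by (intro sum_mono)
  also have "\<dots> = (K ^ n) powr (r / q) * (\<Sum>i<2^Suc n. norm (x i) powr r)"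
   unfolding power_Suc2[of 2 n] sum_lessThan_mult sum_distrib_left by (rule sum.swap)
  finally show ?thesis using r K by (intro mult_left_mono powr_mono2 sum_nonneg) auto
 qed
 also have "\<dots> = K * K ^ n * (\<Sum>i<2^Suc n. norm (x i) powr r) powr (q / r)"
 proof -
  have "((K ^ n) powr (r / q) * Z) powr (q / r) = K ^ n * Z powr (q / r)" if "Z >= 0" for Z
   using r K that by (simp add: powr_mult powr_powr)
  then show ?thesis by (simp only: sum_nonneg powr_ge_zero mult.assoc)
 qed
 finally show ?case by (simp only: power_Suc)
qed

lemma tens_sum:
 assumes "!!b. b < 2 ==> (\<Sum>a<4. v a b) = \<sigma>"
 shows "(\<Sum>j<4^n. tens v n j i) = \<sigma> ^ n"
proof (induction n arbitrary: i)
 case (Suc n)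
 have "(\<Sum>j<4^Suc n. tens v (Suc n) j i) = (\<Sum>j<4^n. \<Sum>a<4. tens v (Suc n) (j * 4 + a) i)"
  unfolding power_Suc2 by (rule sum_lessThan_mult)
 also have "\<dots> = (\<Sum>j<4^n. \<Sum>a<4. v a (i mod 2) * tens v n j (i div 2))"
  by (intro sum.cong refl) simp
 also have "\<dots> = (\<Sum>a<4. v a (i mod 2)) * (\<Sum>j<4^n. tens v n j (i div 2))"
  unfolding sum_product by (rule sum.swap)
 finally show ?case using assms[of "i mod 2"] Suc.IH by simp
qed simp

lemma tens_mult: "tens (%a b. s a b * t a b) n j i = tens s n j i * tens t n j i"
 by (induction n arbitrary: j i) auto

lemma tens_abs_powr: "tens (%a b. \<bar>t a b\<bar> powr c) n j i = \<bar>tens t n j i\<bar> powr c"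
 by (induction n arbitrary: j i) (auto simp: abs_mult powr_mult)

lemma tens_row: "tens (%a b. d a) n j i = tens (%a b. d a) n j 0"
proof (induction n arbitrary: j i)
 case (Suc n)
 then show ?case by simp
qed simp

text \<open>
 The matrix splits as \<open>d w\<close> with \<open>w\<close> having orthogonal columns. Moving \<open>w\<close> onto \<open>Y\<close> and applying the Cauchy--Schwarz inequality twice leaves the square sums of \<open>d\<close> and of \<open>w Y\<close>, each of which contributes \<open>S^(n/2)\<close>; the factor \<open>2^(n/2)\<close> comes from the \<open>2^n\<close> vectors \<open>Y i\<close>.
\<close>

lemma tens_trace:
 fixes X Y :: "nat => nat => 'k::real_normed_field"
 assumes d: "(\<Sum>a<4. (d a)\<^sup>2) = S" and S: "0 <= S"
  and w: "!!x :: 'k seq. (\<Sum>a<4. (norm (\<Sum>b<2. of_real (w a b) * x b))\<^sup>2) <= S * (\<Sum>b<2. (norm (x b))\<^sup>2)"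
  and X: "!!j. (\<Sum>m<M. (norm (X j m))\<^sup>2) <= x\<^sup>2" and Y: "!!i. (\<Sum>m<M. (norm (Y i m))\<^sup>2) <= y\<^sup>2"
  and xy: "0 <= x" "0 <= y"
 shows "norm (\<Sum>j<4^n. \<Sum>i<2^n. of_real (tens (%a b. d a * w a b) n j i) * (\<Sum>m<M. X j m * Y i m)) <= (S * sqrt 2) ^ n * x * y"
proof -
 define D where "D j = tens (%a b. d a) n j 0" for j
 define Z where "Z j m = (\<Sum>i<2^n. of_real (tens w n j i) * Y i m)" for j m
 have u: "tens (%a b. d a * w a b) n j i = D j * tens w n j i" for j i
  unfolding D_def tens_mult using tens_row[of d n j i] by simp
 have wn: "(\<Sum>j<4^n. (norm (\<Sum>i<2^n. of_real (tens w n j i) * z i))\<^sup>2) <= S ^ n * (\<Sum>i<2^n. (norm (z i))\<^sup>2)" for z :: "'k seq"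
 proof -
  have sq: "norm v powr 2 = (norm v)\<^sup>2" for v :: 'k by simp
  have "(\<Sum>j<4^n. norm (\<Sum>i<2^n. of_real (tens w n j i) * z i) powr 2) <= S ^ n * (\<Sum>i<2^n. norm (z i) powr 2) powr (2 / 2)"
   by (rule tens_contractive) (use S w in \<open>simp_all add: sum_nonneg\<close>)
  then show ?thesis by (simp add: sum_nonneg)
 qed
 have D: "(\<Sum>j<4^n. (D j)\<^sup>2) = S ^ n"
  using tens_sum[of "%a b. d a * d a" S n 0] d by (simp add: D_def power2_eq_square tens_mult[of "%a b. d a" "%a b. d a"])
 have ZZ: "(\<Sum>j<4^n. \<Sum>m<M. (norm (Z j m))\<^sup>2) <= S ^ n * (2 ^ n * y\<^sup>2)"
 proof -
  have "(\<Sum>j<4^n. \<Sum>m<M. (norm (Z j m))\<^sup>2) = (\<Sum>m<M. \<Sum>j<4^n. (norm (Z j m))\<^sup>2)" by (rule sum.swap)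
  also have "\<dots> <= (\<Sum>m<M. S ^ n * (\<Sum>i<2^n. (norm (Y i m))\<^sup>2))" unfolding Z_def by (intro sum_mono wn)
  also have "\<dots> = S ^ n * (\<Sum>i<2^n. \<Sum>m<M. (norm (Y i m))\<^sup>2)" unfolding sum_distrib_left by (rule sum.swap)
  also have "\<dots> <= S ^ n * (\<Sum>i<(2::nat)^n. y\<^sup>2)" using S Y by (intro mult_left_mono sum_mono) auto
  finally show ?thesis by simp
 qed
 have "(\<Sum>j<4^n. \<Sum>i<2^n. of_real (tens (%a b. d a * w a b) n j i) * (\<Sum>m<M. X j m * Y i m))
  = (\<Sum>j<4^n. of_real (D j) * (\<Sum>m<M. X j m * Z j m))"
 proof (rule sum.cong[OF refl])
  fix j
  have "(\<Sum>i<2^n. of_real (D j * tens w n j i) * (\<Sum>m<M. X j m * Y i m))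
   = (\<Sum>i<2^n. \<Sum>m<M. of_real (D j) * (X j m * (of_real (tens w n j i) * Y i m)))"
   unfolding sum_distrib_left by (intro sum.cong refl) (simp add: mult_ac)
  also have "\<dots> = (\<Sum>m<M. \<Sum>i<2^n. of_real (D j) * (X j m * (of_real (tens w n j i) * Y i m)))" by (rule sum.swap)
  also have "\<dots> = of_real (D j) * (\<Sum>m<M. X j m * Z j m)" unfolding Z_def by (simp only: sum_distrib_left)
  finally show "(\<Sum>i<2^n. of_real (tens (%a b. d a * w a b) n j i) * (\<Sum>m<M. X j m * Y i m))
   = of_real (D j) * (\<Sum>m<M. X j m * Z j m)" unfolding u .
 qed
 also have "norm \<dots> <= (\<Sum>j<4^n. \<bar>D j\<bar> * (x * \<bar>L2_set (%m. norm (Z j m)) {..<M}\<bar>))"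
 proof (intro order_trans[OF norm_sum] sum_mono)
  fix j
  have "norm (\<Sum>m<M. X j m * Z j m) <= (\<Sum>m<M. \<bar>norm (X j m)\<bar> * \<bar>norm (Z j m)\<bar>)"
   by (rule order_trans[OF norm_sum]) (simp add: norm_mult)
  also have "\<dots> <= L2_set (%m. norm (X j m)) {..<M} * L2_set (%m. norm (Z j m)) {..<M}" by (rule L2_set_mult_ineq)
  also have "\<dots> <= x * L2_set (%m. norm (Z j m)) {..<M}"
   using X[of j] xy by (intro mult_right_mono) (auto simp: L2_set_def intro: real_le_lsqrt sum_nonneg)
  finally show "norm (of_real (D j) * (\<Sum>m<M. X j m * Z j m)) <= \<bar>D j\<bar> * (x * \<bar>L2_set (%m. norm (Z j m)) {..<M}\<bar>)"
   by (simp add: norm_mult mult_left_mono)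
 qed
 also have "\<dots> = x * (\<Sum>j<4^n. \<bar>D j\<bar> * \<bar>L2_set (%m. norm (Z j m)) {..<M}\<bar>)" by (simp add: sum_distrib_left mult_ac)
 also have "\<dots> <= x * (L2_set D {..<4^n} * L2_set (%j. L2_set (%m. norm (Z j m)) {..<M}) {..<4^n})"
  using xy by (intro mult_left_mono L2_set_mult_ineq)
 also have "\<dots> <= x * (sqrt (S ^ n) * sqrt (S ^ n * (2 ^ n * y\<^sup>2)))"
 proof -
  have "L2_set D {..<4^n} = sqrt (S ^ n)" by (simp add: L2_set_def D)
  moreover have "L2_set (%j. L2_set (%m. norm (Z j m)) {..<M}) {..<4^n} <= sqrt (S ^ n * (2 ^ n * y\<^sup>2))"
   using ZZ by (simp add: L2_set_def sum_nonneg)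
  ultimately show ?thesis using xy S by (simp add: mult_left_mono)
 qed
 also have "sqrt (S ^ n * (2 ^ n * y\<^sup>2)) = sqrt (S ^ n) * (sqrt 2 ^ n * y)" using xy by (simp add: real_sqrt_mult real_sqrt_power)
 also have "x * (sqrt (S ^ n) * (sqrt (S ^ n) * (sqrt 2 ^ n * y))) = (sqrt (S ^ n) * sqrt (S ^ n)) * sqrt 2 ^ n * x * y" by (simp only: mult_ac)
 also have "\<dots> = (S * sqrt 2) ^ n * x * y" using S by (simp add: power_mult_distrib)
 finally show ?thesis .
qed

lemma base_orthogonal:
 fixes x :: "'k::{real_normed_field,euclidean_space} seq"
 shows "(\<Sum>a<4. (norm (\<Sum>b<2. of_real (base u v a b) * x b))\<^sup>2) = (2 * u\<^sup>2 + v\<^sup>2) * (\<Sum>b<2. (norm (x b))\<^sup>2)"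
proof -
 have par: "(norm (a + b))\<^sup>2 + (norm (a - b))\<^sup>2 = 2 * (norm a)\<^sup>2 + 2 * (norm b)\<^sup>2" for a b :: 'k
  by (simp add: power2_norm_eq_inner inner_add_left inner_add_right inner_diff_left inner_diff_right inner_commute)
 have "(\<Sum>a<4. (norm (\<Sum>b<2. of_real (base u v a b) * x b))\<^sup>2)
  = (norm (of_real u * (x 0 + x 1)))\<^sup>2 + (norm (of_real u * (x 0 - x 1)))\<^sup>2 + (norm (of_real v * x 0))\<^sup>2 + (norm (of_real v * x 1))\<^sup>2"
  unfolding sum_lessThan_4 sum_lessThan_2 by (simp add: base_def algebra_simps)
 also have "\<dots> = u\<^sup>2 * ((norm (x 0 + x 1))\<^sup>2 + (norm (x 0 - x 1))\<^sup>2) + v\<^sup>2 * ((norm (x 0))\<^sup>2 + (norm (x 1))\<^sup>2)"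
  by (simp add: norm_mult power_mult_distrib) (simp add: algebra_simps)
 finally show ?thesis unfolding par sum_lessThan_2 by (simp add: algebra_simps)
qed

section \<open>Operators given by blocks of matrices\<close>

lemma matrix_block_op:
 fixes V :: "nat => nat => nat => real"
 assumes pq: "1 <= p" "p <= q" and K: "0 <= K"
  and dis: "disjoint_family (%n. {s n..<s n + N n})" "disjoint_family (%n. {e n..<e n + M n})"
  and V: "!!n (x :: 'k::real_normed_field seq). (\<Sum>j<M n. norm (\<Sum>i<N n. of_real (V n j i) * x i) powr q)
   <= K powr q * (\<Sum>i<N n. norm (x i) powr p) powr (q / p)"
 shows "\<exists>T :: 'k seq_op. T \<in> bounded_ops p q \<and>
  (\<forall>x\<in>lp p. \<forall>n. \<forall>j<M n. T x (e n + j) = (\<Sum>i<N n. of_real (V n j i) * x (s n + i)))"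
proof -
 define D where "D n = {s n..<s n + N n}" for n
 define R where "R n = {e n..<e n + M n}" for n
 define G :: "nat => 'k seq_op" where
  "G n x = (%k. if k \<in> R n then \<Sum>i<N n. of_real (V n (k - e n) i) * x (s n + i) else 0)" for n x
 have DR: "finite (D n)" "finite (R n)" for n by (auto simp: D_def R_def)
 have bd: "lp_norm q (G n x) <= K * lp_norm p (restr (D n) x)" if "x \<in> lp p" for n x
 proof -
  have "lp_norm q (G n x) powr q = (\<Sum>k\<in>R n. norm (G n x k) powr q)"
   using lp_restr_finite(2)[of q "R n" "G n x"] pq DR by (simp add: restr_def G_def if_distrib cong: if_cong)
  also have "\<dots> = (\<Sum>j<M n. norm (\<Sum>i<N n. of_real (V n j i) * x (s n + i)) powr q)"
   by (rule sum.reindex_bij_witness[of _ "%j. e n + j" "%k. k - e n"]) (auto simp: R_def G_def)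
  also have "\<dots> <= K powr q * (\<Sum>i<N n. norm (x (s n + i)) powr p) powr (q / p)" by (rule V)
  also have "(\<Sum>i<N n. norm (x (s n + i)) powr p) = (\<Sum>k\<in>D n. norm (x k) powr p)"
   by (rule sum.reindex_bij_witness[of _ "%k. k - s n" "%i. s n + i"]) (auto simp: D_def)
  also have "\<dots> = lp_norm p (restr (D n) x) powr p" using lp_restr_finite(2)[of p "D n" x] pq DR by simp
  also have "K powr q * (lp_norm p (restr (D n) x) powr p) powr (q / p) = (K * lp_norm p (restr (D n) x)) powr q"
   using pq K by (simp add: powr_powr powr_mult)
  finally show ?thesis by (rule le_powr_cancel) (use pq K in auto)
 qed
 interpret block_data p q K D R G
 proof
  show "disjoint_family D" "disjoint_family R" using dis unfolding D_def R_def by blast+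
  show "seq_linear (G n)" for n
   by (auto simp: seq_linear_def G_def fun_eq_iff seq_scale_def sum.distrib distrib_left sum_distrib_left mult_ac)
  show "restr (R n) (G n x) = G n x" for n x by (auto simp: restr_def G_def fun_eq_iff)
 qed (use pq K DR bd in auto)
 show ?thesis
 proof (intro exI[of _ "block_op p R G"] conjI ballI allI impI block_op_bounded_ops)
  fix x :: "'k seq" and n j assume "x \<in> lp p" "j < M n"
  moreover from this have "e n + j \<in> R n" by (simp add: R_def)
  ultimately show "block_op p R G x (e n + j) = (\<Sum>i<N n. of_real (V n j i) * x (s n + i))"
   by (simp add: block_op_apply) (simp add: G_def)
 qed
qed

section \<open>A trace obstruction to factoring through Hilbert space\<close>

lemma ops_restr_apply:
 assumes "A \<in> bounded_ops r q" "1 <= r" "1 <= q" "finite S"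
 shows "A (restr S y) j = (\<Sum>m\<in>S. y m * A (unit m) j)"
proof -
 have "A (restr S y) = (\<Sum>m\<in>S. A (seq_scale (y m) (unit m)))"
  unfolding restr_finite_eq_sum[OF assms(4)] using assms by (intro ops_sum) (auto intro!: lp_scale_unit)
 also have "\<dots> = (\<Sum>m\<in>S. seq_scale (y m) (A (unit m)))"
  using assms by (intro sum.cong refl ops_scale unit_lp) auto
 finally show ?thesis by (simp add: sum_fun_apply seq_scale_def)
qed

lemma ops_expansion:
 fixes A :: "'k::real_normed_field seq_op"
 assumes "A \<in> bounded_ops r q" "1 <= r" "1 <= q" "y \<in> lp r"
 shows "(%M. \<Sum>m<M. y m * A (unit m) j) \<longlonglongrightarrow> A y j"
proof -
 obtain C where C: "0 < C" "!!x. x \<in> lp r ==> lp_norm q (A x) <= C * lp_norm r x" using ops_bound[OF assms(1)] by (metis (lifting))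
 show ?thesis
 proof (rule LIMSEQ_I)
  fix e :: real assume e: "0 < e"
  obtain M0 where M0: "!!m. m >= M0 ==> lp_norm r (restr {m..} y) < e / C" using lp_tail[of r y "e / C"] assms e C(1) by auto
  have "norm ((\<Sum>m<M. y m * A (unit m) j) - A y j) < e" if "M >= M0" for M
  proof -
   have mem: "restr {..<M} y \<in> lp r" "restr {M..} y \<in> lp r" using assms by (auto intro!: lp_restr)
   have "restr {M..} y = y - restr {..<M} y" by (auto simp: restr_def fun_eq_iff)
   then have "A (restr {M..} y) = A y - A (restr {..<M} y)" using ops_diff[OF assms(1,2,4) mem(1)] by simp
   then have "norm ((\<Sum>m<M. y m * A (unit m) j) - A y j) = norm (A (restr {M..} y) j)"
    by (simp add: ops_restr_apply[OF assms(1-3)] norm_minus_commute)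
   also have "\<dots> <= lp_norm q (A (restr {M..} y))" using assms mem by (intro lp_norm_component ops_in[OF assms(1)]) auto
   also have "\<dots> <= C * lp_norm r (restr {M..} y)" by (rule C(2)[OF mem(2)])
   also have "\<dots> < e" using M0[OF that] C(1) by (simp add: field_simps)
   finally show ?thesis .
  qed
  then show "\<exists>M0. \<forall>M\<ge>M0. norm ((\<Sum>m<M. y m * A (unit m) j) - A y j) < e" by blast
 qed
qed

text \<open>
 The rows of \<open>A\<close> are functionals on \<open>\<ell>\<^sub>2\<close>; test \<open>A\<close> on the conjugate of the row.
\<close>

lemma row_square_sum:
 fixes A :: "'k::{real_normed_field,euclidean_space} seq_op"
 assumes A: "A \<in> bounded_ops 2 q" "1 <= q" and a: "0 <= a" "!!x. x \<in> lp 2 ==> lp_norm q (A x) <= a * lp_norm 2 x"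
 shows "(\<Sum>m<M. (norm (A (unit m) j))\<^sup>2) <= a\<^sup>2"
proof -
 define \<sigma> where "\<sigma> = (\<Sum>m<M. (norm (A (unit m) j))\<^sup>2)"
 define x where "x = restr {..<M} (%m. kcnj (A (unit m) j))"
 have x: "x \<in> lp 2" "(lp_norm 2 x)\<^sup>2 = \<sigma>"
  unfolding x_def \<sigma>_def by (auto intro!: lp_restr_finite simp: lp_norm_2_square)
 have "A x j = of_real \<sigma>" unfolding x_def \<sigma>_def using ops_restr_apply[OF A(1) _ A(2)]
  by (simp add: mult.commute[of "kcnj _"] mult_kcnj flip: of_real_sum of_real_power)
 then have "\<bar>\<sigma>\<bar> <= lp_norm q (A x)" using lp_norm_component[OF ops_in[OF A(1) x(1)], of j] A(2) by simp
 also have "\<dots> <= a * lp_norm 2 x" by (rule a(2)[OF x(1)])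
 finally have "(lp_norm 2 x) * lp_norm 2 x <= a * lp_norm 2 x" unfolding x(2)[symmetric] by (simp add: power2_eq_square)
 moreover have "lp_norm 2 x >= 0" by (simp add: lp_norm_def)
 ultimately have "lp_norm 2 x <= a" using a(1) by (cases "lp_norm 2 x = 0") auto
 then show ?thesis using x(2) \<open>lp_norm 2 x >= 0\<close> unfolding \<sigma>_def by (metis power_mono)
qed

text \<open>
 The pairing with \<open>W\<close> equals \<open>L n\<close> on \<open>T\<close> and changes by at most \<open>L n / 2\<close> when \<open>T\<close> is replaced by an operator within distance \<open>1/2\<close>. If the latter factors through \<open>\<ell>\<^sub>2\<close>, its entries are inner products of vectors of bounded length, and the pairing is \<open>O(\<tau> n)\<close>. The inner products are series, which is why the trace bound is required for finite sums of every length \<open>M\<close>.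
\<close>

lemma trace_obstruction:
 fixes T :: "'k::{real_normed_field,euclidean_space} seq_op" and W :: "nat => nat => nat => real"
 assumes pq: "1 <= p" "1 <= q" and T: "T \<in> bounded_ops p q"
  and tr: "!!n M (X :: nat => nat => 'k) Y x y. 0 <= x ==> 0 <= y ==>
   (!!j. (\<Sum>m<M. (norm (X j m))\<^sup>2) <= x\<^sup>2) ==> (!!i. (\<Sum>m<M. (norm (Y i m))\<^sup>2) <= y\<^sup>2) ==>
   norm (\<Sum>j<R n. \<Sum>i<N n. of_real (W n j i) * (\<Sum>m<M. X j m * Y i m)) <= \<tau> n * x * y"
  and val: "!!n. (\<Sum>j<R n. \<Sum>i<N n. of_real (W n j i) * T (unit (s n + i)) (e n + j)) = of_real (L n)"
  and err: "!!n (D :: 'k seq_op) \<epsilon>. D \<in> bounded_ops p q ==> (!!x. x \<in> lp p ==> lp_norm q (D x) <= \<epsilon> * lp_norm p x) ==> 0 <= \<epsilon> ==>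
   norm (\<Sum>j<R n. \<Sum>i<N n. of_real (W n j i) * D (unit (s n + i)) (e n + j)) <= \<epsilon> * L n"
  and unb: "!!C. \<exists>n. C * \<tau> n < L n"
 shows "T \<notin> hilbert_ideal p q"
proof
 assume "T \<in> hilbert_ideal p q"
 then have "op_approx p q (hilbert_factorable p q) T" using pq by (simp add: hilbert_ideal_eq)
 then obtain S where S: "S \<in> hilbert_factorable p q" "!!x. x \<in> lp p ==> lp_norm q (S x - T x) <= 1 / 2 * lp_norm p x"
  unfolding op_approx_def by (meson half_gt_zero zero_less_one)
 then obtain A B where AB: "S = A \<circ> B" "A \<in> bounded_ops 2 q" "B \<in> bounded_ops p 2"
  unfolding hilbert_factorable_def by blast
 obtain a where a: "0 < a" "!!x. x \<in> lp 2 ==> lp_norm q (A x) <= a * lp_norm 2 x" using ops_bound[OF AB(2)] by (metis (lifting))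
 obtain b where b: "0 < b" "!!x. x \<in> lp p ==> lp_norm 2 (B x) <= b * lp_norm p x" using ops_bound[OF AB(3)] by (metis (lifting))
 have Sb: "S \<in> bounded_ops p q" unfolding AB(1) using AB by (intro bounded_ops_comp)
 have Db: "S - T \<in> bounded_ops p q" using pq Sb T by (intro bounded_ops_diff)
 have bound: "L n <= 2 * a * b * \<tau> n" for n
 proof -
  have unitp: "unit i \<in> lp p" "lp_norm p (unit i :: 'k seq) = 1" for i using unit_lp[of p i] pq by auto
  have Y: "(\<Sum>m<M. (norm (B (unit (s n + i)) m))\<^sup>2) <= b\<^sup>2" for M i
  proof -
   have "(\<Sum>m<M. (norm (B (unit (s n + i)) m))\<^sup>2) = (lp_norm 2 (restr {..<M} (B (unit (s n + i)))))\<^sup>2"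
    by (simp add: lp_norm_2_square)
   also have "\<dots> <= (lp_norm 2 (B (unit (s n + i))))\<^sup>2"
    using lp_restr(2)[OF _ ops_in[OF AB(3) unitp(1)]] by (intro power_mono) (auto simp: lp_norm_def)
   also have "\<dots> <= (b * 1)\<^sup>2" using b(2)[OF unitp(1)] by (intro power_mono) (auto simp: unitp(2))
   finally show ?thesis by simp
  qed
  have lim: "(%M. \<Sum>m<M. A (unit m) (e n + j) * B (unit (s n + i)) m) \<longlonglongrightarrow> S (unit (s n + i)) (e n + j)" for i j
   unfolding AB(1) o_def using ops_expansion[OF AB(2) _ pq(2) ops_in[OF AB(3) unitp(1)]] by (simp add: mult.commute)
  have "norm (\<Sum>j<R n. \<Sum>i<N n. of_real (W n j i) * S (unit (s n + i)) (e n + j)) <= \<tau> n * a * b"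
  proof (rule LIMSEQ_le_const2)
   show "(%M. norm (\<Sum>j<R n. \<Sum>i<N n. of_real (W n j i) * (\<Sum>m<M. A (unit m) (e n + j) * B (unit (s n + i)) m)))
    \<longlonglongrightarrow> norm (\<Sum>j<R n. \<Sum>i<N n. of_real (W n j i) * S (unit (s n + i)) (e n + j))"
    by (intro tendsto_intros lim)
   show "\<exists>N0. \<forall>M\<ge>N0. norm (\<Sum>j<R n. \<Sum>i<N n. of_real (W n j i) * (\<Sum>m<M. A (unit m) (e n + j) * B (unit (s n + i)) m)) <= \<tau> n * a * b"
    using a b by (intro exI[of _ 0] allI impI tr Y row_square_sum[OF AB(2) pq(2)]) auto
  qed
  moreover have "norm (\<Sum>j<R n. \<Sum>i<N n. of_real (W n j i) * (S - T) (unit (s n + i)) (e n + j)) <= 1 / 2 * L n"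
   by (rule err[OF Db]) (use S(2) in auto)
  moreover have "(\<Sum>j<R n. \<Sum>i<N n. of_real (W n j i) * S (unit (s n + i)) (e n + j))
   - (\<Sum>j<R n. \<Sum>i<N n. of_real (W n j i) * (S - T) (unit (s n + i)) (e n + j)) = of_real (L n)"
   unfolding val[symmetric] by (simp add: sum_subtractf[symmetric] algebra_simps)
  moreover have tri: "norm w <= c + d" if "norm u <= c" "norm v <= d" "u - v = w" for u v w :: 'k and c d
   using norm_triangle_ineq4[of u v] that by simp
  ultimately have "norm (of_real (L n) :: 'k) <= \<tau> n * a * b + 1 / 2 * L n" by (intro tri)
  then show ?thesis by (simp add: mult_ac)
 qed
 obtain n where "2 * a * b * \<tau> n < L n" using unb by blast
 then show False using bound[of n] by simp
qed

text \<open>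
 Duality: pair the transposed image with its own norming coefficients \<open>c\<close> and move the matrix back.
\<close>

lemma transpose_contractive:
 fixes V :: "nat => nat => real" and y :: "'k::real_normed_field seq"
 assumes r: "1 < r" "1 / r + 1 / s = 1" and q: "1 < q" "1 / q + 1 / p = 1" and K: "0 <= K"
  and V: "!!x :: 'k seq. (\<Sum>j<M. norm (\<Sum>i<N. of_real (V j i) * x i) powr q) <= K powr q * (\<Sum>i<N. norm (x i) powr r) powr (q / r)"
 shows "(\<Sum>i<N. norm (\<Sum>j<M. of_real (V j i) * y j) powr s) <= K powr s * (\<Sum>j<M. norm (y j) powr p) powr (s / p)"
proof -
 have "1 / s = (r - 1) / r" "1 / p = (q - 1) / q" using r q by (auto simp: field_simps)
 then have sp: "s = r / (r - 1)" "p = q / (q - 1)" by (metis divide_divide_eq_right divide_cancel_right div_by_1 mult_1 inverse_divide inverse_inverse_eq inverse_eq_divide)+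
 have pos: "0 < s" "0 < p" using r q by (auto simp: sp)
 define v where "v i = (\<Sum>j<M. of_real (V j i) * y j)" for i
 define c where "c i = of_real (norm (v i) powr s) * inverse (v i)" for i
 define \<sigma> where "\<sigma> = (\<Sum>i<N. norm (v i) powr s)"
 define Y where "Y = (\<Sum>j<M. norm (y j) powr p)"
 have nn: "\<sigma> >= 0" "Y >= 0" unfolding \<sigma>_def Y_def by (auto intro: sum_nonneg)
 have cv: "c i * v i = of_real (norm (v i) powr s)" for i by (cases "v i = 0") (auto simp: c_def)
 have cr: "norm (c i) powr r = norm (v i) powr s" for i
 proof (cases "v i = 0")
  case False
  then have "norm (c i) = norm (v i) powr (s - 1)" by (simp add: c_def norm_mult norm_inverse powr_diff divide_inverse)
  moreover have "(s - 1) * r = s" using r by (simp add: sp field_simps)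
  ultimately show ?thesis by (simp add: powr_powr)
 qed (use r in \<open>simp add: c_def\<close>)
 have "of_real \<sigma> = (\<Sum>i<N. c i * v i)" by (simp add: \<sigma>_def cv)
 also have "\<dots> = (\<Sum>j<M. y j * (\<Sum>i<N. of_real (V j i) * c i))"
  unfolding v_def sum_distrib_left by (subst sum.swap) (simp add: mult_ac)
 finally have "norm (of_real \<sigma> :: 'k) <= (\<Sum>j<M. norm (y j) * norm (\<Sum>i<N. of_real (V j i) * c i))"
  by (simp add: norm_mult order_trans[OF norm_sum] del: norm_of_real)
 then have "\<sigma> <= (\<Sum>j<M. norm (y j) * norm (\<Sum>i<N. of_real (V j i) * c i))" using nn by simp
 also have "\<dots> = (\<Sum>j<M. norm (\<Sum>i<N. of_real (V j i) * c i) * norm (y j))" by (simp add: mult.commute)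
 also have "\<dots> <= (\<Sum>j<M. norm (\<Sum>i<N. of_real (V j i) * c i) powr q) powr (1 / q) * Y powr (1 / p)"
  unfolding Y_def by (intro Holder_sum q) auto
 also have "\<dots> <= (K powr q * \<sigma> powr (q / r)) powr (1 / q) * Y powr (1 / p)"
  using V[of c] q unfolding cr \<sigma>_def[symmetric] by (intro mult_right_mono powr_mono2 sum_nonneg) auto
 also have "\<dots> = \<sigma> powr (1 / r) * (K * Y powr (1 / p))" using q nn K by (simp add: powr_mult powr_powr)
 finally have le: "\<sigma> <= \<sigma> powr (1 / r) * (K * Y powr (1 / p))" .
 have "\<sigma> powr (1 / s) <= K * Y powr (1 / p)"
 proof (cases "\<sigma> = 0")
  case False
  have "\<sigma> powr (1 / r) * \<sigma> powr (1 / s) = \<sigma>" using False nn r(2) by (simp flip: powr_add)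
  then have "\<sigma> powr (1 / r) * \<sigma> powr (1 / s) <= \<sigma> powr (1 / r) * (K * Y powr (1 / p))" using le by simp
  then show ?thesis using False nn by simp
 qed (use K in auto)
 then have "(\<sigma> powr (1 / s)) powr s <= (K * Y powr (1 / p)) powr s" using pos by (intro powr_mono2) auto
 then show ?thesis using pos nn K by (simp add: powr_powr powr_mult \<sigma>_def v_def Y_def)
qed

lemma lp_norm_block:
 assumes "y \<in> lp q" "0 < q"
 shows "(\<Sum>j<M. norm (y (e + j)) powr q) powr (1 / q) <= lp_norm q y"
proof -
 have "(\<Sum>j<M. norm (y (e + j)) powr q) = (\<Sum>k\<in>{e..<e + M}. norm (y k) powr q)"
  by (rule sum.reindex_bij_witness[of _ "%k. k - e" "%i. e + i"]) auto
 also have "\<dots> = lp_norm q (restr {e..<e + M} y) powr q" using assms by (simp add: lp_restr_finite(2))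
 finally show ?thesis using lp_restr(2)[of q y "{e..<e + M}"] assms by (simp add: powr_powr)
qed

text \<open>
 \<open>u\<close> has the entries \<open>\<bar>t\<bar>^(q - 1)\<close> with the signs of \<open>t\<close>, so that its columns norm those of \<open>t\<close>. The trace constant is \<open>\<kappa> = sqrt 2 S\<close> with \<open>S\<close> the quantity bounded in \<open>weights_near_one\<close>.
\<close>

lemma contractive_tensors:
 fixes q p :: real
 assumes q: "2 < q" and p: "p = q / (q - 1)"
 shows "\<exists>t u r \<kappa>. p < r \<and> r < 2 \<and> 0 <= \<kappa> \<and> \<kappa> < 2 \<and>
  (\<forall>n (x :: 'k::{real_normed_field,euclidean_space} seq).
   (\<Sum>j<4^n. norm (\<Sum>i<2^n. of_real (tens t n j i) * x i) powr q) <= (\<Sum>i<2^n. norm (x i) powr r) powr (q / r)) \<and>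
  (\<forall>n i. (\<Sum>j<4^n. tens u n j i * tens t n j i) = 1) \<and>
  (\<forall>n i. (\<Sum>j<4^n. \<bar>tens u n j i\<bar> powr p) = 1) \<and>
  (\<forall>n M (X :: nat => nat => 'k) Y x y. 0 <= x --> 0 <= y -->
   (\<forall>j. (\<Sum>m<M. (norm (X j m))\<^sup>2) <= x\<^sup>2) --> (\<forall>i. (\<Sum>m<M. (norm (Y i m))\<^sup>2) <= y\<^sup>2) -->
   norm (\<Sum>j<4^n. \<Sum>i<2^n. of_real (tens u n j i) * (\<Sum>m<M. X j m * Y i m)) <= \<kappa> ^ n * x * y)"
proof -
 obtain \<alpha> where \<alpha>: "0 < \<alpha>" "\<alpha> < 1" and S: "2 * (\<alpha> / 2) powr (1 - 1 / q) + sqrt 2 * (1 - \<alpha>) powr (1 - 1 / q) < sqrt 2"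
  using weights_near_one[OF q] by blast
 obtain r where r: "p < r" "r < 2" and two: "!!t. 0 <= t ==> t <= 1 ==>
   \<alpha> * (((1 + t) powr q + (1 - t) powr q) / 2) + (1 - \<alpha>) * (1 + t powr q) <= (1 + t powr r) powr (q / r)"
  using perturbed_two_point[OF q p \<alpha>] by blast
 have p1: "1 < p" "(1 - 1 / q) * p = 1" "1 / q + (1 - 1 / q) = 1" using q by (auto simp: p field_simps)
 define A where "A = (\<alpha> / 2) powr (1 - 1 / q)"
 define B where "B = (1 - \<alpha>) powr (1 - 1 / q)"
 define t where "t = base ((\<alpha> / 2) powr (1 / q)) ((1 - \<alpha>) powr (1 / q))"
 define u where "u = base A B"
 define d where "d a = (if a < 2 then sqrt A else sqrt (B / sqrt 2))" for a :: nat
 define w where "w = base (sqrt A) (sqrt (sqrt 2 * B))"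
 define S where "S = 2 * A + sqrt 2 * B"
 have AB: "0 <= A" "0 <= B" "0 <= S" by (auto simp: A_def B_def S_def)
 have udw: "u = (%a b. d a * w a b)"
 proof -
  have "sqrt A * sqrt A = A" "sqrt (B / sqrt 2) * sqrt (sqrt 2 * B) = B"
   using AB by (auto simp: power2_eq_square simp flip: real_sqrt_mult)
  then show ?thesis by (auto simp: u_def d_def w_def base_def fun_eq_iff)
 qed
 have dS: "(\<Sum>a<4. (d a)\<^sup>2) = S"
  unfolding sum_lessThan_4 using AB by (simp add: d_def S_def real_sqrt_pow2 real_div_sqrt field_simps)
 have wS: "(\<Sum>a<4. (norm (\<Sum>b<2. of_real (w a b) * x b))\<^sup>2) <= S * (\<Sum>b<2. (norm (x b))\<^sup>2)" for x :: "'k seq"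
  unfolding w_def base_orthogonal using AB by (simp add: S_def)
 have tc: "(\<Sum>j<4^n. norm (\<Sum>i<2^n. of_real (tens t n j i) * x i) powr q) <= 1 ^ n * (\<Sum>i<2^n. norm (x i) powr r) powr (q / r)"
  for n and x :: "'k seq"
  using r q p1 base_contractive[OF q \<alpha> _ two] unfolding t_def by (intro tens_contractive) auto
 have ut: "(\<Sum>j<4^n. tens u n j i * tens t n j i) = 1 ^ n" for n i
  unfolding tens_mult[symmetric]
 proof (rule tens_sum)
  fix b :: nat assume "b < 2"
  then have "b = 0 \<or> b = 1" by linarith
  moreover have "A * (\<alpha> / 2) powr (1 / q) = \<alpha> / 2" "B * (1 - \<alpha>) powr (1 / q) = 1 - \<alpha>"
   using \<alpha> p1(3) by (auto simp: A_def B_def simp flip: powr_add)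
  ultimately show "(\<Sum>a<4. u a b * t a b) = 1" unfolding sum_lessThan_4 by (auto simp: u_def t_def base_def)
 qed
 have up: "(\<Sum>j<4^n. \<bar>tens u n j i\<bar> powr p) = 1 ^ n" for n i
  unfolding tens_abs_powr[symmetric]
 proof (rule tens_sum)
  fix b :: nat assume "b < 2"
  then have "b = 0 \<or> b = 1" by linarith
  moreover have "\<bar>A\<bar> powr p = \<alpha> / 2" "\<bar>B\<bar> powr p = 1 - \<alpha>"
   using \<alpha> p1(2) AB by (auto simp: A_def B_def powr_powr)
  ultimately show "(\<Sum>a<4. \<bar>u a b\<bar> powr p) = 1" unfolding sum_lessThan_4 by (auto simp: u_def base_def)
 qed
 have "S * sqrt 2 < sqrt 2 * sqrt 2" using S by (intro mult_strict_right_mono) (simp_all add: S_def A_def B_def)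
 then have \<kappa>: "0 <= S * sqrt 2" "S * sqrt 2 < 2" using AB by auto
 show ?thesis
  using r \<kappa> tc ut up tens_trace[OF dS AB(3) wS, folded udw]
  by (intro exI[of _ t] exI[of _ u] exI[of _ r] exI[of _ "S * sqrt 2"] conjI allI impI) (simp_all only: power_one mult_1)
qed

lemma disjoint_blocks:
 assumes "!!n. s (Suc n) >= s n + N n"
 shows "disjoint_family (%n. {s n..<s n + N n :: nat})"
proof -
 have "mono s" using assms by (intro incseq_SucI) (meson add_leD1)
 from disjoint_intervals[OF this] show ?thesis
 proof (rule disjoint_family_subset)
  show "{s n..<s n + N n} \<subseteq> {s n..<s (Suc n)}" for n using assms[of n] by auto
 qed
qed

lemma power_gap:
 fixes \<kappa> C :: real
 assumes "0 <= \<kappa>" "\<kappa> < 2"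
 shows "\<exists>n. C * \<kappa> ^ n < 2 ^ n"
proof -
 have "\<exists>n. (\<kappa> / 2) ^ n < 1 / (\<bar>C\<bar> + 1)" by (rule real_arch_pow_inv) (use assms in auto)
 then obtain n where n: "(\<kappa> / 2) ^ n < 1 / (\<bar>C\<bar> + 1)" by blast
 then have "(\<bar>C\<bar> + 1) * \<kappa> ^ n < 2 ^ n" by (simp add: power_divide field_simps)
 moreover have "C * \<kappa> ^ n <= (\<bar>C\<bar> + 1) * \<kappa> ^ n" using assms by (intro mult_right_mono) auto
 ultimately show ?thesis by (intro exI[of _ n]) linarith
qed

lemma unit_block_sum:
 "i < N ==> (\<Sum>k<N. of_real (v k) * (unit (s + i) (s + k) :: 'k::real_normed_field)) = of_real (v i)"
 by (simp add: unit_def if_distrib cong: if_cong)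

text \<open>
 If \<open>p \<le> q / (q - 1)\<close>, the tensor blocks map \<open>\<ell>\<^sub>r\<close> to \<open>\<ell>\<^sub>q\<close> for some \<open>r > p\<close> and are preceded by the formal identity \<open>\<ell>\<^sub>p \<rightarrow> \<ell>\<^sub>r\<close>. Otherwise the construction is carried out for the conjugate exponent \<open>p'\<close> of \<open>p\<close>, and the transposed blocks map \<open>\<ell>\<^sub>p\<close> to \<open>\<ell>\<^sub>s\<close> with \<open>s < p' < q\<close> and are followed by \<open>\<ell>\<^sub>s \<rightarrow> \<ell>\<^sub>q\<close>. In both cases the formal identity makes the operator FSS.
\<close>

lemma fss_not_hilbert:
 assumes pq: "1 < p" "p < 2" "2 < q"
 shows "\<exists>T :: 'k::{real_normed_field,euclidean_space} seq_op. T \<in> fss_ops p q \<and> T \<notin> hilbert_ideal p q"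
proof (cases "p <= q / (q - 1)")
 case True
 obtain t u r \<kappa> where r: "q / (q - 1) < r" "r < 2" and \<kappa>: "0 <= \<kappa>" "\<kappa> < 2"
  and con: "\<forall>n (x :: 'k seq). (\<Sum>j<4^n. norm (\<Sum>i<2^n. of_real (tens t n j i) * x i) powr q) <= (\<Sum>i<2^n. norm (x i) powr r) powr (q / r)"
  and ut: "\<forall>n i. (\<Sum>j<4^n. tens u n j i * tens t n j i) = 1"
  and up: "\<forall>n i. (\<Sum>j<4^n. \<bar>tens u n j i\<bar> powr (q / (q - 1))) = 1"
  and tr: "\<forall>n M (X :: nat => nat => 'k) Y x y. 0 <= x --> 0 <= y -->
   (\<forall>j. (\<Sum>m<M. (norm (X j m))\<^sup>2) <= x\<^sup>2) --> (\<forall>i. (\<Sum>m<M. (norm (Y i m))\<^sup>2) <= y\<^sup>2) -->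
   norm (\<Sum>j<4^n. \<Sum>i<2^n. of_real (tens u n j i) * (\<Sum>m<M. X j m * Y i m)) <= \<kappa> ^ n * x * y"
  using contractive_tensors[OF pq(3) refl, where 'k = 'k] by (elim exE conjE) (rule that, assumption+)
 note con = con[rule_format] and ut = ut[rule_format] and up = up[rule_format] and tr = tr[rule_format]
 have pr: "p < r" "1 <= r" "r <= q" using True r pq by auto
 have "\<exists>T :: 'k seq_op. T \<in> bounded_ops r q \<and>
  (\<forall>x\<in>lp r. \<forall>n. \<forall>j<4^n. T x (4 ^ n + j) = (\<Sum>i<2^n. of_real (tens t n j i) * x (2 ^ n + i)))"
 proof (rule matrix_block_op[of r q 1])
  show "disjoint_family (%n. {2 ^ n..<2 ^ n + 2 ^ n :: nat})" "disjoint_family (%n. {4 ^ n..<4 ^ n + 4 ^ n :: nat})"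
   by (rule disjoint_blocks, simp)+
 qed (use pr con in simp_all)
 then obtain V :: "'k seq_op" where V: "V \<in> bounded_ops r q"
  and Vx: "!!x n j. x \<in> lp r ==> j < 4 ^ n ==> V x (4 ^ n + j) = (\<Sum>i<2^n. of_real (tens t n j i) * x (2 ^ n + i))" by blast
 define T where "T = V \<circ> formal_identity p"
 have Tx: "T x = V x" if "x \<in> lp p" for x using that by (simp add: T_def formal_identity_def)
 have Tb: "T \<in> bounded_ops p q" unfolding T_def
  using pq pr V by (intro bounded_ops_comp[of _ r] formal_identity_bounded_ops) auto
 have "T \<in> fss_ops p q"
 proof (subst fss_ops_iff)
  obtain C where C: "0 < C" "!!x. x \<in> lp r ==> lp_norm q (V x) <= C * lp_norm r x" using ops_bound[OF V] by metis
  show "T \<in> bounded_ops p q \<and> (\<forall>e>0. \<exists>n. \<forall>E. dim_ge p n E --> (\<exists>x\<in>E. x ~= 0 \<and> lp_norm q (T x) <= e * lp_norm p x))"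
  proof (intro conjI Tb allI impI)
   fix e :: real assume e: "0 < e"
   then obtain n where n: "\<forall>E :: 'k seq set. dim_ge p n E --> (\<exists>x\<in>E. x ~= 0 \<and> lp_norm r x <= e / C * lp_norm p x)"
    using flat_inclusion[of p r "e / C", where 'k = 'k] pq pr C(1) by auto
   have "\<exists>x\<in>E. x ~= 0 \<and> lp_norm q (T x) <= e * lp_norm p x" if E: "dim_ge p n E" for E :: "'k seq set"
   proof -
    obtain x where x: "x \<in> E" "x ~= 0" "lp_norm r x <= e / C * lp_norm p x" using n E by blast
    have "x \<in> lp p" using E x(1) by (auto simp: dim_ge_def)
    moreover from this have "x \<in> lp r" using pq pr by (intro lp_mono(1)[of p r]) auto
    ultimately have "lp_norm q (T x) <= C * lp_norm r x" using C(2) by (simp add: Tx)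
    also have "\<dots> <= C * (e / C * lp_norm p x)" using x(3) C(1) by (intro mult_left_mono) auto
    finally show ?thesis using x C(1) by auto
   qed
   then show "\<exists>n. \<forall>E. dim_ge p n E --> (\<exists>x\<in>E. x ~= 0 \<and> lp_norm q (T x) <= e * lp_norm p x)" by blast
  qed
 qed (use pq in auto)
 moreover have "T \<notin> hilbert_ideal p q"
 proof (rule trace_obstruction[where W = "tens u" and R = "%n. 4 ^ n" and N = "%n. 2 ^ n" and s = "%n. 2 ^ n" and e = "%n. 4 ^ n"
   and \<tau> = "%n. \<kappa> ^ n" and L = "%n. 2 ^ n", OF _ _ Tb])
  fix n
  have "(\<Sum>j<4 ^ n. \<Sum>i<2 ^ n. of_real (tens u n j i) * T (unit (2 ^ n + i)) (4 ^ n + j))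
   = (\<Sum>j<4 ^ n. \<Sum>i<2 ^ n. of_real (tens u n j i * tens t n j i) :: 'k)"
   using pq pr by (intro sum.cong refl) (simp add: Tx unit_lp Vx unit_block_sum)
  also have "\<dots> = of_real (\<Sum>i<2 ^ n. \<Sum>j<4 ^ n. tens u n j i * tens t n j i)" by (subst sum.swap) simp
  finally show "(\<Sum>j<4 ^ n. \<Sum>i<2 ^ n. of_real (tens u n j i) * T (unit (2 ^ n + i)) (4 ^ n + j)) = of_real (2 ^ n)" by (simp add: ut)
 next
  fix n and D :: "'k seq_op" and \<epsilon> :: real
  assume D: "D \<in> bounded_ops p q" "!!x. x \<in> lp p ==> lp_norm q (D x) <= \<epsilon> * lp_norm p x"
  have col: "(\<Sum>j<4 ^ n. \<bar>tens u n j i\<bar> * norm (D (unit (2 ^ n + i)) (4 ^ n + j))) <= \<epsilon>" for i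
  proof -
   have y: "D (unit (2 ^ n + i)) \<in> lp q" using pq by (intro ops_in[OF D(1)] unit_lp) auto
   have "(\<Sum>j<4 ^ n. \<bar>tens u n j i\<bar> * norm (D (unit (2 ^ n + i)) (4 ^ n + j)))
    <= (\<Sum>j<4 ^ n. \<bar>tens u n j i\<bar> powr (q / (q - 1))) powr (1 / (q / (q - 1))) * (\<Sum>j<4 ^ n. norm (D (unit (2 ^ n + i)) (4 ^ n + j)) powr q) powr (1 / q)"
    using pq by (intro Holder_sum) (auto simp: field_simps)
   also have "\<dots> <= lp_norm q (D (unit (2 ^ n + i)))" using lp_norm_block[OF y] pq by (simp add: up)
   also have "\<dots> <= \<epsilon>" using D(2)[of "unit (2 ^ n + i)"] pq by (simp add: unit_lp)
   finally show ?thesis .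
  qed
  have "norm (\<Sum>j<4 ^ n. \<Sum>i<2 ^ n. of_real (tens u n j i) * D (unit (2 ^ n + i)) (4 ^ n + j))
   <= (\<Sum>j<4 ^ n. \<Sum>i<2 ^ n. \<bar>tens u n j i\<bar> * norm (D (unit (2 ^ n + i)) (4 ^ n + j)))"
   by (intro order_trans[OF norm_sum] sum_mono) (simp add: norm_mult)
  also have "\<dots> = (\<Sum>i<2 ^ n. \<Sum>j<4 ^ n. \<bar>tens u n j i\<bar> * norm (D (unit (2 ^ n + i)) (4 ^ n + j)))" by (rule sum.swap)
  also have "\<dots> <= (\<Sum>i<(2::nat) ^ n. \<epsilon>)" by (intro sum_mono col)
  finally show "norm (\<Sum>j<4 ^ n. \<Sum>i<2 ^ n. of_real (tens u n j i) * D (unit (2 ^ n + i)) (4 ^ n + j)) <= \<epsilon> * 2 ^ n" by (simp add: mult.commute)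
 qed (use pq tr power_gap[OF \<kappa>] in auto)
 ultimately show ?thesis by blast
next
 case False
 define q' where "q' = p / (p - 1)"
 have q': "2 < q'" "p = q' / (q' - 1)" using pq by (auto simp: q'_def field_simps)
 obtain t u r \<kappa> where r: "p < r" "r < 2" and \<kappa>: "0 <= \<kappa>" "\<kappa> < 2"
  and con: "\<forall>n (x :: 'k seq). (\<Sum>j<4^n. norm (\<Sum>i<2^n. of_real (tens t n j i) * x i) powr q') <= (\<Sum>i<2^n. norm (x i) powr r) powr (q' / r)"
  and ut: "\<forall>n i. (\<Sum>j<4^n. tens u n j i * tens t n j i) = 1"
  and up: "\<forall>n i. (\<Sum>j<4^n. \<bar>tens u n j i\<bar> powr p) = 1"
  and tr: "\<forall>n M (X :: nat => nat => 'k) Y x y. 0 <= x --> 0 <= y -->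
   (\<forall>j. (\<Sum>m<M. (norm (X j m))\<^sup>2) <= x\<^sup>2) --> (\<forall>i. (\<Sum>m<M. (norm (Y i m))\<^sup>2) <= y\<^sup>2) -->
   norm (\<Sum>j<4^n. \<Sum>i<2^n. of_real (tens u n j i) * (\<Sum>m<M. X j m * Y i m)) <= \<kappa> ^ n * x * y"
  using contractive_tensors[OF q', where 'k = 'k] by (elim exE conjE) (rule that, assumption+)
 note con = con[rule_format] and ut = ut[rule_format] and up = up[rule_format] and tr = tr[rule_format]
 have rq: "1 < r" "1 < q'" using pq r q'(1) by linarith+
 define s where "s = r / (r - 1)"
 have s: "1 / r + 1 / s = 1" "1 < s" "p <= s" "s < q" "1 / q' + 1 / p = 1"
 proof -
  have r1: "1 < r" using pq r by simp
  show "1 / r + 1 / s = 1" "1 < s" using r1 by (auto simp: s_def field_simps)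
  show "1 / q' + 1 / p = 1" using pq by (auto simp: q'_def field_simps)
  have "2 < s" using r1 r by (simp add: s_def field_simps)
  then show "p <= s" using pq by simp
  have "s = 1 + 1 / (r - 1)" using r1 by (simp add: s_def field_simps)
  also have "\<dots> < 1 + 1 / (p - 1)" using pq r by (simp add: frac_less2)
  also have "\<dots> <= q"
  proof -
   have "q / (q - 1) < p" using False by simp
   then have "q < p * (q - 1)" using pq by (simp add: field_simps)
   then show ?thesis using pq by (simp add: field_simps)
  qed
  finally show "s < q" .
 qed
 have "\<exists>T :: 'k seq_op. T \<in> bounded_ops p s \<and>
  (\<forall>x\<in>lp p. \<forall>n. \<forall>j<2^n. T x (2 ^ n + j) = (\<Sum>i<4^n. of_real (tens t n i j) * x (4 ^ n + i)))"
 proof (rule matrix_block_op[of p s 1])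
  fix n and x :: "'k seq"
  show "(\<Sum>j<2 ^ n. norm (\<Sum>i<4 ^ n. of_real (tens t n i j) * x i) powr s) <= 1 powr s * (\<Sum>i<4 ^ n. norm (x i) powr p) powr (s / p)"
   by (rule transpose_contractive[of r s q' p]) (use s(1,5) rq con in simp_all)
 next
  show "disjoint_family (%n. {4 ^ n..<4 ^ n + 4 ^ n :: nat})" "disjoint_family (%n. {2 ^ n..<2 ^ n + 2 ^ n :: nat})"
   by (rule disjoint_blocks, simp)+
 qed (use s pq in simp_all)
 then obtain V :: "'k seq_op" where V: "V \<in> bounded_ops p s"
  and Vx: "!!x n j. x \<in> lp p ==> j < 2 ^ n ==> V x (2 ^ n + j) = (\<Sum>i<4^n. of_real (tens t n i j) * x (4 ^ n + i))" by blast
 define T where "T = formal_identity s \<circ> V"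
 have Tx: "T x = V x" if "x \<in> lp p" for x using ops_in[OF V that] by (simp add: T_def formal_identity_def)
 have Tb: "T \<in> bounded_ops p q" unfolding T_def
  using s V by (intro bounded_ops_comp[of _ s] formal_identity_bounded_ops) auto
 have "T \<in> fss_ops p q"
 proof (subst fss_ops_iff)
  obtain C where C: "0 < C" "!!x. x \<in> lp p ==> lp_norm s (V x) <= C * lp_norm p x" using ops_bound[OF V] by metis
  show "T \<in> bounded_ops p q \<and> (\<forall>e>0. \<exists>n. \<forall>E. dim_ge p n E --> (\<exists>x\<in>E. x ~= 0 \<and> lp_norm q (T x) <= e * lp_norm p x))"
  proof (intro conjI Tb allI impI)
   fix e :: real assume e: "0 < e"
   then obtain n where n: "\<forall>E :: 'k seq set. dim_ge s n E --> (\<exists>x\<in>E. x ~= 0 \<and> lp_norm q x <= e / C * lp_norm s x)"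
    using flat_inclusion[of s q "e / C", where 'k = 'k] s C(1) by auto
   have "\<exists>x\<in>E. x ~= 0 \<and> lp_norm q (T x) <= e * lp_norm p x" if E: "dim_ge p n E" for E :: "'k seq set"
   proof -
    have Ep: "x \<in> lp p" if "x \<in> E" for x using E that by (auto simp: dim_ge_def)
    show ?thesis
    proof (cases "\<exists>x\<in>E. x ~= 0 \<and> V x = 0")
     case True
     then obtain x where x: "x \<in> E" "x ~= 0" "V x = 0" by blast
     then have "lp_norm q (T x) <= e * lp_norm p x" using Tx[OF Ep[OF x(1)]] e by (simp add: lp_norm_eq_0 lp_norm_def)
     then show ?thesis using x by blast
    next
     case False
     then have "dim_ge s n (V ` E)" by (intro dim_ge_image[OF V E]) blast
     then obtain x where x: "x \<in> E" "V x ~= 0" "lp_norm q (V x) <= e / C * lp_norm s (V x)" using n by blast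
     have "lp_norm q (T x) <= e / C * (C * lp_norm p x)"
      unfolding Tx[OF Ep[OF x(1)]] by (rule order_trans[OF x(3) mult_left_mono[OF C(2)[OF Ep[OF x(1)]]]]) (use C(1) e in simp)
     then have "lp_norm q (T x) <= e * lp_norm p x" using C(1) by simp
     moreover have "x ~= 0" using x(2) ops_0[OF V] by metis
     ultimately show ?thesis using x(1) by blast
    qed
   qed
   then show "\<exists>n. \<forall>E. dim_ge p n E --> (\<exists>x\<in>E. x ~= 0 \<and> lp_norm q (T x) <= e * lp_norm p x)" by blast
  qed
 qed (use pq in auto)
 moreover have "T \<notin> hilbert_ideal p q"
 proof (rule trace_obstruction[where W = "%n j i. tens u n i j" and R = "%n. 2 ^ n" and N = "%n. 4 ^ n" and s = "%n. 4 ^ n" and e = "%n. 2 ^ n"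
   and \<tau> = "%n. \<kappa> ^ n" and L = "%n. 2 ^ n", OF _ _ Tb])
  fix n
  have "(\<Sum>j<2 ^ n. \<Sum>i<4 ^ n. of_real (tens u n i j) * T (unit (4 ^ n + i)) (2 ^ n + j))
   = (\<Sum>j<2 ^ n. \<Sum>i<4 ^ n. of_real (tens u n i j * tens t n i j) :: 'k)"
   using pq by (intro sum.cong refl) (simp add: Tx unit_lp Vx unit_block_sum)
  also have "\<dots> = of_real (\<Sum>j<2 ^ n. \<Sum>i<4 ^ n. tens u n i j * tens t n i j)" by simp
  finally show "(\<Sum>j<2 ^ n. \<Sum>i<4 ^ n. of_real (tens u n i j) * T (unit (4 ^ n + i)) (2 ^ n + j)) = of_real (2 ^ n)" by (simp only: ut) simp
 next
  fix n and D :: "'k seq_op" and \<epsilon> :: real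
  assume D: "D \<in> bounded_ops p q" "!!x. x \<in> lp p ==> lp_norm q (D x) <= \<epsilon> * lp_norm p x"
  have row: "norm (\<Sum>i<4 ^ n. of_real (tens u n i j) * D (unit (4 ^ n + i)) (2 ^ n + j)) <= \<epsilon>" for j
  proof -
   define I :: "nat set" where "I = {4 ^ n..<4 ^ n + 4 ^ n}"
   define z :: "'k seq" where "z = restr I (%m. of_real (tens u n (m - 4 ^ n) j))"
   have "lp_norm p z powr p = (\<Sum>m\<in>I. \<bar>tens u n (m - 4 ^ n) j\<bar> powr p)"
    unfolding z_def using pq by (subst lp_restr_finite(2)) (auto simp: I_def)
   also have "\<dots> = (\<Sum>i<4 ^ n. \<bar>tens u n i j\<bar> powr p)"
    by (rule sum.reindex_bij_witness[of _ "%i. 4 ^ n + i" "%m. m - 4 ^ n"]) (auto simp: I_def)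
   finally have "lp_norm p z powr p = 1 powr p" by (simp add: up)
   then have z: "z \<in> lp p" "lp_norm p z <= 1" using pq le_powr_cancel[of "lp_norm p z" p 1]
    by (auto simp: z_def I_def intro!: lp_restr_finite(1))
   have "(\<Sum>i<4 ^ n. of_real (tens u n i j) * D (unit (4 ^ n + i)) (2 ^ n + j)) = (\<Sum>m\<in>I. of_real (tens u n (m - 4 ^ n) j) * D (unit m) (2 ^ n + j))"
    by (rule sum.reindex_bij_witness[of _ "%m. m - 4 ^ n" "%i. 4 ^ n + i"]) (auto simp: I_def)
   also have "\<dots> = D z (2 ^ n + j)" unfolding z_def using pq by (subst ops_restr_apply[OF D(1)]) (auto simp: I_def)
   also have "norm \<dots> <= lp_norm q (D z)" using pq by (intro lp_norm_component ops_in[OF D(1)] z) auto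
   also have "\<dots> <= \<epsilon> * lp_norm p z" by (rule D(2)[OF z(1)])
   also have "lp_norm p z = 1" using \<open>lp_norm p z powr p = 1 powr p\<close> pq le_powr_cancel[of 1 p "lp_norm p z"] z(2) by simp
   finally show ?thesis by simp
  qed
  have "norm (\<Sum>j<2 ^ n. \<Sum>i<4 ^ n. of_real (tens u n i j) * D (unit (4 ^ n + i)) (2 ^ n + j)) <= (\<Sum>j<(2::nat) ^ n. \<epsilon>)"
   by (intro order_trans[OF norm_sum] sum_mono row)
  then show "norm (\<Sum>j<2 ^ n. \<Sum>i<4 ^ n. of_real (tens u n i j) * D (unit (4 ^ n + i)) (2 ^ n + j)) <= \<epsilon> * 2 ^ n" by (simp add: mult.commute)
 next
  fix n M and X Y :: "nat => nat => 'k" and x y :: real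
  assume "0 <= x" "0 <= y" "!!j. (\<Sum>m<M. (norm (X j m))\<^sup>2) <= x\<^sup>2" "!!i. (\<Sum>m<M. (norm (Y i m))\<^sup>2) <= y\<^sup>2"
  then have "norm (\<Sum>j<4^n. \<Sum>i<2^n. of_real (tens u n j i) * (\<Sum>m<M. Y j m * X i m)) <= \<kappa> ^ n * y * x" by (intro tr) auto
  moreover have "(\<Sum>j<4^n. \<Sum>i<2^n. of_real (tens u n j i) * (\<Sum>m<M. Y j m * X i m))
   = (\<Sum>j<2^n. \<Sum>i<4^n. of_real (tens u n i j) * (\<Sum>m<M. X j m * Y i m))"
   by (subst sum.swap) (simp add: mult.commute)
  ultimately show "norm (\<Sum>j<2^n. \<Sum>i<4^n. of_real (tens u n i j) * (\<Sum>m<M. X j m * Y i m)) <= \<kappa> ^ n * x * y"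
   by (simp add: mult_ac)
 qed (use pq power_gap[OF \<kappa>] in auto)
 ultimately show ?thesis by blast
qed

section \<open>Rademacher matrices\<close>

text \<open>
 The value of the \<open>k\<close>-th Rademacher function at the point \<open>j\<close>: a sign given by the binary digit \<open>k\<close> of \<open>j\<close>.
\<close>

definition rad :: "nat => nat => real" where
 "rad j k = (-1) ^ (j div 2 ^ k)"

lemma rad_shift: "k < n ==> rad (2 ^ n + j) k = rad j k"
proof -
 assume "k < n"
 then obtain d where d: "n = k + Suc d" by (metis less_imp_Suc_add add_Suc_right)
 have e: "2 ^ n + j = j + (2 * 2 ^ d) * 2 ^ k" by (simp add: d power_add)
 have "(2 ^ n + j) div 2 ^ k = 2 * 2 ^ d + j div 2 ^ k" unfolding e by (rule div_mult_self1) simp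
 then show ?thesis by (simp add: rad_def power_add power_mult)
qed

lemma rad_top: "j < 2 ^ n ==> rad j n = 1" "j < 2 ^ n ==> rad (2 ^ n + j) n = - 1"
 by (auto simp: rad_def)

lemma sum_lessThan_double:
 fixes f :: "nat => 'a::comm_monoid_add"
 shows "(\<Sum>j<2 ^ Suc n. f j) = (\<Sum>j<2 ^ n. f j) + (\<Sum>j<2 ^ n. f (2 ^ n + j))"
proof -
 have "{..<2 ^ Suc n} = {..<2 ^ n} \<union> {2 ^ n..<2 ^ n + 2 ^ n :: nat}" by auto
 moreover have "(\<Sum>j\<in>{2 ^ n..<2 ^ n + 2 ^ n}. f j) = (\<Sum>j<2 ^ n. f (2 ^ n + j))"
  by (rule sum.reindex_bij_witness[of _ "%j. 2 ^ n + j" "%k. k - 2 ^ n"]) auto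
 moreover have "{..<2 ^ n} \<inter> {2 ^ n..<2 ^ n + 2 ^ n :: nat} = {}" by auto
 ultimately show ?thesis by (simp add: sum.union_disjoint)
qed

lemma rad_orthogonal:
 "k < n ==> l < n ==> (\<Sum>j<2 ^ n. rad j k * rad j l) = (if k = l then 2 ^ n else 0)"
proof (induction n)
 case (Suc n)
 have one: "rad j k * rad j k = 1" for j k unfolding rad_def by (simp flip: power_add)
 show ?case
 proof (cases "k = l")
  case True
  then show ?thesis by (simp add: one)
 next
  case False
  then consider "k < n" "l < n" | "k = n" "l < n" | "k < n" "l = n" using Suc.prems by linarith
  then show ?thesis
  proof cases
   case 1
   then show ?thesis using Suc.IH False by (simp only: sum_lessThan_double rad_shift) simp
  qed (use False in \<open>simp_all only: sum_lessThan_double if_False\<close>,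
    simp_all add: rad_shift rad_top sum_negf cong: sum.cong_simp)
 qed
qed simp

lemma rav_rad:
 fixes a :: "nat => 'k::real_normed_field"
 shows "(\<Sum>j<2 ^ n. F (z + (\<Sum>k<n. of_real (rad j k) * a k))) = 2 ^ n * rav F (map a (rev [0..<n])) z"
proof (induction n arbitrary: z)
 case (Suc n)
 have "(\<Sum>j<2 ^ Suc n. F (z + (\<Sum>k<Suc n. of_real (rad j k) * a k)))
  = (\<Sum>j<2 ^ n. F ((z + a n) + (\<Sum>k<n. of_real (rad j k) * a k))) + (\<Sum>j<2 ^ n. F ((z - a n) + (\<Sum>k<n. of_real (rad j k) * a k)))"
  unfolding sum_lessThan_double
 proof (rule arg_cong2[of _ _ _ _ "(+)"]; intro sum.cong refl)
  fix j :: nat assume "j \<in> {..<2 ^ n}"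
  then have j: "j < 2 ^ n" by simp
  show "F (z + (\<Sum>k<Suc n. of_real (rad j k) * a k)) = F ((z + a n) + (\<Sum>k<n. of_real (rad j k) * a k))"
   unfolding sum.lessThan_Suc rad_top(1)[OF j] by (simp add: algebra_simps)
  have "(\<Sum>k<n. of_real (rad (2 ^ n + j) k) * a k) = (\<Sum>k<n. of_real (rad j k) * a k)"
   by (intro sum.cong refl) (simp add: rad_shift)
  then show "F (z + (\<Sum>k<Suc n. of_real (rad (2 ^ n + j) k) * a k)) = F ((z - a n) + (\<Sum>k<n. of_real (rad j k) * a k))"
   unfolding sum.lessThan_Suc rad_top(2)[OF j] by (simp only:) (simp add: algebra_simps)
 qed
 also have "\<dots> = 2 ^ n * rav F (map a (rev [0..<n])) (z + a n) + 2 ^ n * rav F (map a (rev [0..<n])) (z - a n)"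
  by (simp only: Suc.IH)
 also have "\<dots> = 2 ^ Suc n * rav F (map a (rev [0..<Suc n])) z" by (simp add: algebra_simps)
 finally show ?case .
qed simp

text \<open>
 Khintchine's inequality, as a bound for the Rademacher matrices as operators from \<open>\<ell>\<^sub>2\<close> to \<open>\<ell>\<^sub>q\<close>.
\<close>

lemma rad_contractive:
 assumes q: "2 <= q"
 shows "\<exists>K\<ge>0. \<forall>n (x :: 'k::{real_normed_field,euclidean_space} seq).
  (\<Sum>j<2 ^ n. norm (\<Sum>k<n. of_real (2 powr (- real n / q) * rad j k) * x k) powr q) <= K powr q * (\<Sum>k<n. norm (x k) powr 2) powr (q / 2)"
proof -
 obtain C where C: "C >= 1" "!!(vs :: 'k list) z. rav (%x. norm x powr q) vs z <= ((norm z)\<^sup>2 + C * (\<Sum>v\<leftarrow>vs. (norm v)\<^sup>2)) powr (q / 2)"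
  using khintchine_upper[OF q] by blast
 have "(\<Sum>j<2 ^ n. norm (\<Sum>k<n. of_real (2 powr (- real n / q) * rad j k) * x k) powr q) <= (sqrt C) powr q * (\<Sum>k<n. norm (x k) powr 2) powr (q / 2)" (is "?L <= _")
  for n and x :: "'k seq"
 proof -
  have two: "(2 powr (- real n / q)) powr q = 1 / 2 ^ n"
  proof -
   have "(2 powr (- real n / q)) powr q = 2 powr (- real n / q * q)" by (rule powr_powr)
   also have "- real n / q * q = - real n" using q by simp
   also have "2 powr (- real n) = 1 / 2 ^ n" by (simp add: powr_minus powr_realpow divide_inverse)
   finally show ?thesis .
  qed
  have "?L = (\<Sum>j<2 ^ n. 1 / 2 ^ n * norm (0 + (\<Sum>k<n. of_real (rad j k) * x k)) powr q)"
  proof (rule sum.cong[OF refl])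
   fix j
   have "(\<Sum>k<n. of_real (2 powr (- real n / q) * rad j k) * x k) = of_real (2 powr (- real n / q)) * (\<Sum>k<n. of_real (rad j k) * x k)"
    by (simp add: sum_distrib_left mult.assoc)
   then show "norm (\<Sum>k<n. of_real (2 powr (- real n / q) * rad j k) * x k) powr q = 1 / 2 ^ n * norm (0 + (\<Sum>k<n. of_real (rad j k) * x k)) powr q"
    by (simp only: norm_mult norm_of_real abs_of_nonneg[OF powr_ge_zero] powr_mult two add_0)
  qed
  also have "\<dots> = 1 / 2 ^ n * (2 ^ n * rav (%x. norm x powr q) (map x (rev [0..<n])) 0)"
   unfolding sum_distrib_left[symmetric] rav_rad[of "%x. norm x powr q"] by (rule refl)
  also have "\<dots> <= ((norm (0 :: 'k))\<^sup>2 + C * (\<Sum>v\<leftarrow>map x (rev [0..<n]). (norm v)\<^sup>2)) powr (q / 2)"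
   by (rule order_trans[OF eq_refl C(2)]) simp
  also have "(\<Sum>v\<leftarrow>map x (rev [0..<n]). (norm v)\<^sup>2) = (\<Sum>k<n. norm (x k) powr 2)"
   by (simp add: rev_map[symmetric] sum_list_rev interv_sum_list_conv_sum_set_nat atLeast0LessThan o_def)
  also have "((norm (0 :: 'k))\<^sup>2 + C * (\<Sum>k<n. norm (x k) powr 2)) powr (q / 2) = (sqrt C) powr q * (\<Sum>k<n. norm (x k) powr 2) powr (q / 2)"
   using C(1) by (simp add: powr_mult sum_nonneg powr_half_sqrt[symmetric] powr_powr)
  finally show ?thesis .
 qed
 then show ?thesis using C(1) by (intro exI[of _ "sqrt C"]) auto
qed

lemma power_mean:
 fixes X :: "nat => real"
 assumes "0 < p" "p < q" "!!j. 0 <= X j"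
 shows "(\<Sum>j<N. X j powr p) powr (1 / p) <= N powr (1 / p - 1 / q) * (\<Sum>j<N. X j powr q) powr (1 / q)"
proof -
 have "(\<Sum>j<N. X j powr p * 1) <= (\<Sum>j<N. (X j powr p) powr (q / p)) powr (1 / (q / p)) * (\<Sum>j<N. 1 powr (q / (q - p))) powr (1 / (q / (q - p)))"
  using assms by (intro Holder_sum) (auto simp: field_simps)
 then have "(\<Sum>j<N. X j powr p) <= (\<Sum>j<N. X j powr q) powr (p / q) * N powr ((q - p) / q)"
  using assms by (simp add: powr_powr)
 then have "(\<Sum>j<N. X j powr p) powr (1 / p) <= ((\<Sum>j<N. X j powr q) powr (p / q) * N powr ((q - p) / q)) powr (1 / p)"
  using assms by (intro powr_mono2 sum_nonneg) auto
 also have "\<dots> = N powr (1 / p - 1 / q) * (\<Sum>j<N. X j powr q) powr (1 / q)"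
 proof -
  have "(q - p) / q * (1 / p) = 1 / p - 1 / q" "p / q * (1 / p) = 1 / q" using assms by (auto simp: field_simps)
  then show ?thesis by (simp add: powr_mult powr_powr)
 qed
 finally show ?thesis .
qed

text \<open>
 The Rademacher functions are orthogonal, hence independent.
\<close>

lemma rademacher_span:
 assumes "1 <= p"
 shows "\<exists>E :: 'k::real_normed_field seq set. dim_ge p n E \<and>
  (\<forall>x\<in>E. restr {2 ^ n..<2 ^ n + 2 ^ n} x = x \<and> (\<exists>a. \<forall>j<2 ^ n. x (2 ^ n + j) = (\<Sum>k<n. of_real (rad j k) * a k)))"
proof -
 define g :: "nat => 'k seq" where "g k = restr {2 ^ n..<2 ^ n + 2 ^ n} (%m. of_real (rad (m - 2 ^ n) k))" for k
 have ga: "g k (2 ^ n + j) = of_real (rad j k)" if "j < 2 ^ n" for j k using that by (simp add: g_def restr_def)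
 have go: "(\<Sum>j<2 ^ n. of_real (rad j l) * g k (2 ^ n + j)) = (if k = l then 2 ^ n else 0)" if "k < n" "l < n" for k l
 proof -
  have "(\<Sum>j<2 ^ n. of_real (rad j l) * g k (2 ^ n + j)) = (\<Sum>j<2 ^ n. of_real (rad j l * rad j k) :: 'k)"
   by (intro sum.cong refl) (simp add: ga)
  also have "\<dots> = of_real (\<Sum>j<2 ^ n. rad j l * rad j k)" by simp
  finally show ?thesis using rad_orthogonal[OF that(2,1)] by simp
 qed
 have inj: "inj_on g {..<n}"
 proof (rule inj_onI)
  fix k l assume kl: "k \<in> {..<n}" "l \<in> {..<n}" "g k = g l"
  then show "k = l" using go[of k l] go[of l l] by (auto split: if_splits)
 qed
 have comb: "(\<Sum>v\<in>g ` {..<n}. seq_scale (u v) v) m = (\<Sum>k<n. u (g k) * g k m)" for u m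
  by (simp add: sum.reindex[OF inj] sum_fun_apply seq_scale_def)
 have ind: "seq.independent (g ` {..<n})"
 proof (rule ccontr)
  assume "\<not> seq.independent (g ` {..<n})"
  then obtain u v where v: "v \<in> g ` {..<n}" "u v ~= 0" and z: "(\<Sum>v\<in>g ` {..<n}. seq_scale (u v) v) = 0"
   using seq.dependent_finite[of "g ` {..<n}"] by auto
  then obtain l where l: "l < n" "v = g l" by blast
  have "0 = (\<Sum>j<2 ^ n. of_real (rad j l) * (\<Sum>k<n. u (g k) * g k (2 ^ n + j)))"
   unfolding comb[symmetric] z by simp
  also have "\<dots> = (\<Sum>k<n. u (g k) * (\<Sum>j<2 ^ n. of_real (rad j l) * g k (2 ^ n + j)))"
   unfolding sum_distrib_left by (subst sum.swap) (simp add: mult_ac)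
  also have "\<dots> = (\<Sum>k<n. if k = l then u (g l) * 2 ^ n else 0)" using l(1) by (intro sum.cong refl) (simp add: go)
  also have "\<dots> = u (g l) * 2 ^ n" using l(1) by simp
  finally show False using v(2) l(2) by simp
 qed
 have "g k \<in> lp p" for k unfolding g_def using assms by (intro lp_restr_finite) auto
 then have "dim_ge p (card (g ` {..<n})) (seq.span (g ` {..<n}))" using assms ind by (intro dim_ge_span) auto
 moreover have "restr {2 ^ n..<2 ^ n + 2 ^ n} x = x \<and> (\<exists>a. \<forall>j<2 ^ n. x (2 ^ n + j) = (\<Sum>k<n. of_real (rad j k) * a k))"
  if xs: "x \<in> seq.span (g ` {..<n})" for x
 proof -
  obtain u where u: "x = (\<Sum>v\<in>g ` {..<n}. seq_scale (u v) v)" using xs seq.span_finite[of "g ` {..<n}"] by auto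
  have x: "x m = (\<Sum>k<n. u (g k) * g k m)" for m unfolding u comb ..
  have "restr {2 ^ n..<2 ^ n + 2 ^ n} x = x" by (rule ext) (auto simp: restr_def x g_def)
  moreover have "\<forall>j<2 ^ n. x (2 ^ n + j) = (\<Sum>k<n. of_real (rad j k) * u (g k))" by (simp add: x ga mult.commute)
  ultimately show ?thesis by (intro conjI exI[of _ "%k. u (g k)"])
 qed
 ultimately show ?thesis by (intro exI[of _ "seq.span (g ` {..<n})"]) (simp add: card_image[OF inj])
qed

text \<open>
 \<open>B\<close> takes the Rademacher coefficients on the \<open>n\<close>-th block and \<open>A\<close> forms the Rademacher sum; \<open>A\<close> is bounded by Khintchine's inequality and \<open>B\<close>, as a transpose, by the one for the conjugate exponent. With the normalisations in \<open>\<ell>\<^sub>p\<close> and \<open>\<ell>\<^sub>q\<close>, \<open>A B\<close> multiplies a Rademacher sum by \<open>2^(n/p - n/q)\<close>, which is just what the power mean inequality loses between the two norms.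
\<close>

lemma hilbert_not_fss:
 assumes pq: "1 < p" "p < 2" "2 < q"
 shows "\<exists>T :: 'k::{real_normed_field,euclidean_space} seq_op. T \<in> hilbert_ideal p q \<and> T \<notin> fss_ops p q"
proof -
 define p' where "p' = p / (p - 1)"
 have p': "2 < p'" "1 / p' + 1 / p = 1" using pq by (auto simp: p'_def field_simps)
 obtain KA where KA: "KA >= 0" "!!n (x :: 'k seq). (\<Sum>j<2 ^ n. norm (\<Sum>k<n. of_real (2 powr (- real n / q) * rad j k) * x k) powr q) <= KA powr q * (\<Sum>k<n. norm (x k) powr 2) powr (q / 2)"
  using rad_contractive[of q, where 'k = 'k] pq by auto
 obtain KB where KB: "KB >= 0" "!!n (x :: 'k seq). (\<Sum>j<2 ^ n. norm (\<Sum>k<n. of_real (2 powr (- real n / p') * rad j k) * x k) powr p') <= KB powr p' * (\<Sum>k<n. norm (x k) powr 2) powr (p' / 2)"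
  using rad_contractive[of p', where 'k = 'k] p' by auto
 have dis: "disjoint_family (%n. {2 ^ n..<2 ^ n + 2 ^ n :: nat})" "disjoint_family (%n. {2 ^ n..<2 ^ n + n :: nat})"
  by (rule disjoint_blocks, simp add: less_imp_le)+
 have "\<exists>T :: 'k seq_op. T \<in> bounded_ops 2 q \<and>
  (\<forall>x\<in>lp 2. \<forall>n. \<forall>j<2^n. T x (2 ^ n + j) = (\<Sum>k<n. of_real (2 powr (- real n / q) * rad j k) * x (2 ^ n + k)))"
  by (rule matrix_block_op[OF _ _ KA(1) dis(2,1) KA(2)]) (use pq in auto)
 then obtain A :: "'k seq_op" where A: "A \<in> bounded_ops 2 q"
  and Ax: "!!x n j. x \<in> lp 2 ==> j < 2 ^ n ==> A x (2 ^ n + j) = (\<Sum>k<n. of_real (2 powr (- real n / q) * rad j k) * x (2 ^ n + k))" by blast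
 have "\<exists>T :: 'k seq_op. T \<in> bounded_ops p 2 \<and>
  (\<forall>x\<in>lp p. \<forall>n. \<forall>k<n. T x (2 ^ n + k) = (\<Sum>j<2^n. of_real (2 powr (- real n / p') * rad j k) * x (2 ^ n + j)))"
 proof (rule matrix_block_op[OF _ _ KB(1) dis])
  fix n and x :: "'k seq"
  show "(\<Sum>k<n. norm (\<Sum>j<2 ^ n. of_real (2 powr (- real n / p') * rad j k) * x j) powr 2) <= KB powr 2 * (\<Sum>j<2 ^ n. norm (x j) powr p) powr (2 / p)"
   by (rule transpose_contractive[OF _ _ _ p'(2) KB(1) KB(2)]) (use p' in auto)
 qed (use pq in auto)
 then obtain B :: "'k seq_op" where B: "B \<in> bounded_ops p 2"
  and Bx: "!!x n k. x \<in> lp p ==> k < n ==> B x (2 ^ n + k) = (\<Sum>j<2^n. of_real (2 powr (- real n / p') * rad j k) * x (2 ^ n + j))" by blast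
 have "A \<circ> B \<in> hilbert_factorable p q" unfolding hilbert_factorable_def using A B by blast
 then have "A \<circ> B \<in> hilbert_ideal p q" using hilbert_factorable_subset[of p q, where 'k = 'k] pq by auto
 moreover have "A \<circ> B \<notin> fss_ops p q"
 proof
  assume "A \<circ> B \<in> fss_ops p q"
  moreover have "1 <= p" "1 <= q" using pq by auto
  ultimately have "\<forall>e>0. \<exists>n. \<forall>E. dim_ge p n E --> (\<exists>x\<in>E. x ~= 0 \<and> lp_norm q ((A \<circ> B) x) <= e * lp_norm p x)"
   using fss_ops_iff by blast
  then obtain n where n: "\<forall>E :: 'k seq set. dim_ge p n E --> (\<exists>x\<in>E. x ~= 0 \<and> lp_norm q ((A \<circ> B) x) <= 1 / 2 * lp_norm p x)"
   by (meson half_gt_zero zero_less_one)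
  obtain E :: "'k seq set" where E: "dim_ge p n E"
   and Ex: "\<forall>x\<in>E. restr {2 ^ n..<2 ^ n + 2 ^ n} x = x \<and> (\<exists>a. \<forall>j<2 ^ n. x (2 ^ n + j) = (\<Sum>k<n. of_real (rad j k) * a k))"
   using rademacher_span[of p n, where 'k = 'k] pq by auto
  obtain x where x: "x \<in> E" "x ~= 0" "lp_norm q (A (B x)) <= 1 / 2 * lp_norm p x" using n E by auto
  then have xp: "x \<in> lp p" using E by (auto simp: dim_ge_def)
  obtain a where xr: "restr {2 ^ n..<2 ^ n + 2 ^ n} x = x" and xa: "!!j. j < 2 ^ n ==> x (2 ^ n + j) = (\<Sum>k<n. of_real (rad j k) * a k)"
   using Ex x(1) by blast
  have Bxk: "B x (2 ^ n + k) = of_real (2 powr (n / p)) * a k" if "k < n" for k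
  proof -
   have "B x (2 ^ n + k) = of_real (2 powr (- real n / p')) * (\<Sum>j<2^n. \<Sum>l<n. of_real (rad j k * rad j l) * a l)"
    unfolding Bx[OF xp that] sum_distrib_left by (intro sum.cong refl) (simp add: xa sum_distrib_left mult_ac)
   also have "(\<Sum>j<2^n. \<Sum>l<n. of_real (rad j k * rad j l) * a l) = (\<Sum>l<n. of_real (\<Sum>j<2^n. rad j k * rad j l) * a l)"
    unfolding of_real_sum sum_distrib_right by (rule sum.swap)
   also have "\<dots> = (\<Sum>l<n. if l = k then 2 ^ n * a k else 0)"
    using that by (intro sum.cong refl) (simp add: rad_orthogonal del: of_real_sum)
   also have "\<dots> = of_real (2 powr n) * a k" using that by (simp add: powr_realpow)
   also have "of_real (2 powr (- real n / p')) * (of_real (2 powr n) * a k) = of_real (2 powr (- real n / p') * 2 powr n) * a k" by simp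
   also have "2 powr (- real n / p') * 2 powr n = 2 powr (n / p)"
   proof -
    have "1 / p = 1 - 1 / p'" using p'(2) by simp
    then have "n / p = n * (1 - 1 / p')" by (metis times_divide_eq_right mult_1_right)
    then have "- real n / p' + n = n / p" by (simp add: algebra_simps)
    then show ?thesis by (simp flip: powr_add)
   qed
   finally show ?thesis .
  qed
  have ABx: "A (B x) (2 ^ n + j) = of_real (2 powr (n / p - n / q)) * x (2 ^ n + j)" if "j < 2 ^ n" for j
  proof -
   have "A (B x) (2 ^ n + j) = (\<Sum>k<n. of_real (2 powr (- real n / q) * 2 powr (n / p)) * (of_real (rad j k) * a k))"
    unfolding Ax[OF ops_in[OF B xp] that] by (intro sum.cong refl) (simp add: Bxk mult_ac)
   also have "2 powr (- real n / q) * 2 powr (n / p) = 2 powr (n / p - n / q)" by (simp flip: powr_add)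
   finally show ?thesis using that by (simp add: xa sum_distrib_left)
  qed
  have "lp_norm p x = (\<Sum>j<2 ^ n. norm (x (2 ^ n + j)) powr p) powr (1 / p)"
  proof -
   have "lp_norm p x powr p = (\<Sum>m\<in>{2 ^ n..<2 ^ n + 2 ^ n}. norm (x m) powr p)"
    using lp_restr_finite(2)[of p "{2 ^ n..<2 ^ n + 2 ^ n}" x] pq by (simp add: xr)
   also have "\<dots> = (\<Sum>j<2 ^ n. norm (x (2 ^ n + j)) powr p)"
    by (rule sum.reindex_bij_witness[of _ "%j. 2 ^ n + j" "%m. m - 2 ^ n"]) auto
   finally have "(lp_norm p x powr p) powr (1 / p) = (\<Sum>j<2 ^ n. norm (x (2 ^ n + j)) powr p) powr (1 / p)" by simp
   then show ?thesis using pq by (simp add: powr_powr)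
  qed
  also have "\<dots> <= real (2 ^ n) powr (1 / p - 1 / q) * (\<Sum>j<2 ^ n. norm (x (2 ^ n + j)) powr q) powr (1 / q)"
   using pq by (intro power_mean) auto
  also have "real (2 ^ n) powr (1 / p - 1 / q) = 2 powr (n / p - n / q)"
   by (simp add: powr_realpow[symmetric] powr_powr right_diff_distrib)
  also have "2 powr (n / p - n / q) * (\<Sum>j<2 ^ n. norm (x (2 ^ n + j)) powr q) powr (1 / q)
   = (\<Sum>j<2 ^ n. norm (A (B x) (2 ^ n + j)) powr q) powr (1 / q)"
  proof -
   have "(\<Sum>j<2 ^ n. norm (A (B x) (2 ^ n + j)) powr q) = (2 powr (n / p - n / q)) powr q * (\<Sum>j<2 ^ n. norm (x (2 ^ n + j)) powr q)"
    unfolding sum_distrib_left by (intro sum.cong refl) (simp add: ABx norm_mult powr_mult)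
   then show ?thesis using pq by (simp add: powr_mult powr_powr sum_nonneg)
  qed
  also have "\<dots> <= lp_norm q (A (B x))" using pq by (intro lp_norm_block ops_in[OF A] ops_in[OF B] xp) auto
  finally have "lp_norm p x <= 1 / 2 * lp_norm p x" using x(3) by simp
  moreover have "lp_norm p x ~= 0" using lp_norm_eq_0[OF xp] pq x(2) by simp
  ultimately show False using lp_norm_nonneg[of p x] by linarith
 qed
 ultimately show ?thesis by blast
qed

section \<open>The lattice of closed ideals\<close>

lemma closed_ideal_zero:
 assumes "1 <= p" "1 <= q"
 shows "closed_ideal p q {0 :: 'k::real_normed_field seq_op}"
proof (rule closed_idealI[OF assms])
 show "{0 :: 'k seq_op} \<subseteq> bounded_ops p q" using assms zero_bounded_ops[of q p] by auto
 show "op_scale c T \<in> {0}" if "T \<in> {0}" for c and T :: "'k seq_op" using that by (auto simp: op_scale_def seq_scale_def fun_eq_iff)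
 show "A \<circ> T \<circ> B \<in> {0}" if "A \<in> bounded_ops q q" "T \<in> {0}" for A T B :: "'k seq_op"
 proof -
  have "T (B x) = 0" for x using that(2) by simp
  then have "A \<circ> T \<circ> B = 0" by (intro ext) (simp add: ops_0[OF that(1)])
  then show ?thesis by simp
 qed
 fix T :: "'k seq_op" assume T: "T \<in> bounded_ops p q" "op_approx p q {0} T"
 have "T x = 0" for x
 proof (cases "x \<in> lp p")
  case True
  have le: "lp_norm q (T x) <= e * lp_norm p x" if "e > 0" for e
   using T(2) that True unfolding op_approx_def lp_norm_def by auto
  have "lp_norm q (T x) <= 0"
  proof (rule field_le_epsilon)
   fix e :: real assume "e > 0"
   then have "lp_norm q (T x) <= e / (lp_norm p x + 1) * lp_norm p x" by (intro le) (simp add: add_nonneg_pos)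
   also have "\<dots> <= e" using \<open>e > 0\<close> by (simp add: pos_divide_le_eq add_nonneg_pos distrib_left)
   finally show "lp_norm q (T x) <= 0 + e" by simp
  qed
  then show ?thesis using lp_norm_eq_0[OF ops_in[OF T(1) True]] assms lp_norm_nonneg[of q "T x"] by auto
 qed (use ops_out[OF T(1)] in auto)
 then show "T \<in> {0}" by (auto simp: fun_eq_iff)
qed auto

lemma formal_identity_not_compact:
 assumes "1 <= p" "1 <= q"
 shows "(formal_identity p :: 'k::{real_normed_field,euclidean_space} seq_op) \<notin> compact_ops p q"
proof
 assume "(formal_identity p :: 'k seq_op) \<in> compact_ops p q"
 then have "\<forall>e>0. \<exists>m. \<forall>x\<in>lp p. lp_norm q (restr {m..} (formal_identity p x :: 'k seq)) <= e * lp_norm p x"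
  using compact_ops_iff[OF assms] by blast
 then obtain m where m: "\<forall>x\<in>lp p. lp_norm q (restr {m..} (formal_identity p x :: 'k seq)) <= 1 / 2 * lp_norm p x"
  by (meson half_gt_zero zero_less_one)
 have u: "(unit m :: 'k seq) \<in> lp p" using assms by (intro unit_lp) auto
 have "restr {m..} (formal_identity p (unit m)) = (unit m :: 'k seq)" using u by (auto simp: formal_identity_def restr_def unit_def fun_eq_iff)
 then have "lp_norm q (unit m :: 'k seq) <= 1 / 2 * lp_norm p (unit m :: 'k seq)" using m u by metis
 then show False using assms by (simp add: unit_lp)
qed

lemma formal_identity_hilbert:
 assumes "1 <= p" "p <= 2" "2 <= q"
 shows "(formal_identity p :: 'k::real_normed_field seq_op) \<in> hilbert_ideal p q"
proof -
 have "(formal_identity p :: 'k seq_op) = formal_identity 2 \<circ> formal_identity p"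
  using assms lp_mono(1)[of p 2] by (auto simp: formal_identity_def fun_eq_iff zero_fun_def)
 moreover have "(formal_identity 2 :: 'k seq_op) \<in> bounded_ops 2 q" "(formal_identity p :: 'k seq_op) \<in> bounded_ops p 2"
  using assms by (auto intro!: formal_identity_bounded_ops)
 ultimately have "(formal_identity p :: 'k seq_op) \<in> hilbert_factorable p q" unfolding hilbert_factorable_def by blast
 then show ?thesis using hilbert_factorable_subset[of p q, where 'k = 'k] assms by auto
qed


lemma only_immediate_successorI:
 assumes "closed_ideal p q J1" "closed_ideal p q J2" "J1 \<subset> J2"
  "!!J. closed_ideal p q J ==> J1 \<subset> J ==> J2 \<subseteq> J"
 shows "only_immediate_successor p q J1 J2"
proof -
 have "J = J2" if "immediate_successor p q J1 J" for J
  using that assms unfolding immediate_successor_def by (metis psubsetI)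
 moreover have "immediate_successor p q J1 J2"
  using assms unfolding immediate_successor_def by (metis psubset_eq order_antisym)
 ultimately show ?thesis unfolding only_immediate_successor_def by blast
qed

theorem mainTheorem2:
  fixes p q :: real
  assumes "1 < p" and "p < 2" and "2 < q"
  shows
    "({0} \<subset> (compact_ops p q :: 'k::{real_normed_field, euclidean_space} seq_op set) \<and>
      compact_ops p q \<subset> (identity_ideal p q :: 'k seq_op set) \<and>
      identity_ideal p q \<subseteq> fss_ops p q \<inter> (hilbert_ideal p q :: 'k seq_op set) \<and>
      only_immediate_successor p q {0} (compact_ops p q :: 'k seq_op set) \<and>
      only_immediate_successor p q (compact_ops p q) (identity_ideal p q :: 'k seq_op set)) \<and>
     (fss_ops p q \<inter> hilbert_ideal p q \<subset> (fss_ops p q :: 'k seq_op set)) \<and>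
     (fss_ops p q \<inter> hilbert_ideal p q \<subset> (hilbert_ideal p q :: 'k seq_op set) \<and>
      \<not> (\<exists>J :: 'k seq_op set. closed_ideal p q J \<and>
            fss_ops p q \<inter> hilbert_ideal p q \<subset> J \<and> J \<subset> hilbert_ideal p q)) \<and>
     (fss_ops p q \<subset> ideal_join p q (fss_ops p q) (hilbert_ideal p q :: 'k seq_op set) \<and>
      only_immediate_successor p q (fss_ops p q)
        (ideal_join p q (fss_ops p q) (hilbert_ideal p q :: 'k seq_op set))) \<and>
     (hilbert_ideal p q \<subset> ideal_join p q (fss_ops p q) (hilbert_ideal p q :: 'k seq_op set)) \<and>
     \<not> (\<forall>J1 J2 :: 'k seq_op set. closed_ideal p q J1 \<and> closed_ideal p q J2 \<longrightarrow>
            J1 \<subseteq> J2 \<or> J2 \<subseteq> J1)"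
proof -
 define Z :: "'k seq_op set" where "Z = {0}"
 define K :: "'k seq_op set" where "K = compact_ops p q"
 define I :: "'k seq_op set" where "I = identity_ideal p q"
 define F :: "'k seq_op set" where "F = fss_ops p q"
 define H :: "'k seq_op set" where "H = hilbert_ideal p q"
 define V :: "'k seq_op set" where "V = ideal_join p q F H"
 have pq: "1 <= p" "1 <= q" "p <= 2" "2 <= q" "p < q" using assms by auto
 have id: "(formal_identity p :: 'k seq_op) \<in> bounded_ops p q" using pq by (intro formal_identity_bounded_ops) auto
 have cl: "closed_ideal p q Z" "closed_ideal p q K" "closed_ideal p q F" "closed_ideal p q H"
  unfolding Z_def K_def F_def H_def
  using pq assms by (auto intro!: closed_ideal_zero closed_ideal_compact_ops closed_ideal_fss_ops closed_ideal_hilbert)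
 have clI: "closed_ideal p q I" unfolding I_def identity_ideal_def using pq id by (intro closed_ideal_generated) auto
 have clV: "closed_ideal p q V" unfolding V_def ideal_join_def
  using pq cl(3,4) by (intro closed_ideal_generated) (use closed_ideal_sub in blast)+
 have idI: "formal_identity p \<in> I" unfolding I_def identity_ideal_def using generated_ideal_sup by blast
 have I_least: "I \<subseteq> J" if "closed_ideal p q J" "formal_identity p \<in> J" for J
  unfolding I_def identity_ideal_def using that by (intro generated_ideal_least) auto
 have V_least: "V \<subseteq> J" if "closed_ideal p q J" "F \<subseteq> J" "H \<subseteq> J" for J
  unfolding V_def ideal_join_def using that by (intro generated_ideal_least) auto
 have FV: "F \<subseteq> V" "H \<subseteq> V" unfolding V_def ideal_join_def using generated_ideal_sup[of "F \<union> H"] by auto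
 have K_least: "K \<subseteq> J" if "closed_ideal p q J" "J ~= Z" for J
  unfolding K_def using compact_ops_least[OF pq(1,2) that(1)] that(2) by (simp add: Z_def)
 have idK: "formal_identity p \<notin> K" unfolding K_def by (rule formal_identity_not_compact[OF pq(1,2)])
 have Z_least: "Z \<subseteq> J" if "closed_ideal p q J" for J unfolding Z_def using closed_ideal_0[OF that] by simp
 have ZI: "I ~= Z"
 proof
  assume "I = Z"
  then have "formal_identity p \<in> K" using Z_least[OF cl(2)] idI by blast
  then show False using idK by blast
 qed
 have noncomp: "I \<subseteq> J" if J: "closed_ideal p q J" "\<not> J \<subseteq> K" for J
 proof -
  obtain T where "T \<in> J" "T \<notin> K" using J by blast
  then have "formal_identity p \<in> J" unfolding K_def using noncompact_identity[OF assms(1) pq(3,4) J(1)] by blast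
  then show ?thesis by (rule I_least[OF J(1)])
 qed
 have ZK: "Z \<subset> K"
 proof -
  have "(proj p {0} :: 'k seq_op) \<in> bounded_ops p q" using pq by (intro proj_bounded_ops) auto
  moreover have "restr {1..} (proj p {0} x) = (0 :: 'k seq)" for x :: "'k seq" by (auto simp: proj_def restr_def fun_eq_iff)
  ultimately have "(proj p {0} :: 'k seq_op) \<in> K" unfolding K_def compact_ops_iff[OF pq(1,2)]
   by (auto intro!: exI[of _ 1] simp: lp_norm_def)
  moreover have "(proj p {0} :: 'k seq_op) ~= 0"
  proof
   assume "(proj p {0} :: 'k seq_op) = 0"
   then have "(proj p {0} (unit 0 :: 'k seq)) 0 = 0" by simp
   then show False using unit_lp(1)[of p 0, where 'k = 'k] pq by (simp add: proj_def restr_def unit_def)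
  qed
  ultimately show ?thesis using Z_least[OF cl(2)] by (auto simp: Z_def)
 qed
 have KI: "K \<subset> I" using K_least[OF clI ZI] idI idK by blast
 have IFH: "I \<subseteq> F \<inter> H"
  using I_least[OF cl(3)] I_least[OF cl(4)] formal_identity_fss[OF pq(1,5)] formal_identity_hilbert[OF pq(1,3,4)]
  unfolding F_def H_def by blast
 have above: "H \<subseteq> J" if J: "closed_ideal p q J" "\<not> J \<subseteq> F" for J
 proof -
  obtain T where "T \<in> J" "T \<notin> F" using J by blast
  then show ?thesis unfolding F_def H_def using nonfss_hilbert[OF assms J(1)] by blast
 qed
 obtain T1 T2 where T: "T1 \<in> F" "T1 \<notin> H" "T2 \<in> H" "T2 \<notin> F"
  using fss_not_hilbert[OF assms, where 'k = 'k] hilbert_not_fss[OF assms, where 'k = 'k] unfolding F_def H_def by blast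
 have "only_immediate_successor p q Z K"
  by (rule only_immediate_successorI[OF cl(1,2) ZK]) (use K_least in blast)
 moreover have "only_immediate_successor p q K I"
  by (rule only_immediate_successorI[OF cl(2) clI KI]) (use noncomp in blast)
 moreover have FV': "F \<subset> V" using FV T by blast
 moreover have "only_immediate_successor p q F V"
  by (rule only_immediate_successorI[OF cl(3) clV FV']) (use above V_least in blast)
 moreover have "H \<subset> V" using FV T by blast
 moreover have "\<not> (\<exists>J. closed_ideal p q J \<and> F \<inter> H \<subset> J \<and> J \<subset> H)" using above by blast
 moreover have "\<not> (\<forall>J1 J2 :: 'k seq_op set. closed_ideal p q J1 \<and> closed_ideal p q J2 --> J1 \<subseteq> J2 \<or> J2 \<subseteq> J1)"
  using cl(3,4) T by blast
 moreover have "F \<inter> H \<subset> F" "F \<inter> H \<subset> H" using T by blast+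
 ultimately show ?thesis using ZK KI IFH unfolding Z_def K_def I_def F_def H_def V_def by blast
qed

end
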